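(* Let $\Omega\subseteq\mathbb R^d$ be open, let $x_0\in\widetilde\Omega_c$ and let $u\in\mathcal G(\Omega)$. The following are equivalent: (1) $u$ is $\widetilde{\mathcal G}^\infty$-microlocally regular at $(x_0,\xi_0)$ for each $\xi_0\in\widetilde{\mathbf S}$; (2) $u\in\widetilde{\mathcal G}^\infty(V)$ for some slow scale neighbourhood $V$ of $x_0$.
   Context: Nets are indexed by $\varepsilon\in(0,1]$. $\mathcal G(\Omega)$ is the special Colombeau algebra: nets $(u_\varepsilon)$ in $C^\infty(\Omega)$ (complex valued) that are moderate (for every compact $K\subset\Omega$ and $\alpha\in\mathbb N^d$ there is $N\in\mathbb N$ with $\sup_K|\partial^\alpha u_\varepsilon|=O(\varepsilon^{-N})$) modulo null nets (for all $K,\alpha,n$: $\sup_K|\partial^\alpha u_\varepsilon|=O(\varepsilon^n)$). $\widetilde{\mathbb R}$, $\widetilde{\mathbb C}$ are the rings of Colombeau generalized numbers (nets with $|x_\varepsilon|=O(\varepsilon^{-N})$ for some $N$, modulo nets with $|x_\varepsilon|=O(\varepsilon^n)$ for all $n$); $\widetilde{\mathbb R}^d=(\widetilde{\mathbb R})^d$. Classes are written $[\cdot_\varepsilon]$. For $x,y\in\widetilde{\mathbb R}$, $x\le y$ means that there are representatives with $x_\varepsilon\le y_\varepsilon$ for all $\varepsilon$. $\widetilde{\mathbb R}_{>0}=\{x\in\widetilde{\mathbb R}:x\ge0,\ x\text{ invertible}\}$, $\rho:=[\varepsilon]$, so $\rho^a=[\varepsilon^a]$ for $a\in\mathbb R$.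 $\widetilde\Omega_c$ is the set of $[x_\varepsilon]\in\widetilde{\mathbb R}^d$ having a representative with values in a fixed compact subset of $\Omega$ for small $\varepsilon$. $u=[u_\varepsilon]\in\mathcal G(\Omega)$ has point values $u([x_\varepsilon])=[u_\varepsilon(x_\varepsilon)]\in\widetilde{\mathbb C}$ for $[x_\varepsilon]\in\widetilde\Omega_c$. $\widetilde{\mathbf S}=\{x\in\widetilde{\mathbb R}^d:|x|=1\}$. $\mathcal G_c(\Omega)$ is the set of compactly supported elements of $\mathcal G(\Omega)$. $\mathcal G_{\mathscr S}(\mathbb R^d)=\mathcal E_{\mathscr S}/\mathcal N_{\mathscr S}$, where $\mathcal E_{\mathscr S}$ (resp. $\mathcal N_{\mathscr S}$) consists of nets in $\mathscr S(\mathbb R^d)$ such that for all $\alpha,\beta$, $\sup_x|x^\alpha\partial^\beta v_\varepsilon(x)|$ is $O(\varepsilon^{-N})$ for some $N$ (resp. $O(\varepsilon^n)$ for all $n$). $\mathcal G_c(\Omega)\subseteq\mathcal G_{\mathscr S}(\mathbb R^d)$ via representatives supported in a fixed compact set, extended by $0$. The Fourier transform is $\widehat v=[\widehat{v_\varepsilon}]\in\mathcal G_{\mathscr S}(\mathbb R^d)$, with point values $\widehat v([\xi_\varepsilon])=[\widehat{v_\varepsilon}(\xi_\varepsilon)]$ for $[\xi_\varepsilon]\in\widetilde{\mathbb R}^d$. $\widetilde{\mathbb R}^d_{fs}=\{x\in\widetilde{\mathbb R}^d:\exists a\in\mathbb R_{>0},\ |x|\ge\rho^{-a}\}$ (fast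 scale). $x\approx_{fast}y$ means $|x-y|\le\rho^a$ for some $a\in\mathbb R_{>0}$. $r\approx_{slow}0$ means $\rho^a\le|r|\le a$ for all $a\in\mathbb R_{>0}$. A slow scale neighbourhood of $x_0$ is a set (here in $\widetilde\Omega_c$) containing $\{x\in\widetilde{\mathbb R}^d:|x-x_0|\le r\}$ for some $r\in\widetilde{\mathbb R}_{>0}$ with $r\approx_{slow}0$. For $\xi_0\in\widetilde{\mathbf S}$, $\Gamma_{fast}(\xi_0)=\{\xi\in\widetilde{\mathbb R}^d:|\xi|\text{ invertible},\ \xi/|\xi|\approx_{fast}\xi_0\}$. Definition. $u\in\mathcal G(\Omega)$ is $\widetilde{\mathcal G}^\infty$-microlocally regular at $(x_0,\xi_0)\in\widetilde\Omega_c\times\widetilde{\mathbf S}$ if there exists $v\in\mathcal G_c(\Omega)$ with $u(x)=v(x)$ for all $x\approx_{fast}x_0$ and $\widehat v(\xi)=0$ for all $\xi\in\widetilde{\mathbb R}^d_{fs}\cap\Gamma_{fast}(\xi_0)$. Definition. For $x\in\widetilde\Omega_c$, $u\in\widetilde{\mathcal G}^\infty(x)$ means: there is $N\in\mathbb N$ such that $|\partial^\alpha u(x)|\le\rho^{-N}$ for all $\alpha\in\mathbb N^d$ ($N$ independent of $\alpha$). For a set $A$ of generalized points, $u\in\widetilde{\mathcal G}^\infty(A)$ means $u\in\widetilde{\mathcal G}^\infty(x)$ for each $x\in A$. *)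

theory Defs
  imports "HOL-Analysis.Analysis" "HOL-Library.Landau_Symbols"
begin

section \<open>Generalized numbers and points\<close>

text \<open>A net indexed by \<open>\<epsilon> \<in> (0,1]\<close> is a function on \<^typ>\<open>real\<close> whose values outside
  \<open>(0,1]\<close> are ignored; asymptotics for \<open>\<epsilon> \<rightarrow> 0\<close> are taken along \<open>at_right 0\<close>.\<close>

definition moderate :: "(real \<Rightarrow> 'a::real_normed_vector) \<Rightarrow> bool" where
  "moderate x \<longleftrightarrow> (\<exists>N::nat. (\<lambda>\<epsilon>. norm (x \<epsilon>)) \<in> O[at_right 0](\<lambda>\<epsilon>. inverse (\<epsilon> ^ N)))"

definition negligible_net :: "(real \<Rightarrow> 'a::real_normed_vector) \<Rightarrow> bool" where
  "negligible_net x \<longleftrightarrow> (\<forall>n::nat. (\<lambda>\<epsilon>. norm (x \<epsilon>)) \<in> O[at_right 0](\<lambda>\<epsilon>. \<epsilon> ^ n))"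

definition colombeau_rel :: "(real \<Rightarrow> 'a::real_normed_vector) \<Rightarrow> (real \<Rightarrow> 'a) \<Rightarrow> bool" where
  "colombeau_rel x y \<longleftrightarrow> moderate x \<and> moderate y \<and> negligible_net (\<lambda>\<epsilon>. x \<epsilon> - y \<epsilon>)"

lemma moderate_0: "moderate (\<lambda>_. 0)"
  by (simp add: moderate_def)

lemma negligible_0: "negligible_net (\<lambda>_. 0)"
  by (simp add: negligible_net_def)

lemma negligible_add:
  assumes "negligible_net x" "negligible_net y"
  shows "negligible_net (\<lambda>\<epsilon>. x \<epsilon> + y \<epsilon>)"
  unfolding negligible_net_def
proof
  fix n :: nat
  have "(\<lambda>\<epsilon>. norm (x \<epsilon>) + norm (y \<epsilon>)) \<in> O[at_right 0](\<lambda>\<epsilon>. \<epsilon> ^ n)"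
    using assms by (intro sum_in_bigo) (auto simp: negligible_net_def)
  moreover have "(\<lambda>\<epsilon>. norm (x \<epsilon> + y \<epsilon>)) \<in> O[at_right 0](\<lambda>\<epsilon>. norm (x \<epsilon>) + norm (y \<epsilon>))"
    by (intro bigoI[of _ 1] always_eventually allI) (simp add: norm_triangle_ineq)
  ultimately show "(\<lambda>\<epsilon>. norm (x \<epsilon> + y \<epsilon>)) \<in> O[at_right 0](\<lambda>\<epsilon>. \<epsilon> ^ n)"
    by (rule landau_o.big_trans[rotated])
qed

lemma negligible_minus: "negligible_net x \<Longrightarrow> negligible_net (\<lambda>\<epsilon>. - x \<epsilon>)"
  by (simp add: negligible_net_def)

lemma negligible_diff_commute:
  "negligible_net (\<lambda>\<epsilon>. x \<epsilon> - y \<epsilon>) \<Longrightarrow> negligible_net (\<lambda>\<epsilon>. y \<epsilon> - x \<epsilon>)"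
  by (simp add: negligible_net_def norm_minus_commute)

lemma inverse_power_bigo:
  "M \<le> N \<Longrightarrow> (\<lambda>\<epsilon>::real. inverse (\<epsilon> ^ M)) \<in> O[at_right 0](\<lambda>\<epsilon>. inverse (\<epsilon> ^ N))"
  by (rule bigoI[of _ 1], rule eventually_at_rightI[of 0 1])
    (auto intro!: le_imp_inverse_le power_decreasing)

lemma moderate_add:
  assumes "moderate x" "moderate y"
  shows "moderate (\<lambda>\<epsilon>. x \<epsilon> + y \<epsilon>)"
proof -
  obtain M N :: nat where
    M: "(\<lambda>\<epsilon>. norm (x \<epsilon>)) \<in> O[at_right 0](\<lambda>\<epsilon>. inverse (\<epsilon> ^ M))" and
    N: "(\<lambda>\<epsilon>. norm (y \<epsilon>)) \<in> O[at_right 0](\<lambda>\<epsilon>. inverse (\<epsilon> ^ N))"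
    using assms by (auto simp: moderate_def)
  have "(\<lambda>\<epsilon>. norm (x \<epsilon>) + norm (y \<epsilon>)) \<in> O[at_right 0](\<lambda>\<epsilon>. inverse (\<epsilon> ^ (max M N)))"
    by (intro sum_in_bigo landau_o.big_trans[OF M] landau_o.big_trans[OF N]
        inverse_power_bigo) auto
  moreover have "(\<lambda>\<epsilon>. norm (x \<epsilon> + y \<epsilon>)) \<in> O[at_right 0](\<lambda>\<epsilon>. norm (x \<epsilon>) + norm (y \<epsilon>))"
    by (intro bigoI[of _ 1] always_eventually allI) (simp add: norm_triangle_ineq)
  ultimately show ?thesis
    unfolding moderate_def by (blast intro: landau_o.big_trans)
qed

lemma moderate_minus: "moderate x \<Longrightarrow> moderate (\<lambda>\<epsilon>. - x \<epsilon>)"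
  by (simp add: moderate_def)

lemma moderate_norm: "moderate x \<Longrightarrow> moderate (\<lambda>\<epsilon>. norm (x \<epsilon>))"
  by (simp add: moderate_def)

lemma moderate_const: "moderate (\<lambda>_. c)"
  unfolding moderate_def by (rule exI[of _ 0]) simp

lemma moderate_scaleR:
  assumes "moderate r" "moderate x"
  shows "moderate (\<lambda>\<epsilon>. r \<epsilon> *\<^sub>R x \<epsilon>)"
proof -
  obtain M N :: nat where
    "(\<lambda>\<epsilon>. norm (r \<epsilon>)) \<in> O[at_right 0](\<lambda>\<epsilon>. inverse (\<epsilon> ^ M))" and
    "(\<lambda>\<epsilon>. norm (x \<epsilon>)) \<in> O[at_right 0](\<lambda>\<epsilon>. inverse (\<epsilon> ^ N))"
    using assms by (auto simp: moderate_def)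
  from landau_o.big.mult[OF this] show ?thesis
    unfolding moderate_def by (intro exI[of _ "M + N"]) (simp add: power_add)
qed

lemma moderate_mult:
  fixes x y :: "real \<Rightarrow> 'a::real_normed_field"
  assumes "moderate x" "moderate y"
  shows "moderate (\<lambda>\<epsilon>. x \<epsilon> * y \<epsilon>)"
  using moderate_scaleR[OF moderate_norm[OF assms(1)] assms(2)]
  by (simp add: moderate_def norm_mult)

lemma negligible_scaleR_right:
  assumes "moderate r" "negligible_net x"
  shows "negligible_net (\<lambda>\<epsilon>. r \<epsilon> *\<^sub>R x \<epsilon>)"
  unfolding negligible_net_def
proof
  fix n :: nat
  obtain N :: nat where N: "(\<lambda>\<epsilon>. norm (r \<epsilon>)) \<in> O[at_right 0](\<lambda>\<epsilon>. inverse (\<epsilon> ^ N))"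
    using assms by (auto simp: moderate_def)
  have "(\<lambda>\<epsilon>. norm (x \<epsilon>)) \<in> O[at_right 0](\<lambda>\<epsilon>. \<epsilon> ^ (N + n))"
    using assms(2) unfolding negligible_net_def by blast
  from landau_o.big.mult[OF N this]
  have "(\<lambda>\<epsilon>. norm (r \<epsilon> *\<^sub>R x \<epsilon>)) \<in> O[at_right 0](\<lambda>\<epsilon>. inverse (\<epsilon> ^ N) * \<epsilon> ^ (N + n))"
    by simp
  moreover have "(\<lambda>\<epsilon>::real. inverse (\<epsilon> ^ N) * \<epsilon> ^ (N + n)) \<in> O[at_right 0](\<lambda>\<epsilon>. \<epsilon> ^ n)"
    by (rule bigoI[of _ 1], rule eventually_at_rightI[of 0 1]) (auto simp: power_add field_simps)
  ultimately show "(\<lambda>\<epsilon>. norm (r \<epsilon> *\<^sub>R x \<epsilon>)) \<in> O[at_right 0](\<lambda>\<epsilon>. \<epsilon> ^ n)"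
    by (rule landau_o.big_trans)
qed

lemma negligible_cong_norm:
  "(\<And>\<epsilon>. norm (x \<epsilon>) = norm (y \<epsilon>)) \<Longrightarrow> negligible_net x \<longleftrightarrow> negligible_net y"
  by (simp add: negligible_net_def)

lemma negligible_scaleR_left:
  "negligible_net r \<Longrightarrow> moderate x \<Longrightarrow> negligible_net (\<lambda>\<epsilon>. r \<epsilon> *\<^sub>R x \<epsilon>)"
  using negligible_scaleR_right[of "\<lambda>\<epsilon>. norm (x \<epsilon>)" r] moderate_norm[of x]
  by (subst negligible_cong_norm[of _ "\<lambda>\<epsilon>. norm (x \<epsilon>) *\<^sub>R r \<epsilon>"]) (auto simp: abs_mult)

lemma colombeau_relD: "colombeau_rel x y \<Longrightarrow> moderate x \<and> moderate y \<and> negligible_net (\<lambda>\<epsilon>. x \<epsilon> - y \<epsilon>)"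
  by (simp add: colombeau_rel_def)

lemma colombeau_rel_refl: "colombeau_rel x x \<longleftrightarrow> moderate x"
  by (simp add: colombeau_rel_def negligible_0)

text \<open>\<open>real colombeau\<close> and \<open>complex colombeau\<close> are the rings of generalized real and complex
  numbers; \<open>(real^'n) colombeau\<close> is their \<open>d\<close>-dimensional analogue with \<open>d = CARD('n)\<close>
  (a net of vectors is moderate or negligible iff its components are).\<close>

quotient_type (overloaded) 'a colombeau = "real \<Rightarrow> 'a::real_normed_vector" / partial: colombeau_rel
proof (rule part_equivpI)
  show "\<exists>x::real \<Rightarrow> 'a. colombeau_rel x x"
    using colombeau_rel_refl moderate_0 by blast
  show "symp (colombeau_rel :: (real \<Rightarrow> 'a) \<Rightarrow> _)"
    by (auto simp: symp_def colombeau_rel_def intro: negligible_diff_commute)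
  show "transp (colombeau_rel :: (real \<Rightarrow> 'a) \<Rightarrow> _)"
  proof (rule transpI)
    fix x y z :: "real \<Rightarrow> 'a"
    assume "colombeau_rel x y" "colombeau_rel y z"
    then show "colombeau_rel x z"
      using negligible_add[of "\<lambda>\<epsilon>. x \<epsilon> - y \<epsilon>" "\<lambda>\<epsilon>. y \<epsilon> - z \<epsilon>"]
      by (auto simp: colombeau_rel_def)
  qed
qed

text \<open>\<open>abs_colombeau x\<close> is the class of the net \<open>x\<close>, but it is unspecified when \<open>x\<close> is not
  moderate; hence the explicit moderateness condition.\<close>

definition represents :: "(real \<Rightarrow> 'a::real_normed_vector) \<Rightarrow> 'a colombeau \<Rightarrow> bool" where
  "represents x' x \<longleftrightarrow> moderate x' \<and> abs_colombeau x' = x"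

instantiation colombeau :: (real_normed_vector) ab_group_add
begin

lift_definition zero_colombeau :: "'a colombeau" is "\<lambda>_. 0"
  by (simp add: colombeau_rel_refl moderate_0)

lift_definition plus_colombeau :: "'a colombeau \<Rightarrow> 'a colombeau \<Rightarrow> 'a colombeau"
  is "\<lambda>x y \<epsilon>. x \<epsilon> + y \<epsilon>"
  subgoal for x x' y y'
    using negligible_add[of "\<lambda>\<epsilon>. x \<epsilon> - x' \<epsilon>" "\<lambda>\<epsilon>. y \<epsilon> - y' \<epsilon>"]
    by (auto simp: colombeau_rel_def algebra_simps intro: moderate_add)
  done

lift_definition uminus_colombeau :: "'a colombeau \<Rightarrow> 'a colombeau" is "\<lambda>x \<epsilon>. - x \<epsilon>"
  subgoal for x y
    using negligible_minus[of "\<lambda>\<epsilon>. x \<epsilon> - y \<epsilon>"]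
    by (auto simp: colombeau_rel_def algebra_simps intro: moderate_minus)
  done

definition minus_colombeau :: "'a colombeau \<Rightarrow> 'a colombeau \<Rightarrow> 'a colombeau" where
  "minus_colombeau x y = x + (- y)"

instance
proof
  fix a b c :: "'a colombeau"
  show "a + b + c = a + (b + c)"
    by transfer (simp add: colombeau_rel_def add.assoc negligible_0 moderate_add)
  show "a + b = b + a"
    by transfer (simp add: colombeau_rel_def add.commute negligible_0 moderate_add)
  show "0 + a = a"
    by transfer (simp add: colombeau_rel_def)
  show "- a + a = 0"
    by transfer (simp add: colombeau_rel_def negligible_0 moderate_0)
  show "a - b = a + - b"
    by (simp add: minus_colombeau_def)
qed

end

instantiation colombeau :: (real_normed_field) comm_ring_1
begin

lift_definition one_colombeau :: "'a colombeau" is "\<lambda>_. 1"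
  by (simp add: colombeau_rel_refl moderate_const)

lift_definition times_colombeau :: "'a colombeau \<Rightarrow> 'a colombeau \<Rightarrow> 'a colombeau"
  is "\<lambda>x y \<epsilon>. x \<epsilon> * y \<epsilon>"
  subgoal premises prems for x x' y y'
  proof -
    note p = colombeau_relD[OF prems(1)] colombeau_relD[OF prems(2)]
    have "negligible_net (\<lambda>\<epsilon>. x \<epsilon> * (y \<epsilon> - y' \<epsilon>))"
      using negligible_scaleR_right[of "\<lambda>\<epsilon>. norm (x \<epsilon>)" "\<lambda>\<epsilon>. y \<epsilon> - y' \<epsilon>"] p moderate_norm
      by (subst negligible_cong_norm[of _ "\<lambda>\<epsilon>. norm (x \<epsilon>) *\<^sub>R (y \<epsilon> - y' \<epsilon>)"])
        (auto simp: norm_mult)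
    moreover have "negligible_net (\<lambda>\<epsilon>. (x \<epsilon> - x' \<epsilon>) * y' \<epsilon>)"
      using negligible_scaleR_right[of "\<lambda>\<epsilon>. norm (y' \<epsilon>)" "\<lambda>\<epsilon>. x \<epsilon> - x' \<epsilon>"] p moderate_norm
      by (subst negligible_cong_norm[of _ "\<lambda>\<epsilon>. norm (y' \<epsilon>) *\<^sub>R (x \<epsilon> - x' \<epsilon>)"])
        (auto simp: norm_mult)
    ultimately have "negligible_net (\<lambda>\<epsilon>. x \<epsilon> * (y \<epsilon> - y' \<epsilon>) + (x \<epsilon> - x' \<epsilon>) * y' \<epsilon>)"
      by (rule negligible_add)
    then show ?thesis
      using p by (auto simp: colombeau_rel_def algebra_simps intro: moderate_mult)
  qed
  done

instance
proof
  fix a b c :: "'a colombeau"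
  show "a * b * c = a * (b * c)"
    by transfer (simp add: colombeau_rel_def mult.assoc negligible_0 moderate_mult)
  show "a * b = b * a"
    by transfer (simp add: colombeau_rel_def mult.commute negligible_0 moderate_mult)
  show "1 * a = a"
    by transfer (simp add: colombeau_rel_def)
  show "(a + b) * c = a * c + b * c"
    by transfer
      (simp add: colombeau_rel_def distrib_right negligible_0 moderate_mult moderate_add)
  show "(0::'a colombeau) \<noteq> 1"
  proof
    assume "(0::'a colombeau) = 1"
    then have "colombeau_rel (\<lambda>_. 0::'a) (\<lambda>_. 1)"
      by transfer
    then have "(\<lambda>\<epsilon>. norm (1::'a)) \<in> O[at_right 0](\<lambda>\<epsilon>. \<epsilon> ^ 1)"
      unfolding colombeau_rel_def negligible_net_def by (auto dest!: spec[of _ 1])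
    then obtain c where c: "c > 0" "eventually (\<lambda>\<epsilon>. 1 \<le> c * \<bar>\<epsilon>\<bar>) (at_right (0::real))"
      by (auto elim!: landau_o.bigE)
    have "eventually (\<lambda>\<epsilon>. c * \<bar>\<epsilon>\<bar> < 1) (at_right (0::real))"
      by (rule eventually_at_rightI[of 0 "1 / c"]) (use c(1) in \<open>auto simp: field_simps\<close>)
    with c(2) have "eventually (\<lambda>\<epsilon>. False) (at_right (0::real))"
      by eventually_elim simp
    then show False
      by simp
  qed
qed

end

text \<open>This is meant for \<open>real colombeau\<close>; at vector types it is not used.\<close>

instantiation colombeau :: ("{real_normed_vector, ord}") ord
begin

definition less_eq_colombeau :: "'a colombeau \<Rightarrow> 'a colombeau \<Rightarrow> bool" where
  "x \<le> y \<longleftrightarrow> (\<exists>x' y'. represents x' x \<and> represents y' y \<and> (\<forall>\<epsilon>\<in>{0<..1}. x' \<epsilon> \<le> y' \<epsilon>))"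

definition less_colombeau :: "'a colombeau \<Rightarrow> 'a colombeau \<Rightarrow> bool" where
  "less_colombeau x y \<longleftrightarrow> x \<le> y \<and> \<not> y \<le> x"

instance ..

end

lift_definition gnorm :: "'a::real_normed_vector colombeau \<Rightarrow> real colombeau"
  is "\<lambda>x \<epsilon>. norm (x \<epsilon>)"
  subgoal premises prems for x y
  proof -
    note p = colombeau_relD[OF prems]
    have "negligible_net (\<lambda>\<epsilon>. norm (x \<epsilon>) - norm (y \<epsilon>))"
      unfolding negligible_net_def
    proof
      fix n :: nat
      have "(\<lambda>\<epsilon>. norm (norm (x \<epsilon>) - norm (y \<epsilon>))) \<in> O[at_right 0](\<lambda>\<epsilon>. norm (x \<epsilon> - y \<epsilon>))"
        by (intro bigoI[of _ 1] always_eventually allI) (simp add: norm_triangle_ineq3)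
      then show "(\<lambda>\<epsilon>. norm (norm (x \<epsilon>) - norm (y \<epsilon>))) \<in> O[at_right 0](\<lambda>\<epsilon>. \<epsilon> ^ n)"
        using p by (auto simp: negligible_net_def intro: landau_o.big_trans)
    qed
    then show ?thesis
      using p by (auto simp: colombeau_rel_def intro: moderate_norm)
  qed
  done

lift_definition gscale :: "real colombeau \<Rightarrow> 'a::real_normed_vector colombeau \<Rightarrow> 'a colombeau"
  is "\<lambda>r x \<epsilon>. r \<epsilon> *\<^sub>R x \<epsilon>"
  subgoal premises prems for r r' x x'
  proof -
    note p = colombeau_relD[OF prems(1)] colombeau_relD[OF prems(2)]
    have "negligible_net (\<lambda>\<epsilon>. r \<epsilon> *\<^sub>R (x \<epsilon> - x' \<epsilon>) + (r \<epsilon> - r' \<epsilon>) *\<^sub>R x' \<epsilon>)"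
      using p by (intro negligible_add negligible_scaleR_left negligible_scaleR_right) auto
    then show ?thesis
      using p by (auto simp: colombeau_rel_def algebra_simps intro: moderate_scaleR)
  qed
  done

definition ginvertible :: "real colombeau \<Rightarrow> bool" where
  "ginvertible x \<longleftrightarrow> (\<exists>y. x * y = 1)"

definition ginverse :: "real colombeau \<Rightarrow> real colombeau" where
  "ginverse x = (THE y. x * y = 1)"

definition gconst :: "real \<Rightarrow> real colombeau" where
  "gconst a = abs_colombeau (\<lambda>_. a)"

definition rho_powr :: "real \<Rightarrow> real colombeau" where
  "rho_powr a = abs_colombeau (\<lambda>\<epsilon>. \<epsilon> powr a)"

definition gpositive :: "real colombeau set" where
  "gpositive = {x. 0 \<le> x \<and> ginvertible x}"

definition compact_points :: "(real^'n) set \<Rightarrow> (real^'n) colombeau set" where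
  "compact_points \<Omega> =
     {x. \<exists>x' K. represents x' x \<and> compact K \<and> K \<subseteq> \<Omega> \<and> (\<forall>\<^sub>F \<epsilon> in at_right 0. x' \<epsilon> \<in> K)}"

definition gsphere :: "(real^'n) colombeau set" where
  "gsphere = {x. gnorm x = 1}"

definition fast_scale :: "(real^'n) colombeau set" where
  "fast_scale = {x. \<exists>a>0. rho_powr (- a) \<le> gnorm x}"

definition approx_fast :: "(real^'n) colombeau \<Rightarrow> (real^'n) colombeau \<Rightarrow> bool"
    (infix \<open>\<approx>\<^sub>f\<^sub>a\<^sub>s\<^sub>t\<close> 50) where
  "x \<approx>\<^sub>f\<^sub>a\<^sub>s\<^sub>t y \<longleftrightarrow> (\<exists>a>0. gnorm (x - y) \<le> rho_powr a)"

definition approx_slow_0 :: "real colombeau \<Rightarrow> bool" where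
  "approx_slow_0 r \<longleftrightarrow> (\<forall>a>0. rho_powr a \<le> gnorm r \<and> gnorm r \<le> gconst a)"

definition slow_scale_nbhd ::
    "(real^'n) set \<Rightarrow> (real^'n) colombeau \<Rightarrow> (real^'n) colombeau set \<Rightarrow> bool" where
  "slow_scale_nbhd \<Omega> x0 V \<longleftrightarrow> V \<subseteq> compact_points \<Omega> \<and>
     (\<exists>r\<in>gpositive. approx_slow_0 r \<and> {x. gnorm (x - x0) \<le> r} \<subseteq> V)"

definition Gamma_fast :: "(real^'n) colombeau \<Rightarrow> (real^'n) colombeau set" where
  "Gamma_fast \<xi>0 =
     {\<xi>. ginvertible (gnorm \<xi>) \<and> gscale (ginverse (gnorm \<xi>)) \<xi> \<approx>\<^sub>f\<^sub>a\<^sub>s\<^sub>t \<xi>0}"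


section \<open>Smooth functions and multi-indices\<close>

definition partial :: "'n \<Rightarrow> (real^'n \<Rightarrow> complex) \<Rightarrow> real^'n \<Rightarrow> complex" where
  "partial i f x = vector_derivative (\<lambda>t. f (x + t *\<^sub>R axis i 1)) (at 0)"

definition coord_list :: "'n::finite list" where
  "coord_list = (SOME is. set is = UNIV \<and> distinct is)"

text \<open>\<open>\<partial>\<^sup>\<alpha> = \<partial>\<^sub>1\<^sup>\<alpha>\<^sup>1 \<dots> \<partial>\<^sub>d\<^sup>\<alpha>\<^sup>d\<close>; the index type carries no order, so some enumeration of the
  coordinates is fixed (immaterial for smooth functions).\<close>

definition mpartial :: "('n \<Rightarrow> nat) \<Rightarrow> (real^'n \<Rightarrow> complex) \<Rightarrow> real^'n \<Rightarrow> complex" where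
  "mpartial \<alpha> f = foldr (\<lambda>i g. (partial i ^^ \<alpha> i) g) coord_list f"

definition monomial :: "('n \<Rightarrow> nat) \<Rightarrow> real^'n \<Rightarrow> real" where
  "monomial \<alpha> x = (\<Prod>i\<in>UNIV. (x $ i) ^ \<alpha> i)"

text \<open>For open \<open>\<Omega>\<close>: iterated partial derivatives, in any order, are (totally) differentiable,
  so in particular they all exist and are continuous.\<close>

definition smooth_on :: "(real^'n) set \<Rightarrow> (real^'n \<Rightarrow> complex) \<Rightarrow> bool" where
  "smooth_on \<Omega> f \<longleftrightarrow> (\<forall>is. \<forall>x\<in>\<Omega>. foldr partial is f differentiable (at x))"

definition schwartz :: "(real^'n \<Rightarrow> complex) set" where
  "schwartz = {f. smooth_on UNIV f \<and>
     (\<forall>\<alpha> \<beta>. bounded (range (\<lambda>x. monomial \<alpha> x *\<^sub>R mpartial \<beta> f x)))}"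

text \<open>\<open>sup\<^sub>K |f\<^sub>\<epsilon>| = O(g(\<epsilon>))\<close>, spelled out because the real-valued \<open>SUP\<close> over an empty or
  unbounded family is a junk value.\<close>

definition sup_bigo ::
    "'b set \<Rightarrow> (real \<Rightarrow> 'b \<Rightarrow> complex) \<Rightarrow> (real \<Rightarrow> real) \<Rightarrow> bool" where
  "sup_bigo K f g \<longleftrightarrow> (\<exists>C. \<forall>\<^sub>F \<epsilon> in at_right 0. \<forall>x\<in>K. norm (f \<epsilon> x) \<le> C * g \<epsilon>)"


section \<open>The algebra of generalized functions on an open set\<close>

type_synonym 'n fnet = "real \<Rightarrow> real^'n \<Rightarrow> complex"

definition EM :: "(real^'n) set \<Rightarrow> 'n fnet set" where
  "EM \<Omega> = {u. (\<forall>\<epsilon>\<in>{0<..1}. smooth_on \<Omega> (u \<epsilon>)) \<and>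
     (\<forall>K \<alpha>. compact K \<and> K \<subseteq> \<Omega> \<longrightarrow>
        (\<exists>N::nat. sup_bigo K (\<lambda>\<epsilon>. mpartial \<alpha> (u \<epsilon>)) (\<lambda>\<epsilon>. inverse (\<epsilon> ^ N))))}"

text \<open>Functions are total but only their values on \<open>\<Omega>\<close> matter: nets that agree on \<open>\<Omega>\<close> are
  related.\<close>

definition Grel :: "(real^'n) set \<Rightarrow> ('n fnet \<times> 'n fnet) set" where
  "Grel \<Omega> = {(u, v). u \<in> EM \<Omega> \<and> v \<in> EM \<Omega> \<and>
     (\<forall>K \<alpha> (n::nat). compact K \<and> K \<subseteq> \<Omega> \<longrightarrow>
        sup_bigo K (\<lambda>\<epsilon>. mpartial \<alpha> (\<lambda>x. u \<epsilon> x - v \<epsilon> x)) (\<lambda>\<epsilon>. \<epsilon> ^ n))}"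

definition G :: "(real^'n) set \<Rightarrow> 'n fnet set set" where
  "G \<Omega> = EM \<Omega> // Grel \<Omega>"

definition Gderiv :: "(real^'n) set \<Rightarrow> ('n \<Rightarrow> nat) \<Rightarrow> 'n fnet set \<Rightarrow> 'n fnet set" where
  "Gderiv \<Omega> \<alpha> u = Grel \<Omega> `` ((\<lambda>u' \<epsilon>. mpartial \<alpha> (u' \<epsilon>)) ` u)"

text \<open>The point value \<open>[u\<^sub>\<epsilon>(x\<^sub>\<epsilon>)]\<close>, which does not depend on the representatives.\<close>

definition Gpoint :: "(real^'n) set \<Rightarrow> 'n fnet set \<Rightarrow> (real^'n) colombeau \<Rightarrow> complex colombeau" where
  "Gpoint \<Omega> u x = (THE y. \<exists>u'\<in>u. \<exists>x' K. represents x' x \<and> compact K \<and> K \<subseteq> \<Omega> \<and>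
     (\<forall>\<^sub>F \<epsilon> in at_right 0. x' \<epsilon> \<in> K) \<and> y = abs_colombeau (\<lambda>\<epsilon>. u' \<epsilon> (x' \<epsilon>)))"

definition Grestrict :: "(real^'n) set \<Rightarrow> 'n fnet set \<Rightarrow> 'n fnet set" where
  "Grestrict \<omega> u = Grel \<omega> `` u"

definition Gzero :: "(real^'n) set \<Rightarrow> 'n fnet set" where
  "Gzero \<omega> = Grel \<omega> `` {\<lambda>_ _. 0}"

definition Gsupport :: "(real^'n) set \<Rightarrow> 'n fnet set \<Rightarrow> (real^'n) set" where
  "Gsupport \<Omega> u = \<Omega> - \<Union>{\<omega>. open \<omega> \<and> \<omega> \<subseteq> \<Omega> \<and> Grestrict \<omega> u = Gzero \<omega>}"

definition Gc :: "(real^'n) set \<Rightarrow> 'n fnet set set" where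
  "Gc \<Omega> = {u \<in> G \<Omega>. compact (Gsupport \<Omega> u)}"


section \<open>The algebra based on the Schwartz space\<close>

definition ES :: "'n::finite fnet set" where
  "ES = {v. (\<forall>\<epsilon>\<in>{0<..1}. v \<epsilon> \<in> schwartz) \<and>
     (\<forall>\<alpha> \<beta>. \<exists>N::nat. sup_bigo UNIV (\<lambda>\<epsilon> x. monomial \<alpha> x *\<^sub>R mpartial \<beta> (v \<epsilon>) x)
        (\<lambda>\<epsilon>. inverse (\<epsilon> ^ N)))}"

definition GSrel :: "('n::finite fnet \<times> 'n fnet) set" where
  "GSrel = {(v, w). v \<in> ES \<and> w \<in> ES \<and>
     (\<forall>\<alpha> \<beta> (n::nat). sup_bigo UNIV
        (\<lambda>\<epsilon> x. monomial \<alpha> x *\<^sub>R mpartial \<beta> (\<lambda>x. v \<epsilon> x - w \<epsilon> x) x) (\<lambda>\<epsilon>. \<epsilon> ^ n))}"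

definition GS :: "'n::finite fnet set set" where
  "GS = ES // GSrel"

text \<open>The embedding of \<open>Gc \<Omega>\<close>: extend by zero the representatives supported in a fixed compact
  set and take the class they generate.\<close>

definition Gc_to_GS :: "(real^'n) set \<Rightarrow> 'n fnet set \<Rightarrow> 'n fnet set" where
  "Gc_to_GS \<Omega> v = GSrel ``
     {(\<lambda>\<epsilon> x. if x \<in> \<Omega> then v' \<epsilon> x else 0) | v'.
        v' \<in> v \<and> (\<exists>K. compact K \<and> K \<subseteq> \<Omega> \<and> (\<forall>\<epsilon>\<in>{0<..1}. \<forall>x\<in>\<Omega> - K. v' \<epsilon> x = 0))}"

definition fourier :: "(real^'n \<Rightarrow> complex) \<Rightarrow> real^'n \<Rightarrow> complex" where
  "fourier f \<xi> = (\<integral>x. f x * exp (- (\<i> * of_real (x \<bullet> \<xi>))) \<partial>lborel)"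

definition GSfourier :: "'n::finite fnet set \<Rightarrow> 'n fnet set" where
  "GSfourier v = GSrel `` ((\<lambda>v' \<epsilon>. fourier (v' \<epsilon>)) ` v)"

definition GSpoint :: "'n::finite fnet set \<Rightarrow> (real^'n) colombeau \<Rightarrow> complex colombeau" where
  "GSpoint w \<xi> =
     (THE y. \<exists>w'\<in>w. \<exists>\<xi>'. represents \<xi>' \<xi> \<and> y = abs_colombeau (\<lambda>\<epsilon>. w' \<epsilon> (\<xi>' \<epsilon>)))"


section \<open>Regularity\<close>

definition microlocally_regular ::
    "(real^'n) set \<Rightarrow> 'n fnet set \<Rightarrow> (real^'n) colombeau \<Rightarrow> (real^'n) colombeau \<Rightarrow> bool" where
  "microlocally_regular \<Omega> u x0 \<xi>0 \<longleftrightarrow>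
     (\<exists>v\<in>Gc \<Omega>. (\<forall>x. x \<approx>\<^sub>f\<^sub>a\<^sub>s\<^sub>t x0 \<longrightarrow> Gpoint \<Omega> u x = Gpoint \<Omega> v x) \<and>
        (\<forall>\<xi>\<in>fast_scale \<inter> Gamma_fast \<xi>0. GSpoint (GSfourier (Gc_to_GS \<Omega> v)) \<xi> = 0))"

definition Ginf_at :: "(real^'n) set \<Rightarrow> 'n fnet set \<Rightarrow> (real^'n) colombeau \<Rightarrow> bool" where
  "Ginf_at \<Omega> u x \<longleftrightarrow>
     (\<exists>N::nat. \<forall>\<alpha>. gnorm (Gpoint \<Omega> (Gderiv \<Omega> \<alpha> u) x) \<le> rho_powr (- real N))"

definition Ginf_on ::
    "(real^'n) set \<Rightarrow> 'n fnet set \<Rightarrow> (real^'n) colombeau set \<Rightarrow> bool" where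
  "Ginf_on \<Omega> u A \<longleftrightarrow> (\<forall>x\<in>A. Ginf_at \<Omega> u x)"

end

theory Submission
  imports Defs "HOL-Probability.Probability"
begin

text \<open>Both directions rest on one principle: a statement about every generalized point of a family of sets
\<open>A\<^sub>\<epsilon>\<close> holds uniformly on \<open>A\<^sub>\<epsilon>\<close> for small \<open>\<epsilon>\<close>, because the points at which it fails can be collected into
one net (\<open>eventually_Ball_if_selections\<close>, and \<open>frequently_simultaneously\<close> for the case that the
statement contains an existential order). Below, \<open>d\<close> is the dimension, and nets of points and
functions are representatives.

Regular implies microlocally regular. On the ball of slow scale radius \<open>r\<close> around \<open>x\<^sub>0\<close> all derivatives
of \<open>u\<close> are bounded by one power \<open>\<epsilon>\<^sup>N\<close>, with \<open>N\<close> independent of the point (\<open>uniform_growth_order\<close>).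
Multiply \<open>u\<close> by a cutoff at the scale \<open>r\<close>. Each derivative of the cutoff costs a factor \<open>1/r\<close>, but any
fixed power of \<open>1/r\<close> is at most \<open>\<epsilon>\<^sup>-\<^sup>1\<close>, so the product \<open>v\<close> has derivatives of a common order as well.
Arbitrarily many integrations by parts then show that the Fourier transform of \<open>v\<close> is negligible at
every fast scale point, in whatever direction (\<open>fourier_negligible_fast_scale\<close>).

Microlocally regular implies regular. The function \<open>v\<close> depends on the direction, and the generalized
sphere has no compactness that would allow finitely many directions to suffice. Instead, localize to
the scale \<open>\<epsilon>\<^sup>a\<close> with a cutoff \<open>\<phi>\<close>: since \<open>u = v\<close> near \<open>x\<^sub>0\<close>, the localized net \<open>\<phi> u\<close> agrees with \<open>\<phi> v\<close> up
to negligible errors and does not depend on the direction any more. The transform of \<open>\<phi> v\<close> is a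
convolution with the transform of \<open>\<phi>\<close>, which is concentrated in the ball of radius \<open>\<epsilon>\<^sup>-\<^sup>3\<^sup>a\<^sup>/\<^sup>2\<close>. If
\<open>|\<xi>| \<ge> \<epsilon>\<^sup>-\<^sup>2\<^sup>a\<close>, this ball around \<open>\<xi>\<close> only contains points whose direction is \<open>\<epsilon>\<^sup>a\<^sup>/\<^sup>4\<close>-close to the
direction of \<open>\<xi>\<close>. Choosing \<open>v\<close> for that direction shows that the transform of \<open>\<phi> u\<close> is
negligible at \<open>\<xi>\<close> (\<open>localized_transform_negligible\<close>), hence uniformly for \<open>|\<xi>| \<ge> \<epsilon>\<^sup>-\<^sup>2\<^sup>a\<close>. By Fourier inversion,
a derivative of order \<open>k\<close> of \<open>u\<close> near \<open>x\<^sub>0\<close> is at most the order of \<open>u\<close> itself times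
\<open>\<epsilon>\<close> to the power \<open>-2a (k + 2d)\<close>, that is, it costs one power of \<open>\<epsilon>\<close> if \<open>a\<close> is small in terms of \<open>k\<close>
(\<open>microlocally_regular_growth\<close>). Letting \<open>a\<close> tend to zero slowly with \<open>\<epsilon>\<close> gives a slow scale ball on
which all derivatives have a common order (\<open>diagonal_index\<close>).

What has to be supplied in addition is the passage from classes to representatives, in particular
that elements with compact support have compactly supported representatives (\<open>Gc_ex_rep\<close>) and that
point values of the function and of its Fourier transform can be read off from them (\<open>Gpoint_G\<close>,
\<open>Gpoint_Gderiv\<close>, \<open>GSpoint_fourier\<close>), and some classical analysis: the symmetry of second derivatives,
smooth cutoffs, and Fourier inversion for test functions.\<close>

section \<open>Orders of growth of nets, uniformly over families of sets\<close>

abbreviation for_small :: "(real \<Rightarrow> bool) \<Rightarrow> bool" (binder \<open>\<forall>\<^sub>0\<close> 10) where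
  "for_small P \<equiv> eventually P (at_right (0::real))"

text \<open>The set of arguments may vary with \<open>\<epsilon>\<close>: a constant compact set gives the seminorms of \<open>\<G>(\<Omega>)\<close>, the
singleton of a net of points gives point values. Real exponents are used throughout, so that the
orders can be computed with \<open>powr_add\<close>; constant factors are absorbed by an arbitrarily small change
of the exponent.\<close>

definition moderate_on :: "(real \<Rightarrow> 'a set) \<Rightarrow> (real \<Rightarrow> 'a \<Rightarrow> real) \<Rightarrow> bool" where
  "moderate_on A f \<longleftrightarrow> (\<exists>N. \<forall>\<^sub>0\<epsilon>. \<forall>x\<in>A \<epsilon>. f \<epsilon> x \<le> \<epsilon> powr N)"

definition negligible_on :: "(real \<Rightarrow> 'a set) \<Rightarrow> (real \<Rightarrow> 'a \<Rightarrow> real) \<Rightarrow> bool" where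
  "negligible_on A f \<longleftrightarrow> (\<forall>n. \<forall>\<^sub>0\<epsilon>. \<forall>x\<in>A \<epsilon>. f \<epsilon> x \<le> \<epsilon> powr n)"

lemma small_less: "\<delta> > 0 \<Longrightarrow> \<forall>\<^sub>0\<epsilon>. 0 < \<epsilon> \<and> \<epsilon> < \<delta>"
  by (rule eventually_at_rightI[of 0 \<delta>]) auto

lemma small_unit: "\<forall>\<^sub>0\<epsilon>. \<epsilon> \<in> {0<..1}"
  by (rule eventually_at_rightI[of 0 1]) auto

lemma small_pos: "\<forall>\<^sub>0\<epsilon>. 0 < \<epsilon>"
  by (rule eventually_at_rightI[of 0 1]) auto

lemma tendsto_powr_small: "a > 0 \<Longrightarrow> ((\<lambda>\<epsilon>. \<epsilon> powr a) \<longlongrightarrow> 0) (at_right (0::real))"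
  by real_asymp

lemma small_powr_le:
  assumes "c > 0" "a > 0" shows "\<forall>\<^sub>0\<epsilon>. \<epsilon> powr a < c"
  using order_tendstoD(2)[OF tendsto_powr_small[OF assms(2)] assms(1)] .

lemma small_const_le:
  assumes "a < 0" shows "\<forall>\<^sub>0\<epsilon>. C \<le> \<epsilon> powr a"
proof -
  have "filterlim (\<lambda>\<epsilon>. \<epsilon> powr a) at_top (at_right (0::real))"
    using assms by real_asymp
  then show ?thesis by (simp add: filterlim_at_top)
qed

lemma small_const_mult:
  assumes "b < a" shows "\<forall>\<^sub>0\<epsilon>. C * \<epsilon> powr a \<le> \<epsilon> powr b"
  using small_const_le[OF iffD2[OF diff_less_0_iff_less assms], of C] small_pos
proof eventually_elim
  case (elim \<epsilon>)
  have "C * \<epsilon> powr a \<le> \<epsilon> powr (b - a) * \<epsilon> powr a"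
    using elim by (intro mult_right_mono) auto
  then show ?case using elim by (simp flip: powr_add)
qed

lemma moderate_on_mono:
  assumes "moderate_on A g" "\<forall>\<^sub>0\<epsilon>. \<forall>x\<in>B \<epsilon>. x \<in> A \<epsilon> \<and> f \<epsilon> x \<le> g \<epsilon> x"
  shows "moderate_on B f"
proof -
  obtain N where "\<forall>\<^sub>0\<epsilon>. \<forall>x\<in>A \<epsilon>. g \<epsilon> x \<le> \<epsilon> powr N"
    using assms(1) by (auto simp: moderate_on_def)
  with assms(2) have "\<forall>\<^sub>0\<epsilon>. \<forall>x\<in>B \<epsilon>. f \<epsilon> x \<le> \<epsilon> powr N"
    by eventually_elim force
  then show ?thesis by (auto simp: moderate_on_def)
qed

lemma negligible_on_mono:
  assumes "negligible_on A g" "\<forall>\<^sub>0\<epsilon>. \<forall>x\<in>B \<epsilon>. x \<in> A \<epsilon> \<and> f \<epsilon> x \<le> g \<epsilon> x"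
  shows "negligible_on B f"
  unfolding negligible_on_def
proof
  fix n
  have "\<forall>\<^sub>0\<epsilon>. \<forall>x\<in>A \<epsilon>. g \<epsilon> x \<le> \<epsilon> powr n"
    using assms(1) by (auto simp: negligible_on_def)
  with assms(2) show "\<forall>\<^sub>0\<epsilon>. \<forall>x\<in>B \<epsilon>. f \<epsilon> x \<le> \<epsilon> powr n"
    by eventually_elim force
qed

lemma moderate_on_const: "moderate_on A (\<lambda>_ _. C)"
  unfolding moderate_on_def
  by (rule exI[of _ "-1"], rule eventually_mono[OF small_const_le[of "-1" C]]) auto

lemma moderate_on_powr: "moderate_on A (\<lambda>\<epsilon> _. \<epsilon> powr a)"
  unfolding moderate_on_def by (rule exI[of _ a]) auto

lemma moderate_on_add:
  assumes "moderate_on A f" "moderate_on A g" shows "moderate_on A (\<lambda>\<epsilon> x. f \<epsilon> x + g \<epsilon> x)"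
proof -
  obtain M N where "\<forall>\<^sub>0\<epsilon>. \<forall>x\<in>A \<epsilon>. f \<epsilon> x \<le> \<epsilon> powr M" "\<forall>\<^sub>0\<epsilon>. \<forall>x\<in>A \<epsilon>. g \<epsilon> x \<le> \<epsilon> powr N"
    using assms by (auto simp: moderate_on_def)
  moreover have "\<forall>\<^sub>0\<epsilon>. 2 * \<epsilon> powr (min M N) \<le> \<epsilon> powr (min M N - 1)"
    by (rule small_const_mult) auto
  ultimately have "\<forall>\<^sub>0\<epsilon>. \<forall>x\<in>A \<epsilon>. f \<epsilon> x + g \<epsilon> x \<le> \<epsilon> powr (min M N - 1)"
    using small_unit
  proof eventually_elim
    case (elim \<epsilon>)
    have "\<epsilon> powr M \<le> \<epsilon> powr min M N" "\<epsilon> powr N \<le> \<epsilon> powr min M N"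
      using elim by (auto intro!: powr_mono')
    then show ?case using elim by force
  qed
  then show ?thesis by (auto simp: moderate_on_def)
qed

lemma negligible_on_add:
  assumes "negligible_on A f" "negligible_on A g" shows "negligible_on A (\<lambda>\<epsilon> x. f \<epsilon> x + g \<epsilon> x)"
  unfolding negligible_on_def
proof
  fix n
  have "\<forall>\<^sub>0\<epsilon>. \<forall>x\<in>A \<epsilon>. f \<epsilon> x \<le> \<epsilon> powr (n + 1)" "\<forall>\<^sub>0\<epsilon>. \<forall>x\<in>A \<epsilon>. g \<epsilon> x \<le> \<epsilon> powr (n + 1)"
    using assms by (auto simp: negligible_on_def)
  moreover have "\<forall>\<^sub>0\<epsilon>. 2 * \<epsilon> powr (n + 1) \<le> \<epsilon> powr n"
    by (rule small_const_mult) auto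
  ultimately show "\<forall>\<^sub>0\<epsilon>. \<forall>x\<in>A \<epsilon>. f \<epsilon> x + g \<epsilon> x \<le> \<epsilon> powr n"
    by eventually_elim force
qed

lemma negligible_on_mult:
  assumes "negligible_on A f" "moderate_on A g"
    and "\<forall>\<^sub>0\<epsilon>. \<forall>x\<in>A \<epsilon>. 0 \<le> f \<epsilon> x \<and> 0 \<le> g \<epsilon> x"
  shows "negligible_on A (\<lambda>\<epsilon> x. f \<epsilon> x * g \<epsilon> x)"
  unfolding negligible_on_def
proof
  fix n
  obtain N where "\<forall>\<^sub>0\<epsilon>. \<forall>x\<in>A \<epsilon>. g \<epsilon> x \<le> \<epsilon> powr N"
    using assms by (auto simp: moderate_on_def)
  moreover have "\<forall>\<^sub>0\<epsilon>. \<forall>x\<in>A \<epsilon>. f \<epsilon> x \<le> \<epsilon> powr (n - N)"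
    using assms by (auto simp: negligible_on_def)
  ultimately show "\<forall>\<^sub>0\<epsilon>. \<forall>x\<in>A \<epsilon>. f \<epsilon> x * g \<epsilon> x \<le> \<epsilon> powr n"
    using assms(3) small_unit
  proof eventually_elim
    case (elim \<epsilon>)
    show ?case
    proof
      fix x assume "x \<in> A \<epsilon>"
      then have "f \<epsilon> x * g \<epsilon> x \<le> \<epsilon> powr (n - N) * \<epsilon> powr N"
        using elim by (intro mult_mono) auto
      then show "f \<epsilon> x * g \<epsilon> x \<le> \<epsilon> powr n"
        using elim by (simp flip: powr_add)
    qed
  qed
qed

lemma moderate_on_mult:
  assumes "moderate_on A f" "moderate_on A g"
    and "\<forall>\<^sub>0\<epsilon>. \<forall>x\<in>A \<epsilon>. 0 \<le> f \<epsilon> x \<and> 0 \<le> g \<epsilon> x"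
  shows "moderate_on A (\<lambda>\<epsilon> x. f \<epsilon> x * g \<epsilon> x)"
proof -
  obtain M N where "\<forall>\<^sub>0\<epsilon>. \<forall>x\<in>A \<epsilon>. f \<epsilon> x \<le> \<epsilon> powr M" "\<forall>\<^sub>0\<epsilon>. \<forall>x\<in>A \<epsilon>. g \<epsilon> x \<le> \<epsilon> powr N"
    using assms by (auto simp: moderate_on_def)
  then have "\<forall>\<^sub>0\<epsilon>. \<forall>x\<in>A \<epsilon>. f \<epsilon> x * g \<epsilon> x \<le> \<epsilon> powr (M + N)"
    using assms(3)
  proof eventually_elim
    case (elim \<epsilon>)
    show ?case
    proof
      fix x assume "x \<in> A \<epsilon>"
      then have "f \<epsilon> x * g \<epsilon> x \<le> \<epsilon> powr M * \<epsilon> powr N"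
        using elim by (intro mult_mono) auto
      then show "f \<epsilon> x * g \<epsilon> x \<le> \<epsilon> powr (M + N)"
        by (simp flip: powr_add)
    qed
  qed
  then show ?thesis by (auto simp: moderate_on_def)
qed

lemma negligible_on_zero: "negligible_on A (\<lambda>_ _. 0)"
  by (auto simp: negligible_on_def)

lemma negligible_on_sum:
  assumes "finite I" "\<And>i. i \<in> I \<Longrightarrow> negligible_on A (f i)"
  shows "negligible_on A (\<lambda>\<epsilon> x. \<Sum>i\<in>I. f i \<epsilon> x)"
  using assms by (induction I) (auto intro: negligible_on_add negligible_on_zero)

lemma moderate_on_sum_list:
  assumes "\<And>i. i \<in> set I \<Longrightarrow> moderate_on A (f i)"
  shows "moderate_on A (\<lambda>\<epsilon> x. \<Sum>i\<leftarrow>I. f i \<epsilon> x)"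
  using assms by (induction I) (auto intro: moderate_on_add moderate_on_const[of _ 0])

lemma negligible_on_sum_list:
  assumes "\<And>i. i \<in> set I \<Longrightarrow> negligible_on A (f i)"
  shows "negligible_on A (\<lambda>\<epsilon> x. \<Sum>i\<leftarrow>I. f i \<epsilon> x)"
  using assms by (induction I) (auto intro: negligible_on_add negligible_on_zero)

lemma moderate_on_Un: 
  assumes "moderate_on A f" "moderate_on B f" shows "moderate_on (\<lambda>\<epsilon>. A \<epsilon> \<union> B \<epsilon>) f"
proof -
  obtain M N where "\<forall>\<^sub>0\<epsilon>. \<forall>x\<in>A \<epsilon>. f \<epsilon> x \<le> \<epsilon> powr M" "\<forall>\<^sub>0\<epsilon>. \<forall>x\<in>B \<epsilon>. f \<epsilon> x \<le> \<epsilon> powr N"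
    using assms by (auto simp: moderate_on_def)
  then have "\<forall>\<^sub>0\<epsilon>. \<forall>x\<in>A \<epsilon> \<union> B \<epsilon>. f \<epsilon> x \<le> \<epsilon> powr min M N"
    using small_unit
  proof eventually_elim
    case (elim \<epsilon>)
    have "\<epsilon> powr M \<le> \<epsilon> powr min M N" "\<epsilon> powr N \<le> \<epsilon> powr min M N"
      using elim by (auto intro!: powr_mono')
    then show ?case using elim by force
  qed
  then show ?thesis by (auto simp: moderate_on_def)
qed

lemma negligible_on_Un: 
  assumes "negligible_on A f" "negligible_on B f" shows "negligible_on (\<lambda>\<epsilon>. A \<epsilon> \<union> B \<epsilon>) f"
  unfolding negligible_on_def
proof
  fix n
  have "\<forall>\<^sub>0\<epsilon>. \<forall>x\<in>A \<epsilon>. f \<epsilon> x \<le> \<epsilon> powr n" "\<forall>\<^sub>0\<epsilon>. \<forall>x\<in>B \<epsilon>. f \<epsilon> x \<le> \<epsilon> powr n"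
    using assms by (auto simp: negligible_on_def)
  then show "\<forall>\<^sub>0\<epsilon>. \<forall>x\<in>A \<epsilon> \<union> B \<epsilon>. f \<epsilon> x \<le> \<epsilon> powr n"
    by eventually_elim auto
qed

lemma negligible_on_UN_finite: 
  assumes "finite I" "\<And>i. i \<in> I \<Longrightarrow> negligible_on (A i) f" shows "negligible_on (\<lambda>\<epsilon>. \<Union>i\<in>I. A i \<epsilon>) f"
  using assms
proof (induction I)
  case empty then show ?case by (simp add: negligible_on_def)
next
  case (insert i I)
  then show ?case using negligible_on_Un[of "A i" f "\<lambda>\<epsilon>. \<Union>i\<in>I. A i \<epsilon>"] by simp
qed

lemma sup_bigo_moderate_on:
  "(\<exists>N::nat. sup_bigo K f (\<lambda>\<epsilon>. inverse (\<epsilon> ^ N))) \<longleftrightarrow> moderate_on (\<lambda>_. K) (\<lambda>\<epsilon> x. norm (f \<epsilon> x))"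
proof
  assume "\<exists>N::nat. sup_bigo K f (\<lambda>\<epsilon>. inverse (\<epsilon> ^ N))"
  then obtain N :: nat and C where C: "\<forall>\<^sub>0\<epsilon>. \<forall>x\<in>K. norm (f \<epsilon> x) \<le> C * inverse (\<epsilon> ^ N)"
    by (auto simp: sup_bigo_def)
  have "\<forall>\<^sub>0\<epsilon>. C * \<epsilon> powr (- real N) \<le> \<epsilon> powr (- real N - 1)"
    by (rule small_const_mult) auto
  with C small_pos have "\<forall>\<^sub>0\<epsilon>. \<forall>x\<in>K. norm (f \<epsilon> x) \<le> \<epsilon> powr (- real N - 1)"
    by eventually_elim (force simp: powr_minus powr_realpow)
  then show "moderate_on (\<lambda>_. K) (\<lambda>\<epsilon> x. norm (f \<epsilon> x))"
    by (auto simp: moderate_on_def)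
next
  assume "moderate_on (\<lambda>_. K) (\<lambda>\<epsilon> x. norm (f \<epsilon> x))"
  then obtain N where N: "\<forall>\<^sub>0\<epsilon>. \<forall>x\<in>K. norm (f \<epsilon> x) \<le> \<epsilon> powr N"
    by (auto simp: moderate_on_def)
  obtain M :: nat where M: "- N \<le> real M" using real_arch_simple by blast
  have "\<forall>\<^sub>0\<epsilon>. \<forall>x\<in>K. norm (f \<epsilon> x) \<le> 1 * inverse (\<epsilon> ^ M)"
    using N small_unit
  proof eventually_elim
    case (elim \<epsilon>)
    have "\<epsilon> powr N \<le> \<epsilon> powr (- real M)" using elim M by (intro powr_mono') auto
    then show ?case using elim by (force simp: powr_minus powr_realpow)
  qed
  then show "\<exists>N::nat. sup_bigo K f (\<lambda>\<epsilon>. inverse (\<epsilon> ^ N))"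
    unfolding sup_bigo_def by blast
qed

lemma sup_bigo_negligible_on:
  "(\<forall>n::nat. sup_bigo K f (\<lambda>\<epsilon>. \<epsilon> ^ n)) \<longleftrightarrow> negligible_on (\<lambda>_. K) (\<lambda>\<epsilon> x. norm (f \<epsilon> x))"
proof
  assume *: "\<forall>n::nat. sup_bigo K f (\<lambda>\<epsilon>. \<epsilon> ^ n)"
  show "negligible_on (\<lambda>_. K) (\<lambda>\<epsilon> x. norm (f \<epsilon> x))"
    unfolding negligible_on_def
  proof
    fix n
    obtain m :: nat where m: "n + 1 \<le> real m" using real_arch_simple by blast
    obtain C where C: "\<forall>\<^sub>0\<epsilon>. \<forall>x\<in>K. norm (f \<epsilon> x) \<le> C * \<epsilon> ^ m"
      using * by (auto simp: sup_bigo_def)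
    have "\<forall>\<^sub>0\<epsilon>. C * \<epsilon> powr real m \<le> \<epsilon> powr n"
      using m by (intro small_const_mult) auto
    with C small_pos show "\<forall>\<^sub>0\<epsilon>. \<forall>x\<in>K. norm (f \<epsilon> x) \<le> \<epsilon> powr n"
      by eventually_elim (force simp: powr_realpow)
  qed
next
  assume *: "negligible_on (\<lambda>_. K) (\<lambda>\<epsilon> x. norm (f \<epsilon> x))"
  show "\<forall>n::nat. sup_bigo K f (\<lambda>\<epsilon>. \<epsilon> ^ n)"
  proof
    fix n :: nat
    have "\<forall>\<^sub>0\<epsilon>. \<forall>x\<in>K. norm (f \<epsilon> x) \<le> \<epsilon> powr real n"
      using * by (auto simp: negligible_on_def)
    with small_pos have "\<forall>\<^sub>0\<epsilon>. \<forall>x\<in>K. norm (f \<epsilon> x) \<le> 1 * \<epsilon> ^ n"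
      by eventually_elim (auto simp: powr_realpow)
    then show "sup_bigo K f (\<lambda>\<epsilon>. \<epsilon> ^ n)" unfolding sup_bigo_def by blast
  qed
qed

lemma bigo_le_iff:
  fixes f g :: "real \<Rightarrow> real"
  assumes "\<And>\<epsilon>. 0 \<le> f \<epsilon>" "\<forall>\<^sub>0\<epsilon>. 0 \<le> g \<epsilon>"
  shows "f \<in> O[at_right 0](g) \<longleftrightarrow> (\<exists>C. \<forall>\<^sub>0\<epsilon>. f \<epsilon> \<le> C * g \<epsilon>)"
proof
  assume "f \<in> O[at_right 0](g)"
  then obtain C where "\<forall>\<^sub>0\<epsilon>. norm (f \<epsilon>) \<le> C * norm (g \<epsilon>)" by (auto elim: landau_o.bigE)
  with assms(2) have "\<forall>\<^sub>0\<epsilon>. f \<epsilon> \<le> C * g \<epsilon>" by eventually_elim (auto simp: assms)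
  then show "\<exists>C. \<forall>\<^sub>0\<epsilon>. f \<epsilon> \<le> C * g \<epsilon>" by blast
next
  assume "\<exists>C. \<forall>\<^sub>0\<epsilon>. f \<epsilon> \<le> C * g \<epsilon>"
  then obtain C where "\<forall>\<^sub>0\<epsilon>. f \<epsilon> \<le> C * g \<epsilon>" by blast
  with assms(2) have "\<forall>\<^sub>0\<epsilon>. norm (f \<epsilon>) \<le> C * norm (g \<epsilon>)" by eventually_elim (auto simp: assms)
  then show "f \<in> O[at_right 0](g)" by (rule bigoI)
qed

lemma moderate_iff_moderate_on: "moderate x \<longleftrightarrow> moderate_on (\<lambda>\<epsilon>. {x \<epsilon>}) (\<lambda>_. norm)"
proof -
  have "moderate x \<longleftrightarrow> (\<exists>N::nat. sup_bigo {()} (\<lambda>\<epsilon> _. of_real (norm (x \<epsilon>))) (\<lambda>\<epsilon>. inverse (\<epsilon> ^ N)))"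
    unfolding moderate_def sup_bigo_def
    by (subst bigo_le_iff) (auto intro: eventually_mono[OF small_pos])
  also have "\<dots> \<longleftrightarrow> moderate_on (\<lambda>\<epsilon>. {x \<epsilon>}) (\<lambda>_. norm)"
    unfolding sup_bigo_moderate_on by (simp add: moderate_on_def)
  finally show ?thesis .
qed

lemma moderate_iff: "moderate x \<longleftrightarrow> (\<exists>N. \<forall>\<^sub>0\<epsilon>. norm (x \<epsilon>) \<le> \<epsilon> powr N)"
  by (simp add: moderate_iff_moderate_on moderate_on_def)

lemma negligible_iff: "negligible_net x \<longleftrightarrow> (\<forall>n. \<forall>\<^sub>0\<epsilon>. norm (x \<epsilon>) \<le> \<epsilon> powr n)"
proof -
  have "negligible_net x \<longleftrightarrow> (\<forall>n::nat. sup_bigo {()} (\<lambda>\<epsilon> _. of_real (norm (x \<epsilon>))) (\<lambda>\<epsilon>. \<epsilon> ^ n))"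
    unfolding negligible_net_def sup_bigo_def
    by (subst bigo_le_iff) (auto intro: eventually_mono[OF small_pos])
  also have "\<dots> \<longleftrightarrow> negligible_on (\<lambda>\<epsilon>. {()}) (\<lambda>\<epsilon> _. norm (x \<epsilon>))"
    unfolding sup_bigo_negligible_on by (simp add: negligible_on_def)
  finally show ?thesis by (simp add: negligible_on_def)
qed

lemma negligible_iff_negligible_on: "negligible_net (\<lambda>\<epsilon>. f \<epsilon> (x \<epsilon>)) \<longleftrightarrow> negligible_on (\<lambda>\<epsilon>. {x \<epsilon>}) (\<lambda>\<epsilon> y. norm (f \<epsilon> y))"
  by (simp add: negligible_iff negligible_on_def)

lemma moderate_compose_iff_moderate_on: "moderate (\<lambda>\<epsilon>. f \<epsilon> (x \<epsilon>)) \<longleftrightarrow> moderate_on (\<lambda>\<epsilon>. {x \<epsilon>}) (\<lambda>\<epsilon> y. norm (f \<epsilon> y))"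
  by (simp add: moderate_iff moderate_on_def)

section \<open>Selection principles\<close>

text \<open>Pointwise implies uniform: choose a violating point wherever there is one. The selection \<open>a\<close> provides
the values at the remaining parameters.\<close>

lemma eventually_Ball_if_selections:
  assumes a: "\<forall>\<^sub>0\<epsilon>. a \<epsilon> \<in> A \<epsilon>"
    and sel: "\<And>s. \<forall>\<^sub>0\<epsilon>. s \<epsilon> \<in> A \<epsilon> \<Longrightarrow> \<forall>\<^sub>0\<epsilon>. P \<epsilon> (s \<epsilon>)"
  shows "\<forall>\<^sub>0\<epsilon>. \<forall>x\<in>A \<epsilon>. P \<epsilon> x"
proof -
  define s where "s \<epsilon> = (if \<exists>x\<in>A \<epsilon>. \<not> P \<epsilon> x then SOME x. x \<in> A \<epsilon> \<and> \<not> P \<epsilon> x else a \<epsilon>)" for \<epsilon>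
  have s: "s \<epsilon> \<in> A \<epsilon> \<and> \<not> P \<epsilon> (s \<epsilon>)" if "\<exists>x\<in>A \<epsilon>. \<not> P \<epsilon> x" for \<epsilon>
    using someI_ex[of "\<lambda>x. x \<in> A \<epsilon> \<and> \<not> P \<epsilon> x"] that by (auto simp: s_def)
  have "\<forall>\<^sub>0\<epsilon>. s \<epsilon> \<in> A \<epsilon>"
    using a by eventually_elim (use s in \<open>auto simp: s_def\<close>)
  from sel[OF this] show ?thesis
    by eventually_elim (use s in blast)
qed

lemma frequently_small: "frequently P (at_right (0::real)) \<longleftrightarrow> (\<forall>\<delta>>0. \<exists>\<epsilon>. 0 < \<epsilon> \<and> \<epsilon> < \<delta> \<and> P \<epsilon>)"
  unfolding frequently_def eventually_at_right_field by (auto simp: not_less) (meson not_less)+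

text \<open>Countably many conditions that hold for arbitrarily small parameters can be distributed over
disjoint sets of parameters, each of them accumulating at zero: choose a strictly decreasing sequence
that deals with the pairs \<open>(N, m)\<close> in turn, so that each \<open>N\<close> is served infinitely often.\<close>

lemma frequently_simultaneously:
  fixes R :: "nat \<Rightarrow> real \<Rightarrow> bool"
  assumes "\<And>N. frequently (R N) (at_right 0)"
  obtains \<nu> :: "real \<Rightarrow> nat" where "\<And>N. frequently (\<lambda>\<epsilon>. \<nu> \<epsilon> = N \<and> R N \<epsilon>) (at_right 0)"
proof -
  have "\<exists>e. \<forall>k. (0 < e k \<and> e k < 1 / real (Suc k) \<and> R (fst (prod_decode k)) (e k)) \<and> e (Suc k) < e k"
  proof (rule dependent_nat_choice)
    show "\<exists>x. 0 < x \<and> x < 1 / real (Suc 0) \<and> R (fst (prod_decode 0)) x"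
      using assms[of "fst (prod_decode 0)"] by (auto simp: frequently_small dest: spec[of _ 1])
  next
    fix x k assume "0 < x \<and> x < 1 / real (Suc k) \<and> R (fst (prod_decode k)) x"
    then have "0 < min x (1 / real (Suc (Suc k)))" by auto
    with assms[of "fst (prod_decode (Suc k))"]
    show "\<exists>y. (0 < y \<and> y < 1 / real (Suc (Suc k)) \<and> R (fst (prod_decode (Suc k))) y) \<and> y < x"
      unfolding frequently_small by (metis min_less_iff_conj)
  qed
  then obtain e where e: "\<And>k. 0 < e k" "\<And>k. e k < 1 / real (Suc k)"
    "\<And>k. R (fst (prod_decode k)) (e k)" "\<And>k. e (Suc k) < e k" by blast
  have "inj e"
    using e(4) by (intro linorder_injI) (metis less_irrefl lift_Suc_mono_less_iff[of "\<lambda>k. - e k"] neg_less_iff_less)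
  define \<nu> where "\<nu> \<epsilon> = fst (prod_decode (inv e \<epsilon>))" for \<epsilon>
  have "frequently (\<lambda>\<epsilon>. \<nu> \<epsilon> = N \<and> R N \<epsilon>) (at_right 0)" for N
    unfolding frequently_small
  proof safe
    fix \<delta> :: real assume "\<delta> > 0"
    then obtain m where m: "1 / real (Suc m) < \<delta>" using nat_approx_posE by blast
    define k where "k = prod_encode (N, m)"
    have "m \<le> k" unfolding k_def by (rule le_prod_encode_2)
    then have "1 / real (Suc k) \<le> 1 / real (Suc m)" by (simp add: frac_le)
    with m e(2)[of k] have "e k < \<delta>" by linarith
    moreover have "\<nu> (e k) = N" by (simp add: \<nu>_def \<open>inj e\<close> k_def)
    moreover have "R N (e k)" using e(3)[of k] by (simp add: k_def)
    ultimately show "\<exists>\<epsilon>>0. \<epsilon> < \<delta> \<and> \<nu> \<epsilon> = N \<and> R N \<epsilon>" using e(1) by blast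
  qed
  then show thesis using that by blast
qed

text \<open>Take the largest index up to \<open>1/\<epsilon>\<close> whose condition holds at \<open>\<epsilon>\<close>. Every fixed index qualifies from some
point on, so these indices tend to infinity.\<close>

lemma diagonal_index:
  fixes P :: "nat \<Rightarrow> real \<Rightarrow> bool"
  assumes "\<And>k. \<forall>\<^sub>0\<epsilon>. P k \<epsilon>"
  obtains \<kappa> :: "real \<Rightarrow> nat" where "\<forall>\<^sub>0\<epsilon>. P (\<kappa> \<epsilon>) \<epsilon>" "\<And>k. \<forall>\<^sub>0\<epsilon>. k \<le> \<kappa> \<epsilon>"
proof -
  define S where "S \<epsilon> = {k. real k \<le> 1 / \<epsilon> \<and> P k \<epsilon>}" for \<epsilon> :: real
  define \<kappa> where "\<kappa> \<epsilon> = Max (S \<epsilon>)" for \<epsilon>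
  have fin: "finite (S \<epsilon>)" for \<epsilon>
  proof -
    have "S \<epsilon> \<subseteq> {..nat \<lfloor>1 / \<epsilon>\<rfloor>}" by (auto simp: S_def le_nat_floor)
    then show ?thesis by (rule finite_subset) simp
  qed
  have in_S: "\<forall>\<^sub>0\<epsilon>. k \<in> S \<epsilon>" for k
    using assms[of k] small_less[of "1 / real (Suc k)", simplified]
  proof eventually_elim
    case (elim \<epsilon>)
    then have "real k * \<epsilon> \<le> 1" by (simp add: field_simps)
    with elim show ?case by (simp add: S_def field_simps)
  qed
  show thesis
  proof
    show "\<forall>\<^sub>0\<epsilon>. P (\<kappa> \<epsilon>) \<epsilon>"
      using in_S[of 0]
    proof eventually_elim
      case (elim \<epsilon>)
      then have "\<kappa> \<epsilon> \<in> S \<epsilon>" unfolding \<kappa>_def using fin by (intro Max_in) auto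
      then show ?case by (simp add: S_def)
    qed
    show "\<forall>\<^sub>0\<epsilon>. k \<le> \<kappa> \<epsilon>" for k
      using in_S[of k] by eventually_elim (simp add: \<kappa>_def fin)
  qed
qed

section \<open>Generalized numbers through representatives\<close>

lemma abs_colombeau_eq_iff:
  assumes "moderate x" "moderate y"
  shows "abs_colombeau x = abs_colombeau y \<longleftrightarrow> negligible_net (\<lambda>\<epsilon>. x \<epsilon> - y \<epsilon>)"
  using Quotient3_rel[OF Quotient3_colombeau, of x y] assms
  by (auto simp: colombeau_rel_def negligible_0)

lemma represents_ex: "\<exists>x'. represents x' x"
proof -
  have "colombeau_rel (rep_colombeau x) (rep_colombeau x)"
    using Quotient3_rep_reflp[OF Quotient3_colombeau] .
  then show ?thesis
    using Quotient3_abs_rep[OF Quotient3_colombeau, of x]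
    by (auto simp: represents_def colombeau_rel_def)
qed

lemma represents_abs: "moderate x \<Longrightarrow> represents x (abs_colombeau x)"
  by (simp add: represents_def)

lemma represents_unique:
  "represents x' x \<Longrightarrow> represents y' x \<Longrightarrow> negligible_net (\<lambda>\<epsilon>. x' \<epsilon> - y' \<epsilon>)"
  by (simp add: represents_def flip: abs_colombeau_eq_iff)

lemma represents_eq_iff:
  "represents x' x \<Longrightarrow> represents y' y \<Longrightarrow> x = y \<longleftrightarrow> negligible_net (\<lambda>\<epsilon>. x' \<epsilon> - y' \<epsilon>)"
  by (auto simp: represents_def abs_colombeau_eq_iff)

lemma negligible_imp_moderate: "negligible_net x \<Longrightarrow> moderate x"
  by (auto simp: negligible_iff moderate_iff)

lemma moderate_if_close:
  assumes "moderate x" "negligible_net (\<lambda>\<epsilon>. y \<epsilon> - x \<epsilon>)" shows "moderate y"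
  using moderate_add[OF assms(1) negligible_imp_moderate[OF assms(2)]] by simp

lemma represents_close:
  assumes "represents x' x" "negligible_net (\<lambda>\<epsilon>. y' \<epsilon> - x' \<epsilon>)" shows "represents y' x"
  using assms moderate_if_close[of x' y'] abs_colombeau_eq_iff[of y' x']
  by (auto simp: represents_def)

lemma negligible_if_eventually_0: "\<forall>\<^sub>0\<epsilon>. x \<epsilon> = 0 \<Longrightarrow> negligible_net x"
  unfolding negligible_iff by (auto elim: eventually_mono)

lemma represents_gnorm: "represents x' x \<Longrightarrow> represents (\<lambda>\<epsilon>. norm (x' \<epsilon>)) (gnorm x)"
  unfolding represents_def
  using gnorm.abs_eq[of x'] by (auto simp: moderate_norm colombeau_rel_refl)

lemma represents_add:
  "represents x' x \<Longrightarrow> represents y' y \<Longrightarrow> represents (\<lambda>\<epsilon>. x' \<epsilon> + y' \<epsilon>) (x + y)"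
  unfolding represents_def
  using plus_colombeau.abs_eq[of x' y'] by (auto simp: moderate_add colombeau_rel_refl)

lemma represents_minus:
  "represents x' x \<Longrightarrow> represents (\<lambda>\<epsilon>. - x' \<epsilon>) (- x)"
  unfolding represents_def
  using uminus_colombeau.abs_eq[of x'] by (auto simp: moderate_minus colombeau_rel_refl)

lemma represents_diff:
  "represents x' x \<Longrightarrow> represents y' y \<Longrightarrow> represents (\<lambda>\<epsilon>. x' \<epsilon> - y' \<epsilon>) (x - y)"
  using represents_add[OF _ represents_minus, of x' x y' y]
  by (simp add: diff_conv_add_uminus del: add_uminus_conv_diff)

lemma represents_mult:
  "represents x' x \<Longrightarrow> represents y' y \<Longrightarrow> represents (\<lambda>\<epsilon>. x' \<epsilon> * y' \<epsilon>) (x * y)"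
  unfolding represents_def
  using times_colombeau.abs_eq[of x' y'] by (auto simp: moderate_mult colombeau_rel_refl)

lemma represents_gscale:
  "represents r' r \<Longrightarrow> represents x' x \<Longrightarrow> represents (\<lambda>\<epsilon>. r' \<epsilon> *\<^sub>R x' \<epsilon>) (gscale r x)"
  unfolding represents_def
  using gscale.abs_eq[of r' x'] by (auto simp: moderate_scaleR colombeau_rel_refl)

lemma represents_1: "represents (\<lambda>_. 1) 1"
  by (simp add: represents_def moderate_const one_colombeau.abs_eq)

lemma represents_0: "represents (\<lambda>_. 0) 0"
  by (simp add: represents_def moderate_const zero_colombeau.abs_eq)

lemma represents_gconst: "represents (\<lambda>_. a) (gconst a)"
  by (simp add: represents_def moderate_const gconst_def)

lemma moderate_powr: "moderate (\<lambda>\<epsilon>::real. \<epsilon> powr a)"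
  unfolding moderate_iff by (intro exI[of _ a]) simp

lemma represents_rho_powr: "represents (\<lambda>\<epsilon>. \<epsilon> powr a) (rho_powr a)"
  by (simp add: represents_def moderate_powr rho_powr_def)

text \<open>The order is defined by a suitable choice of representatives. For given ones it amounts to an
inequality up to negligible errors: replace \<open>y'\<close> by the maximum of both.\<close>

lemma le_colombeau_iff:
  fixes x y :: "real colombeau"
  assumes x: "represents x' x" and y: "represents y' y"
  shows "x \<le> y \<longleftrightarrow> (\<forall>n. \<forall>\<^sub>0\<epsilon>. x' \<epsilon> \<le> y' \<epsilon> + \<epsilon> powr n)"
proof
  assume "x \<le> y"
  then obtain x2 y2 where 2: "represents x2 x" "represents y2 y" and le: "\<forall>\<epsilon>\<in>{0<..1}. x2 \<epsilon> \<le> y2 \<epsilon>"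
    by (auto simp: less_eq_colombeau_def)
  show "\<forall>n. \<forall>\<^sub>0\<epsilon>. x' \<epsilon> \<le> y' \<epsilon> + \<epsilon> powr n"
  proof
    fix n
    have "\<forall>\<^sub>0\<epsilon>. norm (x' \<epsilon> - x2 \<epsilon>) \<le> \<epsilon> powr (n + 1)" "\<forall>\<^sub>0\<epsilon>. norm (y2 \<epsilon> - y' \<epsilon>) \<le> \<epsilon> powr (n + 1)"
      using represents_unique[OF x 2(1)] represents_unique[OF 2(2) y] by (auto simp: negligible_iff)
    moreover have "\<forall>\<^sub>0\<epsilon>. 2 * \<epsilon> powr (n + 1) \<le> \<epsilon> powr n" by (rule small_const_mult) simp
    ultimately show "\<forall>\<^sub>0\<epsilon>. x' \<epsilon> \<le> y' \<epsilon> + \<epsilon> powr n"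
      using small_unit
    proof eventually_elim
      case (elim \<epsilon>)
      then show ?case using le[rule_format, of \<epsilon>] by (simp add: abs_le_iff)
    qed
  qed
next
  assume *: "\<forall>n. \<forall>\<^sub>0\<epsilon>. x' \<epsilon> \<le> y' \<epsilon> + \<epsilon> powr n"
  have "negligible_net (\<lambda>\<epsilon>. max (x' \<epsilon>) (y' \<epsilon>) - y' \<epsilon>)"
    unfolding negligible_iff
  proof
    fix n
    from * have "\<forall>\<^sub>0\<epsilon>. x' \<epsilon> \<le> y' \<epsilon> + \<epsilon> powr n" by blast
    then show "\<forall>\<^sub>0\<epsilon>. norm (max (x' \<epsilon>) (y' \<epsilon>) - y' \<epsilon>) \<le> \<epsilon> powr n"
      by eventually_elim (auto simp: max_def)
  qed
  from represents_close[OF y this] x show "x \<le> y"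
    unfolding less_eq_colombeau_def by (intro exI[of _ x'] exI[of _ "\<lambda>\<epsilon>. max (x' \<epsilon>) (y' \<epsilon>)"]) auto
qed

lemma le_colombeauI:
  fixes x y :: "real colombeau"
  assumes "represents x' x" "represents y' y" "\<forall>\<^sub>0\<epsilon>. x' \<epsilon> \<le> y' \<epsilon>"
  shows "x \<le> y"
  unfolding le_colombeau_iff[OF assms(1,2)]
proof
  fix n show "\<forall>\<^sub>0\<epsilon>. x' \<epsilon> \<le> y' \<epsilon> + \<epsilon> powr n"
    using assms(3) by eventually_elim (simp add: add_increasing2)
qed

lemma ginvertibleI:
  assumes "represents x' x" "\<forall>\<^sub>0\<epsilon>. \<epsilon> powr a \<le> x' \<epsilon>"
  shows "ginvertible x"
proof -
  have "moderate (\<lambda>\<epsilon>. inverse (x' \<epsilon>))"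
    unfolding moderate_iff
  proof
    show "\<forall>\<^sub>0\<epsilon>. norm (inverse (x' \<epsilon>)) \<le> \<epsilon> powr (- a)"
      using assms(2) small_pos
    proof eventually_elim
      case (elim \<epsilon>)
      then have "0 < \<epsilon> powr a" by simp
      with elim have "0 < x' \<epsilon>" by linarith
      moreover have "inverse (x' \<epsilon>) \<le> inverse (\<epsilon> powr a)"
        using elim \<open>0 < \<epsilon> powr a\<close> by (intro le_imp_inverse_le)
      ultimately show ?case using elim by (simp add: powr_minus)
    qed
  qed
  then have inv: "represents (\<lambda>\<epsilon>. inverse (x' \<epsilon>)) (abs_colombeau (\<lambda>\<epsilon>. inverse (x' \<epsilon>)))"
    by (rule represents_abs)
  have "\<forall>\<^sub>0\<epsilon>. x' \<epsilon> * inverse (x' \<epsilon>) - 1 = 0"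
    using assms(2) small_pos
  proof eventually_elim
    case (elim \<epsilon>)
    then have "0 < x' \<epsilon>" using powr_gt_zero[of \<epsilon> a] by linarith
    then show ?case by simp
  qed
  then have "x * abs_colombeau (\<lambda>\<epsilon>. inverse (x' \<epsilon>)) = 1"
    unfolding represents_eq_iff[OF represents_mult[OF assms(1) inv] represents_1]
    by (rule negligible_if_eventually_0)
  then show ?thesis by (auto simp: ginvertible_def)
qed

lemma ginvertible_mult_ginverse: "ginvertible x \<Longrightarrow> x * ginverse x = 1"
proof -
  assume "ginvertible x"
  then obtain y where y: "x * y = 1" by (auto simp: ginvertible_def)
  have "z = y" if "x * z = 1" for z
    by (metis that y mult.commute mult.left_commute mult_1)
  then have "ginverse x = y" unfolding ginverse_def using y by (intro the_equality)
  then show ?thesis using y by simp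
qed

section \<open>Iterated partial derivatives\<close>

abbreviation pd :: "'n list \<Rightarrow> (real^'n \<Rightarrow> complex) \<Rightarrow> real^'n \<Rightarrow> complex" where
  "pd is f \<equiv> foldr partial is f"

lemma smooth_onD: "smooth_on \<Omega> f \<Longrightarrow> x \<in> \<Omega> \<Longrightarrow> pd is f differentiable (at x)"
  by (auto simp: smooth_on_def)

lemma smooth_on_pd: "smooth_on \<Omega> f \<Longrightarrow> smooth_on \<Omega> (pd is f)"
  unfolding smooth_on_def by (metis foldr_append comp_apply)

lemma smooth_on_partial: "smooth_on \<Omega> f \<Longrightarrow> smooth_on \<Omega> (partial i f)"
  using smooth_on_pd[of \<Omega> f "[i]"] by simp

lemma smooth_on_differentiable: "smooth_on \<Omega> f \<Longrightarrow> x \<in> \<Omega> \<Longrightarrow> f differentiable (at x)"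
  using smooth_onD[of \<Omega> f x "[]"] by simp

lemma smooth_on_subset: "smooth_on \<Omega> f \<Longrightarrow> \<omega> \<subseteq> \<Omega> \<Longrightarrow> smooth_on \<omega> f"
  by (auto simp: smooth_on_def)

lemma smooth_on_continuous_on: "smooth_on \<Omega> f \<Longrightarrow> continuous_on \<Omega> f"
  by (meson continuous_at_imp_continuous_on differentiable_imp_continuous_within smooth_on_differentiable)

lemma has_vector_derivative_line:
  assumes "(f has_derivative f') (at (x + s *\<^sub>R v))"
  shows "((\<lambda>t. f (x + t *\<^sub>R v)) has_vector_derivative f' v) (at s within S)"
proof -
  have "((\<lambda>t. x + t *\<^sub>R v) has_derivative (\<lambda>t. t *\<^sub>R v)) (at s within S)"
    by (auto intro!: derivative_eq_intros)
  from has_derivative_compose[OF this assms]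
  show ?thesis
    using linear_scale[OF has_derivative_linear[OF assms]]
    by (simp add: has_vector_derivative_def)
qed

lemma partial_eq: "(f has_derivative f') (at x) \<Longrightarrow> partial i f x = f' (axis i 1)"
  unfolding partial_def
  using has_vector_derivative_line[of f f' x 0 "axis i 1" UNIV] by (simp add: vector_derivative_at)

lemma has_derivative_eq_sum_partial:
  assumes "(f has_derivative f') (at x)"
  shows "f' h = (\<Sum>i\<in>UNIV. (h $ i) *\<^sub>R partial i f x)"
proof -
  have "f' h = f' (\<Sum>i\<in>UNIV. (h $ i) *\<^sub>R axis i 1)"
    using basis_expansion[of h] by (simp add: scalar_mult_eq_scaleR)
  also have "\<dots> = (\<Sum>i\<in>UNIV. (h $ i) *\<^sub>R f' (axis i 1))"
    using has_derivative_linear[OF assms] by (simp add: linear_sum linear_scale)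
  finally show ?thesis using partial_eq[OF assms] by simp
qed

lemma partial_cong:
  assumes "open \<Omega>" "x \<in> \<Omega>" "\<And>y. y \<in> \<Omega> \<Longrightarrow> f y = g y"
  shows "partial i f x = partial i g x"
proof -
  have "continuous (at 0) (\<lambda>t. x + t *\<^sub>R axis i 1)" by (intro continuous_intros)
  then have "((\<lambda>t. x + t *\<^sub>R axis i 1) \<longlongrightarrow> x) (nhds 0)"
    using tendsto_at_iff_tendsto_nhds[of "\<lambda>t. x + t *\<^sub>R axis i 1" 0] by (simp add: continuous_within)
  from topological_tendstoD[OF this assms(1,2)]
  have "eventually (\<lambda>t. x + t *\<^sub>R axis i 1 \<in> \<Omega>) (nhds (0::real))" .
  then show ?thesis
    unfolding partial_def
    by (intro vector_derivative_cong_eq) (auto elim!: eventually_mono intro!: assms(3))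
qed

lemma pd_cong:
  assumes "open \<Omega>" "\<And>y. y \<in> \<Omega> \<Longrightarrow> f y = g y"
  shows "x \<in> \<Omega> \<Longrightarrow> pd is f x = pd is g x"
proof (induction "is" arbitrary: x)
  case (Cons i "is")
  then show ?case using partial_cong[OF assms(1) Cons.prems, of "pd is f" "pd is g" i] by simp
qed (use assms in simp)

lemma differentiable_cong_open:
  assumes "open \<Omega>" "x \<in> \<Omega>" "\<And>y. y \<in> \<Omega> \<Longrightarrow> f y = g y" "f differentiable (at x)"
  shows "g differentiable (at x)"
  using assms unfolding differentiable_def
  by (meson has_derivative_transform_within_open)

lemma smooth_on_cong:
  assumes "open \<Omega>" "\<And>y. y \<in> \<Omega> \<Longrightarrow> f y = g y" "smooth_on \<Omega> f"
  shows "smooth_on \<Omega> g"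
  unfolding smooth_on_def
proof (intro allI ballI)
  fix "is" x assume "x \<in> \<Omega>"
  then show "pd is g differentiable (at x)"
    by (intro differentiable_cong_open[OF assms(1) _ pd_cong[OF assms(1,2)] smooth_onD[OF assms(3)]])
qed

lemma smooth_on_Un: "smooth_on A f \<Longrightarrow> smooth_on B f \<Longrightarrow> smooth_on (A \<union> B) f"
  by (auto simp: smooth_on_def)

text \<open>Coinduction for smoothness: it suffices to exhibit a family of differentiable functions that contains
the function and is closed under partial derivatives.\<close>

lemma smooth_on_closed_family:
  assumes "open \<Omega>" "f \<in> F"
    and "\<And>g x. g \<in> F \<Longrightarrow> x \<in> \<Omega> \<Longrightarrow> g differentiable (at x)"
    and "\<And>g i. g \<in> F \<Longrightarrow> \<exists>h\<in>F. \<forall>x\<in>\<Omega>. partial i g x = h x"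
  shows "smooth_on \<Omega> f"
proof -
  have *: "\<exists>h\<in>F. \<forall>x\<in>\<Omega>. pd is f x = h x" for "is"
  proof (induction "is")
    case Nil then show ?case using assms by auto
  next
    case (Cons i "is")
    then obtain h where h: "h \<in> F" "\<And>x. x \<in> \<Omega> \<Longrightarrow> pd is f x = h x" by blast
    obtain k where k: "k \<in> F" "\<And>x. x \<in> \<Omega> \<Longrightarrow> partial i h x = k x" using assms(4)[OF h(1)] by blast
    have "pd (i # is) f x = k x" if "x \<in> \<Omega>" for x
      using partial_cong[OF assms(1) that h(2), where i=i] k(2)[OF that] by simp
    then show ?case using k by blast
  qed
  show ?thesis
    unfolding smooth_on_def
  proof (intro allI ballI)
    fix "is" x assume x: "x \<in> \<Omega>"
    obtain h where h: "h \<in> F" "\<And>x. x \<in> \<Omega> \<Longrightarrow> pd is f x = h x" using *[of "is"] by blast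
    from differentiable_cong_open[OF assms(1) x, of h "pd is f"] h assms(3)[OF h(1) x]
    show "pd is f differentiable (at x)" by simp
  qed
qed

lemma partial_const [simp]: "partial i (\<lambda>_. c) x = 0"
  using partial_eq[of "\<lambda>_. c" "\<lambda>_. 0" x i] by simp

lemma partial_add:
  "f differentiable (at x) \<Longrightarrow> g differentiable (at x) \<Longrightarrow>
    partial i (\<lambda>x. f x + g x) x = partial i f x + partial i g x"
  unfolding differentiable_def
  by (elim exE) (subst partial_eq[OF has_derivative_add], assumption+, simp add: partial_eq)

lemma partial_diff:
  "f differentiable (at x) \<Longrightarrow> g differentiable (at x) \<Longrightarrow>
    partial i (\<lambda>x. f x - g x) x = partial i f x - partial i g x"
  unfolding differentiable_def
  by (elim exE) (subst partial_eq[OF has_derivative_diff], assumption+, simp add: partial_eq)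

lemma partial_mult:
  "f differentiable (at x) \<Longrightarrow> g differentiable (at x) \<Longrightarrow>
    partial i (\<lambda>x. f x * g x) x = partial i f x * g x + f x * partial i g x"
  unfolding differentiable_def
  by (elim exE) (subst partial_eq[OF has_derivative_mult], assumption+, simp add: partial_eq)

lemma differentiable_sum_list:
  "(\<And>p. p \<in> set L \<Longrightarrow> F p differentiable (at x)) \<Longrightarrow> (\<lambda>x. \<Sum>p\<leftarrow>L. F p x) differentiable (at x)"
  by (induction L) (auto intro: differentiable_add)

lemma partial_sum_list:
  "(\<And>p. p \<in> set L \<Longrightarrow> F p differentiable (at x)) \<Longrightarrow>
    partial i (\<lambda>x. \<Sum>p\<leftarrow>L. F p x) x = (\<Sum>p\<leftarrow>L. partial i (F p) x)"
proof (induction L)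
  case (Cons p L)
  then show ?case
    using partial_add[OF _ differentiable_sum_list, of "F p" x L F i] by simp
qed simp

lemma smooth_on_const: "smooth_on \<Omega> (\<lambda>_. c)"
proof -
  have "smooth_on UNIV (\<lambda>_. c)"
    by (rule smooth_on_closed_family[of _ _ "range (\<lambda>c _. c)"]) auto
  then show ?thesis by (rule smooth_on_subset) simp
qed

lemma pd_const_0 [simp]: "pd is (\<lambda>_. 0) = (\<lambda>_. 0)"
proof (induction "is")
  case (Cons i "is")
  then have "pd (i # is) (\<lambda>_. 0) = partial i (\<lambda>_. 0)" by simp
  then show ?case by (simp add: fun_eq_iff)
qed (auto simp: fun_eq_iff)

lemma pd_diff:
  assumes "open \<Omega>" "smooth_on \<Omega> f" "smooth_on \<Omega> g"
  shows "x \<in> \<Omega> \<Longrightarrow> pd is (\<lambda>x. f x - g x) x = pd is f x - pd is g x"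
proof (induction "is" arbitrary: x)
  case (Cons i "is")
  have "pd (i # is) (\<lambda>x. f x - g x) x = partial i (\<lambda>x. pd is f x - pd is g x) x"
    using partial_cong[OF assms(1) Cons.prems Cons.IH] by simp
  then show ?case using partial_diff[OF smooth_onD smooth_onD] assms Cons.prems by simp
qed simp

lemma smooth_on_diff:
  assumes "open \<Omega>" "smooth_on \<Omega> f" "smooth_on \<Omega> g"
  shows "smooth_on \<Omega> (\<lambda>x. f x - g x)"
  unfolding smooth_on_def
proof (intro allI ballI)
  fix "is" x assume x: "x \<in> \<Omega>"
  show "pd is (\<lambda>x. f x - g x) differentiable (at x)"
    by (rule differentiable_cong_open[OF assms(1) x pd_diff[OF assms, symmetric]])
      (use x in \<open>auto intro: differentiable_diff smooth_onD assms\<close>)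
qed

text \<open>The two complementary parts into which Leibniz's rule splits a list of derivations.\<close>

fun splits :: "'a list \<Rightarrow> ('a list \<times> 'a list) list" where
  "splits [] = [([], [])]"
| "splits (i # is) = map (\<lambda>p. (i # fst p, snd p)) (splits is) @ map (\<lambda>p. (fst p, i # snd p)) (splits is)"

lemma pd_mult:
  assumes "open \<Omega>" "smooth_on \<Omega> f" "smooth_on \<Omega> g"
  shows "x \<in> \<Omega> \<Longrightarrow> pd is (\<lambda>x. f x * g x) x = (\<Sum>p\<leftarrow>splits is. pd (fst p) f x * pd (snd p) g x)"
proof (induction "is" arbitrary: x)
  case (Cons i "is")
  have "pd (i # is) (\<lambda>x. f x * g x) x
      = partial i (\<lambda>x. \<Sum>p\<leftarrow>splits is. pd (fst p) f x * pd (snd p) g x) x"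
    using partial_cong[OF assms(1) Cons.prems Cons.IH] by simp
  also have "\<dots> = (\<Sum>p\<leftarrow>splits is. partial i (\<lambda>x. pd (fst p) f x * pd (snd p) g x) x)"
    using Cons.prems by (intro partial_sum_list differentiable_mult smooth_onD[OF assms(2)] smooth_onD[OF assms(3)])
  also have "\<dots> = (\<Sum>p\<leftarrow>splits is. partial i (pd (fst p) f) x * pd (snd p) g x + pd (fst p) f x * partial i (pd (snd p) g) x)"
    using partial_mult[OF smooth_onD[OF assms(2)] smooth_onD[OF assms(3)]] Cons.prems by simp
  also have "\<dots> = (\<Sum>p\<leftarrow>splits (i # is). pd (fst p) f x * pd (snd p) g x)"
    by (simp add: sum_list_addf o_def)
  finally show ?case .
qed simp

lemma smooth_on_mult:
  assumes "open \<Omega>" "smooth_on \<Omega> f" "smooth_on \<Omega> g"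
  shows "smooth_on \<Omega> (\<lambda>x. f x * g x)"
  unfolding smooth_on_def
proof (intro allI ballI)
  fix "is" x assume x: "x \<in> \<Omega>"
  show "pd is (\<lambda>x. f x * g x) differentiable (at x)"
    by (rule differentiable_cong_open[OF assms(1) x pd_mult[OF assms, symmetric]])
      (use x in \<open>auto intro!: differentiable_sum_list differentiable_mult smooth_onD assms\<close>)
qed

lemma smooth_on_prod:
  assumes "open \<Omega>" "finite I" "\<And>i. i \<in> I \<Longrightarrow> smooth_on \<Omega> (f i)"
  shows "smooth_on \<Omega> (\<lambda>x. \<Prod>i\<in>I. f i x)"
  using assms(2,3) by (induction I) (auto intro: smooth_on_const smooth_on_mult[OF assms(1)])

section \<open>Symmetry of second derivatives\<close>

text \<open>The second difference of \<open>f\<close> is the increment along \<open>e\<^sub>i\<close> of the difference along \<open>e\<^sub>j\<close>. Its derivative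
along \<open>e\<^sub>i\<close> is a difference of \<open>\<partial>\<^sub>i f\<close>, which is controlled by total differentiability of \<open>\<partial>\<^sub>i f\<close> at the one
point \<open>x\<close>. As the second difference is symmetric in \<open>i\<close> and \<open>j\<close>, so is its limit.\<close>

lemma second_difference_estimate:
  assumes "open \<Omega>" "x \<in> \<Omega>" "\<And>y. y \<in> \<Omega> \<Longrightarrow> f differentiable (at y)"
    and "partial i f differentiable (at x)" and "e > 0"
  shows "\<exists>d>0. \<forall>h. 0 < h \<and> h < d \<longrightarrow>
    norm (f (x + h *\<^sub>R axis i 1 + h *\<^sub>R axis j 1) - f (x + h *\<^sub>R axis i 1) - f (x + h *\<^sub>R axis j 1) + f x
      - (h * h) *\<^sub>R partial j (partial i f) x) \<le> e * (h * h)"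
proof -
  define g where "g = partial i f"
  obtain g' where g': "(g has_derivative g') (at x)"
    using assms(4) by (auto simp: g_def differentiable_def)
  note lin = has_derivative_linear[OF g']
  obtain d1 where d1: "d1 > 0" "\<And>y. norm (y - x) < d1 \<Longrightarrow> norm (g y - g x - g' (y - x)) \<le> e/3 * norm (y - x)"
    using g' assms(5) unfolding has_derivative_at_alt by (meson divide_pos_pos zero_less_numeral)
  obtain d2 where d2: "d2 > 0" "ball x d2 \<subseteq> \<Omega>" using assms(1,2) open_contains_ball by blast
  define ei where "ei = (axis i 1 :: real^'a)"
  define ej where "ej = (axis j 1 :: real^'a)"
  have nrm: "norm ei = 1" "norm ej = 1" by (simp_all add: ei_def ej_def norm_axis_1)
  show ?thesis
  proof (intro exI[of _ "min d1 d2 / 2"] conjI allI impI)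
    show "0 < min d1 d2 / 2" using d1 d2 by simp
    fix h :: real assume h: "0 < h \<and> h < min d1 d2 / 2"
    have near: "norm (s *\<^sub>R ei + t *\<^sub>R ej) \<le> s + t" if "0 \<le> s" "0 \<le> t" for s t
      using norm_triangle_ineq[of "s *\<^sub>R ei" "t *\<^sub>R ej"] that nrm by simp
    have in\<Omega>: "x + s *\<^sub>R ei + t *\<^sub>R ej \<in> \<Omega>" if "s \<in> {0..h}" "t \<in> {0..h}" for s t
    proof -
      have "dist x (x + (s *\<^sub>R ei + t *\<^sub>R ej)) = norm (s *\<^sub>R ei + t *\<^sub>R ej)"
        by (metis add_diff_cancel_left' dist_commute dist_norm)
      with near[of s t] that h have "dist x (x + (s *\<^sub>R ei + t *\<^sub>R ej)) < d2" by simp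
      then show ?thesis using d2 by (auto simp: add.assoc)
    qed
    have est: "norm (g (x + s *\<^sub>R ei + t *\<^sub>R ej) - g x - g' (s *\<^sub>R ei + t *\<^sub>R ej)) \<le> e/3 * (s + t)"
      if "s \<in> {0..h}" "t \<in> {0..h}" for s t
    proof -
      have n: "norm (s *\<^sub>R ei + t *\<^sub>R ej) \<le> s + t" using near that by simp
      then have "norm (x + s *\<^sub>R ei + t *\<^sub>R ej - x) < d1" using that h by (simp add: add.assoc)
      from d1(2)[OF this] have "norm (g (x + s *\<^sub>R ei + t *\<^sub>R ej) - g x - g' (s *\<^sub>R ei + t *\<^sub>R ej))
        \<le> e/3 * norm (s *\<^sub>R ei + t *\<^sub>R ej)" by (simp add: add.assoc)
      also have "\<dots> \<le> e/3 * (s + t)" using n assms(5) by (intro mult_left_mono) auto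
      finally show ?thesis .
    qed
    define \<phi> where "\<phi> s = f (x + h *\<^sub>R ej + s *\<^sub>R ei) - f (x + s *\<^sub>R ei) - s *\<^sub>R (h *\<^sub>R g' ej)" for s
    define \<phi>' where "\<phi>' s = g (x + h *\<^sub>R ej + s *\<^sub>R ei) - g (x + s *\<^sub>R ei) - h *\<^sub>R g' ej" for s
    have der: "(\<phi> has_vector_derivative \<phi>' s) (at s within {0..h})" if s: "s \<in> {0..h}" for s
    proof -
      have "x + h *\<^sub>R ej + s *\<^sub>R ei \<in> \<Omega>" "x + s *\<^sub>R ei \<in> \<Omega>"
        using in\<Omega>[of s h] in\<Omega>[of s 0] s h by (simp_all add: algebra_simps)
      from this[THEN assms(3)] obtain f1 f2 where f12: "(f has_derivative f1) (at (x + h *\<^sub>R ej + s *\<^sub>R ei))"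
         "(f has_derivative f2) (at (x + s *\<^sub>R ei))" by (auto simp: differentiable_def)
      have "f1 ei = g (x + h *\<^sub>R ej + s *\<^sub>R ei)" "f2 ei = g (x + s *\<^sub>R ei)"
        using partial_eq[OF f12(1), of i] partial_eq[OF f12(2), of i] by (auto simp: g_def ei_def)
      with has_vector_derivative_line[OF f12(1)] has_vector_derivative_line[OF f12(2)]
      have "((\<lambda>s. f (x + h *\<^sub>R ej + s *\<^sub>R ei)) has_vector_derivative g (x + h *\<^sub>R ej + s *\<^sub>R ei)) (at s within {0..h})"
        "((\<lambda>s. f (x + s *\<^sub>R ei)) has_vector_derivative g (x + s *\<^sub>R ei)) (at s within {0..h})" by auto
      moreover have "((\<lambda>s. s *\<^sub>R (h *\<^sub>R g' ej)) has_vector_derivative (h *\<^sub>R g' ej)) (at s within {0..h})"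
        by (auto intro!: derivative_eq_intros)
      ultimately show ?thesis
        unfolding \<phi>_def \<phi>'_def by (intro has_vector_derivative_diff) auto
    qed
    have bound: "norm (\<phi>' s) \<le> e * h" if s: "s \<in> {0..h}" for s
    proof -
      have "\<phi>' s = (g (x + s *\<^sub>R ei + h *\<^sub>R ej) - g x - g' (s *\<^sub>R ei + h *\<^sub>R ej))
          - (g (x + s *\<^sub>R ei + 0 *\<^sub>R ej) - g x - g' (s *\<^sub>R ei + 0 *\<^sub>R ej))"
        unfolding \<phi>'_def using lin by (simp add: linear_add linear_scale algebra_simps)
      also have "norm \<dots> \<le> e/3 * (s + h) + e/3 * (s + 0)"
        by (rule order_trans[OF norm_triangle_ineq4 add_mono[OF est est]]) (use s h in auto)
      also have "\<dots> \<le> e * h"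
      proof -
        have "e * s \<le> e * h" using s assms(5) by (intro mult_left_mono) auto
        then show ?thesis by (simp add: field_simps)
      qed
      finally show ?thesis .
    qed
    have "norm (\<phi> h - \<phi> 0) \<le> e * h * norm (h - 0)"
    proof (rule differentiable_bound[of "{0..h}"])
      show "(\<phi> has_derivative (\<lambda>t. t *\<^sub>R \<phi>' s)) (at s within {0..h})" if "s \<in> {0..h}" for s
        using der[OF that] by (simp add: has_vector_derivative_def)
      show "onorm (\<lambda>t. t *\<^sub>R \<phi>' s) \<le> e * h" if "s \<in> {0..h}" for s
        using bound[OF that] by (simp add: onorm_scaleR_left[of "\<lambda>x. x", simplified] onorm_id)
    qed (use h in auto)
    moreover have "\<phi> h - \<phi> 0 = f (x + h *\<^sub>R ei + h *\<^sub>R ej) - f (x + h *\<^sub>R ei) - f (x + h *\<^sub>R ej) + f x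
      - (h * h) *\<^sub>R partial j g x"
      using partial_eq[OF g', of j] by (simp add: \<phi>_def ej_def algebra_simps)
    ultimately show "norm (f (x + h *\<^sub>R axis i 1 + h *\<^sub>R axis j 1) - f (x + h *\<^sub>R axis i 1) - f (x + h *\<^sub>R axis j 1) + f x
      - (h * h) *\<^sub>R partial j (partial i f) x) \<le> e * (h * h)"
      using h by (simp add: ei_def ej_def g_def mult.assoc)
  qed
qed

lemma partial_commute:
  assumes "open \<Omega>" "x \<in> \<Omega>" "smooth_on \<Omega> f"
  shows "partial i (partial j f) x = partial j (partial i f) x"
proof -
  have "norm (partial i (partial j f) x - partial j (partial i f) x) \<le> 0 + e" if "e > 0" for e
  proof -
    note d = smooth_on_differentiable[OF assms(3)] smooth_on_differentiable[OF smooth_on_partial[OF assms(3)] assms(2)]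
    have "e / 2 > 0" using that by simp
    from second_difference_estimate[OF assms(1,2) d this, of i j] second_difference_estimate[OF assms(1,2) d this, of j i]
    obtain d1 d2 where d: "d1 > 0" "d2 > 0" and
      1: "\<forall>h. 0 < h \<and> h < d1 \<longrightarrow> norm (f (x + h *\<^sub>R axis i 1 + h *\<^sub>R axis j 1) - f (x + h *\<^sub>R axis i 1) - f (x + h *\<^sub>R axis j 1) + f x
      - (h * h) *\<^sub>R partial j (partial i f) x) \<le> e/2 * (h * h)" and
      2: "\<forall>h. 0 < h \<and> h < d2 \<longrightarrow> norm (f (x + h *\<^sub>R axis j 1 + h *\<^sub>R axis i 1) - f (x + h *\<^sub>R axis j 1) - f (x + h *\<^sub>R axis i 1) + f x
      - (h * h) *\<^sub>R partial i (partial j f) x) \<le> e/2 * (h * h)" by blast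
    define h where "h = min d1 d2 / 2"
    have h: "0 < h" "h < d1" "h < d2" using d by (auto simp: h_def)
    define D where "D = f (x + h *\<^sub>R axis i 1 + h *\<^sub>R axis j 1) - f (x + h *\<^sub>R axis i 1) - f (x + h *\<^sub>R axis j 1) + f x"
    have D': "D = f (x + h *\<^sub>R axis j 1 + h *\<^sub>R axis i 1) - f (x + h *\<^sub>R axis j 1) - f (x + h *\<^sub>R axis i 1) + f x"
      by (simp add: D_def algebra_simps)
    have "(h * h) * norm (partial i (partial j f) x - partial j (partial i f) x)
        = norm ((h * h) *\<^sub>R (partial i (partial j f) x - partial j (partial i f) x))" by simp
    also have "\<dots> = norm ((D - (h * h) *\<^sub>R partial j (partial i f) x) - (D - (h * h) *\<^sub>R partial i (partial j f) x))"
      by (rule arg_cong[of _ _ norm]) (simp add: algebra_simps)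
    also have "\<dots> \<le> e/2 * (h * h) + e/2 * (h * h)"
    proof (rule order_trans[OF norm_triangle_ineq4 add_mono])
      show "norm (D - (h * h) *\<^sub>R partial j (partial i f) x) \<le> e/2 * (h * h)"
        using 1[rule_format, of h] h unfolding D_def by blast
      show "norm (D - (h * h) *\<^sub>R partial i (partial j f) x) \<le> e/2 * (h * h)"
        using 2[rule_format, of h] h unfolding D' by blast
    qed
    also have "\<dots> = (h * h) * e" by (simp add: field_simps)
    finally show ?thesis using h by (simp add: mult_le_cancel_left)
  qed
  then have "norm (partial i (partial j f) x - partial j (partial i f) x) \<le> 0"
    by (rule field_le_epsilon)
  then show ?thesis by simp
qed

lemma pd_move_front:
  assumes "open \<Omega>" "smooth_on \<Omega> f"
  shows "x \<in> \<Omega> \<Longrightarrow> pd (a @ i # b) f x = pd (i # a @ b) f x"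
proof (induction a arbitrary: x)
  case (Cons j a)
  have "pd ((j # a) @ i # b) f x = partial j (pd (i # a @ b) f) x"
    using partial_cong[OF assms(1) Cons.prems Cons.IH, where i=j] by simp
  also have "\<dots> = partial i (partial j (pd (a @ b) f)) x"
    using partial_commute[OF assms(1) Cons.prems smooth_on_pd[OF assms(2)], of j i "a @ b"] by simp
  finally show ?case by simp
qed simp

lemma pd_permute:
  assumes "open \<Omega>" "smooth_on \<Omega> f"
  shows "x \<in> \<Omega> \<Longrightarrow> mset is = mset js \<Longrightarrow> pd is f x = pd js f x"
proof (induction "is" arbitrary: js x)
  case (Cons i "is")
  from Cons.prems(2) have "i \<in> set js" by (metis list.set_intros(1) set_mset_mset)
  then obtain a b where js: "js = a @ i # b" by (auto simp: in_set_conv_decomp)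
  with Cons.prems(2) have "mset is = mset (a @ b)" by simp
  then have "pd is f y = pd (a @ b) f y" if "y \<in> \<Omega>" for y using Cons.IH that by blast
  from partial_cong[OF assms(1) Cons.prems(1) this, where i=i]
  have "pd (i # is) f x = pd (i # a @ b) f x" by simp
  then show ?case using pd_move_front[OF assms Cons.prems(1)] js by simp
qed simp

text \<open>The list of derivations, in the fixed order of the coordinates, that a multi-index stands for.
Lists are easier to induct on, and by symmetry every list of derivations is equivalent to one of
these.\<close>

definition mlist :: "('n::finite \<Rightarrow> nat) \<Rightarrow> 'n list" where
  "mlist \<alpha> = concat (map (\<lambda>i. replicate (\<alpha> i) i) coord_list)"

lemma mpartial_eq_pd: "mpartial \<alpha> f = pd (mlist \<alpha>) f"
proof -
  have r: "pd (replicate n i) g = (partial i ^^ n) g" for n :: nat and i :: 'a and g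
    by (induction n) auto
  have "foldr (\<lambda>i g. (partial i ^^ \<alpha> i) g) cs f = pd (concat (map (\<lambda>i. replicate (\<alpha> i) i) cs)) f" for cs
    by (induction cs) (auto simp: r)
  then show ?thesis by (simp add: mpartial_def mlist_def)
qed

lemma coord_list: "set (coord_list :: 'n::finite list) = UNIV" "distinct (coord_list :: 'n list)"
proof -
  have "\<exists>is. set is = (UNIV :: 'n set) \<and> distinct is" using finite_distinct_list[of "UNIV :: 'n set"] by simp
  from someI_ex[OF this] show "set (coord_list :: 'n::finite list) = UNIV" "distinct (coord_list :: 'n list)"
    by (auto simp: coord_list_def)
qed

lemma mset_mlist_count: "mset (mlist (\<lambda>i. count (mset is) i)) = mset is"
proof (rule multiset_eqI)
  fix j
  have "count (mset (concat (map (\<lambda>i. replicate (\<alpha> i) i) cs))) j = (if j \<in> set cs then \<alpha> j else 0)"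
    if "distinct cs" for cs and \<alpha> :: "'a \<Rightarrow> nat"
    using that by (induction cs) (auto simp: count_replicate_mset)
  from this[OF coord_list(2)] show "count (mset (mlist (\<lambda>i. count (mset is) i))) j = count (mset is) j"
    by (simp add: mlist_def coord_list)
qed

lemma pd_eq_mpartial:
  "open \<Omega> \<Longrightarrow> smooth_on \<Omega> f \<Longrightarrow> x \<in> \<Omega> \<Longrightarrow> pd is f x = mpartial (\<lambda>i. count (mset is) i) f x"
  unfolding mpartial_eq_pd by (rule pd_permute) (auto simp: mset_mlist_count)

section \<open>The algebra of generalized functions in terms of iterated derivatives\<close>

text \<open>The conditions on derivatives alone; for the difference of two moderate nets they express equality in
\<open>\<G>(\<Omega>)\<close>.\<close>

definition null_nets :: "(real^'n) set \<Rightarrow> 'n fnet set" where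
  "null_nets \<Omega> = {w. \<forall>K is. compact K \<and> K \<subseteq> \<Omega> \<longrightarrow> negligible_on (\<lambda>_. K) (\<lambda>\<epsilon> x. norm (pd is (w \<epsilon>) x))}"

lemma moderate_on_cong:
  "(\<And>\<epsilon> x. \<epsilon> \<in> {0<..1} \<Longrightarrow> x \<in> A \<epsilon> \<Longrightarrow> f \<epsilon> x = g \<epsilon> x) \<Longrightarrow> moderate_on A f \<Longrightarrow> moderate_on A g"
  by (erule moderate_on_mono, rule eventually_mono[OF small_unit]) auto

lemma negligible_on_cong:
  "(\<And>\<epsilon> x. \<epsilon> \<in> {0<..1} \<Longrightarrow> x \<in> A \<epsilon> \<Longrightarrow> f \<epsilon> x = g \<epsilon> x) \<Longrightarrow> negligible_on A f \<Longrightarrow> negligible_on A g"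
  by (erule negligible_on_mono, rule eventually_mono[OF small_unit]) auto

lemma EM_iff:
  assumes "open \<Omega>"
  shows "u \<in> EM \<Omega> \<longleftrightarrow> (\<forall>\<epsilon>\<in>{0<..1}. smooth_on \<Omega> (u \<epsilon>)) \<and>
    (\<forall>K is. compact K \<and> K \<subseteq> \<Omega> \<longrightarrow> moderate_on (\<lambda>_. K) (\<lambda>\<epsilon> x. norm (pd is (u \<epsilon>) x)))"
    (is "?l \<longleftrightarrow> ?r")
proof
  assume l: ?l
  have "moderate_on (\<lambda>_. K) (\<lambda>\<epsilon> x. norm (pd is (u \<epsilon>) x))" if K: "compact K" "K \<subseteq> \<Omega>" for K "is"
  proof (rule moderate_on_cong)
    show "moderate_on (\<lambda>_. K) (\<lambda>\<epsilon> x. norm (mpartial (\<lambda>i. count (mset is) i) (u \<epsilon>) x))"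
      using l K by (auto simp: EM_def sup_bigo_moderate_on)
  next
    fix \<epsilon> :: real and x assume "\<epsilon> \<in> {0<..1}" "x \<in> K"
    then show "norm (mpartial (\<lambda>i. count (mset is) i) (u \<epsilon>) x) = norm (pd is (u \<epsilon>) x)"
      using pd_eq_mpartial[OF assms, of "u \<epsilon>" x "is"] l K by (auto simp: EM_def)
  qed
  then show ?r using l by (auto simp: EM_def)
next
  assume ?r then show ?l by (auto simp: EM_def sup_bigo_moderate_on mpartial_eq_pd)
qed

lemma EM_smooth: "u \<in> EM \<Omega> \<Longrightarrow> \<epsilon> \<in> {0<..1} \<Longrightarrow> smooth_on \<Omega> (u \<epsilon>)"
  by (simp add: EM_def)

lemma EM_moderate_on: "u \<in> EM \<Omega> \<Longrightarrow> open \<Omega> \<Longrightarrow> compact K \<Longrightarrow> K \<subseteq> \<Omega> \<Longrightarrow> moderate_on (\<lambda>_. K) (\<lambda>\<epsilon> x. norm (pd is (u \<epsilon>) x))"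
  by (auto simp: EM_iff)

lemma Grel_iff:
  assumes "open \<Omega>"
  shows "(u, v) \<in> Grel \<Omega> \<longleftrightarrow> u \<in> EM \<Omega> \<and> v \<in> EM \<Omega> \<and> (\<lambda>\<epsilon> x. u \<epsilon> x - v \<epsilon> x) \<in> null_nets \<Omega>"
    (is "?l \<longleftrightarrow> ?r")
proof
  assume l: ?l
  then have uv: "u \<in> EM \<Omega>" "v \<in> EM \<Omega>" by (auto simp: Grel_def)
  have "negligible_on (\<lambda>_. K) (\<lambda>\<epsilon> x. norm (pd is (\<lambda>x. u \<epsilon> x - v \<epsilon> x) x))" if K: "compact K" "K \<subseteq> \<Omega>" for K "is"
  proof (rule negligible_on_cong)
    show "negligible_on (\<lambda>_. K) (\<lambda>\<epsilon> x. norm (mpartial (\<lambda>i. count (mset is) i) (\<lambda>x. u \<epsilon> x - v \<epsilon> x) x))"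
      using l K by (auto simp: Grel_def simp flip: sup_bigo_negligible_on)
  next
    fix \<epsilon> :: real and x assume "\<epsilon> \<in> {0<..1}" "x \<in> K"
    then show "norm (mpartial (\<lambda>i. count (mset is) i) (\<lambda>x. u \<epsilon> x - v \<epsilon> x) x) = norm (pd is (\<lambda>x. u \<epsilon> x - v \<epsilon> x) x)"
      using pd_eq_mpartial[OF assms smooth_on_diff[OF assms EM_smooth[OF uv(1)] EM_smooth[OF uv(2)]], of \<epsilon> \<epsilon> x "is"] K by auto
  qed
  then show ?r using uv by (auto simp: null_nets_def)
next
  assume ?r then show ?l by (auto simp: Grel_def null_nets_def mpartial_eq_pd sup_bigo_negligible_on[symmetric])
qed

lemma null_nets_cong:
  assumes "open \<Omega>" "w \<in> null_nets \<Omega>" "\<And>\<epsilon> x. \<epsilon> \<in> {0<..1} \<Longrightarrow> x \<in> \<Omega> \<Longrightarrow> w \<epsilon> x = w' \<epsilon> x"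
  shows "w' \<in> null_nets \<Omega>"
  unfolding null_nets_def
proof safe
  fix K "is" assume K: "compact K" "K \<subseteq> \<Omega>"
  show "negligible_on (\<lambda>_. K) (\<lambda>\<epsilon> x. norm (pd is (w' \<epsilon>) x))"
  proof (rule negligible_on_cong)
    show "negligible_on (\<lambda>_. K) (\<lambda>\<epsilon> x. norm (pd is (w \<epsilon>) x))" using assms K by (auto simp: null_nets_def)
    fix \<epsilon> :: real and x assume e: "\<epsilon> \<in> {0<..1}" "x \<in> K"
    then have "pd is (w \<epsilon>) x = pd is (w' \<epsilon>) x"
      using K by (intro pd_cong[OF assms(1) assms(3)]) auto
    then show "norm (pd is (w \<epsilon>) x) = norm (pd is (w' \<epsilon>) x)" by simp
  qed
qed

lemma EM_diff:
  assumes "open \<Omega>" "u \<in> EM \<Omega>" "v \<in> EM \<Omega>" shows "(\<lambda>\<epsilon> x. u \<epsilon> x - v \<epsilon> x) \<in> EM \<Omega>"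
  unfolding EM_iff[OF assms(1)]
proof safe
  fix \<epsilon> :: real assume "\<epsilon> \<in> {0<..1}"
  then show "smooth_on \<Omega> (\<lambda>x. u \<epsilon> x - v \<epsilon> x)"
    using smooth_on_diff[OF assms(1)] assms EM_smooth by blast
next
  fix K "is" assume K: "compact K" "K \<subseteq> \<Omega>"
  show "moderate_on (\<lambda>_. K) (\<lambda>\<epsilon> x. norm (pd is (\<lambda>x. u \<epsilon> x - v \<epsilon> x) x))"
  proof (rule moderate_on_mono)
    show "moderate_on (\<lambda>_. K) (\<lambda>\<epsilon> x. norm (pd is (u \<epsilon>) x) + norm (pd is (v \<epsilon>) x))"
      using assms K by (intro moderate_on_add EM_moderate_on) auto
    show "\<forall>\<^sub>0\<epsilon>. \<forall>x\<in>K. x \<in> K \<and> norm (pd is (\<lambda>x. u \<epsilon> x - v \<epsilon> x) x) \<le> norm (pd is (u \<epsilon>) x) + norm (pd is (v \<epsilon>) x)"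
      using small_unit
    proof eventually_elim
      case (elim \<epsilon>)
      then show ?case using K pd_diff[OF assms(1) EM_smooth[OF assms(2)] EM_smooth[OF assms(3)], of \<epsilon> \<epsilon>]
        by (auto simp: subset_iff norm_triangle_ineq4)
    qed
  qed
qed

lemma Leibniz_bound:
  assumes "open \<Omega>" "smooth_on \<Omega> f" "smooth_on \<Omega> g" "x \<in> \<Omega>"
  shows "norm (pd is (\<lambda>x. f x * g x) x) \<le> (\<Sum>p\<leftarrow>splits is. norm (pd (fst p) f x) * norm (pd (snd p) g x))"
proof -
  have "norm (\<Sum>p\<leftarrow>L. F p) \<le> (\<Sum>p\<leftarrow>L. norm (F p))" for L and F :: "'a list \<times> 'a list \<Rightarrow> complex"
    by (induction L) (auto intro: order_trans[OF norm_triangle_ineq])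
  from this[of "\<lambda>p. pd (fst p) f x * pd (snd p) g x"] pd_mult[OF assms] show ?thesis by (simp add: norm_mult)
qed

lemma EM_mult:
  assumes "open \<Omega>" "u \<in> EM \<Omega>" "v \<in> EM \<Omega>" shows "(\<lambda>\<epsilon> x. u \<epsilon> x * v \<epsilon> x) \<in> EM \<Omega>"
  unfolding EM_iff[OF assms(1)]
proof safe
  fix \<epsilon> :: real assume "\<epsilon> \<in> {0<..1}"
  then show "smooth_on \<Omega> (\<lambda>x. u \<epsilon> x * v \<epsilon> x)"
    using smooth_on_mult[OF assms(1)] assms EM_smooth by blast
next
  fix K "is" assume K: "compact K" "K \<subseteq> \<Omega>"
  show "moderate_on (\<lambda>_. K) (\<lambda>\<epsilon> x. norm (pd is (\<lambda>x. u \<epsilon> x * v \<epsilon> x) x))"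
  proof (rule moderate_on_mono)
    show "moderate_on (\<lambda>_. K) (\<lambda>\<epsilon> x. \<Sum>p\<leftarrow>splits is. norm (pd (fst p) (u \<epsilon>) x) * norm (pd (snd p) (v \<epsilon>) x))"
      using assms K by (intro moderate_on_sum_list moderate_on_mult EM_moderate_on) auto
    show "\<forall>\<^sub>0\<epsilon>. \<forall>x\<in>K. x \<in> K \<and> norm (pd is (\<lambda>x. u \<epsilon> x * v \<epsilon> x) x) \<le> (\<Sum>p\<leftarrow>splits is. norm (pd (fst p) (u \<epsilon>) x) * norm (pd (snd p) (v \<epsilon>) x))"
      using small_unit
    proof eventually_elim
      case (elim \<epsilon>)
      then show ?case using K Leibniz_bound[OF assms(1) EM_smooth[OF assms(2)] EM_smooth[OF assms(3)], of \<epsilon> \<epsilon>]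
        by blast
    qed
  qed
qed

lemma null_nets_mult:
  assumes "open \<Omega>" "u \<in> EM \<Omega>" "v \<in> null_nets \<Omega>" "\<And>\<epsilon>. \<epsilon> \<in> {0<..1} \<Longrightarrow> smooth_on \<Omega> (v \<epsilon>)"
  shows "(\<lambda>\<epsilon> x. u \<epsilon> x * v \<epsilon> x) \<in> null_nets \<Omega>"
  unfolding null_nets_def
proof safe
  fix K "is" assume K: "compact K" "K \<subseteq> \<Omega>"
  show "negligible_on (\<lambda>_. K) (\<lambda>\<epsilon> x. norm (pd is (\<lambda>x. u \<epsilon> x * v \<epsilon> x) x))"
  proof (rule negligible_on_mono)
    have n: "negligible_on (\<lambda>_. K) (\<lambda>\<epsilon> x. norm (pd js (v \<epsilon>) x))" for js using assms(3) K by (auto simp: null_nets_def)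
    have "negligible_on (\<lambda>_. K) (\<lambda>\<epsilon> x. \<Sum>p\<leftarrow>splits is. norm (pd (snd p) (v \<epsilon>) x) * norm (pd (fst p) (u \<epsilon>) x))"
      using assms K n by (intro negligible_on_sum_list negligible_on_mult EM_moderate_on) auto
    then show "negligible_on (\<lambda>_. K) (\<lambda>\<epsilon> x. \<Sum>p\<leftarrow>splits is. norm (pd (fst p) (u \<epsilon>) x) * norm (pd (snd p) (v \<epsilon>) x))"
      by (simp add: mult.commute)
    show "\<forall>\<^sub>0\<epsilon>. \<forall>x\<in>K. x \<in> K \<and> norm (pd is (\<lambda>x. u \<epsilon> x * v \<epsilon> x) x) \<le> (\<Sum>p\<leftarrow>splits is. norm (pd (fst p) (u \<epsilon>) x) * norm (pd (snd p) (v \<epsilon>) x))"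
      using small_unit
    proof eventually_elim
      case (elim \<epsilon>)
      then show ?case using K Leibniz_bound[OF assms(1) EM_smooth[OF assms(2)] assms(4), of \<epsilon> \<epsilon>]
        by blast
    qed
  qed
qed

lemma pd_pd: "pd js (pd is f) = pd (js @ is) f"
  by simp

lemma EM_pd:
  assumes "open \<Omega>" "u \<in> EM \<Omega>" shows "(\<lambda>\<epsilon>. pd js (u \<epsilon>)) \<in> EM \<Omega>"
  unfolding EM_iff[OF assms(1)]
proof (intro conjI ballI allI impI)
  show "smooth_on \<Omega> (pd js (u \<epsilon>))" if "\<epsilon> \<in> {0<..1}" for \<epsilon>
    by (rule smooth_on_pd[OF EM_smooth[OF assms(2) that]])
  show "moderate_on (\<lambda>_. K) (\<lambda>\<epsilon> x. norm (pd is (pd js (u \<epsilon>)) x))" if "compact K \<and> K \<subseteq> \<Omega>" for K "is"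
    unfolding pd_pd using EM_moderate_on[OF assms(2,1)] that by blast
qed

lemma null_nets_pd: "u \<in> null_nets \<Omega> \<Longrightarrow> (\<lambda>\<epsilon>. pd js (u \<epsilon>)) \<in> null_nets \<Omega>"
  unfolding null_nets_def mem_Collect_eq pd_pd by blast

lemma EM_subset: "open \<Omega> \<Longrightarrow> open \<omega> \<Longrightarrow> \<omega> \<subseteq> \<Omega> \<Longrightarrow> u \<in> EM \<Omega> \<Longrightarrow> u \<in> EM \<omega>"
  unfolding EM_iff by (auto intro: smooth_on_subset)

lemma EM_const:
  assumes "open \<Omega>" "smooth_on \<Omega> f" shows "(\<lambda>_. f) \<in> EM \<Omega>"
  unfolding EM_iff[OF assms(1)]
proof (intro conjI ballI allI impI assms)
  fix K "is" assume K: "compact K \<and> K \<subseteq> \<Omega>"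
  have "continuous_on K (pd is f)"
    using smooth_on_continuous_on[OF smooth_on_pd[OF assms(2)]] K continuous_on_subset by blast
  with K have "bounded (pd is f ` K)" using compact_continuous_image compact_imp_bounded by blast
  then obtain B where "\<forall>x\<in>K. norm (pd is f x) \<le> B" by (auto simp: bounded_iff)
  then show "moderate_on (\<lambda>_. K) (\<lambda>\<epsilon> x. norm (pd is f x))"
    by (intro moderate_on_mono[OF moderate_on_const[of "\<lambda>_. K" B]]) auto
qed

lemma null_nets_uminus:
  assumes "open \<Omega>" "w \<in> null_nets \<Omega>" "\<And>\<epsilon>. \<epsilon> \<in> {0<..1} \<Longrightarrow> smooth_on \<Omega> (w \<epsilon>)"
  shows "(\<lambda>\<epsilon> x. - w \<epsilon> x) \<in> null_nets \<Omega>"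
proof -
  have "(\<lambda>_ _. -1) \<in> EM \<Omega>" by (rule EM_const[OF assms(1) smooth_on_const])
  from null_nets_mult[OF assms(1) this assms(2,3)] show ?thesis by simp
qed

lemma null_nets_diff:
  assumes "open \<Omega>" "u \<in> null_nets \<Omega>" "v \<in> null_nets \<Omega>"
    "\<And>\<epsilon>. \<epsilon> \<in> {0<..1} \<Longrightarrow> smooth_on \<Omega> (u \<epsilon>)" "\<And>\<epsilon>. \<epsilon> \<in> {0<..1} \<Longrightarrow> smooth_on \<Omega> (v \<epsilon>)"
  shows "(\<lambda>\<epsilon> x. u \<epsilon> x - v \<epsilon> x) \<in> null_nets \<Omega>"
  unfolding null_nets_def
proof safe
  fix K "is" assume K: "compact K" "K \<subseteq> \<Omega>"
  show "negligible_on (\<lambda>_. K) (\<lambda>\<epsilon> x. norm (pd is (\<lambda>x. u \<epsilon> x - v \<epsilon> x) x))"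
  proof (rule negligible_on_mono)
    show "negligible_on (\<lambda>_. K) (\<lambda>\<epsilon> x. norm (pd is (u \<epsilon>) x) + norm (pd is (v \<epsilon>) x))"
      using assms K by (intro negligible_on_add) (auto simp: null_nets_def)
    show "\<forall>\<^sub>0\<epsilon>. \<forall>x\<in>K. x \<in> K \<and> norm (pd is (\<lambda>x. u \<epsilon> x - v \<epsilon> x) x) \<le> norm (pd is (u \<epsilon>) x) + norm (pd is (v \<epsilon>) x)"
      using small_unit
    proof eventually_elim
      case (elim \<epsilon>)
      then show ?case using K pd_diff[OF assms(1) assms(4) assms(5), of \<epsilon> \<epsilon>]
        by (auto simp: subset_iff norm_triangle_ineq4)
    qed
  qed
qed

lemma Grel_refl: "open \<Omega> \<Longrightarrow> u \<in> EM \<Omega> \<Longrightarrow> (u, u) \<in> Grel \<Omega>"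
  by (simp add: Grel_iff null_nets_def negligible_on_zero)

lemma equiv_Grel:
  assumes "open \<Omega>" shows "equiv (EM \<Omega>) (Grel \<Omega>)"
proof (rule equivI)
  show "Grel \<Omega> \<subseteq> EM \<Omega> \<times> EM \<Omega>" by (auto simp: Grel_def)
  show "refl_on (EM \<Omega>) (Grel \<Omega>)"
    using Grel_refl[OF assms] by (auto simp: refl_on_def)
  show "sym (Grel \<Omega>)"
  proof (rule symI)
    fix u v assume uv: "(u, v) \<in> Grel \<Omega>"
    then have "u \<in> EM \<Omega>" "v \<in> EM \<Omega>" by (auto simp: Grel_def)
    then have "smooth_on \<Omega> (\<lambda>x. u \<epsilon> x - v \<epsilon> x)" if "\<epsilon> \<in> {0<..1}" for \<epsilon>
      using smooth_on_diff[OF assms] that EM_smooth by blast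
    with uv null_nets_uminus[OF assms, of "\<lambda>\<epsilon> x. u \<epsilon> x - v \<epsilon> x"] show "(v, u) \<in> Grel \<Omega>"
      by (auto simp: Grel_iff[OF assms])
  qed
  show "trans (Grel \<Omega>)"
  proof (rule transI)
    fix u v w assume uv: "(u, v) \<in> Grel \<Omega>" and vw: "(v, w) \<in> Grel \<Omega>"
    then have e: "u \<in> EM \<Omega>" "v \<in> EM \<Omega>" "w \<in> EM \<Omega>" by (auto simp: Grel_def)
    note s = EM_smooth[OF EM_diff[OF assms]]
    have "(\<lambda>\<epsilon> x. v \<epsilon> x - w \<epsilon> x) \<in> null_nets \<Omega>" "(\<lambda>\<epsilon> x. u \<epsilon> x - v \<epsilon> x) \<in> null_nets \<Omega>"
      using uv vw by (auto simp: Grel_iff[OF assms])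
    from null_nets_diff[OF assms this(2) null_nets_uminus[OF assms this(1) s[OF e(2,3)]] s[OF e(1,2)]]
      EM_smooth[OF EM_diff[OF assms e(3,2)]] 
    have "(\<lambda>\<epsilon> x. u \<epsilon> x - w \<epsilon> x) \<in> null_nets \<Omega>" by simp
    then show "(u, w) \<in> Grel \<Omega>" using e by (simp add: Grel_iff[OF assms])
  qed
qed

lemma G_ex_rep: "open \<Omega> \<Longrightarrow> u \<in> G \<Omega> \<Longrightarrow> \<exists>u'\<in>EM \<Omega>. u' \<in> u \<and> u = Grel \<Omega> `` {u'}"
  unfolding G_def by (elim quotientE) (metis equiv_class_self equiv_Grel)

lemma G_Grel: "open \<Omega> \<Longrightarrow> u \<in> G \<Omega> \<Longrightarrow> u' \<in> u \<Longrightarrow> u'' \<in> u \<Longrightarrow> (u', u'') \<in> Grel \<Omega>"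
  unfolding G_def by (metis equiv_Grel in_quotient_imp_in_rel insert_subset empty_subsetI)

lemma G_EM: "open \<Omega> \<Longrightarrow> u \<in> G \<Omega> \<Longrightarrow> u' \<in> u \<Longrightarrow> u' \<in> EM \<Omega>"
  using G_Grel[of \<Omega> u u' u'] by (auto simp: Grel_def)

lemma G_memI: "open \<Omega> \<Longrightarrow> u \<in> G \<Omega> \<Longrightarrow> u' \<in> u \<Longrightarrow> (u', u'') \<in> Grel \<Omega> \<Longrightarrow> u'' \<in> u"
  unfolding G_def by (metis equiv_Grel in_quotient_imp_closed)

section \<open>Point values\<close>

lemma compact_neighbourhood:
  fixes K :: "(real^'n) set"
  assumes "compact K" "open \<Omega>" "K \<subseteq> \<Omega>"
  obtains \<delta> K' where "\<delta> > 0" "compact K'" "K' \<subseteq> \<Omega>" "K \<subseteq> K'" "\<And>x y. x \<in> K \<Longrightarrow> norm (y - x) \<le> \<delta> \<Longrightarrow> y \<in> K'"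
proof -
  obtain e where e: "e > 0" "(\<Union>x\<in>K. ball x e) \<subseteq> \<Omega>"
    using compact_subset_open_imp_ball_epsilon_subset[OF assms] by blast
  show thesis
  proof (rule that[of "e/2" "\<Union>x\<in>K. cball x (e/2)"])
    show "compact (\<Union>x\<in>K. cball x (e/2))" by (rule compact_minkowski_sum_cball[OF assms(1)])
    show "(\<Union>x\<in>K. cball x (e/2)) \<subseteq> \<Omega>" using e by (force simp: subset_iff)
    show "K \<subseteq> (\<Union>x\<in>K. cball x (e/2))" using e by force
    show "y \<in> (\<Union>x\<in>K. cball x (e/2))" if "x \<in> K" "norm (y - x) \<le> e/2" for x y
      using that by (auto simp: dist_norm norm_minus_commute intro!: bexI[of _ x])
  qed (use e in auto)
qed

lemma norm_diff_le_partials: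
  fixes f :: "real^'n \<Rightarrow> complex"
  assumes "cball x \<delta> \<subseteq> \<Omega>" "\<And>z. z \<in> cball x \<delta> \<Longrightarrow> f differentiable (at z)"
    and "\<And>z i. z \<in> cball x \<delta> \<Longrightarrow> norm (partial i f z) \<le> B" and "norm (y - x) \<le> \<delta>"
  shows "norm (f y - f x) \<le> real CARD('n) * B * norm (y - x)"
proof -
  have "\<forall>z\<in>cball x \<delta>. \<exists>f'. (f has_derivative f') (at z)"
    using assms(2) by (auto simp: differentiable_def)
  then obtain f' where f': "\<And>z. z \<in> cball x \<delta> \<Longrightarrow> (f has_derivative f' z) (at z)"
    by metis
  show ?thesis
  proof (rule differentiable_bound[of "cball x \<delta>" f f'])
    show "onorm (f' z) \<le> real CARD('n) * B" if z: "z \<in> cball x \<delta>" for z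
    proof (rule onorm_le)
      fix h
      have "norm (f' z h) \<le> (\<Sum>i\<in>UNIV. norm ((h $ i) *\<^sub>R partial i f z))"
        unfolding has_derivative_eq_sum_partial[OF f'[OF z]] by (rule norm_sum)
      also have "\<dots> \<le> (\<Sum>i::'n\<in>UNIV. norm h * B)"
        using assms(3)[OF z] by (intro sum_mono) (auto intro!: mult_mono component_le_norm_cart)
      finally show "norm (f' z h) \<le> real CARD('n) * B * norm h" by (simp add: mult_ac)
    qed
    have "0 \<le> \<delta>" using assms(4) norm_ge_zero order_trans by blast
    then show "x \<in> cball x \<delta>" by simp
    show "y \<in> cball x \<delta>" using assms(4) by (simp add: dist_norm norm_minus_commute)
    show "(f has_derivative f' z) (at z within cball x \<delta>)" if "z \<in> cball x \<delta>" for z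
      by (rule has_derivative_at_withinI[OF f'[OF that]])
  qed simp
qed

text \<open>Mean value estimate: a moderate net of functions maps equivalent nets of points of a compact
  set to equivalent nets.\<close>

lemma EM_point_negligible:
  fixes u :: "'n::finite fnet"
  assumes "open \<Omega>" "u \<in> EM \<Omega>" "compact K" "K \<subseteq> \<Omega>" "\<forall>\<^sub>0\<epsilon>. x \<epsilon> \<in> K"
    and "negligible_net (\<lambda>\<epsilon>. y \<epsilon> - x \<epsilon>)"
  shows "negligible_net (\<lambda>\<epsilon>. u \<epsilon> (y \<epsilon>) - u \<epsilon> (x \<epsilon>))"
proof -
  obtain \<delta> K' where K': "\<delta> > 0" "compact K'" "K' \<subseteq> \<Omega>" "\<And>x y. x \<in> K \<Longrightarrow> norm (y - x) \<le> \<delta> \<Longrightarrow> y \<in> K'"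
    using compact_neighbourhood[OF assms(3,1,4)] by metis
  have "\<exists>N. \<forall>\<^sub>0\<epsilon>. \<forall>x\<in>K'. norm (pd [i] (u \<epsilon>) x) \<le> \<epsilon> powr N" for i
    using EM_moderate_on[OF assms(2,1) K'(2,3), of "[i]"] unfolding moderate_on_def .
  then have "\<exists>N. \<forall>i. \<forall>\<^sub>0\<epsilon>. \<forall>x\<in>K'. norm (pd [i] (u \<epsilon>) x) \<le> \<epsilon> powr (N i)" by (intro choice allI)
  then obtain N where N: "\<forall>i. \<forall>\<^sub>0\<epsilon>. \<forall>x\<in>K'. norm (pd [i] (u \<epsilon>) x) \<le> \<epsilon> powr (N i)" ..
  define M where "M = Min (range N)"
  have ev: "\<forall>\<^sub>0\<epsilon>. \<forall>i. \<forall>x\<in>K'. norm (partial i (u \<epsilon>) x) \<le> \<epsilon> powr M"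
  proof (subst eventually_all_finite, safe)
    fix i show "\<forall>\<^sub>0\<epsilon>. \<forall>x\<in>K'. norm (partial i (u \<epsilon>) x) \<le> \<epsilon> powr M"
      using N[rule_format, of i] small_unit
    proof eventually_elim
      case (elim \<epsilon>)
      have "\<epsilon> powr N i \<le> \<epsilon> powr M" using elim by (intro powr_mono') (auto simp: M_def)
      then show ?case using elim by fastforce
    qed
  qed
  show ?thesis
    unfolding negligible_iff
  proof
    fix n
    have "\<forall>\<^sub>0\<epsilon>. norm (y \<epsilon> - x \<epsilon>) \<le> \<epsilon> powr (n - M + 1)" "\<forall>\<^sub>0\<epsilon>. norm (y \<epsilon> - x \<epsilon>) \<le> \<epsilon> powr 1"
      using assms(6) unfolding negligible_iff by blast+
    moreover have "\<forall>\<^sub>0\<epsilon>. real CARD('n) * \<epsilon> powr (n + 1) \<le> \<epsilon> powr n" by (rule small_const_mult) simp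
    ultimately show "\<forall>\<^sub>0\<epsilon>. norm (u \<epsilon> (y \<epsilon>) - u \<epsilon> (x \<epsilon>)) \<le> \<epsilon> powr n"
      using ev assms(5) small_less[OF K'(1)] small_unit
    proof eventually_elim
      case (elim \<epsilon>)
      have cb: "cball (x \<epsilon>) \<delta> \<subseteq> K'" using K'(4)[OF elim(5)] by (auto simp: dist_norm norm_minus_commute)
      have "norm (u \<epsilon> (y \<epsilon>) - u \<epsilon> (x \<epsilon>)) \<le> real CARD('n) * \<epsilon> powr M * norm (y \<epsilon> - x \<epsilon>)"
      proof (rule norm_diff_le_partials[of _ \<delta> UNIV])
        show "u \<epsilon> differentiable (at z)" if "z \<in> cball (x \<epsilon>) \<delta>" for z
          using that cb K'(3) smooth_on_differentiable[OF EM_smooth[OF assms(2) elim(7)]] by blast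
        show "norm (y \<epsilon> - x \<epsilon>) \<le> \<delta>" using elim by simp
      qed (use elim(4) cb in auto)
      also have "\<dots> \<le> real CARD('n) * \<epsilon> powr M * \<epsilon> powr (n - M + 1)"
        using elim by (intro mult_left_mono) auto
      also have "\<dots> = real CARD('n) * \<epsilon> powr (n + 1)" by (simp add: mult.assoc flip: powr_add)
      also have "\<dots> \<le> \<epsilon> powr n" by (rule elim)
      finally show ?case .
    qed
  qed
qed

lemma EM_point_moderate:
  assumes "open \<Omega>" "u \<in> EM \<Omega>" "compact K" "K \<subseteq> \<Omega>" "\<forall>\<^sub>0\<epsilon>. x \<epsilon> \<in> K"
  shows "moderate (\<lambda>\<epsilon>. u \<epsilon> (x \<epsilon>))"
  unfolding moderate_compose_iff_moderate_on
  using EM_moderate_on[OF assms(2,1,3,4), of "[]"]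
  by (rule moderate_on_mono) (use assms(5) in \<open>auto elim: eventually_mono\<close>)

lemma null_nets_point:
  assumes "u \<in> null_nets \<Omega>" "compact K" "K \<subseteq> \<Omega>" "\<forall>\<^sub>0\<epsilon>. x \<epsilon> \<in> K"
  shows "negligible_net (\<lambda>\<epsilon>. u \<epsilon> (x \<epsilon>))"
proof -
  have "negligible_on (\<lambda>_. K) (\<lambda>\<epsilon> x. norm (pd [] (u \<epsilon>) x))" using assms unfolding null_nets_def by blast
  then show ?thesis
    unfolding negligible_iff_negligible_on
    by (rule negligible_on_mono) (use assms(4) in \<open>auto elim: eventually_mono\<close>)
qed

text \<open>Stated for any set of nets equivalent to one of its elements, so that it applies to the elements of
\<open>\<G>(\<Omega>)\<close> and to the set that defines a derivative.\<close>

lemma Gpoint_eq: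
  fixes U :: "'n::finite fnet set"
  assumes "open \<Omega>" "w \<in> U" "\<And>v. v \<in> U \<Longrightarrow> (v, w) \<in> Grel \<Omega>"
    and x: "represents x' x" "compact K" "K \<subseteq> \<Omega>" "\<forall>\<^sub>0\<epsilon>. x' \<epsilon> \<in> K"
  shows "represents (\<lambda>\<epsilon>. w \<epsilon> (x' \<epsilon>)) (Gpoint \<Omega> U x)"
proof -
  have w: "w \<in> EM \<Omega>" using assms(3)[OF assms(2)] by (auto simp: Grel_def)
  note mod = EM_point_moderate[OF assms(1) w x(2-4)]
  have "Gpoint \<Omega> U x = abs_colombeau (\<lambda>\<epsilon>. w \<epsilon> (x' \<epsilon>))"
    unfolding Gpoint_def
  proof (rule the_equality)
    show "\<exists>u'\<in>U. \<exists>x'' K. represents x'' x \<and> compact K \<and> K \<subseteq> \<Omega> \<and> (\<forall>\<^sub>0\<epsilon>. x'' \<epsilon> \<in> K) \<and>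
      abs_colombeau (\<lambda>\<epsilon>. w \<epsilon> (x' \<epsilon>)) = abs_colombeau (\<lambda>\<epsilon>. u' \<epsilon> (x'' \<epsilon>))"
      using assms by blast
  next
    fix y assume "\<exists>u'\<in>U. \<exists>x'' K. represents x'' x \<and> compact K \<and> K \<subseteq> \<Omega> \<and> (\<forall>\<^sub>0\<epsilon>. x'' \<epsilon> \<in> K) \<and>
      y = abs_colombeau (\<lambda>\<epsilon>. u' \<epsilon> (x'' \<epsilon>))"
    then obtain u' x'' K2 where u': "u' \<in> U" "represents x'' x" "compact K2" "K2 \<subseteq> \<Omega>" "\<forall>\<^sub>0\<epsilon>. x'' \<epsilon> \<in> K2"
      and y: "y = abs_colombeau (\<lambda>\<epsilon>. u' \<epsilon> (x'' \<epsilon>))" by blast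
    from assms(3)[OF u'(1)] have uw: "u' \<in> EM \<Omega>" "(\<lambda>\<epsilon> x. u' \<epsilon> x - w \<epsilon> x) \<in> null_nets \<Omega>"
      by (auto simp: Grel_iff[OF assms(1)])
    have "negligible_net (\<lambda>\<epsilon>. (u' \<epsilon> (x'' \<epsilon>) - w \<epsilon> (x'' \<epsilon>)) + (w \<epsilon> (x'' \<epsilon>) - w \<epsilon> (x' \<epsilon>)))"
      by (intro negligible_add EM_point_negligible[OF assms(1) w x(2-4)] null_nets_point[OF uw(2) u'(3-5)]
          represents_unique[OF u'(2) x(1)])
    then show "y = abs_colombeau (\<lambda>\<epsilon>. w \<epsilon> (x' \<epsilon>))"
      unfolding y abs_colombeau_eq_iff[OF EM_point_moderate[OF assms(1) uw(1) u'(3-5)] mod] by simp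
  qed
  then show ?thesis using represents_abs[OF mod] by simp
qed

lemma Gpoint_G:
  assumes "open \<Omega>" "u \<in> G \<Omega>" "u' \<in> u"
    "represents x' x" "compact K" "K \<subseteq> \<Omega>" "\<forall>\<^sub>0\<epsilon>. x' \<epsilon> \<in> K"
  shows "represents (\<lambda>\<epsilon>. u' \<epsilon> (x' \<epsilon>)) (Gpoint \<Omega> u x)"
  using assms(4-7) by (intro Gpoint_eq[OF assms(1,3)] G_Grel[OF assms(1,2) _ assms(3)])

lemma Gpoint_Gderiv:
  assumes "open \<Omega>" "u \<in> G \<Omega>" "u' \<in> u"
    and x: "represents x' x" "compact K" "K \<subseteq> \<Omega>" "\<forall>\<^sub>0\<epsilon>. x' \<epsilon> \<in> K"
  shows "represents (\<lambda>\<epsilon>. pd (mlist \<alpha>) (u' \<epsilon>) (x' \<epsilon>)) (Gpoint \<Omega> (Gderiv \<Omega> \<alpha> u) x)"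
proof (rule Gpoint_eq[OF assms(1) _ _ x, where w="\<lambda>\<epsilon>. pd (mlist \<alpha>) (u' \<epsilon>)"])
  have EM: "(\<lambda>\<epsilon>. pd (mlist \<alpha>) (v \<epsilon>)) \<in> EM \<Omega>" if "v \<in> u" for v
    using EM_pd G_EM assms that by blast
  show "(\<lambda>\<epsilon>. pd (mlist \<alpha>) (u' \<epsilon>)) \<in> Gderiv \<Omega> \<alpha> u"
    unfolding Gderiv_def mpartial_eq_pd using Grel_refl[OF assms(1) EM[OF assms(3)]] assms(3) by blast
  fix v assume "v \<in> Gderiv \<Omega> \<alpha> u"
  then obtain w where w: "w \<in> u" "(\<lambda>\<epsilon>. pd (mlist \<alpha>) (w \<epsilon>), v) \<in> Grel \<Omega>"
    unfolding Gderiv_def mpartial_eq_pd by blast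
  have wu: "(w, u') \<in> Grel \<Omega>" using G_Grel assms w by blast
  have "(\<lambda>\<epsilon>. pd (mlist \<alpha>) (w \<epsilon>), \<lambda>\<epsilon>. pd (mlist \<alpha>) (u' \<epsilon>)) \<in> Grel \<Omega>"
    unfolding Grel_iff[OF assms(1)]
  proof (intro conjI EM assms w)
    show "(\<lambda>\<epsilon> x. pd (mlist \<alpha>) (w \<epsilon>) x - pd (mlist \<alpha>) (u' \<epsilon>) x) \<in> null_nets \<Omega>"
    proof (rule null_nets_cong[OF assms(1) null_nets_pd])
      show "(\<lambda>\<epsilon> x. w \<epsilon> x - u' \<epsilon> x) \<in> null_nets \<Omega>" using wu by (simp add: Grel_iff[OF assms(1)])
      show "pd (mlist \<alpha>) (\<lambda>x. w \<epsilon> x - u' \<epsilon> x) x = pd (mlist \<alpha>) (w \<epsilon>) x - pd (mlist \<alpha>) (u' \<epsilon>) x"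
        if "\<epsilon> \<in> {0<..1}" "x \<in> \<Omega>" for \<epsilon> x
        by (rule pd_diff[OF assms(1) EM_smooth[OF G_EM[OF assms(1,2) w(1)] that(1)] EM_smooth[OF G_EM[OF assms(1-3)] that(1)] that(2)])
    qed
  qed
  with w(2) equiv_Grel[OF assms(1)] show "(v, \<lambda>\<epsilon>. pd (mlist \<alpha>) (u' \<epsilon>)) \<in> Grel \<Omega>"
    by (meson equivE symD transD)
qed

section \<open>Smooth functions of one variable and cutoffs\<close>

text \<open>\<open>n\<close>-fold differentiability, as a recursion on \<open>n\<close> in which products and reciprocals are immediate.
Smoothness is the conjunction over all \<open>n\<close>.\<close>

fun Ck :: "nat \<Rightarrow> (real \<Rightarrow> real) \<Rightarrow> bool" where
  "Ck 0 f \<longleftrightarrow> True"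
| "Ck (Suc n) f \<longleftrightarrow> (\<exists>f'. (\<forall>t. (f has_real_derivative f' t) (at t)) \<and> Ck n f')"

lemma Ck_Suc_imp: "Ck (Suc n) f \<Longrightarrow> Ck n f"
proof (induction n arbitrary: f)
  case (Suc n)
  then obtain f' where "\<forall>t. (f has_real_derivative f' t) (at t)" "Ck (Suc n) f'" by auto
  with Suc.IH[of f'] show ?case by auto
qed simp

lemma Ck_const: "Ck n (\<lambda>_. c)"
proof (induction n arbitrary: c)
  case (Suc n) then show ?case by (auto intro!: exI[of _ "\<lambda>_. 0"])
qed simp

lemma Ck_add: "Ck n f \<Longrightarrow> Ck n g \<Longrightarrow> Ck n (\<lambda>t. f t + g t)"
proof (induction n arbitrary: f g)
  case (Suc n)
  then obtain f' g' where "\<forall>t. (f has_real_derivative f' t) (at t)" "Ck n f'"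
    "\<forall>t. (g has_real_derivative g' t) (at t)" "Ck n g'" by auto
  with Suc.IH[of f' g'] show ?case
    by (auto intro!: exI[of _ "\<lambda>t. f' t + g' t"] derivative_intros)
qed simp

lemma Ck_mult: "Ck n f \<Longrightarrow> Ck n g \<Longrightarrow> Ck n (\<lambda>t. f t * g t)"
proof (induction n arbitrary: f g)
  case (Suc n)
  note C = Ck_Suc_imp[OF Suc.prems(1)] Ck_Suc_imp[OF Suc.prems(2)]
  from Suc.prems obtain f' g' where *: "\<forall>t. (f has_real_derivative f' t) (at t)" "Ck n f'"
    "\<forall>t. (g has_real_derivative g' t) (at t)" "Ck n g'" by auto
  have "Ck n (\<lambda>t. f' t * g t + g' t * f t)"
    by (intro Ck_add Suc.IH * C)
  moreover have "\<forall>t. ((\<lambda>t. f t * g t) has_real_derivative (f' t * g t + g' t * f t)) (at t)"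
    using * by (auto intro!: DERIV_mult)
  ultimately show ?case by (auto simp del: DERIV_mult)
qed simp

lemma Ck_affine: "Ck n f \<Longrightarrow> Ck n (\<lambda>t. f (a * t + b))"
proof (induction n arbitrary: f)
  case (Suc n)
  then obtain f' where *: "\<forall>t. (f has_real_derivative f' t) (at t)" "Ck n f'" by auto
  have "Ck n (\<lambda>t. a * f' (a * t + b))"
    by (intro Ck_mult Ck_const Suc.IH *)
  moreover have "((\<lambda>t. f (a * t + b)) has_real_derivative a * f' (a * t + b)) (at t)" for t
  proof -
    have "((\<lambda>t. a * t + b) has_real_derivative a) (at t)" by (auto intro!: derivative_eq_intros)
    from DERIV_chain2[OF *(1)[rule_format] this] show ?thesis by (simp add: mult.commute)
  qed
  ultimately show ?case unfolding Ck.simps by (intro exI[of _ "\<lambda>t. a * f' (a * t + b)"] conjI allI)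
qed simp

lemma Ck_inverse: "Ck n f \<Longrightarrow> (\<And>t. f t \<noteq> 0) \<Longrightarrow> Ck n (\<lambda>t. inverse (f t))"
proof (induction n)
  case (Suc n)
  note C = Ck_Suc_imp[OF Suc.prems(1)]
  from Suc.prems obtain f' where *: "\<forall>t. (f has_real_derivative f' t) (at t)" "Ck n f'" by auto
  have "Ck n (\<lambda>t. (- 1) * (f' t * (inverse (f t) * inverse (f t))))"
    by (intro Ck_mult Ck_const Suc.IH * C Suc.prems)
  moreover have "\<forall>t. ((\<lambda>t. inverse (f t)) has_real_derivative (- 1) * (f' t * (inverse (f t) * inverse (f t)))) (at t)"
    using * Suc.prems(2) by (auto intro!: derivative_eq_intros simp: power2_eq_square)
  ultimately show ?case by auto
qed simp

definition Cinf :: "(real \<Rightarrow> real) \<Rightarrow> bool" where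
  "Cinf f \<longleftrightarrow> (\<forall>n. Ck n f)"

lemma Cinf_DERIV:
  assumes "Cinf f" shows "(f has_real_derivative deriv f t) (at t)"
proof -
  have "Ck (Suc 0) f" using assms by (simp only: Cinf_def)
  then obtain f' where "\<forall>t. (f has_real_derivative f' t) (at t)" by auto
  then show ?thesis by (metis DERIV_imp_deriv)
qed

lemma Cinf_deriv:
  assumes "Cinf f" shows "Cinf (deriv f)"
  unfolding Cinf_def
proof
  fix n
  have "Ck (Suc n) f" using assms by (simp only: Cinf_def)
  then obtain f' where *: "\<forall>t. (f has_real_derivative f' t) (at t)" "Ck n f'" by auto
  then have "f' = deriv f" by (metis DERIV_imp_deriv ext)
  with * show "Ck n (deriv f)" by simp
qed

lemma Cinf_funpow_deriv: "Cinf f \<Longrightarrow> Cinf ((deriv ^^ k) f)"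
  by (induction k) (auto intro: Cinf_deriv)

text \<open>The functions \<open>p (1/t) e\<^sup>-\<^sup>1\<^sup>/\<^sup>t\<close> with a polynomial \<open>p\<close>, extended by zero to \<open>t \<le> 0\<close>, are closed
  under differentiation; hence all of them are smooth.\<close>

definition flat :: "real poly \<Rightarrow> real \<Rightarrow> real" where
  "flat p t = (if t > 0 then poly p (inverse t) * exp (- inverse t) else 0)"

lemma poly_exp_tendsto: "((\<lambda>x::real. x ^ k * poly p x * exp (- x)) \<longlongrightarrow> 0) at_top"
proof (induction p arbitrary: k)
  case (pCons a p)
  have "((\<lambda>x::real. a * (x ^ k / exp x) + x ^ Suc k * poly p x * exp (- x)) \<longlongrightarrow> a * 0 + 0) at_top"
    by (intro tendsto_intros tendsto_power_div_exp_0 pCons)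
  then show ?case by (simp add: algebra_simps exp_minus field_simps)
qed simp

lemma flat_DERIV:
  "(flat p has_real_derivative flat ((p - pderiv p) * [:0, 0, 1:]) t) (at t)"
proof -
  consider "t > 0" | "t < 0" | "t = 0" by linarith
  then show ?thesis
  proof cases
    case 1
    have "((\<lambda>t. poly p (inverse t) * exp (- inverse t)) has_real_derivative flat ((p - pderiv p) * [:0, 0, 1:]) t) (at t)"
    proof -
      have inv: "(inverse has_real_derivative - (inverse t * inverse t)) (at t)"
        using DERIV_inverse[of t UNIV] 1 by simp
      have "((\<lambda>t. poly p (inverse t) * exp (- inverse t)) has_real_derivative
        poly p (inverse t) * (exp (- inverse t) * - (- (inverse t * inverse t)))
        + poly (pderiv p) (inverse t) * - (inverse t * inverse t) * exp (- inverse t)) (at t)"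
        by (rule DERIV_mult'[OF DERIV_chain2[OF poly_DERIV inv] DERIV_chain2[OF DERIV_exp DERIV_minus[OF inv]]])
      also have "poly p (inverse t) * (exp (- inverse t) * - (- (inverse t * inverse t)))
        + poly (pderiv p) (inverse t) * - (inverse t * inverse t) * exp (- inverse t)
        = flat ((p - pderiv p) * [:0, 0, 1:]) t"
        using 1 by (simp add: flat_def algebra_simps)
      finally show ?thesis .
    qed
    moreover have "eventually (\<lambda>s. poly p (inverse s) * exp (- inverse s) = flat p s) (nhds t)"
      using eventually_nhds_in_open[of "{0<..}" t] 1 by (auto simp: flat_def elim: eventually_mono)
    ultimately show ?thesis by (rule iffD1[OF DERIV_cong_ev[OF refl _ refl], rotated])
  next
    case 2
    have "((\<lambda>t. 0) has_real_derivative flat ((p - pderiv p) * [:0, 0, 1:]) t) (at t)"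
      using 2 by (simp add: flat_def)
    moreover have "eventually (\<lambda>s. 0 = flat p s) (nhds t)"
      using eventually_nhds_in_open[of "{..<0}" t] 2 by (auto simp: flat_def elim: eventually_mono)
    ultimately show ?thesis by (rule iffD1[OF DERIV_cong_ev[OF refl _ refl], rotated])
  next
    case 3
    have "((\<lambda>h. (flat p (0 + h) - flat p 0) / h) \<longlongrightarrow> 0) (at 0)"
    proof (rule filterlim_split_at)
      show "((\<lambda>h. (flat p (0 + h) - flat p 0) / h) \<longlongrightarrow> 0) (at_left 0)"
      proof (rule tendsto_eventually)
        show "eventually (\<lambda>h. (flat p (0 + h) - flat p 0) / h = 0) (at_left 0)"
          by (rule eventually_at_leftI[of "-1"]) (auto simp: flat_def)
      qed
      have "((\<lambda>h. inverse h ^ 1 * poly p (inverse h) * exp (- inverse h)) \<longlongrightarrow> 0) (at_right (0::real))"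
        by (rule filterlim_compose[OF poly_exp_tendsto filterlim_inverse_at_top_right])
      moreover have "eventually (\<lambda>h. inverse h ^ 1 * poly p (inverse h) * exp (- inverse h) = (flat p (0 + h) - flat p 0) / h) (at_right 0)"
        by (rule eventually_at_rightI[of 0 1]) (auto simp: flat_def field_simps)
      ultimately show "((\<lambda>h. (flat p (0 + h) - flat p 0) / h) \<longlongrightarrow> 0) (at_right 0)"
        by (rule Lim_transform_eventually)
    qed
    then show ?thesis using 3 by (simp add: DERIV_def flat_def)
  qed
qed

lemma Ck_flat: "Ck n (flat p)"
  by (induction n arbitrary: p) (use flat_DERIV in auto)

definition smooth_step :: "real \<Rightarrow> real" where
  "smooth_step t = flat 1 t * inverse (flat 1 t + flat 1 (1 - t))"

definition plateau :: "real \<Rightarrow> real" where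
  "plateau t = smooth_step (t + 2) * smooth_step (2 - t)"

lemma flat_1_nonneg: "0 \<le> flat 1 t" by (simp add: flat_def)

lemma flat_1_pos: "0 < t \<Longrightarrow> 0 < flat 1 t" by (simp add: flat_def)

lemma flat_1_sum_pos: "0 < flat 1 t + flat 1 (1 - t)"
proof (cases "t > 0")
  case True then show ?thesis using flat_1_pos[of t] flat_1_nonneg[of "1 - t"] by linarith
next
  case False then show ?thesis using flat_1_pos[of "1 - t"] flat_1_nonneg[of t] by linarith
qed

lemma smooth_step_simps: "t \<le> 0 \<Longrightarrow> smooth_step t = 0" "1 \<le> t \<Longrightarrow> smooth_step t = 1"
  using flat_1_pos[of t] by (auto simp: smooth_step_def flat_def)

lemma smooth_step_bounds: "0 \<le> smooth_step t" "smooth_step t \<le> 1"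
  using flat_1_sum_pos[of t] flat_1_nonneg[of t] flat_1_nonneg[of "1 - t"]
  by (auto simp: smooth_step_def field_simps)

lemma Cinf_plateau: "Cinf plateau"
proof -
  have s: "Ck n smooth_step" for n
    unfolding smooth_step_def
    using flat_1_sum_pos Ck_affine[OF Ck_flat, of n 1 "-1" 1]
    by (intro Ck_mult Ck_inverse Ck_add Ck_flat) (auto simp: less_imp_neq[symmetric] algebra_simps)
  show ?thesis
    unfolding Cinf_def plateau_def
    using Ck_affine[OF s, of _ 1 2] Ck_affine[OF s, of _ "-1" 2]
    by (auto intro!: Ck_mult simp: algebra_simps)
qed

lemma plateau_eq_1: "\<bar>t\<bar> \<le> 1 \<Longrightarrow> plateau t = 1"
  by (simp add: plateau_def smooth_step_simps abs_le_iff)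

lemma plateau_eq_0: "2 \<le> \<bar>t\<bar> \<Longrightarrow> plateau t = 0"
  by (cases "t \<ge> 0") (simp_all add: plateau_def smooth_step_simps)

lemma plateau_bounds: "0 \<le> plateau t" "plateau t \<le> 1"
  using mult_mono[OF smooth_step_bounds(2)[of "t + 2"] smooth_step_bounds(2)[of "2 - t"]]
    smooth_step_bounds(1)
  by (auto simp: plateau_def)

definition plateau_deriv :: "nat \<Rightarrow> real \<Rightarrow> real" where
  "plateau_deriv k = (deriv ^^ k) plateau"

lemma plateau_DERIV: "(plateau_deriv k has_real_derivative plateau_deriv (Suc k) t) (at t)"
  using Cinf_DERIV[OF Cinf_funpow_deriv[OF Cinf_plateau]] by (simp add: plateau_deriv_def)

lemma plateau_deriv_eq_0: "2 < \<bar>t\<bar> \<Longrightarrow> plateau_deriv k t = 0"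
proof (induction k arbitrary: t)
  case 0 then show ?case by (simp add: plateau_deriv_def plateau_eq_0)
next
  case (Suc k)
  have "open {t::real. 2 < \<bar>t\<bar>}" by (intro open_Collect_less continuous_intros)
  then have ev: "eventually (\<lambda>s. 0 = plateau_deriv k s) (nhds t)"
    using eventually_nhds_in_open[of "{t::real. 2 < \<bar>t\<bar>}" t] Suc by (auto elim!: eventually_mono)
  have "((\<lambda>_. 0) has_real_derivative plateau_deriv (Suc k) t) (at t)"
    using plateau_DERIV[of k t] by (rule iffD2[OF DERIV_cong_ev[OF refl ev refl]])
  then show ?case using DERIV_unique DERIV_const by blast
qed

lemma plateau_deriv_bounded: "\<exists>M\<ge>0. \<forall>t. \<bar>plateau_deriv k t\<bar> \<le> M"
proof -
  have "continuous_on {-2..2} (plateau_deriv k)"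
    using plateau_DERIV by (meson DERIV_isCont continuous_at_imp_continuous_on)
  then have "bounded (plateau_deriv k ` {-2..2})"
    using compact_continuous_image compact_imp_bounded by blast
  then obtain M where M: "\<forall>t\<in>{-2..2}. \<bar>plateau_deriv k t\<bar> \<le> M" by (auto simp: bounded_iff)
  have "\<bar>plateau_deriv k t\<bar> \<le> max M 0" for t
  proof (cases "\<bar>t\<bar> \<le> 2")
    case True
    then have "t \<in> {-2..2}" by auto
    with M show ?thesis by (auto intro: max.coboundedI1)
  next
    case False then show ?thesis using plateau_deriv_eq_0[of t k] by simp
  qed
  then show ?thesis by (intro exI[of _ "max M 0"]) auto
qed

subsection \<open>Cutoffs in several variables\<close>

text \<open>A product of one-dimensional plateaus of width \<open>r\<close> and its partial derivatives, up to powers of \<open>r\<close>: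
\<open>k\<close> counts the derivatives taken in each coordinate.\<close>

definition bump_deriv :: "real^'n \<Rightarrow> real \<Rightarrow> ('n \<Rightarrow> nat) \<Rightarrow> real^'n \<Rightarrow> complex" where
  "bump_deriv c r k x = of_real (\<Prod>j\<in>UNIV. plateau_deriv (k j) ((x $ j - c $ j) / r))"

abbreviation bump :: "real^'n \<Rightarrow> real \<Rightarrow> real^'n \<Rightarrow> complex" where
  "bump c r \<equiv> bump_deriv c r (\<lambda>_. 0)"

lemma bump_deriv_differentiable: "r > 0 \<Longrightarrow> bump_deriv c r k differentiable (at x)"
proof -
  assume r: "r > 0"
  have "(\<lambda>x. plateau_deriv (k j) ((x $ j - c $ j) / r)) differentiable (at x)" for j
  proof -
    have "((\<lambda>x::real^'a. (x $ j - c $ j) / r) has_derivative (\<lambda>h. (h $ j) / r)) (at x)"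
      using r bounded_linear_imp_has_derivative[OF bounded_linear_vec_nth, of j "at x"]
      by (auto intro!: derivative_eq_intros)
    from has_derivative_compose[OF this plateau_DERIV[of "k j", unfolded has_field_derivative_def]]
    show ?thesis by (auto simp: differentiable_def)
  qed
  then obtain f' where f': "\<And>j. ((\<lambda>x. plateau_deriv (k j) ((x $ j - c $ j) / r)) has_derivative f' j) (at x)"
    unfolding differentiable_def by metis
  have "((\<lambda>x. complex_of_real (\<Prod>j\<in>UNIV. plateau_deriv (k j) ((x $ j - c $ j) / r))) has_derivative
    (\<lambda>y. of_real (\<Sum>i\<in>UNIV. f' i y * (\<Prod>j\<in>UNIV - {i}. plateau_deriv (k j) ((x $ j - c $ j) / r))))) (at x)"
    by (intro has_derivative_of_real has_derivative_prod f')
  then show ?thesis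
    unfolding bump_deriv_def differentiable_def by blast
qed

lemma partial_bump_deriv:
  assumes "r > 0"
  shows "partial i (bump_deriv c r k) x = of_real (1 / r) * bump_deriv c r (k(i := Suc (k i))) x"
proof -
  define C where "C = (\<Prod>j\<in>UNIV - {i}. plateau_deriv (k j) ((x $ j - c $ j) / r))"
  have split: "bump_deriv c r (k(i := m)) (x + t *\<^sub>R axis i 1) = of_real (plateau_deriv m ((x $ i + t - c $ i) / r) * C)" for t m
    unfolding bump_deriv_def C_def
    by (subst prod.remove[of _ i]) (auto intro!: prod.cong simp: axis_def)
  have "((\<lambda>t. (x $ i + t - c $ i) / r) has_real_derivative (1 / r)) (at 0)"
    using assms by (auto intro!: derivative_eq_intros)
  from DERIV_chain2[OF plateau_DERIV this, of "k i"]
  have "((\<lambda>t. plateau_deriv (k i) ((x $ i + t - c $ i) / r) * C) has_real_derivative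
      plateau_deriv (Suc (k i)) ((x $ i + 0 - c $ i) / r) * (1 / r) * C) (at 0)"
    by (rule DERIV_cmult_right)
  then have "((\<lambda>t. complex_of_real (plateau_deriv (k i) ((x $ i + t - c $ i) / r) * C)) has_vector_derivative
      of_real (plateau_deriv (Suc (k i)) ((x $ i + 0 - c $ i) / r) * (1 / r) * C)) (at 0)"
    by (intro has_vector_derivative_of_real) (simp add: has_real_derivative_iff_has_vector_derivative)
  from vector_derivative_at[OF this] show ?thesis
    unfolding partial_def
    using split[of "k i"] split[of "Suc (k i)" 0] by (simp add: mult_ac)
qed

lemma pd_bump:
  assumes "r > 0"
  shows "pd is (bump_deriv c r k) x = of_real ((1 / r) ^ length is) * bump_deriv c r (\<lambda>j. k j + count (mset is) j) x"
proof (induction "is" arbitrary: x)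
  case (Cons i "is")
  define k2 where "k2 = (\<lambda>j. k j + count (mset is) j)"
  have "pd (i # is) (bump_deriv c r k) x = partial i (\<lambda>x. of_real ((1 / r) ^ length is) * bump_deriv c r k2 x) x"
    unfolding foldr.simps comp_apply k2_def Cons.IH[abs_def] by simp
  also have "\<dots> = of_real ((1 / r) ^ length is) * (of_real (1 / r) * bump_deriv c r (k2(i := Suc (k2 i))) x)"
    by (subst partial_mult) (use assms in \<open>auto simp: partial_bump_deriv bump_deriv_differentiable\<close>)
  also have "k2(i := Suc (k2 i)) = (\<lambda>j. k j + count (mset (i # is)) j)"
    by (auto simp: k2_def fun_eq_iff)
  finally show ?case by simp
qed simp

lemma smooth_on_bump: "r > 0 \<Longrightarrow> smooth_on UNIV (bump c r)"
proof -
  assume r: "r > 0"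
  have "pd is (bump c r) = (\<lambda>x. of_real ((1 / r) ^ length is) * bump_deriv c r (\<lambda>j. 0 + count (mset is) j) x)" for "is"
    using pd_bump[OF r] by (rule ext)
  then show ?thesis
    unfolding smooth_on_def using r by (auto intro!: differentiable_mult bump_deriv_differentiable)
qed

lemma bump_deriv_bounded: "\<exists>M\<ge>0. \<forall>c r (x::real^'n). norm (bump_deriv c r k x) \<le> M"
proof -
  have "\<forall>j. \<exists>M\<ge>0. \<forall>t. \<bar>plateau_deriv (k j) t\<bar> \<le> M" using plateau_deriv_bounded by blast
  then obtain M where M: "\<forall>j. M j \<ge> 0 \<and> (\<forall>t. \<bar>plateau_deriv (k j) t\<bar> \<le> M j)"
    by metis
  then have "norm (bump_deriv c r k x) \<le> (\<Prod>j\<in>UNIV. M j)" for c r and x :: "real^'n"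
    unfolding bump_deriv_def norm_of_real abs_prod by (intro prod_mono) auto
  then show ?thesis using M by (intro exI[of _ "\<Prod>j\<in>UNIV. M j"]) (auto intro: prod_nonneg)
qed

text \<open>The constant is independent of the centre and of the width; a derivative costs a factor \<open>1/r\<close>.\<close>

lemma pd_bump_bound:
  "\<exists>M\<ge>0. \<forall>c r (x::real^'n). r > 0 \<longrightarrow> norm (pd is (bump c r) x) \<le> M * (1 / r) ^ length is"
proof -
  obtain M where M: "M \<ge> 0" "\<forall>c r (x::real^'n). norm (bump_deriv c r (\<lambda>j. 0 + count (mset is) j) x) \<le> M"
    using bump_deriv_bounded by blast
  have "norm (pd is (bump c r) x) \<le> M * (1 / r) ^ length is" if "r > 0" for c r and x :: "real^'n"
  proof -
    have "norm (pd is (bump c r) x) = (1 / r) ^ length is * norm (bump_deriv c r (\<lambda>j. 0 + count (mset is) j) x)"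
      unfolding pd_bump[OF that] norm_mult norm_of_real using that by (simp add: power_abs)
    also have "\<dots> \<le> (1 / r) ^ length is * M"
      using M that by (intro mult_left_mono) auto
    finally show ?thesis by (simp add: mult.commute)
  qed
  then show ?thesis using M(1) by blast
qed

lemma bump_eq_1:
  assumes "r > 0" "norm (x - c) \<le> r" shows "bump c r x = 1"
proof -
  have "\<bar>(x $ j - c $ j) / r\<bar> \<le> 1" for j
    using order_trans[OF component_le_norm_cart[of "x - c" j] assms(2)] assms(1) by (simp add: field_simps)
  then show ?thesis by (simp add: bump_deriv_def plateau_deriv_def plateau_eq_1)
qed

lemma bump_eq_0:
  fixes x :: "real^'n"
  assumes "r > 0" "2 * real CARD('n) * r < norm (x - c)" shows "bump c r x = 0"
proof -
  have "\<exists>j. 2 * r \<le> \<bar>x $ j - c $ j\<bar>"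
  proof (rule ccontr)
    assume "\<not> ?thesis"
    then have "norm (x - c) \<le> (\<Sum>j::'n\<in>UNIV. 2 * r)"
      by (intro order_trans[OF norm_le_l1_cart] sum_mono) (auto simp: not_le less_imp_le)
    with assms show False by simp
  qed
  then obtain j where "2 \<le> \<bar>(x $ j - c $ j) / r\<bar>" using assms(1) by (auto simp: field_simps)
  then have "plateau ((x $ j - c $ j) / r) = 0" by (rule plateau_eq_0)
  then show ?thesis by (auto simp: bump_deriv_def plateau_deriv_def)
qed

lemma norm_bump_le: "norm (bump c r x) \<le> 1"
  unfolding bump_deriv_def norm_of_real abs_prod plateau_deriv_def
  using plateau_bounds by (intro prod_le_1) (auto simp: abs_le_iff)

text \<open>Cover the set by finitely many bumps and take one minus the product of their complements.\<close>

lemma smooth_cutoff: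
  fixes S :: "(real^'n) set"
  assumes "compact S" "open U" "S \<subseteq> U"
  obtains \<psi> W K where "smooth_on UNIV \<psi>" "open W" "S \<subseteq> W" "\<And>x. x \<in> W \<Longrightarrow> \<psi> x = 1"
    "compact K" "K \<subseteq> U" "\<And>x. x \<notin> K \<Longrightarrow> \<psi> x = 0"
proof -
  define d where "d = 2 * real CARD('n)"
  have "d > 0" by (simp add: d_def)
  have "\<forall>x\<in>S. \<exists>r. r > 0 \<and> cball x (d * r) \<subseteq> U"
  proof
    fix x assume "x \<in> S"
    then obtain e where "e > 0" "cball x e \<subseteq> U" using assms open_contains_cball by blast
    then show "\<exists>r. r > 0 \<and> cball x (d * r) \<subseteq> U" using \<open>d > 0\<close> by (intro exI[of _ "e / d"]) auto
  qed
  from bchoice[OF this] obtain r where r: "\<And>x. x \<in> S \<Longrightarrow> r x > 0 \<and> cball x (d * r x) \<subseteq> U" by blast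
  have "S \<subseteq> (\<Union>x\<in>S. ball x (r x))" using r by auto
  then obtain T where T: "T \<subseteq> S" "finite T" "S \<subseteq> (\<Union>x\<in>T. ball x (r x))"
    using compactE_image[OF assms(1), of S "\<lambda>x. ball x (r x)"] by auto
  define \<psi> where "\<psi> x = 1 - (\<Prod>y\<in>T. 1 - bump y (r y) x)" for x
  show thesis
  proof (rule that[of \<psi> "\<Union>x\<in>T. ball x (r x)" "\<Union>x\<in>T. cball x (d * r x)"])
    show "smooth_on UNIV \<psi>"
      unfolding \<psi>_def using T r
      by (intro smooth_on_diff smooth_on_const smooth_on_prod smooth_on_bump) auto
    show "\<psi> x = 1" if "x \<in> (\<Union>x\<in>T. ball x (r x))" for x
    proof -
      from that obtain y where y: "y \<in> T" "norm (x - y) < r y" by (auto simp: dist_norm norm_minus_commute)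
      with T(1) r have "bump y (r y) x = 1" by (intro bump_eq_1) auto
      with y T show ?thesis by (auto simp: \<psi>_def)
    qed
    show "\<psi> x = 0" if "x \<notin> (\<Union>x\<in>T. cball x (d * r x))" for x
    proof -
      have "bump y (r y) x = 0" if "y \<in> T" for y
        using that \<open>x \<notin> _\<close> T(1) r
        by (intro bump_eq_0) (auto simp: dist_norm norm_minus_commute d_def not_le)
      then show ?thesis by (simp add: \<psi>_def)
    qed
  qed (use T r in auto)
qed

section \<open>Generalized functions with compact support\<close>

text \<open>Being null is a local property, by compactness.\<close>

lemma null_nets_Union:
  assumes "\<And>\<omega>. \<omega> \<in> \<W> \<Longrightarrow> open \<omega> \<and> w \<in> null_nets \<omega>"
  shows "w \<in> null_nets (\<Union>\<W>)"
  unfolding null_nets_def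
proof safe
  fix K "is" assume K: "compact K" "K \<subseteq> \<Union>\<W>"
  have "\<forall>x\<in>K. \<exists>e. e > 0 \<and> (\<exists>\<omega>\<in>\<W>. cball x e \<subseteq> \<omega>)"
  proof
    fix x assume "x \<in> K"
    then obtain \<omega> where "\<omega> \<in> \<W>" "x \<in> \<omega>" using K(2) by blast
    with assms[of \<omega>] show "\<exists>e. e > 0 \<and> (\<exists>\<omega>\<in>\<W>. cball x e \<subseteq> \<omega>)" by (meson open_contains_cball)
  qed
  from bchoice[OF this] obtain e where e: "\<And>x. x \<in> K \<Longrightarrow> e x > 0 \<and> (\<exists>\<omega>\<in>\<W>. cball x (e x) \<subseteq> \<omega>)" by blast
  have "K \<subseteq> (\<Union>x\<in>K. ball x (e x))" using e by auto
  then obtain T where T: "T \<subseteq> K" "finite T" "K \<subseteq> (\<Union>x\<in>T. ball x (e x))"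
    using compactE_image[OF K(1), of K "\<lambda>x. ball x (e x)"] by auto
  have "negligible_on (\<lambda>\<epsilon>. \<Union>x\<in>T. cball x (e x)) (\<lambda>\<epsilon> x. norm (pd is (w \<epsilon>) x))"
  proof (rule negligible_on_UN_finite[OF T(2)])
    fix x assume "x \<in> T"
    then obtain \<omega> where "\<omega> \<in> \<W>" "cball x (e x) \<subseteq> \<omega>" using T(1) e by blast
    with assms[of \<omega>] show "negligible_on (\<lambda>\<epsilon>. cball x (e x)) (\<lambda>\<epsilon> x. norm (pd is (w \<epsilon>) x))"
      by (auto simp: null_nets_def)
  qed
  then show "negligible_on (\<lambda>_. K) (\<lambda>\<epsilon> x. norm (pd is (w \<epsilon>) x))"
    by (rule negligible_on_mono) (use T(3) in \<open>force simp: less_imp_le\<close>)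
qed

text \<open>Cut off an arbitrary representative by a function that is one near the support. The error vanishes
near the support and is null away from it, since the complement of the support is the union of the
open sets on which the class restricts to zero.\<close>

lemma Gc_ex_rep:
  assumes "open \<Omega>" "v \<in> Gc \<Omega>"
  obtains v' K where "v' \<in> v" "v' \<in> EM \<Omega>" "compact K" "K \<subseteq> \<Omega>" "\<And>\<epsilon> x. x \<notin> K \<Longrightarrow> v' \<epsilon> x = 0"
proof -
  have v: "v \<in> G \<Omega>" and S: "compact (Gsupport \<Omega> v)" using assms(2) by (auto simp: Gc_def)
  obtain v0 where v0: "v0 \<in> EM \<Omega>" "v0 \<in> v" using G_ex_rep[OF assms(1) v] by blast
  define \<W> where "\<W> = {\<omega>. open \<omega> \<and> \<omega> \<subseteq> \<Omega> \<and> Grestrict \<omega> v = Gzero \<omega>}"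
  have supp: "Gsupport \<Omega> v = \<Omega> - \<Union>\<W>" by (simp add: Gsupport_def \<W>_def)
  have null: "v0 \<in> null_nets (\<Union>\<W>)"
  proof (rule null_nets_Union)
    fix \<omega> assume "\<omega> \<in> \<W>"
    then have o: "open \<omega>" "\<omega> \<subseteq> \<Omega>" "Grestrict \<omega> v = Gzero \<omega>" by (auto simp: \<W>_def)
    have "v0 \<in> Grestrict \<omega> v"
      unfolding Grestrict_def using Grel_refl[OF o(1) EM_subset[OF assms(1) o(1,2) v0(1)]] v0(2) by blast
    then have "(\<lambda>_ _. 0, v0) \<in> Grel \<omega>" unfolding o(3) Gzero_def by simp
    then have "(v0, \<lambda>_ _. 0) \<in> Grel \<omega>" using equiv_Grel[OF o(1)] by (meson equivE symD)
    then show "open \<omega> \<and> v0 \<in> null_nets \<omega>" using o by (simp add: Grel_iff)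
  qed
  obtain \<psi> W K where \<psi>: "smooth_on UNIV \<psi>" "open W" "Gsupport \<Omega> v \<subseteq> W" "\<And>x. x \<in> W \<Longrightarrow> \<psi> x = 1"
    "compact K" "K \<subseteq> \<Omega>" "\<And>x. x \<notin> K \<Longrightarrow> \<psi> x = 0"
    using smooth_cutoff[OF S assms(1)] supp by (metis Diff_subset)
  have s\<psi>: "smooth_on A \<psi>" for A using \<psi>(1) by (rule smooth_on_subset) simp
  define v' where "v' \<epsilon> x = \<psi> x * v0 \<epsilon> x" for \<epsilon> x
  have v': "v' \<in> EM \<Omega>"
    unfolding v'_def by (rule EM_mult[OF assms(1) EM_const[OF assms(1) s\<psi>] v0(1)])
  define \<omega>1 where "\<omega>1 = \<Union>\<W>"
  define \<omega>2 where "\<omega>2 = W \<inter> \<Omega>"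
  have o: "open \<omega>1" "\<omega>1 \<subseteq> \<Omega>" "open \<omega>2" "\<Union>{\<omega>1, \<omega>2} = \<Omega>"
    using assms(1) \<psi>(2,3) supp by (auto simp: \<omega>1_def \<omega>2_def \<W>_def)
  have "(\<lambda>\<epsilon> x. v0 \<epsilon> x - v' \<epsilon> x) \<in> null_nets (\<Union>{\<omega>1, \<omega>2})"
  proof (rule null_nets_Union)
    fix \<omega> assume "\<omega> \<in> {\<omega>1, \<omega>2}"
    then show "open \<omega> \<and> (\<lambda>\<epsilon> x. v0 \<epsilon> x - v' \<epsilon> x) \<in> null_nets \<omega>"
    proof (elim insertE emptyE)
      assume w: "\<omega> = \<omega>1"
      have "(\<lambda>\<epsilon> x. (1 - \<psi> x) * v0 \<epsilon> x) \<in> null_nets \<omega>1"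
        using EM_smooth[OF EM_subset[OF assms(1) o(1,2) v0(1)]] null
        by (intro null_nets_mult[OF o(1) EM_const[OF o(1)]] smooth_on_diff smooth_on_const s\<psi> o)
           (auto simp: \<omega>1_def)
      then show ?thesis using w o by (simp add: v'_def algebra_simps)
    next
      assume w: "\<omega> = \<omega>2"
      have "(\<lambda>\<epsilon> x. v0 \<epsilon> x - v' \<epsilon> x) \<in> null_nets \<omega>2"
      proof (rule null_nets_cong[OF o(3)])
        show "(\<lambda>_ _. 0) \<in> null_nets \<omega>2" by (simp add: null_nets_def negligible_on_zero)
      qed (auto simp: v'_def \<omega>2_def \<psi>)
      then show ?thesis using w o by simp
    qed
  qed
  then have "(v0, v') \<in> Grel \<Omega>" using o v0 v' by (simp add: Grel_iff[OF assms(1)])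
  from G_memI[OF assms(1) v v0(2) this] show thesis
    using v' \<psi>(5-7) by (intro that[of v' K]) (auto simp: v'_def)
qed

lemma Gc_I:
  assumes "open \<Omega>" "v' \<in> EM \<Omega>" "compact K" "K \<subseteq> \<Omega>" "\<And>\<epsilon> x. \<epsilon> \<in> {0<..1} \<Longrightarrow> x \<in> \<Omega> - K \<Longrightarrow> v' \<epsilon> x = 0"
  shows "Grel \<Omega> `` {v'} \<in> Gc \<Omega>"
proof -
  define v where "v = Grel \<Omega> `` {v'}"
  have v: "v \<in> G \<Omega>" unfolding v_def G_def by (rule quotientI[OF assms(2)])
  have v'v: "v' \<in> v" unfolding v_def using Grel_refl[OF assms(1,2)] by simp
  define \<omega> where "\<omega> = \<Omega> - K"
  have o: "open \<omega>" "\<omega> \<subseteq> \<Omega>" using assms by (auto simp: \<omega>_def open_Diff compact_imp_closed)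
  have sub: "(a, b) \<in> Grel \<Omega> \<Longrightarrow> (a, b) \<in> Grel \<omega>" for a b
    using EM_subset[OF assms(1) o] subset_trans[OF _ o(2)]
    unfolding Grel_iff[OF assms(1)] Grel_iff[OF o(1)] null_nets_def mem_Collect_eq by blast
  have EM0: "(\<lambda>_ _. 0) \<in> EM \<omega>" by (rule EM_const[OF o(1) smooth_on_const])
  have z: "(\<lambda>_ _. 0, v') \<in> Grel \<omega>"
    unfolding Grel_iff[OF o(1)]
  proof (intro conjI EM0 EM_subset[OF assms(1) o assms(2)])
    show "(\<lambda>\<epsilon> x. 0 - v' \<epsilon> x) \<in> null_nets \<omega>"
    proof (rule null_nets_cong[OF o(1)])
      show "(\<lambda>_ _. 0) \<in> null_nets \<omega>" by (simp add: null_nets_def negligible_on_zero)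
    qed (use assms(5) in \<open>auto simp: \<omega>_def\<close>)
  qed
  note eq = equiv_Grel[OF o(1)]
  have "Grestrict \<omega> v = Gzero \<omega>"
  proof
    show "Grestrict \<omega> v \<subseteq> Gzero \<omega>"
    proof
      fix w assume "w \<in> Grestrict \<omega> v"
      then obtain a where "(v', a) \<in> Grel \<Omega>" "(a, w) \<in> Grel \<omega>" by (auto simp: Grestrict_def v_def)
      with sub z eq have "(\<lambda>_ _. 0, w) \<in> Grel \<omega>" by (meson equivE transD)
      then show "w \<in> Gzero \<omega>" by (simp add: Gzero_def)
    qed
    show "Gzero \<omega> \<subseteq> Grestrict \<omega> v"
    proof
      fix w assume "w \<in> Gzero \<omega>"
      then have "(\<lambda>_ _. 0, w) \<in> Grel \<omega>" by (simp add: Gzero_def)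
      with z eq have "(v', w) \<in> Grel \<omega>" by (meson equivE transD symD)
      then show "w \<in> Grestrict \<omega> v" using v'v by (auto simp: Grestrict_def)
    qed
  qed
  then have "Gsupport \<Omega> v = K - \<Union>{\<omega>. open \<omega> \<and> \<omega> \<subseteq> \<Omega> \<and> Grestrict \<omega> v = Gzero \<omega>}"
    unfolding Gsupport_def using o assms(4) by (auto simp: \<omega>_def)
  then have "compact (Gsupport \<Omega> v)"
    using compact_diff[OF assms(3), of "\<Union>{\<omega>. open \<omega> \<and> \<omega> \<subseteq> \<Omega> \<and> Grestrict \<omega> v = Gzero \<omega>}"]
    by (auto intro: open_Union)
  with v show ?thesis by (simp add: Gc_def v_def)
qed

subsection \<open>Nets of test functions\<close>

text \<open>Representatives, extended by zero to the whole space, of generalized functions with compact support.\<close>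

definition test_nets :: "(real^'n) set \<Rightarrow> 'n fnet set" where
  "test_nets K = {w \<in> EM UNIV. \<forall>\<epsilon>\<in>{0<..1}. \<forall>x. x \<notin> K \<longrightarrow> w \<epsilon> x = 0}"

definition test_function :: "(real^'n) set \<Rightarrow> (real^'n \<Rightarrow> complex) \<Rightarrow> bool" where
  "test_function K f \<longleftrightarrow> smooth_on UNIV f \<and> (\<forall>x. x \<notin> K \<longrightarrow> f x = 0)"

lemma test_nets_function: "w \<in> test_nets K \<Longrightarrow> \<epsilon> \<in> {0<..1} \<Longrightarrow> test_function K (w \<epsilon>)"
  by (simp add: test_nets_def test_function_def EM_def)

lemma pd_eq_0_outside:
  assumes "closed K" "\<And>x. x \<notin> K \<Longrightarrow> f x = 0" "x \<notin> K" shows "pd is f x = 0"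
  using pd_cong[of "- K" f "\<lambda>_. 0" x "is"] assms by auto

lemma test_function_pd: "closed K \<Longrightarrow> test_function K f \<Longrightarrow> test_function K (pd is f)"
  using smooth_on_pd pd_eq_0_outside[of K f] by (auto simp: test_function_def)

lemma test_function_mult:
  "test_function K f \<Longrightarrow> smooth_on UNIV g \<Longrightarrow> test_function K (\<lambda>x. g x * f x)"
  by (auto simp: test_function_def intro: smooth_on_mult)

lemma smooth_on_zero_extension:
  assumes "open \<Omega>" "smooth_on \<Omega> f" "closed K" "K \<subseteq> \<Omega>" "\<And>x. x \<in> \<Omega> \<Longrightarrow> g x = f x" "\<And>x. x \<notin> K \<Longrightarrow> g x = 0"
  shows "smooth_on UNIV g"
proof -
  have "smooth_on (\<Omega> \<union> - K) g"
  proof (rule smooth_on_Un)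
    show "smooth_on \<Omega> g" by (rule smooth_on_cong[OF assms(1) _ assms(2)]) (simp add: assms)
    show "smooth_on (- K) g" by (rule smooth_on_cong[OF _ _ smooth_on_const[of _ 0]]) (use assms in auto)
  qed
  also have "\<Omega> \<union> - K = UNIV" using assms(4) by auto
  finally show ?thesis .
qed

text \<open>Extension by zero preserves moderateness, because all derivatives of a net that vanishes off a
  compact subset of \<open>\<Omega>\<close> vanish there as well.\<close>

lemma test_netsI:
  assumes "open \<Omega>" "u \<in> EM \<Omega>" "compact K" "K \<subseteq> \<Omega>"
    and eq: "\<And>\<epsilon> x. \<epsilon> \<in> {0<..1} \<Longrightarrow> x \<in> \<Omega> \<Longrightarrow> w \<epsilon> x = u \<epsilon> x"
    and z: "\<And>\<epsilon> x. \<epsilon> \<in> {0<..1} \<Longrightarrow> x \<notin> K \<Longrightarrow> w \<epsilon> x = 0"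
  shows "w \<in> test_nets K"
proof -
  have cl: "closed K" using assms(3) by (rule compact_imp_closed)
  have "w \<in> EM UNIV"
    unfolding EM_iff[OF open_UNIV]
  proof (intro conjI ballI allI impI)
    fix \<epsilon> :: real assume e: "\<epsilon> \<in> {0<..1}"
    show "smooth_on UNIV (w \<epsilon>)"
      using e by (intro smooth_on_zero_extension[OF assms(1) EM_smooth[OF assms(2)] cl assms(4) eq z])
  next
    fix L "is" assume "compact L \<and> L \<subseteq> (UNIV :: (real^'a) set)"
    have "moderate_on (\<lambda>_. K) (\<lambda>\<epsilon> x. norm (pd is (u \<epsilon>) x))" by (rule EM_moderate_on[OF assms(2,1,3,4)])
    then have 1: "moderate_on (\<lambda>_. K) (\<lambda>\<epsilon> x. norm (pd is (w \<epsilon>) x))"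
    proof (rule moderate_on_cong[rotated])
      fix \<epsilon> :: real and x assume e: "\<epsilon> \<in> {0<..1}" "x \<in> K"
      then have "pd is (w \<epsilon>) x = pd is (u \<epsilon>) x"
        by (intro pd_cong[OF assms(1) eq]) (use assms(4) in auto)
      then show "norm (pd is (u \<epsilon>) x) = norm (pd is (w \<epsilon>) x)" by simp
    qed
    have 2: "moderate_on (\<lambda>_. - K) (\<lambda>\<epsilon> x. norm (pd is (w \<epsilon>) x))"
    proof (rule moderate_on_cong[OF _ moderate_on_const[of _ 0]])
      fix \<epsilon> :: real and x assume e: "\<epsilon> \<in> {0<..1}" "x \<in> - K"
      then show "0 = norm (pd is (w \<epsilon>) x)" using pd_eq_0_outside[OF cl z[OF e(1)]] by simp
    qed
    show "moderate_on (\<lambda>_. L) (\<lambda>\<epsilon> x. norm (pd is (w \<epsilon>) x))"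
      by (rule moderate_on_mono[OF moderate_on_Un[OF 1 2]]) auto
  qed
  with z show ?thesis by (simp add: test_nets_def)
qed

lemma test_nets_moderate_on:
  assumes "compact K" "w \<in> test_nets K"
  shows "moderate_on (\<lambda>_. UNIV) (\<lambda>\<epsilon> x. norm (pd is (w \<epsilon>) x))"
proof -
  have w: "w \<in> EM UNIV" "\<And>\<epsilon> x. \<epsilon> \<in> {0<..1} \<Longrightarrow> x \<notin> K \<Longrightarrow> w \<epsilon> x = 0"
    using assms(2) by (auto simp: test_nets_def)
  have 1: "moderate_on (\<lambda>_. K) (\<lambda>\<epsilon> x. norm (pd is (w \<epsilon>) x))"
    by (rule EM_moderate_on[OF w(1) _ assms(1)]) auto
  have 2: "moderate_on (\<lambda>_. - K) (\<lambda>\<epsilon> x. norm (pd is (w \<epsilon>) x))"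
  proof (rule moderate_on_cong[OF _ moderate_on_const[of _ 0]])
    fix \<epsilon> :: real and x assume e: "\<epsilon> \<in> {0<..1}" "x \<in> - K"
    then show "0 = norm (pd is (w \<epsilon>) x)"
      using pd_eq_0_outside[OF compact_imp_closed[OF assms(1)] w(2)[OF e(1)]] by simp
  qed
  show ?thesis using moderate_on_Un[OF 1 2] by simp
qed

section \<open>Fourier transforms of continuous functions with compact support\<close>

abbreviation wave :: "real^'n \<Rightarrow> real^'n \<Rightarrow> complex" where
  "wave \<xi> x \<equiv> exp (- (\<i> * of_real (x \<bullet> \<xi>)))"

lemma norm_wave: "norm (wave \<xi> x) = 1"
  by (simp add: norm_exp_eq_Re)

lemma continuous_wave: "continuous_on A (wave \<xi>)"
  by (intro continuous_intros)

definition supp_in :: "(real^'n) set \<Rightarrow> (real^'n \<Rightarrow> complex) \<Rightarrow> bool" where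
  "supp_in K f \<longleftrightarrow> continuous_on UNIV f \<and> (\<forall>x. x \<notin> K \<longrightarrow> f x = 0)"

lemma test_function_supp_in: "test_function K f \<Longrightarrow> supp_in K f"
  by (simp add: test_function_def supp_in_def smooth_on_continuous_on)

lemma supp_in_mult: "supp_in K f \<Longrightarrow> continuous_on UNIV g \<Longrightarrow> supp_in K (\<lambda>x. f x * g x)"
  by (auto simp: supp_in_def intro: continuous_intros)

lemma integrable_supp_in:
  assumes "compact K" "supp_in K f" shows "integrable lborel f"
proof -
  have "integrable lborel (\<lambda>x. indicator K x *\<^sub>R f x)"
    using assms by (intro borel_integrable_compact) (auto simp: supp_in_def intro: continuous_on_subset)
  also have "(\<lambda>x. indicator K x *\<^sub>R f x) = f"
    using assms(2) by (auto simp: supp_in_def indicator_def)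
  finally show ?thesis .
qed

lemma supp_in_bounded:
  assumes "compact K" "supp_in K f" obtains B where "B \<ge> 0" "\<And>x. norm (f x) \<le> B"
proof -
  have "bounded (f ` K)"
    using assms continuous_on_subset[of UNIV f K] compact_continuous_image[of K f] compact_imp_bounded
    by (auto simp: supp_in_def)
  then obtain B where B: "\<And>x. x \<in> K \<Longrightarrow> norm (f x) \<le> B" by (auto simp: bounded_iff)
  have "norm (f x) \<le> max B 0" for x
    using B[of x] assms(2) by (cases "x \<in> K") (auto simp: supp_in_def)
  then show thesis by (intro that[of "max B 0"]) auto
qed

lemma norm_integral_le_measure:
  fixes f :: "real^'n \<Rightarrow> complex"
  assumes "compact K" "\<And>x. norm (f x) \<le> B * indicator K x"
  shows "norm (\<integral>x. f x \<partial>lborel) \<le> B * measure lborel K"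
proof (cases "integrable lborel f")
  case True
  have fin: "integrable lborel (indicator K :: _ \<Rightarrow> real)"
    using assms(1) emeasure_compact_finite[OF assms(1)]
    by (intro integrable_real_indicator) (auto simp: compact_imp_closed borel_closed)
  have "norm (\<integral>x. f x \<partial>lborel) \<le> (\<integral>x. B * indicator K x \<partial>lborel)"
    using True fin assms(2) by (intro Bochner_Integration.integral_norm_bound_integral) auto
  also have "\<dots> = B * measure lborel K" by simp
  finally show ?thesis .
next
  case False
  show ?thesis
  proof (cases "K = {}")
    case True
    then have "f = (\<lambda>_. 0)" using assms(2) by (auto simp: fun_eq_iff)
    then show ?thesis using True by simp
  next
    case ne: False
    then obtain x where "x \<in> K" by blast
    then have "0 \<le> B" using order_trans[OF norm_ge_zero assms(2)[of x]] by simp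
    then show ?thesis using False by (simp add: not_integrable_integral_eq)
  qed
qed

lemma norm_fourier_le:
  assumes "compact K" "\<And>x. norm (f x) \<le> B" "\<And>x. x \<notin> K \<Longrightarrow> f x = 0"
  shows "norm (fourier f \<xi>) \<le> B * measure lborel K"
  unfolding fourier_def
proof (rule norm_integral_le_measure[OF assms(1)])
  show "norm (f x * wave \<xi> x) \<le> B * indicator K x" for x
  proof -
    have "norm (f x * wave \<xi> x) = norm (f x)" by (simp only: norm_mult norm_wave mult_1_right)
    then show ?thesis using assms(2)[of x] assms(3)[of x] by (cases "x \<in> K") simp_all
  qed
qed

lemma integrable_wave_mult:
  assumes "integrable lborel f" shows "integrable lborel (\<lambda>x. f x * wave \<xi> x)"
proof (rule Bochner_Integration.integrable_bound[OF assms])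
  have "wave \<xi> \<in> borel_measurable borel"
    by (rule borel_measurable_continuous_onI[OF continuous_wave])
  then show "(\<lambda>x. f x * wave \<xi> x) \<in> borel_measurable lborel"
    using assms by simp
qed (simp add: norm_mult norm_wave)

lemma fourier_diff:
  assumes "integrable lborel f" "integrable lborel g"
  shows "fourier f \<xi> - fourier g \<xi> = fourier (\<lambda>x. f x - g x) \<xi>"
  unfolding fourier_def left_diff_distrib
  by (rule Bochner_Integration.integral_diff[symmetric]) (intro integrable_wave_mult assms)+

subsection \<open>Exchange of differentiation and multiplication\<close>

lemma integral_translate:
  fixes f :: "real^'n \<Rightarrow> complex"
  assumes "f \<in> borel_measurable borel"
  shows "(\<integral>x. f (a + x) \<partial>lborel) = (\<integral>x. f x \<partial>lborel)"
proof -
  have "(\<integral>x. f x \<partial>lborel) = (\<integral>x. f x \<partial>(distr lborel borel ((+) a)))"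
    by (simp only: lborel_distr_plus)
  also have "\<dots> = (\<integral>x. f (a + x) \<partial>lborel)"
    using assms by (intro integral_distr) auto
  finally show ?thesis by simp
qed

text \<open>The integrals of the difference quotients vanish by translation invariance. They converge to the
integral of the derivative by dominated convergence.\<close>

lemma integral_partial_eq_0:
  fixes f :: "real^'n \<Rightarrow> complex"
  assumes K: "compact K" and f: "test_function K f"
  shows "(\<integral>x. partial i f x \<partial>lborel) = 0"
proof -
  have cl: "closed K" using K by (rule compact_imp_closed)
  have "\<exists>B. B \<ge> 0 \<and> (\<forall>x. norm (pd [j] f x) \<le> B)" for j
    by (rule supp_in_bounded[OF K test_function_supp_in[OF test_function_pd[OF cl f]], of "[j]"]) blast
  then have "\<forall>j. \<exists>B. B \<ge> 0 \<and> (\<forall>x. norm (partial j f x) \<le> B)" by simp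
  from choice[OF this] obtain Bf where Bf: "\<And>j. Bf j \<ge> 0" "\<And>j x. norm (partial j f x) \<le> Bf j" by blast
  define B where "B = Max (range Bf)"
  have B: "norm (partial j f x) \<le> B" for j x
    using Bf(2)[of j x] by (auto simp: B_def intro: order_trans Max_ge)
  have B0: "0 \<le> B" using B[of i 0] norm_ge_zero order_trans by blast
  obtain R where R: "K \<subseteq> cball 0 R"
    using compact_imp_bounded[OF K] unfolding bounded_iff by (auto simp: subset_iff)
  define s :: "nat \<Rightarrow> real^'n \<Rightarrow> complex"
    where "s n x = real (Suc n) *\<^sub>R (f (inverse (real (Suc n)) *\<^sub>R axis i 1 + x) - f x)" for n x
  have smooth: "smooth_on UNIV f" using f by (simp add: test_function_def)
  have meas: "f \<in> borel_measurable borel"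
    by (rule borel_measurable_continuous_onI[OF smooth_on_continuous_on[OF smooth]])
  have int: "integrable lborel f" by (rule integrable_supp_in[OF K test_function_supp_in[OF f]])
  have int2: "integrable lborel (\<lambda>x. f (a + x))" for a
  proof -
    have "supp_in ((\<lambda>x. x - a) ` K) (\<lambda>x. f (a + x))"
      using f smooth_on_continuous_on[OF smooth]
      by (auto simp: supp_in_def test_function_def image_iff algebra_simps intro!: continuous_on_compose2[of UNIV f] continuous_intros)
    moreover have "compact ((\<lambda>x. x - a) ` K)"
      using K by (intro compact_continuous_image continuous_intros)
    ultimately show ?thesis by (rule integrable_supp_in[rotated])
  qed
  have "(\<lambda>n. \<integral>x. s n x \<partial>lborel) \<longlonglongrightarrow> (\<integral>x. partial i f x \<partial>lborel)"
  proof (rule integral_dominated_convergence)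
    show "partial i f \<in> borel_measurable lborel"
      using borel_measurable_continuous_onI[OF smooth_on_continuous_on[OF smooth_on_partial[OF smooth]]] by simp
    show "s n \<in> borel_measurable lborel" for n
      unfolding s_def[abs_def] using meas by measurable
    show "integrable lborel (\<lambda>x::real^'n. real CARD('n) * B * indicator (cball 0 (R + 1)) x :: real)"
      using emeasure_lborel_cball_finite[of "0::real^'n" "R + 1"]
      by (intro Bochner_Integration.integrable_mult_right integrable_real_indicator) auto
    show "AE x in lborel. (\<lambda>n. s n x) \<longlonglongrightarrow> partial i f x"
    proof (rule AE_I2)
      fix x
      obtain f' where f': "(f has_derivative f') (at x)"
        using smooth_on_differentiable[OF smooth, of x] by (auto simp: differentiable_def)
      have "((\<lambda>t. f (x + t *\<^sub>R axis i 1)) has_vector_derivative f' (axis i 1)) (at 0)"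
        using has_vector_derivative_line[of f f' x 0 "axis i 1"] f' by simp
      then have that: "((\<lambda>t. f (x + t *\<^sub>R axis i 1)) has_vector_derivative partial i f x) (at 0)"
        by (simp add: partial_eq[OF f'])
      have lim: "((\<lambda>t. (f (x + t *\<^sub>R axis i 1) - f x) /\<^sub>R t) \<longlongrightarrow> partial i f x) (at 0)"
      proof -
        have "((\<lambda>h. norm (f (x + h *\<^sub>R axis i 1) - f x - h *\<^sub>R partial i f x) / norm h) \<longlongrightarrow> 0) (at 0)"
          using that unfolding has_vector_derivative_def has_derivative_at by simp
        moreover have "eventually (\<lambda>h::real. norm (f (x + h *\<^sub>R axis i 1) - f x - h *\<^sub>R partial i f x) / norm h
          = norm ((f (x + h *\<^sub>R axis i 1) - f x) /\<^sub>R h - partial i f x)) (at 0)"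
          unfolding eventually_at_filter
        proof (intro always_eventually allI impI)
          fix h :: real assume "h \<noteq> 0"
          then have "(f (x + h *\<^sub>R axis i 1) - f x) /\<^sub>R h - partial i f x
            = (f (x + h *\<^sub>R axis i 1) - f x - h *\<^sub>R partial i f x) /\<^sub>R h"
            by (simp add: scaleR_diff_right)
          then show "norm (f (x + h *\<^sub>R axis i 1) - f x - h *\<^sub>R partial i f x) / norm h
            = norm ((f (x + h *\<^sub>R axis i 1) - f x) /\<^sub>R h - partial i f x)"
            by (simp add: divide_inverse mult.commute)
        qed
        ultimately have "((\<lambda>h. norm ((f (x + h *\<^sub>R axis i 1) - f x) /\<^sub>R h - partial i f x)) \<longlongrightarrow> 0) (at 0)"
          by (rule Lim_transform_eventually)
        then show ?thesis by (simp add: tendsto_norm_zero_iff flip: Lim_null)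
      qed
      have seq: "filterlim (\<lambda>n. inverse (real (Suc n))) (at 0) sequentially"
        unfolding filterlim_at by (intro conjI LIMSEQ_inverse_real_of_nat always_eventually allI) auto
      from filterlim_compose[OF lim seq] show "(\<lambda>n. s n x) \<longlonglongrightarrow> partial i f x"
        by (simp add: s_def add.commute)
    qed
    show "AE x in lborel. norm (s n x) \<le> real CARD('n) * B * indicator (cball 0 (R + 1)) x" for n
    proof (rule AE_I2)
      fix x
      define a where "a = inverse (real (Suc n)) *\<^sub>R (axis i 1 :: real^'n)"
      have na: "norm a = inverse (real (Suc n))" by (simp add: a_def norm_axis_1)
      have na1: "norm a \<le> 1" unfolding na by (simp add: field_simps)
      show "norm (s n x) \<le> real CARD('n) * B * indicator (cball 0 (R + 1)) x"
      proof (cases "x \<in> cball 0 (R + 1)")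
        case True
        have "norm (f (a + x) - f x) \<le> real CARD('n) * B * norm (a + x - x)"
          by (rule norm_diff_le_partials[of x "norm a" UNIV])
            (auto intro: B smooth_on_differentiable[OF smooth])
        also have "\<dots> = real CARD('n) * B * inverse (real (Suc n))" by (simp add: na)
        finally have "real (Suc n) * norm (f (a + x) - f x) \<le> real (Suc n) * (real CARD('n) * B * inverse (real (Suc n)))"
          by (intro mult_left_mono) auto
        also have "\<dots> = real CARD('n) * B" by (simp del: of_nat_Suc)
        finally show ?thesis using True by (simp add: s_def a_def del: of_nat_Suc)
      next
        case False
        have "norm x \<le> norm (a + x) + norm a" using norm_triangle_ineq4[of "a + x" a] by simp
        with False na1 R have "x \<notin> K" "a + x \<notin> K" by auto
        then have "f x = 0" "f (a + x) = 0" using f by (auto simp: test_function_def)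
        then show ?thesis using False by (simp add: s_def a_def)
      qed
    qed
  qed
  moreover have "(\<integral>x. s n x \<partial>lborel) = 0" for n
    unfolding s_def using int int2 integral_translate[OF meas] by simp
  ultimately show ?thesis by (simp add: LIMSEQ_const_iff)
qed

lemma wave_has_derivative:
  "(wave \<xi> has_derivative (\<lambda>h. - (\<i> * of_real (h \<bullet> \<xi>)) * wave \<xi> x)) (at x)"
proof -
  have "((\<lambda>x. - (\<i> * complex_of_real (x \<bullet> \<xi>))) has_derivative (\<lambda>h. - (\<i> * of_real (h \<bullet> \<xi>)))) (at x)"
    by (auto intro!: derivative_eq_intros)
  from has_derivative_compose[OF this DERIV_exp[unfolded has_field_derivative_def]]
  show ?thesis by (simp add: mult.commute)
qed

lemma partial_wave: "partial i (wave \<xi>) x = - (\<i> * of_real (\<xi> $ i)) * wave \<xi> x"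
  using partial_eq[OF wave_has_derivative[of \<xi> x], of i] by (simp add: inner_axis')

lemma smooth_on_wave: "smooth_on UNIV (wave \<xi>)"
proof (rule smooth_on_closed_family[where F="range (\<lambda>c x. c * wave \<xi> x)"])
  show "wave \<xi> \<in> range (\<lambda>c x. c * wave \<xi> x)" by (auto intro!: image_eqI[of _ _ 1])
  fix g assume "g \<in> range (\<lambda>c x. c * wave \<xi> x)"
  then obtain c where g: "g = (\<lambda>x. c * wave \<xi> x)" by blast
  have d: "wave \<xi> differentiable (at x)" for x
    using wave_has_derivative by (auto simp: differentiable_def)
  show "g differentiable (at x)" for x unfolding g using d by (intro differentiable_mult) auto
  fix i
  have "partial i g x = (c * - (\<i> * of_real (\<xi> $ i))) * wave \<xi> x" for x
    unfolding g using partial_mult[of "\<lambda>_. c" x "wave \<xi>" i] d by (simp add: partial_wave mult.assoc)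
  then show "\<exists>h\<in>range (\<lambda>c x. c * wave \<xi> x). \<forall>x\<in>UNIV. partial i g x = h x" by blast
qed auto

lemma fourier_partial:
  assumes K: "compact K" and f: "test_function K f"
  shows "fourier (partial i f) \<xi> = \<i> * of_real (\<xi> $ i) * fourier f \<xi>"
proof -
  have smooth: "smooth_on UNIV f" using f by (simp add: test_function_def)
  have cl: "closed K" using K by (rule compact_imp_closed)
  have "test_function K (\<lambda>x. wave \<xi> x * f x)" by (rule test_function_mult[OF f smooth_on_wave])
  from integral_partial_eq_0[OF K this, of i]
  have "0 = (\<integral>x. partial i (\<lambda>x. wave \<xi> x * f x) x \<partial>lborel)" by simp
  also have "\<dots> = (\<integral>x. partial i f x * wave \<xi> x - \<i> * of_real (\<xi> $ i) * (f x * wave \<xi> x) \<partial>lborel)"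
  proof (rule Bochner_Integration.integral_cong[OF refl])
    fix x
    show "partial i (\<lambda>x. wave \<xi> x * f x) x = partial i f x * wave \<xi> x - \<i> * of_real (\<xi> $ i) * (f x * wave \<xi> x)"
      unfolding partial_mult[OF smooth_on_differentiable[OF smooth_on_wave UNIV_I] smooth_on_differentiable[OF smooth UNIV_I]] partial_wave
      by (simp add: algebra_simps)
  qed
  also have "\<dots> = fourier (partial i f) \<xi> - \<i> * of_real (\<xi> $ i) * fourier f \<xi>"
    unfolding fourier_def
    using integrable_supp_in[OF K test_function_supp_in[OF test_function_pd[OF cl f, of "[i]"]]]
      integrable_supp_in[OF K test_function_supp_in[OF f]]
    by (subst Bochner_Integration.integral_diff) (auto intro!: integrable_wave_mult integrable_mult_right)
  finally show ?thesis by simp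
qed

lemma norm_fourier_pd:
  assumes K: "compact K" and f: "test_function K f"
  shows "norm (fourier (pd is f) \<xi>) = (\<Prod>j\<leftarrow>is. \<bar>\<xi> $ j\<bar>) * norm (fourier f \<xi>)"
proof (induction "is")
  case (Cons i "is")
  have "test_function K (pd is f)" by (rule test_function_pd[OF compact_imp_closed[OF K] f])
  from fourier_partial[OF K this, of i \<xi>] Cons show ?case by (simp add: norm_mult mult.assoc)
qed simp

lemma norm_power_le_sum:
  fixes x :: "real^'n"
  shows "norm x ^ m \<le> real CARD('n) ^ m * (\<Sum>j\<in>UNIV. \<bar>x $ j\<bar> ^ m)"
proof -
  define M where "M = Max (range (\<lambda>j. \<bar>x $ j\<bar>))"
  have "M \<in> range (\<lambda>j. \<bar>x $ j\<bar>)" unfolding M_def by (rule Max_in) auto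
  then obtain j where j: "M = \<bar>x $ j\<bar>" by blast
  have "norm x \<le> (\<Sum>j\<in>UNIV. \<bar>x $ j\<bar>)" by (rule norm_le_l1_cart)
  also have "\<dots> \<le> (\<Sum>j::'n\<in>UNIV. M)" by (intro sum_mono) (auto simp: M_def)
  finally have "norm x \<le> real CARD('n) * \<bar>x $ j\<bar>" by (simp add: j)
  then have "norm x ^ m \<le> (real CARD('n) * \<bar>x $ j\<bar>) ^ m" by (intro power_mono) auto
  also have "\<dots> \<le> real CARD('n) ^ m * (\<Sum>j\<in>UNIV. \<bar>x $ j\<bar> ^ m)"
    unfolding power_mult_distrib by (intro mult_left_mono member_le_sum) auto
  finally show ?thesis .
qed

text \<open>Integrate by parts \<open>m\<close> times in the direction of each coordinate.\<close>

lemma fourier_decay: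
  fixes f :: "real^'n \<Rightarrow> complex"
  assumes K: "compact K" and f: "test_function K f"
    and B: "\<And>j x. norm (pd (replicate m j) f x) \<le> B"
  shows "norm \<xi> ^ m * norm (fourier f \<xi>) \<le> real CARD('n) ^ (m + 1) * B * measure lborel K"
proof -
  have "norm \<xi> ^ m * norm (fourier f \<xi>)
      \<le> (real CARD('n) ^ m * (\<Sum>j\<in>UNIV. \<bar>\<xi> $ j\<bar> ^ m)) * norm (fourier f \<xi>)"
    by (intro mult_right_mono norm_power_le_sum) auto
  also have "\<dots> = real CARD('n) ^ m * (\<Sum>j\<in>UNIV. norm (fourier (pd (replicate m j) f) \<xi>))"
    unfolding norm_fourier_pd[OF K f] by (simp add: sum_distrib_right mult.assoc)
  also have "\<dots> \<le> real CARD('n) ^ m * (\<Sum>j::'n\<in>UNIV. B * measure lborel K)"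
  proof (intro mult_left_mono sum_mono)
    fix j
    show "norm (fourier (pd (replicate m j) f) \<xi>) \<le> B * measure lborel K"
      using test_function_pd[OF compact_imp_closed[OF K] f, of "replicate m j"]
      by (intro norm_fourier_le[OF K B]) (auto simp: test_function_def)
  qed auto
  finally show ?thesis by (simp add: mult_ac)
qed

subsection \<open>Smoothness of the Fourier transform\<close>

lemma norm_iexp_remainder: "norm (exp (- (\<i> * of_real a)) - 1 + \<i> * of_real a) \<le> \<bar>a\<bar>^2"
proof -
  have "norm (exp (- (\<i> * of_real a)) - 1 + \<i> * of_real a) \<le> \<bar>- a\<bar>^2 / 2"
    using iexp_approx1[of "- a" 1] by (simp add: algebra_simps power2_eq_square)
  also have "\<dots> \<le> \<bar>a\<bar>^2" by simp
  finally show ?thesis .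
qed

text \<open>Differentiation under the integral sign: on the compact support the second order remainder of the
exponential is bounded by a multiple of \<open>|h|\<^sup>2\<close>.\<close>

lemma fourier_has_derivative:
  fixes f :: "real^'n \<Rightarrow> complex"
  assumes K: "compact K" and f: "supp_in K f"
  shows "(fourier f has_derivative (\<lambda>h. \<Sum>j\<in>UNIV. (h $ j) *\<^sub>R fourier (\<lambda>x. f x * - (\<i> * of_real (x $ j))) \<xi>)) (at \<xi>)"
proof -
  obtain B where B: "B \<ge> 0" "\<And>x. norm (f x) \<le> B" using supp_in_bounded[OF K f] by blast
  obtain R where R: "R > 0" "\<And>x. x \<in> K \<Longrightarrow> norm x \<le> R"
    using compact_imp_bounded[OF K] by (auto simp: bounded_pos)
  define C where "C = B * R^2 * measure lborel K"
  define L where "L h = (\<Sum>j\<in>UNIV. (h $ j) *\<^sub>R fourier (\<lambda>x. f x * - (\<i> * of_real (x $ j))) \<xi>)" for h :: "real^'n"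
  have supp: "supp_in K (\<lambda>x. f x * - (\<i> * of_real (x $ j)))" for j
    by (intro supp_in_mult[OF f] continuous_intros)
  have int: "integrable lborel f" "integrable lborel (\<lambda>x. f x * - (\<i> * of_real (x $ j)))" for j
    using integrable_supp_in[OF K f] integrable_supp_in[OF K supp] by auto
  have L: "L h = (\<integral>x. f x * (- (\<i> * of_real (x \<bullet> h))) * wave \<xi> x \<partial>lborel)" for h
  proof -
    have "L h = (\<Sum>j\<in>UNIV. (\<integral>x. (h $ j) *\<^sub>R (f x * - (\<i> * of_real (x $ j)) * wave \<xi> x) \<partial>lborel))"
      by (simp add: L_def fourier_def)
    also have "\<dots> = (\<integral>x. (\<Sum>j\<in>UNIV. (h $ j) *\<^sub>R (f x * - (\<i> * of_real (x $ j)) * wave \<xi> x)) \<partial>lborel)"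
      by (rule Bochner_Integration.integral_sum[symmetric])
        (intro integrable_scaleR_right integrable_wave_mult int)
    also have "\<dots> = (\<integral>x. f x * (- (\<i> * of_real (x \<bullet> h))) * wave \<xi> x \<partial>lborel)"
    proof (rule Bochner_Integration.integral_cong[OF refl])
      fix x
      have "complex_of_real (x \<bullet> h) = (\<Sum>j\<in>UNIV. of_real (h $ j) * of_real (x $ j))"
        by (simp add: inner_vec_def mult.commute)
      then show "(\<Sum>j\<in>UNIV. (h $ j) *\<^sub>R (f x * - (\<i> * of_real (x $ j)) * wave \<xi> x)) = f x * (- (\<i> * of_real (x \<bullet> h))) * wave \<xi> x"
        by (simp add: scaleR_conv_of_real sum_distrib_left sum_distrib_right sum_negf mult_ac)
    qed
    finally show ?thesis .
  qed
  have "(fourier f has_derivative L) (at \<xi>)"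
  proof (rule has_derivativeI_sandwich[of 1])
    show "bounded_linear L"
      unfolding L_def by (intro bounded_linear_sum bounded_linear_scaleR_const bounded_linear_vec_nth)
    show "((\<lambda>\<eta>. C * norm (\<eta> - \<xi>)) \<longlongrightarrow> 0) (at \<xi>)"
      by (auto intro!: tendsto_eq_intros)
    fix \<eta> assume ne: "\<eta> \<noteq> \<xi>"
    define h where "h = \<eta> - \<xi>"
    have Lint: "integrable lborel (\<lambda>x. f x * (- (\<i> * of_real (x \<bullet> h))) * wave \<xi> x)"
      by (intro integrable_wave_mult integrable_supp_in[OF K] supp_in_mult[OF f] continuous_intros)
    have "fourier f \<eta> - fourier f \<xi> - L h
      = (\<integral>x. (f x * wave \<eta> x - f x * wave \<xi> x) - f x * (- (\<i> * of_real (x \<bullet> h))) * wave \<xi> x \<partial>lborel)"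
      unfolding L fourier_def using integrable_wave_mult[OF int(1)] Lint by simp
    also have "\<dots> = (\<integral>x. f x * wave \<xi> x * (exp (- (\<i> * of_real (x \<bullet> h))) - 1 + \<i> * of_real (x \<bullet> h)) \<partial>lborel)"
    proof (rule Bochner_Integration.integral_cong[OF refl])
      fix x
      have "wave \<eta> x = wave \<xi> x * exp (- (\<i> * of_real (x \<bullet> h)))"
        by (simp add: h_def inner_diff_right algebra_simps flip: exp_add)
      then show "(f x * wave \<eta> x - f x * wave \<xi> x) - f x * (- (\<i> * of_real (x \<bullet> h))) * wave \<xi> x
        = f x * wave \<xi> x * (exp (- (\<i> * of_real (x \<bullet> h))) - 1 + \<i> * of_real (x \<bullet> h))"
        by (simp add: algebra_simps)
    qed
    also have "norm \<dots> \<le> (B * (R * norm h)^2) * measure lborel K"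
    proof (rule norm_integral_le_measure[OF K])
      fix x
      show "norm (f x * wave \<xi> x * (exp (- (\<i> * of_real (x \<bullet> h))) - 1 + \<i> * of_real (x \<bullet> h)))
        \<le> B * (R * norm h)^2 * indicator K x"
      proof (cases "x \<in> K")
        case True
        have "\<bar>x \<bullet> h\<bar> \<le> R * norm h"
          using Cauchy_Schwarz_ineq2[of x h] R(2)[OF True] by (meson mult_right_mono norm_ge_zero order_trans)
        then have "\<bar>x \<bullet> h\<bar>^2 \<le> (R * norm h)^2" by (intro power_mono) auto
        then have "norm (exp (- (\<i> * of_real (x \<bullet> h))) - 1 + \<i> * of_real (x \<bullet> h)) \<le> (R * norm h)^2"
          using norm_iexp_remainder order_trans by blast
        then show ?thesis
          using True B unfolding norm_mult norm_wave by (auto intro!: mult_mono)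
      next
        case False then show ?thesis using f by (simp add: supp_in_def)
      qed
    qed
    finally have "norm (fourier f \<eta> - fourier f \<xi> - L h) \<le> C * norm h * norm h"
      by (simp add: C_def power_mult_distrib power2_eq_square mult_ac)
    then show "norm (fourier f \<eta> - fourier f \<xi> - L (\<eta> - \<xi>)) / norm (\<eta> - \<xi>) \<le> C * norm (\<eta> - \<xi>)"
      using ne by (simp add: h_def field_simps)
  qed simp
  then show ?thesis by (simp add: L_def[abs_def])
qed

lemma partial_fourier:
  assumes "compact K" "supp_in K f"
  shows "partial i (fourier f) \<xi> = fourier (\<lambda>x. f x * - (\<i> * of_real (x $ i))) \<xi>"
proof -
  have "(\<Sum>j\<in>UNIV. (axis i 1 $ j) *\<^sub>R fourier (\<lambda>x. f x * - (\<i> * of_real (x $ j))) \<xi>)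
     = fourier (\<lambda>x. f x * - (\<i> * of_real (x $ i))) \<xi>"
    by (subst sum.remove[of _ i]) (auto intro!: sum.neutral simp: axis_def)
  then show ?thesis using partial_eq[OF fourier_has_derivative[OF assms]] by simp
qed

text \<open>The factors that derivatives of a Fourier transform produce under the integral.\<close>

definition coord_prod :: "'n list \<Rightarrow> real^'n \<Rightarrow> complex" where
  "coord_prod is x = (\<Prod>j\<leftarrow>is. - (\<i> * of_real (x $ j)))"

lemma continuous_coord_prod: "continuous_on A (coord_prod is)"
proof (induction "is")
  case (Cons i "is")
  then have "continuous_on A (\<lambda>x. - (\<i> * of_real (x $ i)) * coord_prod is x)"
    by (intro continuous_intros)
  then show ?case by (simp add: coord_prod_def)
qed (simp add: coord_prod_def)

lemma pd_fourier:
  assumes "compact K" "supp_in K f"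
  shows "pd is (fourier f) = fourier (\<lambda>x. f x * coord_prod is x)"
proof (induction "is")
  case (Cons i "is")
  have "pd (i # is) (fourier f) = partial i (fourier (\<lambda>x. f x * coord_prod is x))" using Cons by simp
  also have "\<dots> = fourier (\<lambda>x. (f x * coord_prod is x) * - (\<i> * of_real (x $ i)))"
    by (rule ext) (rule partial_fourier[OF assms(1) supp_in_mult[OF assms(2) continuous_coord_prod]])
  also have "\<dots> = fourier (\<lambda>x. f x * coord_prod (i # is) x)"
    by (simp add: coord_prod_def mult_ac)
  finally show ?case .
qed (simp add: coord_prod_def)

lemma smooth_on_fourier:
  assumes "compact K" "supp_in K f" shows "smooth_on UNIV (fourier f)"
  unfolding smooth_on_def pd_fourier[OF assms]
  using fourier_has_derivative[OF assms(1) supp_in_mult[OF assms(2) continuous_coord_prod]]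
  by (auto simp: differentiable_def)

subsection \<open>Integrable weights and Gaussians\<close>

text \<open>Lebesgue measure on \<open>\<real>\<^sup>d\<close> is the image of a product measure indexed by the standard basis; this is
Fubini's theorem for functions with separated variables.\<close>

lemma product_lborel:
  fixes g :: "'n::finite \<Rightarrow> real \<Rightarrow> 'b::{real_normed_field, banach, second_countable_topology}"
  assumes "\<And>j. integrable lborel (g j)"
  shows "integrable lborel (\<lambda>x::real^'n. \<Prod>j\<in>UNIV. g j (x $ j))" (is ?int)
    and "(\<integral>x. (\<Prod>j\<in>UNIV. g j (x $ j)) \<partial>(lborel :: (real^'n) measure)) = (\<Prod>j\<in>UNIV. \<integral>s. g j s \<partial>lborel)" (is ?eq)
proof -
  interpret product_sigma_finite "\<lambda>_::real^'n. lborel :: real measure" by standard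
  define ax where "ax = (\<lambda>j::'n. axis j (1::real))"
  have inj: "inj ax" by (auto simp: ax_def inj_on_def axis_eq_axis)
  have Basis: "Basis = range ax" by (auto simp: ax_def Basis_vec_def)
  define G where "G b = g (the_inv ax b)" for b
  have G: "G (ax j) = g j" for j by (simp add: G_def the_inv_f_f[OF inj])
  have comp: "(\<Sum>b\<in>Basis. f b *\<^sub>R b) $ j = f (ax j)" for f :: "real^'n \<Rightarrow> real" and j
  proof -
    have "ax j \<in> Basis" unfolding Basis by blast
    then have "(\<Sum>b\<in>Basis. f b *\<^sub>R b) \<bullet> ax j = f (ax j)" by (rule inner_sum_left_Basis)
    then show ?thesis by (simp add: ax_def inner_axis)
  qed
  have eq: "(\<Prod>j\<in>UNIV. g j ((\<Sum>b\<in>Basis. f b *\<^sub>R b) $ j)) = (\<Prod>b\<in>Basis. G b (f b))" for f :: "real^'n \<Rightarrow> real"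
    unfolding comp unfolding Basis by (simp add: prod.reindex[OF inj] G)
  have intG: "integrable lborel (G b)" if "b \<in> Basis" for b
    using that assms G by (auto simp: Basis)
  have meas: "(\<lambda>x::real^'n. \<Prod>j\<in>UNIV. g j (x $ j)) \<in> borel_measurable borel"
  proof (rule borel_measurable_prod)
    fix j
    have "g j \<in> borel_measurable borel" using borel_measurable_integrable[OF assms[of j]] by simp
    moreover have "(\<lambda>x::real^'n. x $ j) \<in> borel_measurable borel"
      by (intro borel_measurable_continuous_onI continuous_intros)
    ultimately show "(\<lambda>x::real^'n. g j (x $ j)) \<in> borel_measurable borel" by measurable
  qed
  have m: "(\<lambda>f. \<Sum>b\<in>Basis. f b *\<^sub>R b) \<in> measurable (Pi\<^sub>M Basis (\<lambda>_. lborel)) (borel :: (real^'n) measure)"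
    by measurable
  show ?int
    unfolding lborel_eq[where 'a="real^'n"]
    using product_integrable_prod[of Basis G, OF finite_Basis intG]
    by (subst integrable_distr_eq[OF m meas]) (simp only: eq)
  have "(\<integral>x. (\<Prod>j\<in>UNIV. g j (x $ j)) \<partial>(lborel :: (real^'n) measure))
    = (\<integral>f. (\<Prod>b\<in>Basis. G b (f b)) \<partial>Pi\<^sub>M Basis (\<lambda>_::real^'n. lborel))"
    unfolding lborel_eq[where 'a="real^'n"] by (subst integral_distr[OF m meas]) (simp only: eq)
  also have "\<dots> = (\<Prod>b\<in>Basis. \<integral>s. G b s \<partial>lborel)"
    by (rule product_integral_prod[OF finite_Basis intG])
  also have "\<dots> = (\<Prod>j\<in>UNIV. \<integral>s. g j s \<partial>lborel)"
    unfolding Basis by (simp add: prod.reindex[OF inj] G)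
  finally show ?eq .
qed

text \<open>A rotation invariant polynomial with integrable reciprocal; the exponent is chosen for a direct
comparison with \<open>\<Prod>\<^sub>j (1 + x\<^sub>j\<^sup>2)\<close>.\<close>

definition weight :: "real^'n \<Rightarrow> real" where
  "weight x = (1 + norm x ^ 2) ^ CARD('n)"

lemma weight_ge_1: "1 \<le> weight x"
  by (simp add: weight_def)

lemma weight_pos: "0 < weight x"
  using weight_ge_1[of x] by linarith

lemma continuous_weight: "continuous_on A weight"
  unfolding weight_def by (intro continuous_intros)

lemma integrable_inverse_weight: "integrable lborel (\<lambda>x::real^'n. inverse (weight x))"
proof (rule Bochner_Integration.integrable_bound)
  have "integrable lborel (\<lambda>s::real. inverse (1 + s^2))"
    using integrable_inverse_1_plus_square by (simp add: set_integrable_def)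
  then show "integrable lborel (\<lambda>x::real^'n. \<Prod>j\<in>UNIV. inverse (1 + (x $ j)^2))"
    by (intro product_lborel(1)[of "\<lambda>_ s. inverse (1 + s^2)"])
  have "continuous_on UNIV (\<lambda>x::real^'n. inverse (weight x))"
    using weight_pos by (intro continuous_intros continuous_weight) (simp add: less_imp_neq[OF weight_pos, symmetric])
  then show "(\<lambda>x::real^'n. inverse (weight x)) \<in> borel_measurable lborel"
    using borel_measurable_continuous_onI by simp
  show "AE x::real^'n in lborel. norm (inverse (weight x)) \<le> norm (\<Prod>j\<in>UNIV. inverse (1 + (x $ j)^2))"
  proof (rule AE_I2)
    fix x :: "real^'n"
    have pos: "0 < (\<Prod>j\<in>UNIV. (1 + (x $ j)^2))" by (intro prod_pos) (auto simp: add_pos_nonneg)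
    have "(\<Prod>j\<in>UNIV. (1 + (x $ j)^2)) \<le> (\<Prod>j::'n\<in>UNIV. 1 + norm x ^ 2)"
      using component_le_norm_cart[of x] by (intro prod_mono) (auto simp: power2_le_iff_abs_le)
    then have "(\<Prod>j\<in>UNIV. (1 + (x $ j)^2)) \<le> weight x" by (simp add: weight_def)
    with pos have "inverse (weight x) \<le> inverse (\<Prod>j\<in>UNIV. (1 + (x $ j)^2))"
      by (intro le_imp_inverse_le)
    also have "\<dots> = (\<Prod>j\<in>UNIV. inverse (1 + (x $ j)^2))" by (simp add: prod_inversef[symmetric] o_def)
    finally show "norm (inverse (weight x)) \<le> norm (\<Prod>j\<in>UNIV. inverse (1 + (x $ j)^2))"
      using weight_pos[of x] by simp
  qed
qed

lemma weight_le: "weight (x :: real^'n) \<le> 2 ^ CARD('n) * (1 + norm x ^ (2 * CARD('n)))"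
proof (cases "norm x \<le> 1")
  case True
  then have "1 + norm x ^ 2 \<le> 2" by (simp add: power_le_one)
  then have "weight x \<le> 2 ^ CARD('n)" unfolding weight_def by (intro power_mono) auto
  also have "\<dots> \<le> 2 ^ CARD('n) * (1 + norm x ^ (2 * CARD('n)))" by simp
  finally show ?thesis .
next
  case False
  then have "1 + norm x ^ 2 \<le> 2 * norm x ^ 2" by (simp add: one_le_power)
  then have "weight x \<le> (2 * norm x ^ 2) ^ CARD('n)" unfolding weight_def by (intro power_mono) auto
  also have "\<dots> \<le> 2 ^ CARD('n) * (1 + norm x ^ (2 * CARD('n)))"
    by (simp add: power_mult_distrib power_mult)
  finally show ?thesis .
qed

lemma integrable_if_weighted_bound:
  fixes f :: "real^'n \<Rightarrow> complex"
  assumes "f \<in> borel_measurable borel" "\<And>x. weight x * norm (f x) \<le> C"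
  shows "integrable lborel f" "norm (\<integral>x. f x \<partial>lborel) \<le> C * (\<integral>x. inverse (weight x) \<partial>(lborel :: (real^'n) measure))"
    "(\<integral>x. norm (f x) \<partial>lborel) \<le> C * (\<integral>x. inverse (weight x) \<partial>(lborel :: (real^'n) measure))"
proof -
  have b: "norm (f x) \<le> C * inverse (weight x)" for x
    using assms(2)[of x] weight_pos[of x] by (simp add: field_simps)
  have i: "integrable lborel (\<lambda>x::real^'n. C * inverse (weight x))"
    by (intro Bochner_Integration.integrable_mult_right integrable_inverse_weight)
  show int: "integrable lborel f"
    by (rule Bochner_Integration.integrable_bound[OF i]) (use assms(1) b in \<open>auto intro: order_trans[OF b] abs_ge_self\<close>)
  show "norm (\<integral>x. f x \<partial>lborel) \<le> C * (\<integral>x. inverse (weight x) \<partial>(lborel :: (real^'n) measure))"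
    using Bochner_Integration.integral_norm_bound_integral[OF int i b] by simp
  show "(\<integral>x. norm (f x) \<partial>lborel) \<le> C * (\<integral>x. inverse (weight x) \<partial>(lborel :: (real^'n) measure))"
    using integral_mono[OF integrable_norm[OF int] i b] by simp
qed

definition gaussian :: "real^'n \<Rightarrow> complex" where
  "gaussian x = of_real (\<Prod>j\<in>UNIV. std_normal_density (x $ j))"

lemma gaussian_continuous: "continuous_on A gaussian"
  unfolding gaussian_def std_normal_density_def by (intro continuous_intros) auto

lemma gaussian_eq: "gaussian (x::real^'n) = of_real ((1 / sqrt (2 * pi)) ^ CARD('n) * exp (- (norm x ^ 2) / 2))"
proof -
  have "norm x ^ 2 = (\<Sum>j\<in>UNIV. (x $ j)^2)"
    by (simp add: norm_vec_def L2_set_def sum_nonneg)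
  then have "exp (- (norm x ^ 2) / 2) = (\<Prod>j\<in>UNIV. exp (- (x $ j)\<^sup>2 / 2))"
    by (simp add: exp_sum sum_negf sum_divide_distrib flip: exp_sum)
  then have "(\<Prod>j\<in>UNIV. std_normal_density (x $ j)) = (1 / sqrt (2 * pi)) ^ CARD('n) * exp (- (norm x ^ 2) / 2)"
    unfolding std_normal_density_def by (simp only: prod.distrib prod_constant)
  then show ?thesis by (simp only: gaussian_def)
qed

lemma integrable_gaussian: "integrable lborel gaussian"
proof -
  have "integrable lborel (\<lambda>x::real^'a. \<Prod>j\<in>UNIV. std_normal_density (x $ j))"
    by (intro product_lborel(1)) auto
  then show ?thesis unfolding gaussian_def by (rule integrable_of_real)
qed

lemma integral_gaussian: "(\<integral>x. gaussian x \<partial>lborel) = 1"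
proof -
  have "(\<integral>x. (\<Prod>j\<in>UNIV. std_normal_density (x $ j)) \<partial>(lborel :: (real^'a) measure)) = (\<Prod>j::'a\<in>UNIV. 1)"
    by (subst product_lborel(2)) auto
  then show ?thesis unfolding gaussian_def by (simp flip: of_real_prod)
qed

text \<open>The one-dimensional case is the characteristic function of the normal distribution.\<close>

lemma fourier_gaussian: "fourier gaussian (z::real^'n) = of_real (sqrt (2 * pi) ^ CARD('n)) * gaussian z"
proof -
  define g where "g j s = of_real (std_normal_density s) * exp (\<i> * of_real (- (z $ j) * s))" for j s
  have int: "integrable lborel (g j)" for j
  proof (rule Bochner_Integration.integrable_bound[of _ std_normal_density])
    show "g j \<in> borel_measurable lborel"
    proof -
      have "continuous_on UNIV (g j)"
        unfolding g_def std_normal_density_def by (intro continuous_intros) auto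
      then show ?thesis by (simp add: borel_measurable_continuous_onI)
    qed
  qed (auto simp: g_def norm_mult norm_exp_eq_Re normal_density_nonneg)
  have "(\<integral>s. g j s \<partial>lborel) = char std_normal_distribution (- (z $ j))" for j
    unfolding char_def g_def
    by (subst integral_density) (auto simp: normal_density_nonneg scaleR_conv_of_real)
  then have int1: "(\<integral>s. g j s \<partial>lborel) = of_real (exp (- ((z $ j)\<^sup>2) / 2))" for j
    by (simp add: char_std_normal_distribution)
  have "gaussian x * wave z x = (\<Prod>j\<in>UNIV. g j (x $ j))" for x
    by (simp add: gaussian_def g_def prod.distrib inner_vec_def exp_sum[symmetric] sum_negf sum_distrib_left mult_ac)
  then have "fourier gaussian z = (\<integral>x. (\<Prod>j\<in>UNIV. g j (x $ j)) \<partial>lborel)"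
    by (simp add: fourier_def)
  also have "\<dots> = (\<Prod>j\<in>UNIV. complex_of_real (exp (- ((z $ j)\<^sup>2) / 2)))"
    using product_lborel(2)[of g, OF int] int1 by simp
  also have "\<dots> = of_real (sqrt (2 * pi) ^ CARD('n)) * gaussian z"
  proof -
    have "exp (- (s^2) / 2) = sqrt (2 * pi) * std_normal_density s" for s :: real
      by (simp add: std_normal_density_def)
    then show ?thesis by (simp add: gaussian_def prod.distrib)
  qed
  finally show ?thesis .
qed

lemma integral_scale:
  fixes g :: "real^'n \<Rightarrow> complex"
  assumes "t > 0" "g \<in> borel_measurable borel"
  shows "(\<integral>x. g x \<partial>lborel) = of_real (t ^ CARD('n)) * (\<integral>x. g (a + t *\<^sub>R x) \<partial>lborel)"
proof -
  have "(\<integral>x. g x \<partial>lborel) = (\<integral>x. g x \<partial>(density (distr lborel borel (\<lambda>x. a + t *\<^sub>R x)) (\<lambda>_. ennreal (\<bar>t\<bar> ^ CARD('n)))))"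
    using lborel_affine[of t a] assms(1) by (simp add: ennreal_power)
  also have "\<dots> = (\<integral>x. (\<bar>t\<bar> ^ CARD('n)) *\<^sub>R g x \<partial>distr lborel borel (\<lambda>x. a + t *\<^sub>R x))"
    using assms by (intro integral_density) auto
  also have "\<dots> = (\<integral>x. (\<bar>t\<bar> ^ CARD('n)) *\<^sub>R g (a + t *\<^sub>R x) \<partial>lborel)"
    using assms by (intro integral_distr) auto
  finally show ?thesis using assms(1) by (simp add: scaleR_conv_of_real)
qed

section \<open>Fourier inversion and the transform of a product\<close>

lemma integrable_pair_mult:
  fixes F G :: "real^'n \<Rightarrow> complex" and E :: "real^'n \<Rightarrow> real^'n \<Rightarrow> complex"
  assumes F: "integrable lborel F" and G: "integrable lborel G"
    and E: "continuous_on UNIV (\<lambda>(x, y). E x y)" "\<And>x y. norm (E x y) = 1"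
  shows "integrable (lborel \<Otimes>\<^sub>M lborel) (\<lambda>(x, y). F x * G y * E x y)"
proof -
  have FG[measurable]: "F \<in> borel_measurable borel" "G \<in> borel_measurable borel"
    using borel_measurable_integrable[OF F] borel_measurable_integrable[OF G] by auto
  have Em: "(\<lambda>(x, y). E x y) \<in> borel_measurable (lborel \<Otimes>\<^sub>M lborel)"
    using borel_measurable_continuous_onI[OF E(1)] by (simp add: lborel_prod)
  have "(\<lambda>p. F (fst p) * G (snd p) * (\<lambda>(x, y). E x y) p) \<in> borel_measurable (lborel \<Otimes>\<^sub>M lborel)"
    by (intro borel_measurable_times Em) measurable
  then have meas: "(\<lambda>(x, y). F x * G y * E x y) \<in> borel_measurable (lborel \<Otimes>\<^sub>M lborel)"
    by (simp add: case_prod_beta')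
  show ?thesis
  proof (rule lborel_pair.Fubini_integrable[OF meas])
    have "(\<lambda>x. \<integral>y. norm ((\<lambda>(x, y). F x * G y * E x y) (x, y)) \<partial>lborel) = (\<lambda>x. norm (F x) * (\<integral>y. norm (G y) \<partial>lborel))"
      by (simp add: norm_mult E(2))
    then show "integrable lborel (\<lambda>x. \<integral>y. norm ((\<lambda>(x, y). F x * G y * E x y) (x, y)) \<partial>lborel)"
      using F by simp
    show "AE x in lborel. integrable lborel (\<lambda>y. (\<lambda>(x, y). F x * G y * E x y) (x, y))"
    proof (rule AE_I2)
      fix x
      have "continuous_on UNIV (\<lambda>y. (\<lambda>(x, y). E x y) (x, y))"
        by (rule continuous_on_compose2[OF E(1)]) (auto intro: continuous_intros)
      then have "E x \<in> borel_measurable borel" by (simp add: borel_measurable_continuous_onI)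
      then have "integrable lborel (\<lambda>y. G y * E x y)"
        by (intro Bochner_Integration.integrable_bound[OF G]) (auto simp: norm_mult E(2))
      then show "integrable lborel (\<lambda>y. (\<lambda>(x, y). F x * G y * E x y) (x, y))"
        by (simp add: mult.assoc)
    qed
  qed
qed

lemma Fubini_mult:
  fixes F G :: "real^'n \<Rightarrow> complex" and E :: "real^'n \<Rightarrow> real^'n \<Rightarrow> complex"
  assumes "integrable lborel F" "integrable lborel G"
    and "continuous_on UNIV (\<lambda>(x, y). E x y)" "\<And>x y. norm (E x y) = 1"
  shows "(\<integral>y. G y * (\<integral>x. F x * E x y \<partial>lborel) \<partial>lborel) = (\<integral>x. F x * (\<integral>y. G y * E x y \<partial>lborel) \<partial>lborel)"
  using lborel_pair.Fubini_integral[OF integrable_pair_mult[OF assms]]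
  by (simp add: mult_ac) (simp add: mult.left_commute[of "F _"] mult.assoc flip: integral_mult_right_zero)

lemma fourier_power_bound:
  assumes "compact K" "test_function K f" shows "\<exists>C. \<forall>\<xi>. norm \<xi> ^ m * norm (fourier f \<xi>) \<le> C"
proof -
  have "\<exists>B. B \<ge> 0 \<and> (\<forall>x. norm (pd (replicate m j) f x) \<le> B)" for j
    by (rule supp_in_bounded[OF assms(1) test_function_supp_in[OF test_function_pd[OF compact_imp_closed[OF assms(1)] assms(2)]], of "replicate m j"]) blast
  then have "\<forall>j. \<exists>B. B \<ge> 0 \<and> (\<forall>x. norm (pd (replicate m j) f x) \<le> B)" by (rule allI)
  from choice[OF this] obtain B where B: "\<And>j x. norm (pd (replicate m j) f x) \<le> B j" by blast
  have "norm (pd (replicate m j) f x) \<le> Max (range B)" for j x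
    using B[of j x] by (rule order_trans) auto
  from fourier_decay[OF assms this] show ?thesis by blast
qed

lemma weight_mult_le:
  "weight (\<xi> :: real^'n) * c \<le> 2 ^ CARD('n) * (c + norm \<xi> ^ (2 * CARD('n)) * c)" if "c \<ge> 0"
  using mult_right_mono[OF weight_le that, of \<xi>] by (simp add: algebra_simps)

lemma fourier_weighted_bound:
  fixes f :: "real^'n \<Rightarrow> complex"
  assumes "compact K" "test_function K f" shows "\<exists>C. \<forall>\<xi>. weight \<xi> * norm (fourier f \<xi>) \<le> C"
proof -
  from fourier_power_bound[OF assms, of 0] fourier_power_bound[OF assms, of "2 * CARD('n)"] obtain C0 C1 where
    C: "\<And>\<xi>. norm (fourier f \<xi>) \<le> C0" "\<And>\<xi>. norm \<xi> ^ (2 * CARD('n)) * norm (fourier f \<xi>) \<le> C1" by auto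
  have "weight \<xi> * norm (fourier f \<xi>) \<le> 2 ^ CARD('n) * (C0 + C1)" for \<xi>
    by (rule order_trans[OF weight_mult_le]) (auto intro!: mult_left_mono add_mono C)
  then show ?thesis by blast
qed

lemma fourier_measurable: "compact K \<Longrightarrow> supp_in K f \<Longrightarrow> fourier f \<in> borel_measurable borel"
  by (rule borel_measurable_continuous_onI[OF smooth_on_continuous_on[OF smooth_on_fourier]])

lemma integrable_fourier:
  assumes "compact K" "test_function K f" shows "integrable lborel (fourier f)"
  using fourier_weighted_bound[OF assms] fourier_measurable[OF assms(1) test_function_supp_in[OF assms(2)]]
    integrable_if_weighted_bound(1) by blast

definition fourier_const :: "'n itself \<Rightarrow> real" where
  "fourier_const _ = (1 / (2 * pi)) ^ CARD('n)"

lemma fourier_const_nonneg: "0 \<le> fourier_const T"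
  by (simp add: fourier_const_def)

text \<open>Insert the Gaussian factor \<open>\<gamma>(t \<xi>)\<close> into the integral. Fubini's theorem turns the result into the average
of \<open>f (x + t z)\<close> with respect to the transform of \<open>\<gamma>\<close>, again a Gaussian. Now let \<open>t\<close> tend to zero on both
sides.\<close>

lemma fourier_inversion:
  fixes f :: "real^'n \<Rightarrow> complex"
  assumes K: "compact K" and f: "test_function K f"
  shows "f x = of_real (fourier_const TYPE('n)) * (\<integral>\<xi>. fourier f \<xi> * exp (\<i> * of_real (x \<bullet> \<xi>)) \<partial>lborel)"
proof -
  define d where "d = CARD('n)"
  note sf = test_function_supp_in[OF f]
  have intf: "integrable lborel f" by (rule integrable_supp_in[OF K sf])
  have contf: "continuous_on UNIV f" using sf by (simp add: supp_in_def)
  obtain B where B: "B \<ge> 0" "\<And>x. norm (f x) \<le> B" using supp_in_bounded[OF K sf] by blast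
  define t where "t n = inverse (real (Suc n))" for n
  have t: "t n > 0" for n by (simp add: t_def)
  have t0: "t \<longlonglongrightarrow> 0" unfolding t_def by (rule LIMSEQ_inverse_real_of_nat)
  define ew where "ew \<xi> = exp (\<i> * complex_of_real (x \<bullet> \<xi>))" for \<xi>
  have ew: "norm (ew \<xi>) = 1" for \<xi> by (simp add: ew_def norm_exp_eq_Re)
  have ewc: "continuous_on A ew" for A unfolding ew_def by (intro continuous_intros)
  have gmeas: "(gaussian :: real^'n \<Rightarrow> complex) \<in> borel_measurable borel"
    by (rule borel_measurable_continuous_onI[OF gaussian_continuous])
  have gbound: "norm (gaussian y) \<le> norm (gaussian (0::real^'n))" for y :: "real^'n"
    unfolding gaussian_eq norm_of_real abs_mult by (intro mult_left_mono) auto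
  \<comment> \<open>Two rescalings by \<open>t\<close>, in \<open>\<xi>\<close> and in \<open>y\<close>, whose Jacobians cancel.\<close>
  have key: "(\<integral>\<xi>. fourier f \<xi> * gaussian (t n *\<^sub>R \<xi>) * ew \<xi> \<partial>lborel)
     = of_real (sqrt (2 * pi) ^ d) * (\<integral>z. f (x + t n *\<^sub>R z) * gaussian z \<partial>lborel)" for n
  proof -
    have intg: "integrable lborel (\<lambda>\<xi>::real^'n. gaussian (t n *\<^sub>R \<xi>))"
    proof -
      have "integrable lborel (\<lambda>\<xi>::real^'n. \<Prod>j\<in>UNIV. std_normal_density (t n * \<xi> $ j))"
        using t[of n] lborel_integrable_real_affine[of std_normal_density "t n" 0]
        by (intro product_lborel(1)) auto
      then show ?thesis unfolding gaussian_def by (simp add: integrable_of_real del: of_real_prod)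
    qed
    have inner: "(\<integral>\<xi>. gaussian (t n *\<^sub>R \<xi>) * exp (\<i> * of_real ((x - y) \<bullet> \<xi>)) \<partial>lborel)
       = of_real ((1 / t n) ^ d * sqrt (2 * pi) ^ d) * gaussian ((y - x) /\<^sub>R t n)" for y
    proof -
      have m: "(\<lambda>\<xi>::real^'n. gaussian (t n *\<^sub>R \<xi>) * exp (\<i> * of_real ((x - y) \<bullet> \<xi>))) \<in> borel_measurable borel"
        by (intro borel_measurable_continuous_onI continuous_intros continuous_on_compose2[OF gaussian_continuous[of UNIV]]) auto
      have "(\<integral>\<xi>. gaussian (t n *\<^sub>R \<xi>) * exp (\<i> * of_real ((x - y) \<bullet> \<xi>)) \<partial>lborel)
        = of_real ((1 / t n) ^ d) * (\<integral>\<eta>. gaussian (t n *\<^sub>R (0 + (1 / t n) *\<^sub>R \<eta>)) * exp (\<i> * of_real ((x - y) \<bullet> (0 + (1 / t n) *\<^sub>R \<eta>))) \<partial>lborel)"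
        unfolding d_def using t[of n] by (intro integral_scale m) auto
      also have "(\<integral>\<eta>. gaussian (t n *\<^sub>R (0 + (1 / t n) *\<^sub>R \<eta>)) * exp (\<i> * of_real ((x - y) \<bullet> (0 + (1 / t n) *\<^sub>R \<eta>))) \<partial>lborel)
        = fourier gaussian ((y - x) /\<^sub>R t n)"
        unfolding fourier_def
        by (rule Bochner_Integration.integral_cong[OF refl])
          (use t[of n] in \<open>simp add: inner_commute inner_diff_left inner_diff_right divide_inverse algebra_simps\<close>)
      finally show ?thesis by (simp add: fourier_gaussian d_def)
    qed
    have "(\<integral>\<xi>. fourier f \<xi> * gaussian (t n *\<^sub>R \<xi>) * ew \<xi> \<partial>lborel)
      = (\<integral>\<xi>. gaussian (t n *\<^sub>R \<xi>) * (\<integral>y. f y * exp (\<i> * of_real ((x - y) \<bullet> \<xi>)) \<partial>lborel) \<partial>lborel)"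
    proof (rule Bochner_Integration.integral_cong[OF refl])
      fix \<xi>
      have "fourier f \<xi> * ew \<xi> = (\<integral>y. f y * wave \<xi> y * ew \<xi> \<partial>lborel)" by (simp add: fourier_def)
      also have "\<dots> = (\<integral>y. f y * exp (\<i> * of_real ((x - y) \<bullet> \<xi>)) \<partial>lborel)"
        by (rule Bochner_Integration.integral_cong[OF refl])
          (simp add: ew_def inner_diff_left algebra_simps flip: exp_add)
      finally show "fourier f \<xi> * gaussian (t n *\<^sub>R \<xi>) * ew \<xi> = gaussian (t n *\<^sub>R \<xi>) * (\<integral>y. f y * exp (\<i> * of_real ((x - y) \<bullet> \<xi>)) \<partial>lborel)"
        by (simp add: mult_ac)
    qed
    also have "\<dots> = (\<integral>y. f y * (\<integral>\<xi>. gaussian (t n *\<^sub>R \<xi>) * exp (\<i> * of_real ((x - y) \<bullet> \<xi>)) \<partial>lborel) \<partial>lborel)"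
      by (rule Fubini_mult[OF intf intg])
        (auto simp: norm_exp_eq_Re case_prod_beta' intro!: continuous_intros)
    also have "\<dots> = (\<integral>y. of_real ((1 / t n) ^ d * sqrt (2 * pi) ^ d) * (f y * gaussian ((y - x) /\<^sub>R t n)) \<partial>lborel)"
      unfolding inner by (simp add: mult_ac)
    also have "\<dots> = of_real ((1 / t n) ^ d * sqrt (2 * pi) ^ d) * (\<integral>y. f y * gaussian ((y - x) /\<^sub>R t n) \<partial>lborel)"
      by (rule integral_mult_right_zero)
    also have "(\<integral>y. f y * gaussian ((y - x) /\<^sub>R t n) \<partial>lborel)
      = of_real (t n ^ d) * (\<integral>z. f (x + t n *\<^sub>R z) * gaussian ((x + t n *\<^sub>R z - x) /\<^sub>R t n) \<partial>lborel)"
      unfolding d_def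
      by (intro integral_scale t borel_measurable_continuous_onI continuous_intros contf
          continuous_on_compose2[OF gaussian_continuous[of UNIV]]) auto
    also have "of_real ((1 / t n) ^ d * sqrt (2 * pi) ^ d) * (of_real (t n ^ d) * (\<integral>z. f (x + t n *\<^sub>R z) * gaussian ((x + t n *\<^sub>R z - x) /\<^sub>R t n) \<partial>lborel))
      = of_real (sqrt (2 * pi) ^ d) * (\<integral>z. f (x + t n *\<^sub>R z) * gaussian z \<partial>lborel)"
      using t[of n] by (simp add: power_one_over)
    finally show ?thesis .
  qed
  have intF: "integrable lborel (fourier f)" by (rule integrable_fourier[OF K f])
  have measF: "fourier f \<in> borel_measurable borel" by (rule fourier_measurable[OF K sf])
  have lim1: "(\<lambda>n. \<integral>\<xi>. fourier f \<xi> * gaussian (t n *\<^sub>R \<xi>) * ew \<xi> \<partial>lborel)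
     \<longlonglongrightarrow> (\<integral>\<xi>. fourier f \<xi> * gaussian (0::real^'n) * ew \<xi> \<partial>lborel)"
  proof (rule integral_dominated_convergence[where w="\<lambda>\<xi>. norm (fourier f \<xi>) * norm (gaussian (0::real^'n))"])
    have ewm: "ew \<in> borel_measurable borel" by (rule borel_measurable_continuous_onI[OF ewc])
    have gm: "(\<lambda>\<xi>::real^'n. gaussian (t n *\<^sub>R \<xi>)) \<in> borel_measurable borel" for n
      by (intro borel_measurable_continuous_onI continuous_on_compose2[OF gaussian_continuous[of UNIV]] continuous_intros) auto
    show "(\<lambda>\<xi>. fourier f \<xi> * gaussian (0::real^'n) * ew \<xi>) \<in> borel_measurable lborel" using measF ewm by simp
    show "(\<lambda>\<xi>. fourier f \<xi> * gaussian (t n *\<^sub>R \<xi>) * ew \<xi>) \<in> borel_measurable lborel" for n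
      using measF ewm gm by simp
    show "integrable lborel (\<lambda>\<xi>. norm (fourier f \<xi>) * norm (gaussian (0::real^'n)))"
      using intF by simp
    show "AE \<xi> in lborel. (\<lambda>n. fourier f \<xi> * gaussian (t n *\<^sub>R \<xi>) * ew \<xi>) \<longlonglongrightarrow> fourier f \<xi> * gaussian (0::real^'n) * ew \<xi>"
    proof (rule AE_I2)
      fix \<xi> :: "real^'n"
      have "(\<lambda>n. t n *\<^sub>R \<xi>) \<longlonglongrightarrow> 0 *\<^sub>R \<xi>" by (intro tendsto_intros t0)
      then have "(\<lambda>n. gaussian (t n *\<^sub>R \<xi>)) \<longlonglongrightarrow> gaussian (0 *\<^sub>R \<xi>)"
        by (rule continuous_on_tendsto_compose[OF gaussian_continuous[of UNIV]]) auto
      then have "(\<lambda>n. gaussian (t n *\<^sub>R \<xi>)) \<longlonglongrightarrow> gaussian (0::real^'n)" by simp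
      then show "(\<lambda>n. fourier f \<xi> * gaussian (t n *\<^sub>R \<xi>) * ew \<xi>) \<longlonglongrightarrow> fourier f \<xi> * gaussian (0::real^'n) * ew \<xi>"
        by (intro tendsto_mult tendsto_const)
    qed
    show "AE \<xi> in lborel. norm (fourier f \<xi> * gaussian (t n *\<^sub>R \<xi>) * ew \<xi>) \<le> norm (fourier f \<xi>) * norm (gaussian (0::real^'n))" for n
      using gbound by (auto simp: norm_mult ew intro!: mult_left_mono)
  qed
  have lim2: "(\<lambda>n. \<integral>z. f (x + t n *\<^sub>R z) * gaussian z \<partial>lborel) \<longlonglongrightarrow> (\<integral>z. f x * gaussian z \<partial>(lborel :: (real^'n) measure))"
  proof (rule integral_dominated_convergence[where w="\<lambda>z::real^'n. B * norm (gaussian z)"])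
    show "(\<lambda>z::real^'n. f x * gaussian z) \<in> borel_measurable lborel" using gmeas by simp
    show "(\<lambda>z. f (x + t n *\<^sub>R z) * gaussian z) \<in> borel_measurable lborel" for n
    proof -
      have "(\<lambda>z. f (x + t n *\<^sub>R z)) \<in> borel_measurable borel"
        by (intro borel_measurable_continuous_onI continuous_on_compose2[OF contf] continuous_intros) auto
      then show ?thesis using gmeas by simp
    qed
    show "integrable lborel (\<lambda>z::real^'n. B * norm (gaussian z))"
      using integrable_norm[OF integrable_gaussian[where 'a='n]] by simp
    show "AE z in lborel. (\<lambda>n. f (x + t n *\<^sub>R z) * gaussian z) \<longlonglongrightarrow> f x * gaussian z"
    proof (rule AE_I2)
      fix z :: "real^'n"
      have "(\<lambda>n. x + t n *\<^sub>R z) \<longlonglongrightarrow> x + 0 *\<^sub>R z" by (intro tendsto_intros t0)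
      then have "(\<lambda>n. f (x + t n *\<^sub>R z)) \<longlonglongrightarrow> f (x + 0 *\<^sub>R z)"
        by (rule continuous_on_tendsto_compose[OF contf]) auto
      then have "(\<lambda>n. f (x + t n *\<^sub>R z)) \<longlonglongrightarrow> f x" by simp
      then show "(\<lambda>n. f (x + t n *\<^sub>R z) * gaussian z) \<longlonglongrightarrow> f x * gaussian z"
        by (intro tendsto_mult tendsto_const)
    qed
    show "AE z in lborel. norm (f (x + t n *\<^sub>R z) * gaussian z) \<le> B * norm (gaussian z)" for n
      using B by (auto simp: norm_mult intro!: mult_right_mono)
  qed
  have "(\<integral>\<xi>. fourier f \<xi> * gaussian (0::real^'n) * ew \<xi> \<partial>lborel) = of_real (sqrt (2 * pi) ^ d) * (\<integral>z. f x * gaussian z \<partial>(lborel :: (real^'n) measure))"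
    using tendsto_mult_left[OF lim2, of "of_real (sqrt (2 * pi) ^ d)"]
    by (intro LIMSEQ_unique[OF lim1]) (simp only: key)
  also have "(\<integral>z. f x * gaussian z \<partial>(lborel :: (real^'n) measure)) = f x" by (simp add: integral_gaussian)
  also have "(\<integral>\<xi>. fourier f \<xi> * gaussian (0::real^'n) * ew \<xi> \<partial>lborel) = gaussian (0::real^'n) * (\<integral>\<xi>. fourier f \<xi> * ew \<xi> \<partial>lborel)"
    by (subst integral_mult_right_zero[symmetric]) (simp add: mult_ac)
  finally have eq: "gaussian (0::real^'n) * (\<integral>\<xi>. fourier f \<xi> * ew \<xi> \<partial>lborel) = of_real (sqrt (2 * pi) ^ d) * f x" .
  have g0: "gaussian (0::real^'n) = of_real ((1 / sqrt (2 * pi)) ^ d)" by (simp add: gaussian_eq d_def)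
  have "fourier_const TYPE('n) = (1 / sqrt (2 * pi)) ^ d * (1 / sqrt (2 * pi)) ^ d"
    unfolding fourier_const_def d_def power_mult_distrib[symmetric] by simp
  then have "of_real (fourier_const TYPE('n)) * (\<integral>\<xi>. fourier f \<xi> * ew \<xi> \<partial>lborel)
    = of_real ((1 / sqrt (2 * pi)) ^ d) * (gaussian (0::real^'n) * (\<integral>\<xi>. fourier f \<xi> * ew \<xi> \<partial>lborel))"
    by (simp add: g0 mult.assoc)
  also have "\<dots> = of_real ((1 / sqrt (2 * pi)) ^ d * sqrt (2 * pi) ^ d) * f x"
    unfolding eq by (simp add: mult.assoc)
  also have "(1 / sqrt (2 * pi)) ^ d * sqrt (2 * pi) ^ d = 1"
    by (simp flip: power_mult_distrib)
  finally show ?thesis by (simp add: ew_def)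
qed

text \<open>Write one factor by the inversion formula and exchange the integrals.\<close>

lemma fourier_mult:
  fixes g h :: "real^'n \<Rightarrow> complex"
  assumes K: "compact K" and g: "test_function K g" and L: "compact L" and h: "supp_in L h"
  shows "fourier (\<lambda>x. h x * g x) \<xi>
    = of_real (fourier_const TYPE('n)) * (\<integral>\<eta>. fourier g \<eta> * fourier h (\<xi> - \<eta>) \<partial>lborel)"
proof -
  have inth: "integrable lborel (\<lambda>x. h x * wave \<xi> x)" by (rule integrable_wave_mult[OF integrable_supp_in[OF L h]])
  have "fourier (\<lambda>x. h x * g x) \<xi>
    = (\<integral>x. of_real (fourier_const TYPE('n)) * (h x * wave \<xi> x * (\<integral>\<eta>. fourier g \<eta> * exp (\<i> * of_real (x \<bullet> \<eta>)) \<partial>lborel)) \<partial>lborel)"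
    unfolding fourier_def[of "\<lambda>x. h x * g x"]
    by (rule Bochner_Integration.integral_cong[OF refl], subst fourier_inversion[OF K g]) (simp add: mult_ac)
  also have "\<dots> = of_real (fourier_const TYPE('n)) * (\<integral>x. h x * wave \<xi> x * (\<integral>\<eta>. fourier g \<eta> * exp (\<i> * of_real (x \<bullet> \<eta>)) \<partial>lborel) \<partial>lborel)"
    by (rule integral_mult_right_zero)
  also have "(\<integral>x. h x * wave \<xi> x * (\<integral>\<eta>. fourier g \<eta> * exp (\<i> * of_real (x \<bullet> \<eta>)) \<partial>lborel) \<partial>lborel)
    = (\<integral>\<eta>. fourier g \<eta> * (\<integral>x. h x * wave \<xi> x * exp (\<i> * of_real (x \<bullet> \<eta>)) \<partial>lborel) \<partial>lborel)"
    by (rule Fubini_mult[OF inth integrable_fourier[OF K g], symmetric])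
      (auto simp: norm_exp_eq_Re case_prod_beta' intro!: continuous_intros)
  also have "\<dots> = (\<integral>\<eta>. fourier g \<eta> * fourier h (\<xi> - \<eta>) \<partial>lborel)"
  proof (rule Bochner_Integration.integral_cong[OF refl])
    fix \<eta>
    have "(\<integral>x. h x * wave \<xi> x * exp (\<i> * of_real (x \<bullet> \<eta>)) \<partial>lborel) = fourier h (\<xi> - \<eta>)"
      unfolding fourier_def
      by (rule Bochner_Integration.integral_cong[OF refl])
        (simp add: inner_diff_right algebra_simps flip: exp_add)
    then show "fourier g \<eta> * (\<integral>x. h x * wave \<xi> x * exp (\<i> * of_real (x \<bullet> \<eta>)) \<partial>lborel) = fourier g \<eta> * fourier h (\<xi> - \<eta>)"
      by simp
  qed
  finally show ?thesis .
qed

section \<open>Fourier transforms of generalized functions with compact support\<close>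

lemma moderate_on_finite_family:
  assumes "finite I" "\<And>i. i \<in> I \<Longrightarrow> moderate_on A (f i)"
  shows "\<exists>N. \<forall>\<^sub>0\<epsilon>. \<forall>i\<in>I. \<forall>x\<in>A \<epsilon>. f i \<epsilon> x \<le> \<epsilon> powr N"
  using assms
proof (induction I)
  case empty then show ?case by simp
next
  case (insert i I)
  then obtain M where M: "\<forall>\<^sub>0\<epsilon>. \<forall>i\<in>I. \<forall>x\<in>A \<epsilon>. f i \<epsilon> x \<le> \<epsilon> powr M" by auto
  have "moderate_on A (f i)" using insert by simp
  then obtain N where N: "\<forall>\<^sub>0\<epsilon>. \<forall>x\<in>A \<epsilon>. f i \<epsilon> x \<le> \<epsilon> powr N" by (auto simp: moderate_on_def)
  have "\<forall>\<^sub>0\<epsilon>. \<forall>i\<in>insert i I. \<forall>x\<in>A \<epsilon>. f i \<epsilon> x \<le> \<epsilon> powr min M N"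
    using M N small_unit
  proof eventually_elim
    case (elim \<epsilon>)
    have "\<epsilon> powr M \<le> \<epsilon> powr min M N" "\<epsilon> powr N \<le> \<epsilon> powr min M N"
      using elim by (auto intro!: powr_mono')
    then show ?case using elim by (auto intro: order_trans)
  qed
  then show ?case by blast
qed

lemma test_nets_fourier_decay:
  fixes w :: "'n::finite fnet"
  assumes K: "compact K" and w: "w \<in> test_nets K"
  shows "moderate_on (\<lambda>_. UNIV) (\<lambda>\<epsilon> \<xi>. norm \<xi> ^ m * norm (fourier (w \<epsilon>) \<xi>))"
proof -
  obtain N where N: "\<forall>\<^sub>0\<epsilon>. \<forall>j\<in>UNIV. \<forall>x\<in>UNIV. norm (pd (replicate m j) (w \<epsilon>) x) \<le> \<epsilon> powr N"
    using moderate_on_finite_family[of "UNIV :: 'n set" "\<lambda>_. UNIV" "\<lambda>j \<epsilon> x. norm (pd (replicate m j) (w \<epsilon>) x)", OF finite test_nets_moderate_on[OF K w]]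
    by blast
  show ?thesis
  proof (rule moderate_on_mono)
    show "moderate_on (\<lambda>_. UNIV :: (real^'n) set) (\<lambda>\<epsilon> \<xi>. (real CARD('n) ^ (m + 1) * measure lborel K) * \<epsilon> powr N)"
      by (intro moderate_on_mult moderate_on_const moderate_on_powr) auto
    show "\<forall>\<^sub>0\<epsilon>. \<forall>\<xi>\<in>UNIV. \<xi> \<in> UNIV \<and> norm \<xi> ^ m * norm (fourier (w \<epsilon>) \<xi>) \<le> (real CARD('n) ^ (m + 1) * measure lborel K) * \<epsilon> powr N"
      using N small_unit
    proof eventually_elim
      case (elim \<epsilon>)
      then have "norm \<xi> ^ m * norm (fourier (w \<epsilon>) \<xi>) \<le> real CARD('n) ^ (m + 1) * \<epsilon> powr N * measure lborel K" for \<xi>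
        by (intro fourier_decay[OF K test_nets_function[OF w]]) auto
      then show ?case by (simp add: mult_ac)
    qed
  qed
qed

lemma test_nets_fourier_weighted:
  fixes w :: "'n::finite fnet"
  assumes K: "compact K" and w: "w \<in> test_nets K"
  shows "moderate_on (\<lambda>_. UNIV) (\<lambda>\<epsilon> \<xi>. weight \<xi> * (norm \<xi> ^ m * norm (fourier (w \<epsilon>) \<xi>)))"
proof (rule moderate_on_mono)
  show "moderate_on (\<lambda>_. UNIV) (\<lambda>\<epsilon> \<xi>. 2 ^ CARD('n) * (norm \<xi> ^ m * norm (fourier (w \<epsilon>) \<xi>) + norm \<xi> ^ (2 * CARD('n) + m) * norm (fourier (w \<epsilon>) \<xi>)))"
    by (intro moderate_on_mult moderate_on_add moderate_on_const test_nets_fourier_decay[OF K w]) auto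
  show "\<forall>\<^sub>0\<epsilon>. \<forall>\<xi>\<in>UNIV. \<xi> \<in> UNIV \<and> weight \<xi> * (norm \<xi> ^ m * norm (fourier (w \<epsilon>) \<xi>))
    \<le> 2 ^ CARD('n) * (norm \<xi> ^ m * norm (fourier (w \<epsilon>) \<xi>) + norm \<xi> ^ (2 * CARD('n) + m) * norm (fourier (w \<epsilon>) \<xi>))"
    using weight_mult_le[of "norm \<xi> ^ m * norm (fourier (w \<epsilon>) \<xi>)" \<xi> for \<xi> \<epsilon>]
    by (intro always_eventually allI) (simp add: power_add mult.assoc)
qed

lemma smooth_on_coord: "smooth_on UNIV (\<lambda>x. - (\<i> * of_real (x $ j)))"
proof (rule smooth_on_closed_family[where F="range (\<lambda>(a, b) x. a * of_real (x $ j) + b)"])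
  show "(\<lambda>x. - (\<i> * of_real (x $ j))) \<in> range (\<lambda>(a, b) x. a * of_real (x $ j) + b)"
    by (auto intro!: image_eqI[of _ _ "(- \<i>, 0)"])
  fix g :: "real^'a \<Rightarrow> complex" assume "g \<in> range (\<lambda>(a, b) x. a * of_real (x $ j) + b)"
  then obtain a b where g: "g = (\<lambda>x. a * of_real (x $ j) + b)" by auto
  have D: "(g has_derivative (\<lambda>h. a * of_real (h $ j))) (at x)" for x
    unfolding g
    by (intro has_derivative_add_const has_derivative_mult_right has_derivative_of_real
        bounded_linear_imp_has_derivative bounded_linear_vec_nth)
  then show "g differentiable (at x)" for x by (auto simp: differentiable_def)
  fix i
  show "\<exists>h\<in>range (\<lambda>(a, b) x. a * of_real (x $ j) + b). \<forall>x\<in>UNIV. partial i g x = h x"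
    using partial_eq[OF D] by (intro bexI[of _ "\<lambda>x. 0 * of_real (x $ j) + a * of_real (axis i 1 $ j)"])
      (auto intro!: image_eqI[of _ _ "(0, a * of_real (axis i 1 $ j))"])
qed auto

lemma smooth_on_coord_prod: "smooth_on UNIV (coord_prod is)"
proof (induction "is")
  case Nil then show ?case unfolding coord_prod_def by (simp add: smooth_on_const)
next
  case (Cons i "is")
  have "smooth_on UNIV (\<lambda>x. - (\<i> * of_real (x $ i)) * coord_prod is x)"
    by (rule smooth_on_mult[OF open_UNIV smooth_on_coord Cons])
  then show ?case by (simp add: coord_prod_def)
qed

lemma test_nets_mult_smooth:
  assumes "w \<in> test_nets K" "smooth_on UNIV g" shows "(\<lambda>\<epsilon> x. w \<epsilon> x * g x) \<in> test_nets K"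
  using assms EM_mult[OF open_UNIV _ EM_const[OF open_UNIV assms(2)], of w] by (auto simp: test_nets_def)

lemma norm_monomial_le: "\<bar>monomial \<alpha> \<xi>\<bar> \<le> norm \<xi> ^ (\<Sum>i\<in>UNIV. \<alpha> i)"
proof -
  have "\<bar>monomial \<alpha> \<xi>\<bar> \<le> (\<Prod>i\<in>UNIV. norm \<xi> ^ \<alpha> i)"
    unfolding monomial_def abs_prod by (intro prod_mono) (auto simp: power_abs intro!: power_mono component_le_norm_cart)
  then show ?thesis by (simp add: power_sum)
qed

lemma fourier_in_ES:
  fixes w :: "'n::finite fnet"
  assumes K: "compact K" and w: "w \<in> test_nets K"
  shows "(\<lambda>\<epsilon>. fourier (w \<epsilon>)) \<in> ES"
proof -
  have eq: "mpartial \<beta> (fourier (w \<epsilon>)) = fourier (\<lambda>x. w \<epsilon> x * coord_prod (mlist \<beta>) x)" if "\<epsilon> \<in> {0<..1}" for \<beta> \<epsilon>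
    unfolding mpartial_eq_pd by (rule pd_fourier[OF K test_function_supp_in[OF test_nets_function[OF w that]]])
  have tn: "(\<lambda>\<epsilon> x. w \<epsilon> x * coord_prod (mlist \<beta>) x) \<in> test_nets K" for \<beta>
    by (rule test_nets_mult_smooth[OF w smooth_on_coord_prod])
  have le: "norm (monomial \<alpha> \<xi> *\<^sub>R c) \<le> norm \<xi> ^ (\<Sum>i\<in>UNIV. \<alpha> i) * norm c" for \<alpha> \<xi> and c :: complex
    using norm_monomial_le[of \<alpha> \<xi>] by (simp add: mult_right_mono)
  have "fourier (w \<epsilon>) \<in> schwartz" if e: "\<epsilon> \<in> {0<..1}" for \<epsilon>
    unfolding schwartz_def mem_Collect_eq
  proof (intro conjI allI)
    show "smooth_on UNIV (fourier (w \<epsilon>))"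
      by (rule smooth_on_fourier[OF K test_function_supp_in[OF test_nets_function[OF w e]]])
    fix \<alpha> \<beta> :: "'n \<Rightarrow> nat"
    obtain C where C: "\<And>\<xi>. norm \<xi> ^ (\<Sum>i\<in>UNIV. \<alpha> i) * norm (fourier (\<lambda>x. w \<epsilon> x * coord_prod (mlist \<beta>) x) \<xi>) \<le> C"
      using fourier_power_bound[OF K test_nets_function[OF tn e]] by blast
    show "bounded (range (\<lambda>x. monomial \<alpha> x *\<^sub>R mpartial \<beta> (fourier (w \<epsilon>)) x))"
      unfolding eq[OF e] bounded_iff using order_trans[OF le C] by blast
  qed
  moreover have "\<exists>N::nat. sup_bigo UNIV (\<lambda>\<epsilon> \<xi>. monomial \<alpha> \<xi> *\<^sub>R mpartial \<beta> (fourier (w \<epsilon>)) \<xi>) (\<lambda>\<epsilon>. inverse (\<epsilon> ^ N))" for \<alpha> \<beta>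
    unfolding sup_bigo_moderate_on
  proof (rule moderate_on_mono[OF test_nets_fourier_decay[OF K tn]])
    show "\<forall>\<^sub>0\<epsilon>. \<forall>\<xi>\<in>UNIV. \<xi> \<in> UNIV \<and> norm (monomial \<alpha> \<xi> *\<^sub>R mpartial \<beta> (fourier (w \<epsilon>)) \<xi>)
      \<le> norm \<xi> ^ (\<Sum>i\<in>UNIV. \<alpha> i) * norm (fourier (\<lambda>x. w \<epsilon> x * coord_prod (mlist \<beta>) x) \<xi>)"
      using small_unit by eventually_elim (use le eq in auto)
  qed
  ultimately show ?thesis by (simp add: ES_def)
qed

lemma test_nets_ES:
  fixes w :: "'n::finite fnet"
  assumes K: "compact K" and w: "w \<in> test_nets K"
  shows "w \<in> ES"
proof -
  have cl: "closed K" by (rule compact_imp_closed[OF K])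
  have z: "pd is (w \<epsilon>) x = 0" if "\<epsilon> \<in> {0<..1}" "x \<notin> K" for "is" \<epsilon> x
    using pd_eq_0_outside[OF cl _ that(2)] w that(1) by (auto simp: test_nets_def)
  have "\<exists>C. C \<ge> 0 \<and> (\<forall>x\<in>K. \<bar>monomial \<alpha> x\<bar> \<le> C)" for \<alpha>
  proof -
    have "compact ((monomial \<alpha> :: real^'n \<Rightarrow> real) ` K)"
      unfolding monomial_def by (intro compact_continuous_image K continuous_intros)
    then obtain C where "\<forall>x\<in>K. \<bar>monomial \<alpha> x\<bar> \<le> C" using compact_imp_bounded by (fastforce simp: bounded_iff)
    then show ?thesis by (intro exI[of _ "max C 0"]) (auto intro: max.coboundedI1)
  qed
  then obtain C where C: "\<And>\<alpha>. C \<alpha> \<ge> 0" "\<And>\<alpha> x. x \<in> K \<Longrightarrow> \<bar>monomial \<alpha> x\<bar> \<le> C \<alpha>" by metis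
  have le: "norm (monomial \<alpha> x *\<^sub>R pd is (w \<epsilon>) x) \<le> C \<alpha> * norm (pd is (w \<epsilon>) x)" if "\<epsilon> \<in> {0<..1}" for \<alpha> x "is" \<epsilon>
    using C(2)[of x \<alpha>] z[OF that, of x "is"] by (cases "x \<in> K") (auto intro: mult_right_mono)
  have "w \<epsilon> \<in> schwartz" if e: "\<epsilon> \<in> {0<..1}" for \<epsilon>
    unfolding schwartz_def mem_Collect_eq mpartial_eq_pd
  proof (intro conjI allI)
    show "smooth_on UNIV (w \<epsilon>)" using w e by (auto simp: test_nets_def EM_def)
    fix \<alpha> \<beta> :: "'n \<Rightarrow> nat"
    obtain B where B: "B \<ge> 0" "\<And>x. norm (pd (mlist \<beta>) (w \<epsilon>) x) \<le> B"
      by (rule supp_in_bounded[OF K test_function_supp_in[OF test_function_pd[OF cl test_nets_function[OF w e]]], of "mlist \<beta>"]) blast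
    have "norm (monomial \<alpha> x *\<^sub>R pd (mlist \<beta>) (w \<epsilon>) x) \<le> C \<alpha> * B" for x
      by (rule order_trans[OF le[OF e] mult_left_mono[OF B(2) C(1)]])
    then show "bounded (range (\<lambda>x. monomial \<alpha> x *\<^sub>R pd (mlist \<beta>) (w \<epsilon>) x))"
      unfolding bounded_iff by blast
  qed
  moreover have "\<exists>N::nat. sup_bigo UNIV (\<lambda>\<epsilon> x. monomial \<alpha> x *\<^sub>R mpartial \<beta> (w \<epsilon>) x) (\<lambda>\<epsilon>. inverse (\<epsilon> ^ N))" for \<alpha> \<beta>
    unfolding sup_bigo_moderate_on mpartial_eq_pd
  proof (rule moderate_on_mono)
    show "moderate_on (\<lambda>_. UNIV) (\<lambda>\<epsilon> x. C \<alpha> * norm (pd (mlist \<beta>) (w \<epsilon>) x))"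
      using C(1) by (intro moderate_on_mult moderate_on_const test_nets_moderate_on[OF K w]) auto
    show "\<forall>\<^sub>0\<epsilon>. \<forall>x\<in>UNIV. x \<in> UNIV \<and> norm (monomial \<alpha> x *\<^sub>R pd (mlist \<beta>) (w \<epsilon>) x) \<le> C \<alpha> * norm (pd (mlist \<beta>) (w \<epsilon>) x)"
      using small_unit by eventually_elim (use le in auto)
  qed
  ultimately show ?thesis by (simp add: ES_def)
qed

lemma GSrel_refl: "w \<in> ES \<Longrightarrow> (w, w) \<in> GSrel"
  by (simp add: GSrel_def mpartial_eq_pd sup_bigo_negligible_on negligible_on_zero)

lemma mpartial_0: "mpartial (\<lambda>_. 0) f = f"
proof -
  have "mlist (\<lambda>_::'a. 0) = []" by (simp add: mlist_def concat_eq_Nil_conv)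
  then show ?thesis by (simp add: mpartial_eq_pd)
qed

lemma weight_le_monomials:
  "weight (x :: real^'n) \<le> 2 ^ CARD('n) * (\<bar>monomial (\<lambda>_. 0) x\<bar> + real CARD('n) ^ (2 * CARD('n)) * (\<Sum>j\<in>UNIV. \<bar>monomial (\<lambda>i. if i = j then 2 * CARD('n) else 0) x\<bar>))"
proof -
  have "monomial (\<lambda>i. if i = j then m else 0) x = (x $ j) ^ m" for j and m :: nat
    unfolding monomial_def by (subst prod.remove[of _ j]) (auto intro!: prod.neutral)
  then have "norm x ^ (2 * CARD('n)) \<le> real CARD('n) ^ (2 * CARD('n)) * (\<Sum>j\<in>UNIV. \<bar>monomial (\<lambda>i. if i = j then 2 * CARD('n) else 0) x\<bar>)"
    using norm_power_le_sum[of x "2 * CARD('n)"] by (simp add: power_abs)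
  then show ?thesis
    by (intro order_trans[OF weight_le] mult_left_mono add_mono) (auto simp: monomial_def)
qed

lemma weighted_norm_le_monomials:
  "weight (x :: real^'n) * norm (c :: complex) \<le> 2 ^ CARD('n) * (norm (monomial (\<lambda>_. 0) x *\<^sub>R c) + real CARD('n) ^ (2 * CARD('n)) * (\<Sum>j\<in>UNIV. norm (monomial (\<lambda>i. if i = j then 2 * CARD('n) else 0) x *\<^sub>R c)))"
  using mult_right_mono[OF weight_le_monomials norm_ge_zero, of x c]
  by (simp add: distrib_right sum_distrib_right mult.assoc)

lemma schwartz_measurable: "f \<in> schwartz \<Longrightarrow> f \<in> borel_measurable borel"
  by (auto simp: schwartz_def intro!: borel_measurable_continuous_onI smooth_on_continuous_on)

lemma schwartz_integrable:
  fixes f :: "real^'n \<Rightarrow> complex"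
  assumes "f \<in> schwartz" shows "integrable lborel f"
proof -
  have "\<exists>C. \<forall>x. norm (monomial \<alpha> x *\<^sub>R f x) \<le> C" for \<alpha>
  proof -
    have "bounded (range (\<lambda>x. monomial \<alpha> x *\<^sub>R mpartial (\<lambda>_. 0) f x))"
      using assms unfolding schwartz_def by blast
    then show ?thesis by (simp add: mpartial_0 bounded_iff)
  qed
  then have "\<forall>\<alpha>. \<exists>C. \<forall>x. norm (monomial \<alpha> x *\<^sub>R f x) \<le> C" by blast
  from choice[OF this] obtain C where C: "\<And>\<alpha> x. norm (monomial \<alpha> x *\<^sub>R f x) \<le> C \<alpha>" by blast
  show ?thesis
  proof (rule integrable_if_weighted_bound(1)[OF schwartz_measurable[OF assms]])
    show "weight x * norm (f x) \<le> 2 ^ CARD('n) * (C (\<lambda>_. 0) + real CARD('n) ^ (2 * CARD('n)) * (\<Sum>j::'n\<in>UNIV. C (\<lambda>i. if i = j then 2 * CARD('n) else 0)))" for x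
      by (rule order_trans[OF weighted_norm_le_monomials]) (intro mult_left_mono add_mono sum_mono C; simp)
  qed
qed

text \<open>The \<open>L\<^sup>1\<close> norm bounds the transform, and it is controlled by finitely many Schwartz seminorms through the
integrable weight.\<close>

lemma GSrel_fourier_negligible_on:
  fixes v w :: "'n::finite fnet"
  assumes "(v, w) \<in> GSrel"
  shows "negligible_on (\<lambda>_. UNIV) (\<lambda>\<epsilon> \<xi>. norm (fourier (v \<epsilon>) \<xi> - fourier (w \<epsilon>) \<xi>))"
proof -
  have vw: "v \<epsilon> \<in> schwartz" "w \<epsilon> \<in> schwartz" if "\<epsilon> \<in> {0<..1}" for \<epsilon>
    using assms that by (auto simp: GSrel_def ES_def)
  have n: "negligible_on (\<lambda>_. UNIV) (\<lambda>\<epsilon> x. norm (monomial \<alpha> x *\<^sub>R (v \<epsilon> x - w \<epsilon> x)))" for \<alpha>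
  proof -
    have "\<forall>n::nat. sup_bigo UNIV (\<lambda>\<epsilon> x. monomial \<alpha> x *\<^sub>R mpartial (\<lambda>_. 0) (\<lambda>x. v \<epsilon> x - w \<epsilon> x) x) (\<lambda>\<epsilon>. \<epsilon> ^ n)"
      using assms unfolding GSrel_def by blast
    then show ?thesis by (simp only: sup_bigo_negligible_on mpartial_0)
  qed
  have c: "negligible_on A (\<lambda>\<epsilon> x. c * f \<epsilon> x)" if "negligible_on A f" "c \<ge> 0" "\<forall>\<^sub>0\<epsilon>. \<forall>x\<in>A \<epsilon>. 0 \<le> f \<epsilon> x" for A :: "real \<Rightarrow> 'b set" and f c
    using negligible_on_mult[OF that(1) moderate_on_const[of A c]] that(2,3) by (simp add: mult.commute)
  have W: "negligible_on (\<lambda>_. UNIV) (\<lambda>\<epsilon> x. weight x * norm (v \<epsilon> x - w \<epsilon> x))"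
  proof (rule negligible_on_mono)
    show "negligible_on (\<lambda>_. UNIV) (\<lambda>\<epsilon> x. 2 ^ CARD('n) * (norm (monomial (\<lambda>_. 0) x *\<^sub>R (v \<epsilon> x - w \<epsilon> x)) + real CARD('n) ^ (2 * CARD('n)) * (\<Sum>j\<in>UNIV. norm (monomial (\<lambda>i. if i = j then 2 * CARD('n) else 0) x *\<^sub>R (v \<epsilon> x - w \<epsilon> x)))))"
      by (intro c negligible_on_add negligible_on_sum n) (auto intro!: always_eventually add_nonneg_nonneg mult_nonneg_nonneg sum_nonneg simp del: norm_scaleR)
  qed (use weighted_norm_le_monomials in \<open>auto intro!: always_eventually simp del: norm_scaleR\<close>)
  show ?thesis
    unfolding negligible_on_def
  proof
    fix n
    define I where "I = (\<integral>x. inverse (weight x) \<partial>(lborel :: (real^'n) measure))"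
    have "\<forall>\<^sub>0\<epsilon>. \<forall>x\<in>UNIV. weight x * norm (v \<epsilon> x - w \<epsilon> x) \<le> \<epsilon> powr (n + 1)"
      using W unfolding negligible_on_def by blast
    moreover have "\<forall>\<^sub>0\<epsilon>. I * \<epsilon> powr (n + 1) \<le> \<epsilon> powr n" by (rule small_const_mult) simp
    ultimately show "\<forall>\<^sub>0\<epsilon>. \<forall>\<xi>\<in>UNIV. norm (fourier (v \<epsilon>) \<xi> - fourier (w \<epsilon>) \<xi>) \<le> \<epsilon> powr n"
      using small_unit
    proof eventually_elim
      case (elim \<epsilon>)
      note m = schwartz_measurable[OF vw(1)[OF elim(3)]] schwartz_measurable[OF vw(2)[OF elim(3)]]
      show ?case
      proof
        fix \<xi> :: "real^'n"
        have "(wave \<xi>) \<in> borel_measurable borel"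
          by (rule borel_measurable_continuous_onI[OF continuous_wave])
        then have "norm (\<integral>x. (v \<epsilon> x - w \<epsilon> x) * wave \<xi> x \<partial>lborel) \<le> \<epsilon> powr (n + 1) * I"
          unfolding I_def
        proof (intro integrable_if_weighted_bound(2))
          show "weight x * norm ((v \<epsilon> x - w \<epsilon> x) * wave \<xi> x) \<le> \<epsilon> powr (n + 1)" for x
            using elim(1) by (simp only: norm_mult norm_wave mult_1_right) simp
        qed (use m in measurable)
        then show "norm (fourier (v \<epsilon>) \<xi> - fourier (w \<epsilon>) \<xi>) \<le> \<epsilon> powr n"
          unfolding fourier_diff[OF schwartz_integrable[OF vw(1)[OF elim(3)]] schwartz_integrable[OF vw(2)[OF elim(3)]]]
          using elim(2) by (simp add: fourier_def mult.commute)
      qed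
    qed
  qed
qed

lemma fourier_point_moderate:
  assumes "compact K" "w \<in> test_nets K" shows "moderate (\<lambda>\<epsilon>. fourier (w \<epsilon>) (\<xi> \<epsilon>))"
proof (rule iffD2[OF moderate_compose_iff_moderate_on[of "\<lambda>\<epsilon>. fourier (w \<epsilon>)" \<xi>]])
  show "moderate_on (\<lambda>\<epsilon>. {\<xi> \<epsilon>}) (\<lambda>\<epsilon> y. norm (fourier (w \<epsilon>) y))"
    using test_nets_fourier_decay[OF assms, of 0] by (rule moderate_on_mono) auto
qed

lemma fourier_point_negligible:
  fixes w :: "'n::finite fnet"
  assumes K: "compact K" and w: "w \<in> test_nets K" and n: "negligible_net (\<lambda>\<epsilon>. \<eta> \<epsilon> - \<xi> \<epsilon>)"
  shows "negligible_net (\<lambda>\<epsilon>. fourier (w \<epsilon>) (\<eta> \<epsilon>) - fourier (w \<epsilon>) (\<xi> \<epsilon>))"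
proof -
  have "moderate_on (\<lambda>_. UNIV) (\<lambda>\<epsilon> \<zeta>. norm (fourier (\<lambda>x. w \<epsilon> x * coord_prod [j] x) \<zeta>))" for j
    using test_nets_fourier_decay[OF K test_nets_mult_smooth[OF w smooth_on_coord_prod], of 0] by simp
  from moderate_on_finite_family[of "UNIV :: 'n set" "\<lambda>_. UNIV" "\<lambda>j \<epsilon> \<zeta>. norm (fourier (\<lambda>x. w \<epsilon> x * coord_prod [j] x) \<zeta>)", OF finite this]
  obtain N where N: "\<forall>\<^sub>0\<epsilon>. \<forall>j\<in>UNIV. \<forall>\<zeta>\<in>UNIV. norm (fourier (\<lambda>x. w \<epsilon> x * coord_prod [j] x) \<zeta>) \<le> \<epsilon> powr N"
    by blast
  show ?thesis
    unfolding negligible_iff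
  proof
    fix n'
    have "\<forall>\<^sub>0\<epsilon>. norm (\<eta> \<epsilon> - \<xi> \<epsilon>) \<le> \<epsilon> powr (n' - N + 1)" using n unfolding negligible_iff by blast
    moreover have "\<forall>\<^sub>0\<epsilon>. real CARD('n) * \<epsilon> powr (n' + 1) \<le> \<epsilon> powr n'" by (rule small_const_mult) simp
    ultimately show "\<forall>\<^sub>0\<epsilon>. norm (fourier (w \<epsilon>) (\<eta> \<epsilon>) - fourier (w \<epsilon>) (\<xi> \<epsilon>)) \<le> \<epsilon> powr n'"
      using N small_unit
    proof eventually_elim
      case (elim \<epsilon>)
      note sp = test_function_supp_in[OF test_nets_function[OF w elim(4)]]
      have "norm (fourier (w \<epsilon>) (\<eta> \<epsilon>) - fourier (w \<epsilon>) (\<xi> \<epsilon>)) \<le> real CARD('n) * \<epsilon> powr N * norm (\<eta> \<epsilon> - \<xi> \<epsilon>)"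
      proof (rule norm_diff_le_partials[of _ "norm (\<eta> \<epsilon> - \<xi> \<epsilon>)" UNIV])
        show "fourier (w \<epsilon>) differentiable (at z)" for z
          using smooth_on_differentiable[OF smooth_on_fourier[OF K sp]] by simp
        show "norm (partial i (fourier (w \<epsilon>)) z) \<le> \<epsilon> powr N" for i z
          using elim(3) unfolding partial_fourier[OF K sp] by (simp add: coord_prod_def)
      qed auto
      also have "\<dots> \<le> real CARD('n) * \<epsilon> powr N * \<epsilon> powr (n' - N + 1)"
        using elim by (intro mult_left_mono) auto
      also have "\<dots> = real CARD('n) * \<epsilon> powr (n' + 1)" by (simp add: mult.assoc flip: powr_add)
      also have "\<dots> \<le> \<epsilon> powr n'" by (rule elim)
      finally show ?case .
    qed
  qed
qed

definition zero_extension :: "(real^'n) set \<Rightarrow> 'n fnet \<Rightarrow> 'n fnet" where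
  "zero_extension \<Omega> v = (\<lambda>\<epsilon> x. if x \<in> \<Omega> then v \<epsilon> x else 0)"

lemma zero_extension_test_nets:
  assumes "open \<Omega>" "v \<in> EM \<Omega>" "compact K" "K \<subseteq> \<Omega>" "\<forall>\<epsilon>\<in>{0<..1}. \<forall>x\<in>\<Omega> - K. v \<epsilon> x = 0"
  shows "zero_extension \<Omega> v \<in> test_nets K"
  by (rule test_netsI[OF assms(1-4)]) (use assms(5) in \<open>auto simp: zero_extension_def\<close>)

lemma fourier_zero_extension_negligible_on:
  fixes v w :: "'n::finite fnet"
  assumes "open \<Omega>" "(v, w) \<in> Grel \<Omega>"
    and K: "compact K" "K \<subseteq> \<Omega>" "\<forall>\<epsilon>\<in>{0<..1}. \<forall>x\<in>\<Omega> - K. v \<epsilon> x = 0"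
    and L: "compact L" "L \<subseteq> \<Omega>" "\<forall>\<epsilon>\<in>{0<..1}. \<forall>x\<in>\<Omega> - L. w \<epsilon> x = 0"
  shows "negligible_on (\<lambda>_. UNIV) (\<lambda>\<epsilon> \<xi>. norm (fourier (zero_extension \<Omega> v \<epsilon>) \<xi> - fourier (zero_extension \<Omega> w \<epsilon>) \<xi>))"
  unfolding negligible_on_def
proof
  fix n
  have vw: "v \<in> EM \<Omega>" "w \<in> EM \<Omega>" "(\<lambda>\<epsilon> x. v \<epsilon> x - w \<epsilon> x) \<in> null_nets \<Omega>"
    using assms(2) by (auto simp: Grel_iff[OF assms(1)])
  have KL: "compact (K \<union> L)" "K \<union> L \<subseteq> \<Omega>" using K L by auto
  note v' = zero_extension_test_nets[OF assms(1) vw(1) K]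
  note w' = zero_extension_test_nets[OF assms(1) vw(2) L]
  have "negligible_on (\<lambda>_. K \<union> L) (\<lambda>\<epsilon> x. norm (pd [] (\<lambda>x. v \<epsilon> x - w \<epsilon> x) x))"
    using vw(3) KL unfolding null_nets_def by blast
  then have "\<forall>\<^sub>0\<epsilon>. \<forall>x\<in>K \<union> L. norm (v \<epsilon> x - w \<epsilon> x) \<le> \<epsilon> powr (n + 1)"
    unfolding negligible_on_def by simp
  moreover have "\<forall>\<^sub>0\<epsilon>. measure lborel (K \<union> L) * \<epsilon> powr (n + 1) \<le> \<epsilon> powr n" by (rule small_const_mult) simp
  ultimately show "\<forall>\<^sub>0\<epsilon>. \<forall>\<xi>\<in>UNIV. norm (fourier (zero_extension \<Omega> v \<epsilon>) \<xi> - fourier (zero_extension \<Omega> w \<epsilon>) \<xi>) \<le> \<epsilon> powr n"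
    using small_unit
  proof eventually_elim
    case (elim \<epsilon>)
    have z: "zero_extension \<Omega> v \<epsilon> x - zero_extension \<Omega> w \<epsilon> x = (if x \<in> K \<union> L then v \<epsilon> x - w \<epsilon> x else 0)" for x
      using K(2,3) L(2,3) elim(3) by (auto simp: zero_extension_def)
    show ?case
    proof
      fix \<xi>
      have "norm (fourier (\<lambda>x. zero_extension \<Omega> v \<epsilon> x - zero_extension \<Omega> w \<epsilon> x) \<xi>) \<le> \<epsilon> powr (n + 1) * measure lborel (K \<union> L)"
        by (rule norm_fourier_le[OF KL(1)]) (use elim(1) z in auto)
      then show "norm (fourier (zero_extension \<Omega> v \<epsilon>) \<xi> - fourier (zero_extension \<Omega> w \<epsilon>) \<xi>) \<le> \<epsilon> powr n"
        using elim(2) fourier_diff[OF integrable_supp_in[OF K(1) test_function_supp_in[OF test_nets_function[OF v' elim(3)]]]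
            integrable_supp_in[OF L(1) test_function_supp_in[OF test_nets_function[OF w' elim(3)]]], of \<xi>]
        by (simp add: mult.commute)
    qed
  qed
qed

lemma negligible_on_negligible_net:
  assumes "negligible_on (\<lambda>_. UNIV) (\<lambda>\<epsilon> \<xi>. norm (f \<epsilon> \<xi>))" shows "negligible_net (\<lambda>\<epsilon>. f \<epsilon> (\<xi> \<epsilon>))"
  unfolding negligible_iff_negligible_on using assms by (rule negligible_on_mono) auto

text \<open>The point value may be computed with any compactly supported representative of \<open>v\<close>: the other members
of the classes involved, and other representatives of \<open>\<xi>\<close>, only change the value by negligible nets.
That the transform is again a moderate net of Schwartz functions is what makes the class of
transforms nonempty.\<close>

lemma GSpoint_fourier:
  assumes "open \<Omega>" "v \<in> Gc \<Omega>" "v' \<in> v" and K: "compact K" "K \<subseteq> \<Omega>" "\<forall>\<epsilon>\<in>{0<..1}. \<forall>x\<in>\<Omega> - K. v' \<epsilon> x = 0"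
    and \<xi>: "represents \<xi>' \<xi>"
  shows "represents (\<lambda>\<epsilon>. fourier (zero_extension \<Omega> v' \<epsilon>) (\<xi>' \<epsilon>)) (GSpoint (GSfourier (Gc_to_GS \<Omega> v)) \<xi>)"
proof -
  have v: "v \<in> G \<Omega>" using assms(2) by (simp add: Gc_def)
  define w where "w = zero_extension \<Omega> v'"
  have w: "w \<in> test_nets K"
    unfolding w_def by (rule zero_extension_test_nets[OF assms(1) G_EM[OF assms(1) v assms(3)] K])
  have "w \<in> Gc_to_GS \<Omega> v"
    unfolding Gc_to_GS_def
  proof (rule ImageI[OF GSrel_refl[OF test_nets_ES[OF K(1) w]]])
    show "w \<in> {(\<lambda>\<epsilon> x. if x \<in> \<Omega> then v' \<epsilon> x else 0) |v'. v' \<in> v \<and> (\<exists>K. compact K \<and> K \<subseteq> \<Omega> \<and> (\<forall>\<epsilon>\<in>{0<..1}. \<forall>x\<in>\<Omega> - K. v' \<epsilon> x = 0))}"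
      unfolding w_def zero_extension_def using assms(3) K by blast
  qed
  then have mem: "(\<lambda>\<epsilon>. fourier (w \<epsilon>)) \<in> GSfourier (Gc_to_GS \<Omega> v)"
    unfolding GSfourier_def using GSrel_refl[OF fourier_in_ES[OF K(1) w]] by blast
  note mod = fourier_point_moderate[OF K(1) w]
  have "GSpoint (GSfourier (Gc_to_GS \<Omega> v)) \<xi> = abs_colombeau (\<lambda>\<epsilon>. fourier (w \<epsilon>) (\<xi>' \<epsilon>))"
    unfolding GSpoint_def
  proof (rule the_equality)
    show "\<exists>w'\<in>GSfourier (Gc_to_GS \<Omega> v). \<exists>\<xi>''. represents \<xi>'' \<xi> \<and>
      abs_colombeau (\<lambda>\<epsilon>. fourier (w \<epsilon>) (\<xi>' \<epsilon>)) = abs_colombeau (\<lambda>\<epsilon>. w' \<epsilon> (\<xi>'' \<epsilon>))"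
      using mem \<xi> by (intro bexI[OF _ mem] exI[of _ \<xi>'] conjI refl)
    fix y assume "\<exists>w'\<in>GSfourier (Gc_to_GS \<Omega> v). \<exists>\<xi>''. represents \<xi>'' \<xi> \<and> y = abs_colombeau (\<lambda>\<epsilon>. w' \<epsilon> (\<xi>'' \<epsilon>))"
    then obtain p \<xi>'' where p: "p \<in> GSfourier (Gc_to_GS \<Omega> v)" "represents \<xi>'' \<xi>" "y = abs_colombeau (\<lambda>\<epsilon>. p \<epsilon> (\<xi>'' \<epsilon>))"
      by blast
    obtain q where q: "q \<in> Gc_to_GS \<Omega> v" "((\<lambda>\<epsilon>. fourier (q \<epsilon>)), p) \<in> GSrel"
      using p(1) unfolding GSfourier_def by blast
    obtain v'' L where v'': "v'' \<in> v" "compact L" "L \<subseteq> \<Omega>" "\<forall>\<epsilon>\<in>{0<..1}. \<forall>x\<in>\<Omega> - L. v'' \<epsilon> x = 0"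
      "(zero_extension \<Omega> v'', q) \<in> GSrel"
      using q(1) unfolding Gc_to_GS_def zero_extension_def by blast
    have n1: "negligible_net (\<lambda>\<epsilon>. fourier (q \<epsilon>) (\<xi>'' \<epsilon>) - p \<epsilon> (\<xi>'' \<epsilon>))"
    proof (rule negligible_on_negligible_net[of "\<lambda>\<epsilon> \<xi>. fourier (q \<epsilon>) \<xi> - p \<epsilon> \<xi>"])
      have "\<forall>n::nat. sup_bigo UNIV (\<lambda>\<epsilon> x. monomial (\<lambda>_. 0) x *\<^sub>R mpartial (\<lambda>_. 0) (\<lambda>x. fourier (q \<epsilon>) x - p \<epsilon> x) x) (\<lambda>\<epsilon>. \<epsilon> ^ n)"
        using q(2) unfolding GSrel_def by blast
      then show "negligible_on (\<lambda>_. UNIV) (\<lambda>\<epsilon> \<xi>. norm (fourier (q \<epsilon>) \<xi> - p \<epsilon> \<xi>))"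
        by (simp add: sup_bigo_negligible_on mpartial_0 monomial_def)
    qed
    have n2: "negligible_net (\<lambda>\<epsilon>. fourier (zero_extension \<Omega> v'' \<epsilon>) (\<xi>'' \<epsilon>) - fourier (q \<epsilon>) (\<xi>'' \<epsilon>))"
      by (rule negligible_on_negligible_net[OF GSrel_fourier_negligible_on[OF v''(5)]])
    have n3: "negligible_net (\<lambda>\<epsilon>. fourier (w \<epsilon>) (\<xi>'' \<epsilon>) - fourier (zero_extension \<Omega> v'' \<epsilon>) (\<xi>'' \<epsilon>))"
      unfolding w_def
      by (rule negligible_on_negligible_net[OF fourier_zero_extension_negligible_on[OF assms(1) G_Grel[OF assms(1) v assms(3) v''(1)] K v''(2-4)]])
    have n4: "negligible_net (\<lambda>\<epsilon>. fourier (w \<epsilon>) (\<xi>' \<epsilon>) - fourier (w \<epsilon>) (\<xi>'' \<epsilon>))"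
      by (rule fourier_point_negligible[OF K(1) w represents_unique[OF \<xi> p(2)]])
    have n: "negligible_net (\<lambda>\<epsilon>. fourier (w \<epsilon>) (\<xi>' \<epsilon>) - p \<epsilon> (\<xi>'' \<epsilon>))"
      using negligible_add[OF negligible_add[OF n4 n3] negligible_add[OF n2 n1]] by simp
    then have "negligible_net (\<lambda>\<epsilon>. p \<epsilon> (\<xi>'' \<epsilon>) - fourier (w \<epsilon>) (\<xi>' \<epsilon>))" by (rule negligible_diff_commute)
    with moderate_if_close[OF mod this] n show "y = abs_colombeau (\<lambda>\<epsilon>. fourier (w \<epsilon>) (\<xi>' \<epsilon>))"
      unfolding p(3) by (subst abs_colombeau_eq_iff) (auto intro: mod)
  qed
  then show ?thesis using represents_abs[OF mod] by (simp add: w_def)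
qed

section \<open>Microlocal regularity and regularity\<close>

text \<open>A representative all of whose values, and not only those for small \<open>\<epsilon>\<close>, have a common neighbourhood in
a compact subset of \<open>\<Omega>\<close>.\<close>

lemma compact_points_rep:
  assumes "open \<Omega>" "x \<in> compact_points \<Omega>"
  obtains x' K \<delta> where "represents x' x" "\<delta> > 0" "compact K" "K \<subseteq> \<Omega>"
    "\<And>\<epsilon> y. norm (y - x' \<epsilon>) \<le> \<delta> \<Longrightarrow> y \<in> K"
proof -
  obtain z L where z: "represents z x" "compact L" "L \<subseteq> \<Omega>" "\<forall>\<^sub>0\<epsilon>. z \<epsilon> \<in> L"
    using assms(2) by (auto simp: compact_points_def)
  have "L \<noteq> {}"
    using z(4) by (auto dest: eventually_happens simp: trivial_limit_at_right_real)
  then obtain c where c: "c \<in> L" by blast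
  define x' where "x' \<epsilon> = (if z \<epsilon> \<in> L then z \<epsilon> else c)" for \<epsilon>
  have "negligible_net (\<lambda>\<epsilon>. x' \<epsilon> - z \<epsilon>)"
    by (rule negligible_if_eventually_0) (use z(4) in \<open>auto simp: x'_def elim: eventually_mono\<close>)
  then have x': "represents x' x" by (rule represents_close[OF z(1)])
  obtain \<delta> K where "\<delta> > 0" "compact K" "K \<subseteq> \<Omega>" "\<And>x y. x \<in> L \<Longrightarrow> norm (y - x) \<le> \<delta> \<Longrightarrow> y \<in> K"
    using compact_neighbourhood[OF z(2) assms(1) z(3)] by metis
  moreover have "x' \<epsilon> \<in> L" for \<epsilon> using c by (simp add: x'_def)
  ultimately show thesis using x' by (intro that[of x' \<delta> K]) blast+
qed

lemma moderate_if_bounded_diff: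
  assumes "moderate x" "\<forall>\<^sub>0\<epsilon>. norm (s \<epsilon> - x \<epsilon>) \<le> \<delta>" shows "moderate s"
proof -
  obtain N where N: "\<forall>\<^sub>0\<epsilon>. norm (x \<epsilon>) \<le> \<epsilon> powr N" using assms(1) by (auto simp: moderate_iff)
  define m where "m = min N (-1) - 1"
  have "\<forall>\<^sub>0\<epsilon>. 2 * \<epsilon> powr (min N (-1)) \<le> \<epsilon> powr m" unfolding m_def by (rule small_const_mult) auto
  moreover have "\<forall>\<^sub>0\<epsilon>. \<delta> \<le> \<epsilon> powr (-1)" by (rule small_const_le) auto
  ultimately have "\<forall>\<^sub>0\<epsilon>. norm (s \<epsilon>) \<le> \<epsilon> powr m"
    using N assms(2) small_unit
  proof eventually_elim
    case (elim \<epsilon>)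
    have "norm (s \<epsilon>) \<le> norm (x \<epsilon>) + norm (s \<epsilon> - x \<epsilon>)"
      using norm_triangle_ineq[of "x \<epsilon>" "s \<epsilon> - x \<epsilon>"] by simp
    also have "\<dots> \<le> \<epsilon> powr N + \<epsilon> powr (-1)" using elim by linarith
    also have "\<dots> \<le> \<epsilon> powr (min N (-1)) + \<epsilon> powr (min N (-1))"
      using elim(5) by (intro add_mono powr_mono') auto
    also have "\<dots> \<le> \<epsilon> powr m" using elim(1) by simp
    finally show ?case .
  qed
  then show ?thesis unfolding moderate_iff by blast
qed

lemma bump_net_EM:
  fixes c :: "real \<Rightarrow> real^'n"
  assumes "open \<Omega>" "\<And>\<epsilon>. \<epsilon> \<in> {0<..1} \<Longrightarrow> q \<epsilon> > 0" "\<forall>\<^sub>0\<epsilon>. \<epsilon> powr a \<le> q \<epsilon>"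
  shows "(\<lambda>\<epsilon>. bump (c \<epsilon>) (q \<epsilon>)) \<in> EM \<Omega>"
  unfolding EM_iff[OF assms(1)]
proof (intro conjI ballI allI impI)
  show "smooth_on \<Omega> (bump (c \<epsilon>) (q \<epsilon>))" if "\<epsilon> \<in> {0<..1}" for \<epsilon>
    using smooth_on_bump[OF assms(2)[OF that]] by (rule smooth_on_subset) simp
  fix K "is"
  obtain M where M: "M \<ge> 0" "\<And>c r (x::real^'n). r > 0 \<Longrightarrow> norm (pd is (bump c r) x) \<le> M * (1 / r) ^ length is"
    using pd_bump_bound by blast
  show "moderate_on (\<lambda>_. K) (\<lambda>\<epsilon> x. norm (pd is (bump (c \<epsilon>) (q \<epsilon>)) x))"
  proof (rule moderate_on_mono)
    show "moderate_on (\<lambda>_. K) (\<lambda>\<epsilon> _. M * \<epsilon> powr (- a * real (length is)))"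
      using M(1) by (intro moderate_on_mult moderate_on_const moderate_on_powr) auto
    show "\<forall>\<^sub>0\<epsilon>. \<forall>x\<in>K. x \<in> K \<and> norm (pd is (bump (c \<epsilon>) (q \<epsilon>)) x) \<le> M * \<epsilon> powr (- a * real (length is))"
      using assms(3) small_unit
    proof eventually_elim
      case (elim \<epsilon>)
      then have "1 / q \<epsilon> \<le> 1 / \<epsilon> powr a" "0 < \<epsilon>" "0 < q \<epsilon>"
        using assms(2)[of \<epsilon>] by (auto intro!: divide_left_mono)
      then have "(1 / q \<epsilon>) ^ length is \<le> (\<epsilon> powr (- a)) ^ length is"
        by (intro power_mono) (auto simp: powr_minus_divide)
      also have "\<dots> = \<epsilon> powr (- a * real (length is))"
        using \<open>0 < \<epsilon>\<close> by (simp add: powr_powr flip: powr_realpow)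
      finally have "M * (1 / q \<epsilon>) ^ length is \<le> M * \<epsilon> powr (- a * real (length is))"
        using M(1) by (rule mult_left_mono)
      with M(2)[OF \<open>0 < q \<epsilon>\<close>, of "c \<epsilon>"] show ?case by (meson order_trans)
    qed
  qed
qed

lemma represents_ginverse:
  assumes "represents x' x" "\<forall>\<^sub>0\<epsilon>. \<epsilon> powr a \<le> x' \<epsilon>"
  shows "represents (\<lambda>\<epsilon>. inverse (x' \<epsilon>)) (ginverse x)"
proof -
  have inv: "x * ginverse x = 1" by (rule ginvertible_mult_ginverse[OF ginvertibleI[OF assms]])
  obtain y where y: "represents y (ginverse x)" using represents_ex by blast
  have "negligible_net (\<lambda>\<epsilon>. x' \<epsilon> * y \<epsilon> - 1)"
    using inv by (simp add: represents_eq_iff[OF represents_mult[OF assms(1) y] represents_1])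
  then have n: "\<forall>\<^sub>0\<epsilon>. norm (x' \<epsilon> * y \<epsilon> - 1) \<le> \<epsilon> powr n" for n unfolding negligible_iff by blast
  have "negligible_net (\<lambda>\<epsilon>. inverse (x' \<epsilon>) - y \<epsilon>)"
    unfolding negligible_iff
  proof
    fix n'
    show "\<forall>\<^sub>0\<epsilon>. norm (inverse (x' \<epsilon>) - y \<epsilon>) \<le> \<epsilon> powr n'"
      using n[of "n' + a"] assms(2) small_pos
    proof eventually_elim
      case (elim \<epsilon>)
      have p: "0 < \<epsilon> powr a" using elim by simp
      then have x: "0 < x' \<epsilon>" using elim by linarith
      have "y \<epsilon> - inverse (x' \<epsilon>) = (x' \<epsilon> * y \<epsilon> - 1) / x' \<epsilon>"
        using x by (simp add: field_simps)
      then have "norm (inverse (x' \<epsilon>) - y \<epsilon>) = norm (x' \<epsilon> * y \<epsilon> - 1) / x' \<epsilon>"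
        using x by (subst norm_minus_commute) (simp add: abs_divide)
      also have "\<dots> \<le> \<epsilon> powr (n' + a) / \<epsilon> powr a"
        using elim p by (intro frac_le) auto
      also have "\<dots> = \<epsilon> powr n'" by (simp add: powr_add)
      finally show ?case .
    qed
  qed
  then show ?thesis by (rule represents_close[OF y])
qed

subsection \<open>Regularity implies microlocal regularity\<close>

text \<open>The representative is modified for large \<open>\<epsilon>\<close> to make the bounds by \<open>0\<close> and \<open>\<delta>\<close> hold for all parameters;
this makes the cutoff nets below smooth at all of them.\<close>

lemma slow_scale_rep:
  assumes "r \<in> gpositive" "approx_slow_0 r" "\<delta> > 0"
  obtains r' where "represents r' r" "\<And>\<epsilon>. 0 < r' \<epsilon> \<and> r' \<epsilon> \<le> \<delta>" "\<And>a. a > 0 \<Longrightarrow> \<forall>\<^sub>0\<epsilon>. \<epsilon> powr a \<le> r' \<epsilon>"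
proof -
  obtain s where s: "represents s r" using represents_ex by blast
  have lower: "\<forall>\<^sub>0\<epsilon>. \<epsilon> powr a \<le> \<bar>s \<epsilon>\<bar>" if a: "a > 0" for a
  proof -
    have "rho_powr (a/2) \<le> gnorm r" using assms(2) a by (auto simp: approx_slow_0_def)
    then have "\<forall>\<^sub>0\<epsilon>. \<epsilon> powr (a/2) \<le> norm (s \<epsilon>) + \<epsilon> powr a"
      by (simp only: le_colombeau_iff[OF represents_rho_powr represents_gnorm[OF s]])
    moreover have "\<forall>\<^sub>0\<epsilon>. 2 * \<epsilon> powr a \<le> \<epsilon> powr (a/2)" using a by (intro small_const_mult) auto
    ultimately show ?thesis by eventually_elim simp
  qed
  have "gnorm r \<le> gconst (\<delta>/2)" using assms by (auto simp: approx_slow_0_def)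
  then have "\<forall>\<^sub>0\<epsilon>. norm (s \<epsilon>) \<le> \<delta>/2 + \<epsilon> powr 1"
    by (simp only: le_colombeau_iff[OF represents_gnorm[OF s] represents_gconst])
  moreover have "\<forall>\<^sub>0\<epsilon>. \<epsilon> powr 1 < \<delta>/2" using assms(3) by (intro small_powr_le) auto
  moreover have "0 \<le> r" using assms(1) by (simp add: gpositive_def)
  then have "\<forall>\<^sub>0\<epsilon>. 0 \<le> s \<epsilon> + \<epsilon> powr 2" by (simp only: le_colombeau_iff[OF represents_0 s])
  moreover have "\<forall>\<^sub>0\<epsilon>. 2 * \<epsilon> powr 2 \<le> \<epsilon> powr 1" by (rule small_const_mult) simp
  ultimately have good: "\<forall>\<^sub>0\<epsilon>. 0 < s \<epsilon> \<and> s \<epsilon> \<le> \<delta>"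
    using lower[of 1, OF zero_less_one] small_pos
  proof eventually_elim
    case (elim \<epsilon>)
    have "0 < \<epsilon> powr 2" using elim by simp
    with elim show ?case by (auto simp: abs_if split: if_splits)
  qed
  define r' where "r' \<epsilon> = (if 0 < s \<epsilon> \<and> s \<epsilon> \<le> \<delta> then s \<epsilon> else \<delta>)" for \<epsilon>
  have eq: "\<forall>\<^sub>0\<epsilon>. r' \<epsilon> = s \<epsilon>" using good by eventually_elim (simp add: r'_def)
  show thesis
  proof
    have "negligible_net (\<lambda>\<epsilon>. r' \<epsilon> - s \<epsilon>)"
      by (rule negligible_if_eventually_0) (use eq in \<open>auto elim: eventually_mono\<close>)
    then show "represents r' r" by (rule represents_close[OF s])
    show "0 < r' \<epsilon> \<and> r' \<epsilon> \<le> \<delta>" for \<epsilon> using assms(3) by (simp add: r'_def)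
    show "\<forall>\<^sub>0\<epsilon>. \<epsilon> powr a \<le> r' \<epsilon>" if "a > 0" for a
      using lower[OF that] eq good by eventually_elim simp
  qed
qed

text \<open>The order of growth on a ball does not depend on the point: otherwise choose, for each order,
  a violating derivative and violating points along a sequence of parameters, and interleave these
  sequences to a single generalized point of the ball that has no order at all.\<close>

lemma uniform_growth_order:
  fixes u :: "'n::finite fnet set"
  assumes "open \<Omega>" "u \<in> G \<Omega>" "u' \<in> u"
    and x0: "represents x0' x0" "compact K" "K \<subseteq> \<Omega>" "\<And>\<epsilon> y. norm (y - x0' \<epsilon>) \<le> \<delta> \<Longrightarrow> y \<in> K"
    and r: "represents r' r" "\<And>\<epsilon>. 0 < r' \<epsilon> \<and> r' \<epsilon> \<le> \<delta>"
    and reg: "\<And>x. gnorm (x - x0) \<le> r \<Longrightarrow> Ginf_at \<Omega> u x"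
  shows "\<exists>N. \<forall>is. \<forall>\<^sub>0\<epsilon>. \<forall>x\<in>cball (x0' \<epsilon>) (r' \<epsilon>). norm (pd is (u' \<epsilon>) x) \<le> \<epsilon> powr N"
proof -
  have "\<exists>N::nat. \<forall>\<alpha>. \<forall>\<^sub>0\<epsilon>. \<forall>x\<in>cball (x0' \<epsilon>) (r' \<epsilon>). norm (pd (mlist \<alpha>) (u' \<epsilon>) x) \<le> \<epsilon> powr (- real N)"
  proof (rule ccontr)
    assume "\<not> ?thesis"
    then have "\<forall>N::nat. \<exists>\<alpha>. \<not> (\<forall>\<^sub>0\<epsilon>. \<forall>x\<in>cball (x0' \<epsilon>) (r' \<epsilon>). norm (pd (mlist \<alpha>) (u' \<epsilon>) x) \<le> \<epsilon> powr (- real N))"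
      by blast
    from choice[OF this] obtain \<alpha> where \<alpha>: "\<And>N::nat. \<not> (\<forall>\<^sub>0\<epsilon>. \<forall>x\<in>cball (x0' \<epsilon>) (r' \<epsilon>). norm (pd (mlist (\<alpha> N)) (u' \<epsilon>) x) \<le> \<epsilon> powr (- real N))"
      by blast
    define bad where "bad N \<epsilon> x \<longleftrightarrow> x \<in> cball (x0' \<epsilon>) (r' \<epsilon>) \<and> \<not> norm (pd (mlist (\<alpha> N)) (u' \<epsilon>) x) \<le> \<epsilon> powr (- real N)" for N \<epsilon> x
    have freq: "frequently (\<lambda>\<epsilon>. \<exists>x. bad N \<epsilon> x) (at_right 0)" for N
      using \<alpha>[of N] unfolding not_eventually bad_def by (rule frequently_mono[rotated]) blast
    obtain \<nu> where \<nu>: "\<And>N. frequently (\<lambda>\<epsilon>. \<nu> \<epsilon> = N \<and> (\<exists>x. bad N \<epsilon> x)) (at_right 0)"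
      by (rule frequently_simultaneously[of "\<lambda>N \<epsilon>. \<exists>x. bad N \<epsilon> x", OF freq]) (rule that)
    define s where "s \<epsilon> = (if \<exists>x. bad (\<nu> \<epsilon>) \<epsilon> x then SOME x. bad (\<nu> \<epsilon>) \<epsilon> x else x0' \<epsilon>)" for \<epsilon>
    have s_bad: "bad (\<nu> \<epsilon>) \<epsilon> (s \<epsilon>)" if "\<exists>x. bad (\<nu> \<epsilon>) \<epsilon> x" for \<epsilon>
      using someI_ex[OF that] that by (simp add: s_def)
    have "s \<epsilon> \<in> cball (x0' \<epsilon>) (r' \<epsilon>)" for \<epsilon>
      using s_bad[of \<epsilon>] r(2)[of \<epsilon>] by (cases "\<exists>x. bad (\<nu> \<epsilon>) \<epsilon> x") (auto simp: bad_def s_def)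
    then have s: "norm (s \<epsilon> - x0' \<epsilon>) \<le> r' \<epsilon>" for \<epsilon> by (simp add: dist_norm norm_minus_commute)
    then have sd: "norm (s \<epsilon> - x0' \<epsilon>) \<le> \<delta>" for \<epsilon> using r(2) order_trans by blast
    have mod: "moderate s"
      using x0(1) sd by (intro moderate_if_bounded_diff[of x0' s \<delta>]) (auto simp: represents_def)
    define x where "x = abs_colombeau s"
    have sx: "represents s x" unfolding x_def by (rule represents_abs[OF mod])
    have "gnorm (x - x0) \<le> r"
      by (rule le_colombeauI[OF represents_gnorm[OF represents_diff[OF sx x0(1)]] r(1)]) (simp add: s)
    from reg[OF this] obtain N :: nat where
      N: "\<And>\<alpha>. gnorm (Gpoint \<Omega> (Gderiv \<Omega> \<alpha> u) x) \<le> rho_powr (- real N)" by (auto simp: Ginf_at_def)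
    have sK: "\<forall>\<^sub>0\<epsilon>. s \<epsilon> \<in> K" using x0(4)[OF sd] by simp
    \<comment> \<open>The order is raised by one to absorb the error term in the inequality between classes.\<close>
    define M where "M = N + 1"
    from N[of "\<alpha> M"] have "\<forall>\<^sub>0\<epsilon>. norm (pd (mlist (\<alpha> M)) (u' \<epsilon>) (s \<epsilon>)) \<le> \<epsilon> powr (- real N) + \<epsilon> powr 0"
      unfolding le_colombeau_iff[OF represents_gnorm[OF Gpoint_Gderiv[OF assms(1-3) sx x0(2,3) sK]] represents_rho_powr]
      by blast
    moreover have "\<forall>\<^sub>0\<epsilon>. 2 * \<epsilon> powr (- real N) \<le> \<epsilon> powr (- real M)"
      unfolding M_def by (rule small_const_mult) simp
    ultimately have "\<forall>\<^sub>0\<epsilon>. norm (pd (mlist (\<alpha> M)) (u' \<epsilon>) (s \<epsilon>)) \<le> \<epsilon> powr (- real M)"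
      using small_unit
    proof eventually_elim
      case (elim \<epsilon>)
      have "\<epsilon> powr 0 \<le> \<epsilon> powr (- real N)" using elim by (intro powr_mono') auto
      with elim show ?case by linarith
    qed
    then have "\<forall>\<^sub>0\<epsilon>. \<not> (\<nu> \<epsilon> = M \<and> (\<exists>x. bad M \<epsilon> x))"
      by eventually_elim (use s_bad in \<open>auto simp: bad_def\<close>)
    with \<nu>[of M] show False by (simp add: frequently_def)
  qed
  then obtain N :: nat where N: "\<And>\<alpha>. \<forall>\<^sub>0\<epsilon>. \<forall>x\<in>cball (x0' \<epsilon>) (r' \<epsilon>). norm (pd (mlist \<alpha>) (u' \<epsilon>) x) \<le> \<epsilon> powr (- real N)"
    by blast
  show ?thesis
  proof (intro exI[of _ "- real N"] allI)
    fix "is"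
    show "\<forall>\<^sub>0\<epsilon>. \<forall>x\<in>cball (x0' \<epsilon>) (r' \<epsilon>). norm (pd is (u' \<epsilon>) x) \<le> \<epsilon> powr (- real N)"
      using N[of "\<lambda>i. count (mset is) i"] small_unit
    proof eventually_elim
      case (elim \<epsilon>)
      show ?case
      proof
        fix x assume x: "x \<in> cball (x0' \<epsilon>) (r' \<epsilon>)"
        then have "norm (x - x0' \<epsilon>) \<le> \<delta>" using r(2)[of \<epsilon>] by (simp add: dist_norm norm_minus_commute)
        then have "x \<in> \<Omega>" using x0(3,4) by blast
        from pd_permute[OF assms(1) EM_smooth[OF G_EM[OF assms(1-3)] elim(2)] this mset_mlist_count[symmetric], of "is"]
        show "norm (pd is (u' \<epsilon>) x) \<le> \<epsilon> powr (- real N)" using elim(1) x by simp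
      qed
    qed
  qed
qed

text \<open>A slow scale net dominates \<open>\<epsilon>\<^sup>a\<close> for arbitrarily small \<open>a\<close>, so the exponent \<open>l\<close> is compensated by the
choice of \<open>a\<close>.\<close>

lemma slow_scale_inverse_power:
  assumes "\<And>a. a > 0 \<Longrightarrow> \<forall>\<^sub>0\<epsilon>. \<epsilon> powr a \<le> q \<epsilon>"
  shows "\<forall>\<^sub>0\<epsilon>. C * (1 / q \<epsilon>) ^ l \<le> \<epsilon> powr (-1)"
proof -
  define a where "a = 1 / (2 * (real l + 1))"
  have a: "a > 0" "a * real l \<le> 1/2" by (auto simp: a_def field_simps)
  have "\<forall>\<^sub>0\<epsilon>. \<bar>C\<bar> * \<epsilon> powr (- (1/2)) \<le> \<epsilon> powr (-1)" by (rule small_const_mult) simp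
  then show ?thesis
    using assms[OF a(1)] small_unit
  proof eventually_elim
    case (elim \<epsilon>)
    have e: "0 < \<epsilon>" "\<epsilon> \<le> 1" using elim by auto
    then have q: "0 < q \<epsilon>" using elim(2) powr_gt_zero[of \<epsilon> a] by linarith
    have "1 / q \<epsilon> \<le> 1 / \<epsilon> powr a" using elim(2) e q by (intro divide_left_mono) auto
    then have "(1 / q \<epsilon>) ^ l \<le> (\<epsilon> powr (- a)) ^ l"
      using q by (intro power_mono) (auto simp: powr_minus_divide)
    also have "\<dots> = \<epsilon> powr (- (a * real l))" using e by (simp add: powr_powr flip: powr_realpow)
    also have "\<dots> \<le> \<epsilon> powr (- (1/2))" using e a by (intro powr_mono') auto
    finally have "\<bar>C\<bar> * (1 / q \<epsilon>) ^ l \<le> \<bar>C\<bar> * \<epsilon> powr (- (1/2))" by (intro mult_left_mono) auto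
    moreover have "C * (1 / q \<epsilon>) ^ l \<le> \<bar>C\<bar> * (1 / q \<epsilon>) ^ l" using q by (intro mult_right_mono) auto
    ultimately show ?case using elim(1) by linarith
  qed
qed

text \<open>By Leibniz's rule; all derivatives of the cutoff together cost at most the factor \<open>\<epsilon>\<^sup>-\<^sup>2\<close>, whatever
their number.\<close>

lemma slow_cutoff_derivatives:
  fixes u :: "'n::finite fnet"
  assumes "open \<Omega>" "\<And>\<epsilon>. \<epsilon> \<in> {0<..1} \<Longrightarrow> smooth_on \<Omega> (u \<epsilon>)"
    and ball: "\<And>\<epsilon>. cball (x0 \<epsilon>) (r \<epsilon>) \<subseteq> \<Omega>"
    and q: "\<And>\<epsilon>. 0 < q \<epsilon>" "\<And>\<epsilon>. 2 * real CARD('n) * q \<epsilon> \<le> r \<epsilon>" "\<And>a. a > 0 \<Longrightarrow> \<forall>\<^sub>0\<epsilon>. \<epsilon> powr a \<le> q \<epsilon>"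
    and N: "\<And>is. \<forall>\<^sub>0\<epsilon>. \<forall>x\<in>cball (x0 \<epsilon>) (r \<epsilon>). norm (pd is (u \<epsilon>) x) \<le> \<epsilon> powr N"
  shows "\<forall>\<^sub>0\<epsilon>. \<forall>x. norm (pd is (\<lambda>x. bump (x0 \<epsilon>) (q \<epsilon>) x * u \<epsilon> x) x) \<le> \<epsilon> powr (N - 2)"
proof -
  have "\<forall>p::'n list. \<exists>M\<ge>0. \<forall>c r (x::real^'n). r > 0 \<longrightarrow> norm (pd p (bump c r) x) \<le> M * (1 / r) ^ length p"
    using pd_bump_bound by blast
  from choice[OF this] obtain M where M: "\<And>p c r (x::real^'n). r > 0 \<Longrightarrow> norm (pd p (bump c r) x) \<le> M p * (1 / r) ^ length p"
    by blast
  have 1: "\<forall>\<^sub>0\<epsilon>. \<forall>p\<in>set (splits is). M (fst p) * (1 / q \<epsilon>) ^ length (fst p) \<le> \<epsilon> powr (-1)"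
    by (intro eventually_ball_finite ballI slow_scale_inverse_power q(3)) auto
  have 2: "\<forall>\<^sub>0\<epsilon>. \<forall>p\<in>set (splits is). \<forall>x\<in>cball (x0 \<epsilon>) (r \<epsilon>). norm (pd (snd p) (u \<epsilon>) x) \<le> \<epsilon> powr N"
    by (intro eventually_ball_finite ballI N) auto
  have "\<forall>\<^sub>0\<epsilon>. real (length (splits is)) * \<epsilon> powr (N - 1) \<le> \<epsilon> powr (N - 2)" by (rule small_const_mult) simp
  with 1 2 show ?thesis using small_unit
  proof eventually_elim
    case (elim \<epsilon>)
    show ?case
    proof
      fix x
      show "norm (pd is (\<lambda>x. bump (x0 \<epsilon>) (q \<epsilon>) x * u \<epsilon> x) x) \<le> \<epsilon> powr (N - 2)"
      proof (cases "x \<in> cball (x0 \<epsilon>) (r \<epsilon>)")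
        case True
        then have x\<Omega>: "x \<in> \<Omega>" using ball by blast
        have sb: "smooth_on \<Omega> (bump (x0 \<epsilon>) (q \<epsilon>))"
          using smooth_on_bump[OF q(1)] by (rule smooth_on_subset) simp
        have "norm (pd is (\<lambda>x. bump (x0 \<epsilon>) (q \<epsilon>) x * u \<epsilon> x) x)
          \<le> (\<Sum>p\<leftarrow>splits is. norm (pd (fst p) (bump (x0 \<epsilon>) (q \<epsilon>)) x) * norm (pd (snd p) (u \<epsilon>) x))"
          by (rule Leibniz_bound[OF assms(1) sb assms(2)[OF elim(4)] x\<Omega>])
        also have "\<dots> \<le> (\<Sum>p\<leftarrow>splits is. \<epsilon> powr (-1) * \<epsilon> powr N)"
        proof (rule sum_list_mono)
          fix p assume p: "p \<in> set (splits is)"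
          have "norm (pd (fst p) (bump (x0 \<epsilon>) (q \<epsilon>)) x) \<le> \<epsilon> powr (-1)"
            using M[OF q(1), of "fst p" "x0 \<epsilon>" \<epsilon> x] elim(1) p by (meson order_trans)
          then show "norm (pd (fst p) (bump (x0 \<epsilon>) (q \<epsilon>)) x) * norm (pd (snd p) (u \<epsilon>) x) \<le> \<epsilon> powr (-1) * \<epsilon> powr N"
            using elim(2) p True by (intro mult_mono) auto
        qed
        also have "\<dots> = real (length (splits is)) * \<epsilon> powr (N - 1)"
          using powr_add[of \<epsilon> "-1" N] by (simp add: sum_list_triv)
        also have "\<dots> \<le> \<epsilon> powr (N - 2)" by (rule elim)
        finally show ?thesis .
      next
        case False
        have "pd is (\<lambda>x. bump (x0 \<epsilon>) (q \<epsilon>) x * u \<epsilon> x) x = 0"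
        proof (rule pd_eq_0_outside[OF closed_cball _ False])
          fix y assume "y \<notin> cball (x0 \<epsilon>) (r \<epsilon>)"
          then have "r \<epsilon> < norm (y - x0 \<epsilon>)" by (simp add: dist_norm norm_minus_commute)
          with q(2)[of \<epsilon>] have "bump (x0 \<epsilon>) (q \<epsilon>) y = 0" by (intro bump_eq_0 q(1)) simp
          then show "bump (x0 \<epsilon>) (q \<epsilon>) y * u \<epsilon> y = 0" by simp
        qed
        then show ?thesis by simp
      qed
    qed
  qed
qed

text \<open>Uniformly bounded orders of all derivatives make the Fourier transform negligible on the fast
  scale: \<open>m\<close> integrations by parts gain the factor \<open>|\<xi>|\<^sup>-\<^sup>m\<close> at no cost.\<close>

lemma fourier_negligible_fast_scale:
  fixes w :: "'n::finite fnet"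
  assumes K: "compact K" and w: "w \<in> test_nets K"
    and N: "\<And>is. \<forall>\<^sub>0\<epsilon>. \<forall>x. norm (pd is (w \<epsilon>) x) \<le> \<epsilon> powr N"
    and b: "b > 0" "\<forall>\<^sub>0\<epsilon>. \<epsilon> powr (- b) \<le> norm (\<xi> \<epsilon>)"
  shows "negligible_net (\<lambda>\<epsilon>. fourier (w \<epsilon>) (\<xi> \<epsilon>))"
  unfolding negligible_iff
proof
  fix n
  \<comment> \<open>The gain \<open>\<epsilon>\<^sup>b\<^sup>m\<close> has to make up for the loss \<open>\<epsilon>\<^sup>N\<close>; one more power absorbs the constant.\<close>
  obtain m :: nat where m: "(n - N + 1) / b \<le> real m" using real_arch_simple by blast
  then have m': "n + 1 \<le> N + b * real m" using b(1) by (simp add: field_simps)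
  define C where "C = real CARD('n) ^ (m + 1) * measure lborel K"
  have "\<forall>\<^sub>0\<epsilon>. \<forall>j\<in>UNIV. \<forall>x. norm (pd (replicate m j) (w \<epsilon>) x) \<le> \<epsilon> powr N"
    by (intro eventually_ball_finite ballI N) auto
  moreover have "\<forall>\<^sub>0\<epsilon>. C * \<epsilon> powr (n + 1) \<le> \<epsilon> powr n" by (rule small_const_mult) simp
  ultimately show "\<forall>\<^sub>0\<epsilon>. norm (fourier (w \<epsilon>) (\<xi> \<epsilon>)) \<le> \<epsilon> powr n"
    using b(2) small_unit
  proof eventually_elim
    case (elim \<epsilon>)
    have e: "0 < \<epsilon>" "\<epsilon> \<le> 1" using elim by auto
    have "\<epsilon> powr (- (b * real m)) = (\<epsilon> powr (- b)) ^ m"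
      using e by (simp add: powr_powr flip: powr_realpow)
    also have "\<dots> \<le> norm (\<xi> \<epsilon>) ^ m" using elim(3) by (intro power_mono) auto
    finally have "\<epsilon> powr (- (b * real m)) * norm (fourier (w \<epsilon>) (\<xi> \<epsilon>)) \<le> norm (\<xi> \<epsilon>) ^ m * norm (fourier (w \<epsilon>) (\<xi> \<epsilon>))"
      by (intro mult_right_mono) auto
    also have "\<dots> \<le> real CARD('n) ^ (m + 1) * \<epsilon> powr N * measure lborel K"
      using elim(1) by (intro fourier_decay[OF K test_nets_function[OF w elim(4)]]) auto
    also have "\<dots> = C * \<epsilon> powr N" by (simp add: C_def)
    finally have "\<epsilon> powr (b * real m) * (\<epsilon> powr (- (b * real m)) * norm (fourier (w \<epsilon>) (\<xi> \<epsilon>))) \<le> \<epsilon> powr (b * real m) * (C * \<epsilon> powr N)"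
      by (rule mult_left_mono) simp
    then have "norm (fourier (w \<epsilon>) (\<xi> \<epsilon>)) \<le> C * \<epsilon> powr (N + b * real m)"
      using e by (simp add: powr_minus powr_add mult_ac)
    also have "\<dots> \<le> C * \<epsilon> powr (n + 1)"
      using e m' by (intro mult_left_mono powr_mono') (auto simp: C_def)
    also have "\<dots> \<le> \<epsilon> powr n" by (rule elim)
    finally show ?case .
  qed
qed

text \<open>The cutoff has the width \<open>r' / (2 d)\<close>: thus it is supported in the ball of radius \<open>r'\<close> and equals one
on a smaller slow scale ball, which contains all points that are fast close to \<open>x\<^sub>0\<close>.\<close>

lemma regular_imp_microlocally_regular:
  fixes \<Omega> :: "(real^'n) set"
  assumes "open \<Omega>" "x0 \<in> compact_points \<Omega>" "u \<in> G \<Omega>"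
    and V: "slow_scale_nbhd \<Omega> x0 V" "Ginf_on \<Omega> u V"
  shows "microlocally_regular \<Omega> u x0 \<xi>0"
proof -
  obtain x0' K \<delta> where x0': "represents x0' x0" "\<delta> > 0" "compact K" "K \<subseteq> \<Omega>"
    "\<And>\<epsilon> y. norm (y - x0' \<epsilon>) \<le> \<delta> \<Longrightarrow> y \<in> K"
    using compact_points_rep[OF assms(1,2)] by metis
  obtain r where r: "r \<in> gpositive" "approx_slow_0 r" "{x. gnorm (x - x0) \<le> r} \<subseteq> V"
    using V(1) by (auto simp: slow_scale_nbhd_def)
  obtain r' where r': "represents r' r" "\<And>\<epsilon>. 0 < r' \<epsilon> \<and> r' \<epsilon> \<le> \<delta>" "\<And>a. a > 0 \<Longrightarrow> \<forall>\<^sub>0\<epsilon>. \<epsilon> powr a \<le> r' \<epsilon>"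
    using slow_scale_rep[OF r(1,2) x0'(2)] by metis
  obtain u' where u': "u' \<in> EM \<Omega>" "u' \<in> u" using G_ex_rep[OF assms(1,3)] by blast
  have reg: "Ginf_at \<Omega> u x" if "gnorm (x - x0) \<le> r" for x
    using V(2) r(3) that by (auto simp: Ginf_on_def)
  have "\<exists>N. \<forall>is. \<forall>\<^sub>0\<epsilon>. \<forall>x\<in>cball (x0' \<epsilon>) (r' \<epsilon>). norm (pd is (u' \<epsilon>) x) \<le> \<epsilon> powr N"
    by (rule uniform_growth_order[OF assms(1,3) u'(2) x0'(1,3,4) _ r'(1,2) reg]) (rule x0'(5))
  then obtain N where N: "\<And>is. \<forall>\<^sub>0\<epsilon>. \<forall>x\<in>cball (x0' \<epsilon>) (r' \<epsilon>). norm (pd is (u' \<epsilon>) x) \<le> \<epsilon> powr N"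
    by blast
  define D where "D = 2 * real CARD('n)"
  have D: "D \<ge> 1" "D > 0"
  proof -
    have "real CARD('n) \<ge> 1" using zero_less_card_finite[where 'a='n] by simp
    then show "D \<ge> 1" "D > 0" unfolding D_def by linarith+
  qed
  define q where "q \<epsilon> = r' \<epsilon> / D" for \<epsilon>
  have q: "0 < q \<epsilon>" "2 * real CARD('n) * q \<epsilon> \<le> r' \<epsilon>" "q \<epsilon> \<le> \<delta>" for \<epsilon>
  proof -
    show "0 < q \<epsilon>" using r'(2)[of \<epsilon>] D by (simp add: q_def)
    show "2 * real CARD('n) * q \<epsilon> \<le> r' \<epsilon>" using D by (simp add: q_def flip: D_def)
    have "r' \<epsilon> * 1 \<le> \<delta> * D" using r'(2)[of \<epsilon>] D x0'(2) by (intro mult_mono) auto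
    then show "q \<epsilon> \<le> \<delta>" using D by (simp add: q_def field_simps)
  qed
  have q_slow: "\<forall>\<^sub>0\<epsilon>. \<epsilon> powr a \<le> q \<epsilon>" if a: "a > 0" for a
  proof -
    have "\<forall>\<^sub>0\<epsilon>. D * \<epsilon> powr a \<le> \<epsilon> powr (a/2)" using a by (intro small_const_mult) simp
    then show ?thesis
      using r'(3)[of "a/2", OF half_gt_zero[OF a]]
    proof eventually_elim
      case (elim \<epsilon>)
      then have "D * \<epsilon> powr a \<le> r' \<epsilon>" by linarith
      then show ?case using D by (simp add: q_def field_simps)
    qed
  qed
  define v' where "v' \<epsilon> x = bump (x0' \<epsilon>) (q \<epsilon>) x * u' \<epsilon> x" for \<epsilon> x
  have v'EM: "v' \<in> EM \<Omega>"
    unfolding v'_def by (intro EM_mult[OF assms(1) bump_net_EM[OF assms(1) q(1) q_slow[of 1]] u'(1)]) simp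
  have v'0: "v' \<epsilon> x = 0" if "x \<notin> K" for \<epsilon> x
  proof -
    have "\<delta> < norm (x - x0' \<epsilon>)" using x0'(5) that not_le by blast
    then have "bump (x0' \<epsilon>) (q \<epsilon>) x = 0" using q(2)[of \<epsilon>] r'(2)[of \<epsilon>] by (intro bump_eq_0 q(1)) linarith
    then show ?thesis by (simp add: v'_def)
  qed
  define v where "v = Grel \<Omega> `` {v'}"
  have v: "v \<in> Gc \<Omega>" unfolding v_def by (rule Gc_I[OF assms(1) v'EM x0'(3,4)]) (use v'0 in auto)
  then have vG: "v \<in> G \<Omega>" by (simp add: Gc_def)
  have v'v: "v' \<in> v" unfolding v_def using Grel_refl[OF assms(1) v'EM] by simp
  have points: "Gpoint \<Omega> u x = Gpoint \<Omega> v x" if "x \<approx>\<^sub>f\<^sub>a\<^sub>s\<^sub>t x0" for x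
  proof -
    obtain a where a: "a > 0" "gnorm (x - x0) \<le> rho_powr a" using \<open>x \<approx>\<^sub>f\<^sub>a\<^sub>s\<^sub>t x0\<close> by (auto simp: approx_fast_def)
    obtain x' where x': "represents x' x" using represents_ex by blast
    have "\<forall>\<^sub>0\<epsilon>. norm (x' \<epsilon> - x0' \<epsilon>) \<le> \<epsilon> powr a + \<epsilon> powr a"
      using a(2) by (simp only: le_colombeau_iff[OF represents_gnorm[OF represents_diff[OF x' x0'(1)]] represents_rho_powr])
    moreover have "\<forall>\<^sub>0\<epsilon>. 2 * \<epsilon> powr a \<le> \<epsilon> powr (a/2)" using a(1) by (intro small_const_mult) simp
    ultimately have near: "\<forall>\<^sub>0\<epsilon>. norm (x' \<epsilon> - x0' \<epsilon>) \<le> q \<epsilon>"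
      using q_slow[OF half_gt_zero[OF a(1)]] by eventually_elim linarith
    have xK: "\<forall>\<^sub>0\<epsilon>. x' \<epsilon> \<in> K" using near by eventually_elim (use x0'(5) q(3) order_trans in blast)
    have "\<forall>\<^sub>0\<epsilon>. u' \<epsilon> (x' \<epsilon>) - v' \<epsilon> (x' \<epsilon>) = 0"
      using near by eventually_elim (simp add: v'_def bump_eq_1[OF q(1)])
    then show ?thesis
      unfolding represents_eq_iff[OF Gpoint_G[OF assms(1,3) u'(2) x' x0'(3,4) xK] Gpoint_G[OF assms(1) vG v'v x' x0'(3,4) xK]]
      by (rule negligible_if_eventually_0)
  qed
  define w where "w = zero_extension \<Omega> v'"
  have w_eq: "w = v'" using v'0 x0'(4) by (auto simp: w_def zero_extension_def fun_eq_iff)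
  have wK: "w \<in> test_nets K"
    unfolding w_def by (rule zero_extension_test_nets[OF assms(1) v'EM x0'(3,4)]) (use v'0 in auto)
  have ball: "cball (x0' \<epsilon>) (r' \<epsilon>) \<subseteq> \<Omega>" for \<epsilon>
  proof
    fix y assume "y \<in> cball (x0' \<epsilon>) (r' \<epsilon>)"
    then have "norm (y - x0' \<epsilon>) \<le> \<delta>" using r'(2)[of \<epsilon>] by (simp add: dist_norm norm_minus_commute)
    then show "y \<in> \<Omega>" using x0'(4,5) by blast
  qed
  have wN: "\<forall>\<^sub>0\<epsilon>. \<forall>x. norm (pd is (w \<epsilon>) x) \<le> \<epsilon> powr (N - 2)" for "is"
    unfolding w_eq v'_def
    by (rule slow_cutoff_derivatives[OF assms(1) EM_smooth[OF u'(1)] ball q(1,2) q_slow N])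
  have "GSpoint (GSfourier (Gc_to_GS \<Omega> v)) \<xi> = 0" if \<xi>: "\<xi> \<in> fast_scale" for \<xi>
  proof -
    obtain a where a: "a > 0" "rho_powr (- a) \<le> gnorm \<xi>" using \<xi> by (auto simp: fast_scale_def)
    obtain \<xi>' where \<xi>': "represents \<xi>' \<xi>" using represents_ex by blast
    have "\<forall>\<^sub>0\<epsilon>. \<epsilon> powr (- a) \<le> norm (\<xi>' \<epsilon>) + \<epsilon> powr 0"
      using a(2) by (simp only: le_colombeau_iff[OF represents_rho_powr represents_gnorm[OF \<xi>']])
    moreover have "\<forall>\<^sub>0\<epsilon>. 2 * \<epsilon> powr (- (a/2)) \<le> \<epsilon> powr (- a)" using a(1) by (intro small_const_mult) simp
    ultimately have large: "\<forall>\<^sub>0\<epsilon>. \<epsilon> powr (- (a/2)) \<le> norm (\<xi>' \<epsilon>)"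
      using small_unit
    proof eventually_elim
      case (elim \<epsilon>)
      have "\<epsilon> powr 0 \<le> \<epsilon> powr (- (a/2))" using elim a(1) by (intro powr_mono') auto
      with elim show ?case by linarith
    qed
    have "negligible_net (\<lambda>\<epsilon>. fourier (w \<epsilon>) (\<xi>' \<epsilon>) - 0)"
      using fourier_negligible_fast_scale[OF x0'(3) wK wN half_gt_zero[OF a(1)] large] by simp
    moreover have "represents (\<lambda>\<epsilon>. fourier (w \<epsilon>) (\<xi>' \<epsilon>)) (GSpoint (GSfourier (Gc_to_GS \<Omega> v)) \<xi>)"
      unfolding w_def by (rule GSpoint_fourier[OF assms(1) v v'v x0'(3,4) _ \<xi>']) (use v'0 in auto)
    ultimately show ?thesis using represents_eq_iff[OF _ represents_0] by blast
  qed
  then show ?thesis unfolding microlocally_regular_def using v points by blast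
qed

subsection \<open>Microlocal regularity implies regularity\<close>

text \<open>A transform that vanishes at the fast scale points of the fast neighbourhood of a direction is
  small there uniformly.\<close>

lemma conic_negligible_uniform:
  fixes w :: "'n::finite fnet"
  assumes K: "compact K" and w: "w \<in> test_nets K" and b: "b > 0"
    and \<xi>0: "represents \<xi>0' \<xi>0" "\<And>\<epsilon>. norm (\<xi>0' \<epsilon>) = 1"
    and van: "\<And>\<xi> \<xi>'. \<xi> \<in> fast_scale \<inter> Gamma_fast \<xi>0 \<Longrightarrow> represents \<xi>' \<xi> \<Longrightarrow> negligible_net (\<lambda>\<epsilon>. fourier (w \<epsilon>) (\<xi>' \<epsilon>))"
  shows "\<forall>\<^sub>0\<epsilon>. \<forall>\<eta>. \<epsilon> powr (- b) \<le> norm \<eta> \<longrightarrow> norm (\<eta> /\<^sub>R norm \<eta> - \<xi>0' \<epsilon>) \<le> \<epsilon> powr b \<longrightarrow>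
    norm (fourier (w \<epsilon>) \<eta>) \<le> \<epsilon> powr n"
proof -
  obtain N where N: "\<forall>\<^sub>0\<epsilon>. \<forall>\<eta>\<in>UNIV. norm \<eta> ^ 1 * norm (fourier (w \<epsilon>) \<eta>) \<le> \<epsilon> powr N"
    using test_nets_fourier_decay[OF K w, of 1] unfolding moderate_on_def by blast
  \<comment> \<open>Beyond \<open>\<epsilon>\<^sup>-\<^sup>M\<close> the decay of the transform suffices, so that the selected points are moderate.\<close>
  define M where "M = max b (n - N)"
  define A where "A \<epsilon> = {\<eta>. \<epsilon> powr (- b) \<le> norm \<eta> \<and> norm \<eta> \<le> \<epsilon> powr (- M) \<and> norm (\<eta> /\<^sub>R norm \<eta> - \<xi>0' \<epsilon>) \<le> \<epsilon> powr b}" for \<epsilon>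
  have "\<forall>\<^sub>0\<epsilon>. \<forall>\<eta>\<in>A \<epsilon>. norm (fourier (w \<epsilon>) \<eta>) \<le> \<epsilon> powr n"
  proof (rule eventually_Ball_if_selections)
    show "\<forall>\<^sub>0\<epsilon>. \<epsilon> powr (- b) *\<^sub>R \<xi>0' \<epsilon> \<in> A \<epsilon>"
      using small_unit
    proof eventually_elim
      case (elim \<epsilon>)
      have "\<epsilon> powr (- b) \<le> \<epsilon> powr (- M)" using elim by (intro powr_mono') (auto simp: M_def)
      then show ?case using elim \<xi>0(2)[of \<epsilon>] by (simp add: A_def)
    qed
  next
    fix s assume s: "\<forall>\<^sub>0\<epsilon>. s \<epsilon> \<in> A \<epsilon>"
    have "\<forall>\<^sub>0\<epsilon>. norm (s \<epsilon>) \<le> \<epsilon> powr (- M)" using s by eventually_elim (simp add: A_def)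
    then have mod: "moderate s" unfolding moderate_iff by blast
    define \<xi> where "\<xi> = abs_colombeau s"
    have rs: "represents s \<xi>" unfolding \<xi>_def by (rule represents_abs[OF mod])
    have low: "\<forall>\<^sub>0\<epsilon>. \<epsilon> powr (- b) \<le> norm (s \<epsilon>)" using s by eventually_elim (simp add: A_def)
    have "rho_powr (- b) \<le> gnorm \<xi>"
      by (rule le_colombeauI[OF represents_rho_powr represents_gnorm[OF rs] low])
    then have fast: "\<xi> \<in> fast_scale" using b by (auto simp: fast_scale_def)
    have inv: "ginvertible (gnorm \<xi>)" by (rule ginvertibleI[OF represents_gnorm[OF rs] low])
    have "represents (\<lambda>\<epsilon>. inverse (norm (s \<epsilon>)) *\<^sub>R s \<epsilon> - \<xi>0' \<epsilon>) (gscale (ginverse (gnorm \<xi>)) \<xi> - \<xi>0)"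
      by (intro represents_diff represents_gscale represents_ginverse[OF represents_gnorm[OF rs] low] rs \<xi>0)
    from represents_gnorm[OF this] have "gnorm (gscale (ginverse (gnorm \<xi>)) \<xi> - \<xi>0) \<le> rho_powr b"
      by (rule le_colombeauI[OF _ represents_rho_powr]) (use s in \<open>auto simp: A_def elim!: eventually_mono\<close>)
    then have "\<xi> \<in> Gamma_fast \<xi>0" using inv b by (auto simp: Gamma_fast_def approx_fast_def)
    with fast van rs have "negligible_net (\<lambda>\<epsilon>. fourier (w \<epsilon>) (s \<epsilon>))" by blast
    then show "\<forall>\<^sub>0\<epsilon>. norm (fourier (w \<epsilon>) (s \<epsilon>)) \<le> \<epsilon> powr n" unfolding negligible_iff by blast
  qed
  then show ?thesis
    using N small_unit
  proof eventually_elim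
    case (elim \<epsilon>)
    have e: "0 < \<epsilon>" "\<epsilon> \<le> 1" using elim by auto
    show ?case
    proof (intro allI impI)
      fix \<eta> assume \<eta>: "\<epsilon> powr (- b) \<le> norm \<eta>" "norm (\<eta> /\<^sub>R norm \<eta> - \<xi>0' \<epsilon>) \<le> \<epsilon> powr b"
      show "norm (fourier (w \<epsilon>) \<eta>) \<le> \<epsilon> powr n"
      proof (cases "norm \<eta> \<le> \<epsilon> powr (- M)")
        case True then show ?thesis using elim(1) \<eta> by (simp add: A_def)
      next
        case False
        have "\<epsilon> powr (- M) * norm (fourier (w \<epsilon>) \<eta>) \<le> norm \<eta> ^ 1 * norm (fourier (w \<epsilon>) \<eta>)"
          using False by (intro mult_right_mono) auto
        also have "\<dots> \<le> \<epsilon> powr N" using elim(2) by blast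
        finally have "\<epsilon> powr M * (\<epsilon> powr (- M) * norm (fourier (w \<epsilon>) \<eta>)) \<le> \<epsilon> powr M * \<epsilon> powr N"
          by (rule mult_left_mono) simp
        moreover have "\<epsilon> powr M * (\<epsilon> powr (- M) * norm (fourier (w \<epsilon>) \<eta>)) = norm (fourier (w \<epsilon>) \<eta>)"
          using e by (simp add: powr_minus)
        ultimately have "norm (fourier (w \<epsilon>) \<eta>) \<le> \<epsilon> powr (M + N)"
          by (simp only: powr_add)
        also have "\<dots> \<le> \<epsilon> powr n" using e by (intro powr_mono') (auto simp: M_def)
        finally show ?thesis .
      qed
    qed
  qed
qed

lemma norm_unit_diff_le:
  fixes x y :: "'a::real_normed_vector"
  assumes "x \<noteq> 0" "y \<noteq> 0"
  shows "norm (y /\<^sub>R norm y - x /\<^sub>R norm x) \<le> 2 * norm (y - x) / norm x"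
proof -
  have "y /\<^sub>R norm y - x /\<^sub>R norm x = (inverse (norm y) - inverse (norm x)) *\<^sub>R y + inverse (norm x) *\<^sub>R (y - x)"
    by (simp add: algebra_simps)
  also have "norm \<dots> \<le> \<bar>inverse (norm y) - inverse (norm x)\<bar> * norm y + inverse (norm x) * norm (y - x)"
    by (rule order_trans[OF norm_triangle_ineq]) simp
  also have "\<bar>inverse (norm y) - inverse (norm x)\<bar> * norm y = \<bar>norm x - norm y\<bar> / norm x"
  proof -
    have "(inverse (norm y) - inverse (norm x)) * norm y = (norm x - norm y) / norm x"
      using assms by (simp add: field_simps)
    then have "\<bar>(inverse (norm y) - inverse (norm x)) * norm y\<bar> = \<bar>(norm x - norm y) / norm x\<bar>" by (rule arg_cong)
    then show ?thesis by (simp add: abs_mult abs_divide)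
  qed
  also have "\<dots> + inverse (norm x) * norm (y - x) \<le> norm (y - x) / norm x + norm (y - x) / norm x"
    using norm_triangle_ineq3[of x y] by (intro add_mono divide_right_mono) (auto simp: norm_minus_commute divide_inverse mult.commute)
  finally show ?thesis by simp
qed

text \<open>Multiplication by a cutoff at scale \<open>\<epsilon>\<^sup>a\<close> convolves the transform with a function that is
  concentrated, up to negligible errors, in the ball of radius \<open>\<epsilon>\<^sup>-\<^sup>3\<^sup>a\<^sup>/\<^sup>2\<close>. At the distance \<open>\<epsilon>\<^sup>-\<^sup>2\<^sup>a\<close>
  from the origin such a ball only meets directions in a fast neighbourhood, so smallness of the
  transform near one direction survives the localization.\<close>

lemma fourier_localized_negligible:
  fixes \<phi> v :: "'n::finite fnet"
  assumes a: "0 < a" and K: "compact K" and \<phi>: "\<phi> \<in> test_nets K" and L: "compact L" and v: "v \<in> test_nets L"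
    and conc: "\<And>n. \<forall>\<^sub>0\<epsilon>. \<forall>\<zeta>. \<epsilon> powr (- (3/2) * a) \<le> norm \<zeta> \<longrightarrow> norm (fourier (\<phi> \<epsilon>) \<zeta>) \<le> \<epsilon> powr n"
    and \<xi>: "\<forall>\<^sub>0\<epsilon>. \<epsilon> powr (- 2 * a) \<le> norm (\<xi> \<epsilon>)" "moderate \<xi>"
    and conic: "\<And>n. \<forall>\<^sub>0\<epsilon>. \<forall>\<eta>. \<epsilon> powr (- (a/4)) \<le> norm \<eta> \<longrightarrow> norm (\<eta> /\<^sub>R norm \<eta> - \<xi> \<epsilon> /\<^sub>R norm (\<xi> \<epsilon>)) \<le> \<epsilon> powr (a/4) \<longrightarrow>
      norm (fourier (v \<epsilon>) \<eta>) \<le> \<epsilon> powr n"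
  shows "negligible_net (\<lambda>\<epsilon>. fourier (\<lambda>x. \<phi> \<epsilon> x * v \<epsilon> x) (\<xi> \<epsilon>))"
  unfolding negligible_iff
proof
  fix n
  obtain M1 where M1: "\<forall>\<^sub>0\<epsilon>. \<forall>\<eta>\<in>UNIV. weight \<eta> * (norm \<eta> ^ 0 * norm (fourier (v \<epsilon>) \<eta>)) \<le> \<epsilon> powr M1"
    using test_nets_fourier_weighted[OF L v, of 0] unfolding moderate_on_def by blast
  obtain M2 where M2: "\<forall>\<^sub>0\<epsilon>. \<forall>\<eta>\<in>UNIV. norm \<eta> ^ 0 * norm (fourier (\<phi> \<epsilon>) \<eta>) \<le> \<epsilon> powr M2"
    using test_nets_fourier_decay[OF K \<phi>, of 0] unfolding moderate_on_def by blast
  have "moderate_on (\<lambda>\<epsilon>. {\<xi> \<epsilon>}) (\<lambda>_ \<eta>. norm \<eta>)" using \<xi>(2) by (simp add: moderate_iff_moderate_on)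
  then have "moderate_on (\<lambda>\<epsilon>. {\<xi> \<epsilon>}) (\<lambda>\<epsilon> \<eta>. norm \<eta> + \<epsilon> powr (- (3/2) * a))"
    by (intro moderate_on_add moderate_on_powr)
  then obtain M3 where M3: "\<forall>\<^sub>0\<epsilon>. norm (\<xi> \<epsilon>) + \<epsilon> powr (- (3/2) * a) \<le> \<epsilon> powr M3"
    by (auto simp: moderate_on_def)
  have "moderate_on (\<lambda>\<epsilon>. {\<epsilon> powr M3}) (\<lambda>\<epsilon> t. t)" unfolding moderate_on_def by (intro exI[of _ M3]) simp
  then have "moderate_on (\<lambda>\<epsilon>. {\<epsilon> powr M3}) (\<lambda>\<epsilon> t. 1 + t * t)"
    by (intro moderate_on_add moderate_on_mult moderate_on_const) auto
  then obtain M4 where M4: "\<forall>\<^sub>0\<epsilon>. 1 + \<epsilon> powr M3 * \<epsilon> powr M3 \<le> \<epsilon> powr M4" by (auto simp: moderate_on_def)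
  define d where "d = real CARD('n)"
  define I where "I = fourier_const TYPE('n) * (\<integral>x. inverse (weight x) \<partial>(lborel :: (real^'n) measure))"
  have "\<forall>\<^sub>0\<epsilon>. I * \<epsilon> powr (n + 1) \<le> \<epsilon> powr n" by (rule small_const_mult) simp
  moreover have "\<forall>\<^sub>0\<epsilon>. 2 * \<epsilon> powr (a/2) \<le> \<epsilon> powr (a/4)" using a by (intro small_const_mult) simp
  moreover have "\<forall>\<^sub>0\<epsilon>. 2 * \<epsilon> powr (- (3/2) * a) \<le> \<epsilon> powr (- 2 * a)" using a by (intro small_const_mult) simp
  moreover note conc[of "n + 1 - M1"] conic[of "n + 1 - M2 - M4 * d"] \<xi>(1) M1 M2 M3 M4 small_unit
  ultimately show "\<forall>\<^sub>0\<epsilon>. norm (fourier (\<lambda>x. \<phi> \<epsilon> x * v \<epsilon> x) (\<xi> \<epsilon>)) \<le> \<epsilon> powr n"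
  proof eventually_elim
    case (elim \<epsilon>)
    have e: "0 < \<epsilon>" "\<epsilon> \<le> 1" using elim(11) by auto
    note tv = test_nets_function[OF v elim(11)] and t\<phi> = test_nets_function[OF \<phi> elim(11)]
    define R where "R = \<epsilon> powr (- (3/2) * a)"
    have \<xi>pos: "0 < norm (\<xi> \<epsilon>)" using elim(6) e powr_gt_zero[of \<epsilon> "- 2 * a"] by linarith
    \<comment> \<open>Far from \<open>\<xi>\<close> the transform of the cutoff is negligible, close to \<open>\<xi>\<close> that of \<open>v\<close>; the other
      factors are moderate. The weight makes the bound integrable in \<open>\<eta>\<close>.\<close>
    have key: "weight \<eta> * norm (fourier (v \<epsilon>) \<eta> * fourier (\<phi> \<epsilon>) (\<xi> \<epsilon> - \<eta>)) \<le> \<epsilon> powr (n + 1)" for \<eta>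
    proof (cases "R \<le> norm (\<xi> \<epsilon> - \<eta>)")
      case True
      have "weight \<eta> * norm (fourier (v \<epsilon>) \<eta> * fourier (\<phi> \<epsilon>) (\<xi> \<epsilon> - \<eta>))
        = (weight \<eta> * norm (fourier (v \<epsilon>) \<eta>)) * norm (fourier (\<phi> \<epsilon>) (\<xi> \<epsilon> - \<eta>))"
        by (simp add: norm_mult mult.assoc)
      also have "\<dots> \<le> \<epsilon> powr M1 * \<epsilon> powr (n + 1 - M1)"
        using elim(4,7) True by (intro mult_mono) (auto simp: R_def)
      also have "\<dots> = \<epsilon> powr (n + 1)" by (simp flip: powr_add)
      finally show ?thesis .
    next
      case False
      then have near: "norm (\<eta> - \<xi> \<epsilon>) \<le> R" by (simp add: norm_minus_commute)
      have up: "norm \<eta> \<le> \<epsilon> powr M3"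
        using norm_triangle_ineq[of "\<xi> \<epsilon>" "\<eta> - \<xi> \<epsilon>"] near elim(9) by (simp add: R_def)
      have "norm (\<xi> \<epsilon>) - R \<le> norm \<eta>" using norm_triangle_ineq2[of "\<xi> \<epsilon>" "\<xi> \<epsilon> - \<eta>"] near
        by (simp add: norm_minus_commute)
      then have "R \<le> norm \<eta>" using elim(3,6) by (simp add: R_def)
      moreover have "\<epsilon> powr (- (a/4)) \<le> R" unfolding R_def using e a by (intro powr_mono') auto
      ultimately have low: "\<epsilon> powr (- (a/4)) \<le> norm \<eta>" by linarith
      then have \<eta>pos: "0 < norm \<eta>" using e powr_gt_zero[of \<epsilon> "- (a/4)"] by linarith
      have "norm (\<eta> /\<^sub>R norm \<eta> - \<xi> \<epsilon> /\<^sub>R norm (\<xi> \<epsilon>)) \<le> 2 * norm (\<eta> - \<xi> \<epsilon>) / norm (\<xi> \<epsilon>)"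
        using \<xi>pos \<eta>pos by (intro norm_unit_diff_le) auto
      also have "\<dots> \<le> 2 * R / \<epsilon> powr (- 2 * a)"
        using near elim(6) e by (intro frac_le) (auto simp: R_def)
      also have "\<dots> = 2 * \<epsilon> powr (a/2)"
      proof -
        have "R / \<epsilon> powr (- 2 * a) = \<epsilon> powr (- (3/2) * a - (- 2 * a))" by (simp only: R_def powr_diff)
        also have "- (3/2) * a - (- 2 * a) = a/2" by simp
        finally show ?thesis by simp
      qed
      also have "\<dots> \<le> \<epsilon> powr (a/4)" by (rule elim(2))
      finally have dir: "norm (\<eta> /\<^sub>R norm \<eta> - \<xi> \<epsilon> /\<^sub>R norm (\<xi> \<epsilon>)) \<le> \<epsilon> powr (a/4)" .
      have "1 + norm \<eta> ^ 2 \<le> 1 + \<epsilon> powr M3 * \<epsilon> powr M3"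
        using up unfolding power2_eq_square by (intro add_mono mult_mono) auto
      also have "\<dots> \<le> \<epsilon> powr M4" by (rule elim(10))
      finally have "weight \<eta> \<le> (\<epsilon> powr M4) ^ CARD('n)" unfolding weight_def by (intro power_mono) auto
      also have "\<dots> = \<epsilon> powr (M4 * d)" using e by (simp add: d_def powr_powr flip: powr_realpow)
      finally have W: "weight \<eta> \<le> \<epsilon> powr (M4 * d)" .
      have "weight \<eta> * norm (fourier (v \<epsilon>) \<eta> * fourier (\<phi> \<epsilon>) (\<xi> \<epsilon> - \<eta>))
        = weight \<eta> * (norm (fourier (v \<epsilon>) \<eta>) * norm (fourier (\<phi> \<epsilon>) (\<xi> \<epsilon> - \<eta>)))"
        by (simp add: norm_mult)
      also have "\<dots> \<le> \<epsilon> powr (M4 * d) * (\<epsilon> powr (n + 1 - M2 - M4 * d) * \<epsilon> powr M2)"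
        using W elim(5,8) low dir by (intro mult_mono) auto
      also have "\<dots> = \<epsilon> powr (n + 1)" by (simp flip: powr_add)
      finally show ?thesis .
    qed
    have meas: "(\<lambda>\<eta>. fourier (v \<epsilon>) \<eta> * fourier (\<phi> \<epsilon>) (\<xi> \<epsilon> - \<eta>)) \<in> borel_measurable borel"
      using fourier_measurable[OF L test_function_supp_in[OF tv]] fourier_measurable[OF K test_function_supp_in[OF t\<phi>]]
      by measurable
    have "norm (fourier (\<lambda>x. \<phi> \<epsilon> x * v \<epsilon> x) (\<xi> \<epsilon>))
      = fourier_const TYPE('n) * norm (\<integral>\<eta>. fourier (v \<epsilon>) \<eta> * fourier (\<phi> \<epsilon>) (\<xi> \<epsilon> - \<eta>) \<partial>lborel)"
      unfolding fourier_mult[OF L tv K test_function_supp_in[OF t\<phi>]]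
      by (simp add: norm_mult fourier_const_nonneg)
    also have "\<dots> \<le> fourier_const TYPE('n) * (\<epsilon> powr (n + 1) * (\<integral>x. inverse (weight x) \<partial>(lborel :: (real^'n) measure)))"
      by (intro mult_left_mono integrable_if_weighted_bound(2)[OF meas key]) (simp add: fourier_const_def)
    also have "\<dots> = I * \<epsilon> powr (n + 1)" by (simp add: I_def mult_ac)
    also have "\<dots> \<le> \<epsilon> powr n" by (rule elim)
    finally show ?case .
  qed
qed

text \<open>The minimum with \<open>\<delta>\<close> keeps the support in the compact neighbourhood for all \<open>\<epsilon>\<close>; for small \<open>\<epsilon>\<close> it is
\<open>\<epsilon>\<^sup>a\<close>.\<close>

definition scale_cutoff :: "(real \<Rightarrow> real^'n) \<Rightarrow> real \<Rightarrow> real \<Rightarrow> 'n fnet" where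
  "scale_cutoff c \<delta> a \<epsilon> = bump (c \<epsilon>) (min \<delta> (\<epsilon> powr a) / (2 * real CARD('n)))"

lemma scale_cutoff_radius:
  assumes "\<delta> > 0" "a > 0"
  shows "\<epsilon> > 0 \<Longrightarrow> 0 < min \<delta> (\<epsilon> powr a) / (2 * real CARD('n::finite))"
    and "\<forall>\<^sub>0\<epsilon>. \<epsilon> powr (2 * a) < min \<delta> (\<epsilon> powr a) / (2 * real CARD('n::finite))"
    and "\<forall>\<^sub>0\<epsilon>. 1 / (min \<delta> (\<epsilon> powr a) / (2 * real CARD('n))) = 2 * real CARD('n) * \<epsilon> powr (- a)"
proof -
  show "\<epsilon> > 0 \<Longrightarrow> 0 < min \<delta> (\<epsilon> powr a) / (2 * real CARD('n::finite))" using assms by simp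
  have le: "\<forall>\<^sub>0\<epsilon>. \<epsilon> powr a < \<delta>" by (rule small_powr_le[OF assms])
  have "\<forall>\<^sub>0\<epsilon>. (4 * real CARD('n)) * \<epsilon> powr (2 * a) \<le> \<epsilon> powr a" using assms by (intro small_const_mult) simp
  with le show "\<forall>\<^sub>0\<epsilon>. \<epsilon> powr (2 * a) < min \<delta> (\<epsilon> powr a) / (2 * real CARD('n::finite))"
    using small_pos
  proof eventually_elim
    case (elim \<epsilon>)
    have pos: "0 < real CARD('n) * \<epsilon> powr (2 * a)" using elim by simp
    have "\<epsilon> powr (2 * a) * (2 * real CARD('n)) = 2 * (real CARD('n) * \<epsilon> powr (2 * a))" by simp
    also have "\<dots> < 4 * (real CARD('n) * \<epsilon> powr (2 * a))" using pos by linarith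
    also have "\<dots> \<le> \<epsilon> powr a" using elim(2) by (simp only: mult.assoc)
    finally have "\<epsilon> powr (2 * a) * (2 * real CARD('n)) < \<epsilon> powr a" .
    then have lt: "\<epsilon> powr (2 * a) * (2 * real CARD('n)) < min \<delta> (\<epsilon> powr a)" using elim(1) by simp
    have c: "0 < 2 * real CARD('n)" by simp
    show ?case by (rule iffD2[OF pos_less_divide_eq[OF c] lt])
  qed
  show "\<forall>\<^sub>0\<epsilon>. 1 / (min \<delta> (\<epsilon> powr a) / (2 * real CARD('n))) = 2 * real CARD('n) * \<epsilon> powr (- a)"
    using le
  proof eventually_elim
    case (elim \<epsilon>)
    have "min \<delta> (\<epsilon> powr a) = \<epsilon> powr a" using elim by linarith
    moreover have "1 / (y / D) = D * inverse y" for y D :: real by (simp add: divide_inverse)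
    ultimately show ?case by (simp only: powr_minus)
  qed
qed

lemma scale_cutoff_eq_0:
  fixes x :: "real^'n"
  assumes "\<delta> > 0" "\<epsilon> > 0" "min \<delta> (\<epsilon> powr a) < norm (x - c \<epsilon>)" shows "scale_cutoff c \<delta> a \<epsilon> x = 0"
  unfolding scale_cutoff_def using assms by (intro bump_eq_0) auto

text \<open>After \<open>m\<close> integrations by parts the derivatives of the cutoff contribute \<open>\<epsilon>\<^sup>-\<^sup>a\<^sup>m\<close> and the frequency at
most \<open>\<epsilon>\<^sup>3\<^sup>a\<^sup>m\<^sup>/\<^sup>2\<close>, which leaves a gain of \<open>\<epsilon>\<^sup>a\<^sup>m\<^sup>/\<^sup>2\<close>.\<close>

lemma scale_cutoff_concentrated:
  fixes c :: "real \<Rightarrow> real^'n"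
  assumes a: "a > 0" and \<delta>: "\<delta> > 0" and K: "compact K" and t: "scale_cutoff c \<delta> a \<in> test_nets K"
  shows "\<forall>\<^sub>0\<epsilon>. \<forall>\<zeta>. \<epsilon> powr (- (3/2) * a) \<le> norm \<zeta> \<longrightarrow> norm (fourier (scale_cutoff c \<delta> a \<epsilon>) \<zeta>) \<le> \<epsilon> powr n"
proof -
  obtain m :: nat where m: "(n + 1) / (a / 2) \<le> real m" using real_arch_simple by blast
  then have m': "n + 1 \<le> a / 2 * real m" using a by (simp add: field_simps)
  have "\<forall>j. \<exists>M\<ge>0. \<forall>c r (x::real^'n). r > 0 \<longrightarrow> norm (pd (replicate m j) (bump c r) x) \<le> M * (1 / r) ^ m"
  proof
    fix j :: 'n show "\<exists>M\<ge>0. \<forall>c r (x::real^'n). r > 0 \<longrightarrow> norm (pd (replicate m j) (bump c r) x) \<le> M * (1 / r) ^ m"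
      using pd_bump_bound[of "replicate m j"] by simp
  qed
  from choice[OF this] obtain Mf where Mf: "\<And>j. Mf j \<ge> 0" "\<And>j c r (x::real^'n). r > 0 \<Longrightarrow> norm (pd (replicate m j) (bump c r) x) \<le> Mf j * (1 / r) ^ m"
    by blast
  define M where "M = (\<Sum>j\<in>UNIV. Mf j)"
  have M: "norm (pd (replicate m j) (bump c r) x) \<le> M * (1 / r) ^ m" if "r > 0" for j c r and x :: "real^'n"
  proof -
    have "Mf j \<le> M" unfolding M_def by (rule member_le_sum) (auto intro: Mf)
    then have "Mf j * (1 / r) ^ m \<le> M * (1 / r) ^ m" using that by (intro mult_right_mono) auto
    with Mf(2)[OF that, of j c x] show ?thesis by linarith
  qed
  have M0: "M \<ge> 0" unfolding M_def by (intro sum_nonneg Mf)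
  define C where "C = real CARD('n) ^ (m + 1) * (M * (2 * real CARD('n)) ^ m) * measure lborel K"
  have C0: "C \<ge> 0" using M0 by (simp add: C_def)
  have "\<forall>\<^sub>0\<epsilon>. C * \<epsilon> powr (n + 1) \<le> \<epsilon> powr n" by (rule small_const_mult) simp
  then show ?thesis
    using scale_cutoff_radius(3)[OF \<delta> a, where 'n='n] small_unit
  proof eventually_elim
    case (elim \<epsilon>)
    have e: "0 < \<epsilon>" "\<epsilon> \<le> 1" using elim by auto
    show ?case
    proof (intro allI impI)
      fix \<zeta> :: "real^'n" assume \<zeta>: "\<epsilon> powr (- (3/2) * a) \<le> norm \<zeta>"
      have "norm (pd (replicate m j) (scale_cutoff c \<delta> a \<epsilon>) x) \<le> M * (2 * real CARD('n) * \<epsilon> powr (- a)) ^ m" for j x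
        using M[OF scale_cutoff_radius(1)[OF \<delta> a e(1), where 'n='n], of j "c \<epsilon>" x] unfolding scale_cutoff_def elim(2) .
      from fourier_decay[OF K test_nets_function[OF t elim(3)] this]
      have "norm \<zeta> ^ m * norm (fourier (scale_cutoff c \<delta> a \<epsilon>) \<zeta>) \<le> real CARD('n) ^ (m + 1) * (M * (2 * real CARD('n) * \<epsilon> powr (- a)) ^ m) * measure lborel K" .
      also have "\<dots> = C * \<epsilon> powr (- (a * real m))"
        using e by (simp add: C_def power_mult_distrib powr_powr mult_ac flip: powr_realpow)
      finally have 1: "norm \<zeta> ^ m * norm (fourier (scale_cutoff c \<delta> a \<epsilon>) \<zeta>) \<le> C * \<epsilon> powr (- (a * real m))" .
      have "\<epsilon> powr (- (3/2) * a * real m) = (\<epsilon> powr (- (3/2) * a)) ^ m"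
        using e by (simp add: powr_powr flip: powr_realpow)
      also have "\<dots> \<le> norm \<zeta> ^ m" using \<zeta> by (intro power_mono) auto
      finally have "\<epsilon> powr (- (3/2) * a * real m) * norm (fourier (scale_cutoff c \<delta> a \<epsilon>) \<zeta>) \<le> C * \<epsilon> powr (- (a * real m))"
        using 1 by (meson mult_right_mono norm_ge_zero order_trans)
      then have "\<epsilon> powr ((3/2) * a * real m) * (\<epsilon> powr (- (3/2) * a * real m) * norm (fourier (scale_cutoff c \<delta> a \<epsilon>) \<zeta>))
        \<le> \<epsilon> powr ((3/2) * a * real m) * (C * \<epsilon> powr (- (a * real m)))"
        by (rule mult_left_mono) simp
      moreover have "\<epsilon> powr ((3/2) * a * real m) * \<epsilon> powr (- (3/2) * a * real m) = 1"
        using e by (simp flip: powr_add)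
      moreover have "\<epsilon> powr ((3/2) * a * real m) * \<epsilon> powr (- (a * real m)) = \<epsilon> powr (a / 2 * real m)"
        by (simp add: field_simps flip: powr_add)
      ultimately have "norm (fourier (scale_cutoff c \<delta> a \<epsilon>) \<zeta>) \<le> C * \<epsilon> powr (a / 2 * real m)"
        by (simp only: mult.assoc[symmetric] mult.commute[of C] mult_1)
      also have "\<dots> \<le> C * \<epsilon> powr (n + 1)" using C0 e m' by (intro mult_left_mono powr_mono') auto
      also have "\<dots> \<le> \<epsilon> powr n" by (rule elim)
      finally show "norm (fourier (scale_cutoff c \<delta> a \<epsilon>) \<zeta>) \<le> \<epsilon> powr n" .
    qed
  qed
qed

lemma scale_cutoff_test_nets:
  fixes \<Omega> :: "(real^'n) set"
  assumes "open \<Omega>" "u \<in> EM \<Omega>" and a: "a > 0" and \<delta>: "\<delta> > 0"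
    and K: "compact K" "K \<subseteq> \<Omega>" "\<And>\<epsilon> y. norm (y - c \<epsilon>) \<le> \<delta> \<Longrightarrow> y \<in> K"
  shows "(\<lambda>\<epsilon> x. scale_cutoff c \<delta> a \<epsilon> x * u \<epsilon> x) \<in> test_nets K"
    and "scale_cutoff c \<delta> a \<in> test_nets K"
proof -
  have EM: "scale_cutoff c \<delta> a \<in> EM \<omega>" if "open \<omega>" for \<omega>
    unfolding scale_cutoff_def[abs_def]
    using scale_cutoff_radius(1,2)[OF \<delta> a, where 'n='n]
    by (intro bump_net_EM[OF that, of _ "2 * a"]) (auto elim: eventually_mono)
  have z: "scale_cutoff c \<delta> a \<epsilon> x = 0" if "\<epsilon> \<in> {0<..1}" "x \<notin> K" for \<epsilon> x
  proof -
    have "\<not> norm (x - c \<epsilon>) \<le> \<delta>" using K(3)[of x \<epsilon>] that(2) by blast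
    then have "min \<delta> (\<epsilon> powr a) < norm (x - c \<epsilon>)" by linarith
    then show ?thesis using that(1) by (intro scale_cutoff_eq_0[OF \<delta>]) auto
  qed
  show "(\<lambda>\<epsilon> x. scale_cutoff c \<delta> a \<epsilon> x * u \<epsilon> x) \<in> test_nets K"
    by (rule test_netsI[OF assms(1) EM_mult[OF assms(1) EM[OF assms(1)] assms(2)] K(1,2)]) (auto simp: z)
  show "scale_cutoff c \<delta> a \<in> test_nets K"
    by (rule test_netsI[OF open_UNIV EM[OF open_UNIV] K(1)]) (auto simp: z)
qed

text \<open>The direction \<open>\<xi>\<^sub>0\<close> is taken to be that of \<open>\<xi>\<close> itself; the function \<open>v\<close> for this direction only serves
in the proof, as \<open>\<phi> u\<close> does not involve it.\<close>

lemma localized_transform_negligible: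
  fixes \<Omega> :: "(real^'n) set"
  assumes "open \<Omega>" "u \<in> G \<Omega>" "u' \<in> u"
    and ml: "\<And>\<xi>0. \<xi>0 \<in> gsphere \<Longrightarrow> microlocally_regular \<Omega> u x0 \<xi>0"
    and x0: "represents x0' x0" "\<delta> > 0" "compact K" "K \<subseteq> \<Omega>" "\<And>\<epsilon> y. norm (y - x0' \<epsilon>) \<le> \<delta> \<Longrightarrow> y \<in> K"
    and a: "a > 0" and \<xi>: "\<forall>\<^sub>0\<epsilon>. \<epsilon> powr (- 2 * a) \<le> norm (\<xi> \<epsilon>)" "moderate \<xi>"
  shows "negligible_net (\<lambda>\<epsilon>. fourier (\<lambda>x. scale_cutoff x0' \<delta> a \<epsilon> x * u' \<epsilon> x) (\<xi> \<epsilon>))"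
proof -
  define \<phi> where "\<phi> = scale_cutoff x0' \<delta> a"
  have u': "u' \<in> EM \<Omega>" by (rule G_EM[OF assms(1-3)])
  have \<phi>t: "(\<lambda>\<epsilon> x. \<phi> \<epsilon> x * u' \<epsilon> x) \<in> test_nets K" "\<phi> \<in> test_nets K"
    unfolding \<phi>_def
    by (rule scale_cutoff_test_nets[OF assms(1) u' a x0(2-4)], rule x0(5), assumption)+
  define e1 where "e1 = (axis undefined 1 :: real^'n)"
  \<comment> \<open>A default direction where \<open>\<xi>\<close> vanishes, which happens only for large \<open>\<epsilon>\<close>.\<close>
  define \<xi>0' where "\<xi>0' \<epsilon> = (if \<xi> \<epsilon> = 0 then e1 else \<xi> \<epsilon> /\<^sub>R norm (\<xi> \<epsilon>))" for \<epsilon>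
  have n1: "norm (\<xi>0' \<epsilon>) = 1" for \<epsilon> by (simp add: \<xi>0'_def e1_def norm_axis_1)
  have mod0: "moderate \<xi>0'" unfolding moderate_iff n1 by (intro exI[of _ 0] eventually_mono[OF small_pos]) simp
  define \<xi>0 where "\<xi>0 = abs_colombeau \<xi>0'"
  have r0: "represents \<xi>0' \<xi>0" unfolding \<xi>0_def by (rule represents_abs[OF mod0])
  have "gnorm \<xi>0 = 1"
    unfolding represents_eq_iff[OF represents_gnorm[OF r0] represents_1] n1 by (simp add: negligible_0)
  then have "microlocally_regular \<Omega> u x0 \<xi>0" by (intro ml) (simp add: gsphere_def)
  then obtain v where v: "v \<in> Gc \<Omega>" "\<And>x. x \<approx>\<^sub>f\<^sub>a\<^sub>s\<^sub>t x0 \<Longrightarrow> Gpoint \<Omega> u x = Gpoint \<Omega> v x"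
    "\<And>\<xi>. \<xi> \<in> fast_scale \<inter> Gamma_fast \<xi>0 \<Longrightarrow> GSpoint (GSfourier (Gc_to_GS \<Omega> v)) \<xi> = 0"
    unfolding microlocally_regular_def by blast
  obtain v' L where v': "v' \<in> v" "v' \<in> EM \<Omega>" "compact L" "L \<subseteq> \<Omega>" "\<And>\<epsilon> x. x \<notin> L \<Longrightarrow> v' \<epsilon> x = 0"
    using Gc_ex_rep[OF assms(1) v(1)] by metis
  have vG: "v \<in> G \<Omega>" using v(1) by (simp add: Gc_def)
  have v'L: "\<forall>\<epsilon>\<in>{0<..1}. \<forall>x\<in>\<Omega> - L. v' \<epsilon> x = 0" using v'(5) by blast
  have zv: "zero_extension \<Omega> v' = v'" using v'(4,5) by (auto simp: zero_extension_def fun_eq_iff)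
  have v't: "v' \<in> test_nets L" using zero_extension_test_nets[OF assms(1) v'(2-4) v'L] by (simp add: zv)
  have van: "negligible_net (\<lambda>\<epsilon>. fourier (v' \<epsilon>) (\<eta>' \<epsilon>))" if "\<eta> \<in> fast_scale \<inter> Gamma_fast \<xi>0" "represents \<eta>' \<eta>" for \<eta> \<eta>'
  proof -
    have "represents (\<lambda>\<epsilon>. fourier (v' \<epsilon>) (\<eta>' \<epsilon>)) 0"
      using GSpoint_fourier[OF assms(1) v(1) v'(1,3,4) v'L that(2)] v(3)[OF that(1)] by (simp add: zv)
    from represents_unique[OF this represents_0] show ?thesis by simp
  qed
  have a4: "a / 4 > 0" using a by simp
  have "\<forall>\<^sub>0\<epsilon>. \<xi>0' \<epsilon> = \<xi> \<epsilon> /\<^sub>R norm (\<xi> \<epsilon>)"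
    using \<xi>(1) small_pos
  proof eventually_elim
    case (elim \<epsilon>)
    have "0 < \<epsilon> powr (- 2 * a)" using elim by simp
    with elim have "\<xi> \<epsilon> \<noteq> 0" by auto
    then show ?case by (simp add: \<xi>0'_def)
  qed
  then have dir: "\<forall>\<^sub>0\<epsilon>. \<xi>0' \<epsilon> = \<xi> \<epsilon> /\<^sub>R norm (\<xi> \<epsilon>)" .
  have conic: "\<forall>\<^sub>0\<epsilon>. \<forall>\<eta>. \<epsilon> powr (- (a/4)) \<le> norm \<eta> \<longrightarrow> norm (\<eta> /\<^sub>R norm \<eta> - \<xi> \<epsilon> /\<^sub>R norm (\<xi> \<epsilon>)) \<le> \<epsilon> powr (a/4) \<longrightarrow>
      norm (fourier (v' \<epsilon>) \<eta>) \<le> \<epsilon> powr n" for n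
  proof -
    have "\<forall>\<^sub>0\<epsilon>. \<forall>\<eta>. \<epsilon> powr (- (a/4)) \<le> norm \<eta> \<longrightarrow> norm (\<eta> /\<^sub>R norm \<eta> - \<xi>0' \<epsilon>) \<le> \<epsilon> powr (a/4) \<longrightarrow>
      norm (fourier (v' \<epsilon>) \<eta>) \<le> \<epsilon> powr n"
      by (rule conic_negligible_uniform[OF v'(3) v't a4 r0 n1]) (rule van)
    with dir show ?thesis by eventually_elim simp
  qed
  have conc: "\<forall>\<^sub>0\<epsilon>. \<forall>\<zeta>. \<epsilon> powr (- (3/2) * a) \<le> norm \<zeta> \<longrightarrow> norm (fourier (\<phi> \<epsilon>) \<zeta>) \<le> \<epsilon> powr n" for n
    unfolding \<phi>_def by (rule scale_cutoff_concentrated[OF a x0(2,3) \<phi>t(2)[unfolded \<phi>_def]])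
  have loc: "negligible_net (\<lambda>\<epsilon>. fourier (\<lambda>x. \<phi> \<epsilon> x * v' \<epsilon> x) (\<xi> \<epsilon>))"
    by (rule fourier_localized_negligible[OF a x0(3) \<phi>t(2) v'(3) v't conc \<xi> conic])
  have near: "\<forall>\<^sub>0\<epsilon>. \<forall>x\<in>{x. norm (x - x0' \<epsilon>) \<le> min \<delta> (\<epsilon> powr a)}. norm (u' \<epsilon> x - v' \<epsilon> x) \<le> \<epsilon> powr n" for n
  proof (rule eventually_Ball_if_selections)
    show "\<forall>\<^sub>0\<epsilon>. x0' \<epsilon> \<in> {x. norm (x - x0' \<epsilon>) \<le> min \<delta> (\<epsilon> powr a)}"
      using x0(2) by simp
    fix s assume s: "\<forall>\<^sub>0\<epsilon>. s \<epsilon> \<in> {x. norm (x - x0' \<epsilon>) \<le> min \<delta> (\<epsilon> powr a)}"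
    have sd: "\<forall>\<^sub>0\<epsilon>. norm (s \<epsilon> - x0' \<epsilon>) \<le> \<delta>" using s by eventually_elim simp
    have mods: "moderate s" using x0(1) by (intro moderate_if_bounded_diff[OF _ sd]) (simp add: represents_def)
    define x where "x = abs_colombeau s"
    have rs: "represents s x" unfolding x_def by (rule represents_abs[OF mods])
    have sK: "\<forall>\<^sub>0\<epsilon>. s \<epsilon> \<in> K" using sd by eventually_elim (rule x0(5))
    have "gnorm (x - x0) \<le> rho_powr a"
      by (rule le_colombeauI[OF represents_gnorm[OF represents_diff[OF rs x0(1)]] represents_rho_powr])
        (use s in \<open>auto elim: eventually_mono\<close>)
    then have "Gpoint \<Omega> u x = Gpoint \<Omega> v x" using a by (intro v(2)) (auto simp: approx_fast_def)
    then have "negligible_net (\<lambda>\<epsilon>. u' \<epsilon> (s \<epsilon>) - v' \<epsilon> (s \<epsilon>))"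
      by (simp only: represents_eq_iff[OF Gpoint_G[OF assms(1-3) rs x0(3,4) sK] Gpoint_G[OF assms(1) vG v'(1) rs x0(3,4) sK]])
    then show "\<forall>\<^sub>0\<epsilon>. norm (u' \<epsilon> (s \<epsilon>) - v' \<epsilon> (s \<epsilon>)) \<le> \<epsilon> powr n" unfolding negligible_iff by blast
  qed
  have diff: "negligible_net (\<lambda>\<epsilon>. fourier (\<lambda>x. \<phi> \<epsilon> x * u' \<epsilon> x) (\<xi> \<epsilon>) - fourier (\<lambda>x. \<phi> \<epsilon> x * v' \<epsilon> x) (\<xi> \<epsilon>))"
    unfolding negligible_iff
  proof
    fix n
    have "\<forall>\<^sub>0\<epsilon>. measure lborel K * \<epsilon> powr (n + 1) \<le> \<epsilon> powr n" by (rule small_const_mult) simp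
    with near[of "n + 1"] show "\<forall>\<^sub>0\<epsilon>. norm (fourier (\<lambda>x. \<phi> \<epsilon> x * u' \<epsilon> x) (\<xi> \<epsilon>) - fourier (\<lambda>x. \<phi> \<epsilon> x * v' \<epsilon> x) (\<xi> \<epsilon>)) \<le> \<epsilon> powr n"
      using small_unit
    proof eventually_elim
      case (elim \<epsilon>)
      note su = test_function_supp_in[OF test_nets_function[OF \<phi>t(1) elim(3)]]
      have sv: "test_function L (\<lambda>x. \<phi> \<epsilon> x * v' \<epsilon> x)"
        using \<phi>t(2) elim(3) by (intro test_function_mult[OF test_nets_function[OF v't elim(3)]]) (auto simp: test_nets_def EM_def)
      have "norm (fourier (\<lambda>x. \<phi> \<epsilon> x * u' \<epsilon> x - \<phi> \<epsilon> x * v' \<epsilon> x) (\<xi> \<epsilon>)) \<le> \<epsilon> powr (n + 1) * measure lborel K"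
      proof (rule norm_fourier_le[OF x0(3)])
        fix x
        show "norm (\<phi> \<epsilon> x * u' \<epsilon> x - \<phi> \<epsilon> x * v' \<epsilon> x) \<le> \<epsilon> powr (n + 1)"
        proof (cases "norm (x - x0' \<epsilon>) \<le> min \<delta> (\<epsilon> powr a)")
          case True
          have "norm (\<phi> \<epsilon> x * u' \<epsilon> x - \<phi> \<epsilon> x * v' \<epsilon> x) = norm (\<phi> \<epsilon> x) * norm (u' \<epsilon> x - v' \<epsilon> x)"
            by (simp add: norm_mult flip: right_diff_distrib)
          also have "\<dots> \<le> 1 * \<epsilon> powr (n + 1)"
            using elim(1) True norm_bump_le by (intro mult_mono) (auto simp: \<phi>_def scale_cutoff_def)
          finally show ?thesis by simp
        next
          case False
          then have "\<phi> \<epsilon> x = 0" unfolding \<phi>_def using elim(3) by (intro scale_cutoff_eq_0[OF x0(2)]) auto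
          then show ?thesis by simp
        qed
        assume "x \<notin> K"
        then have "\<phi> \<epsilon> x = 0" using \<phi>t(2) elim(3) by (auto simp: test_nets_def)
        then show "\<phi> \<epsilon> x * u' \<epsilon> x - \<phi> \<epsilon> x * v' \<epsilon> x = 0" by simp
      qed
      with elim(2) show ?case
        unfolding fourier_diff[OF integrable_supp_in[OF x0(3) su] integrable_supp_in[OF v'(3) test_function_supp_in[OF sv]]]
        by (simp add: mult.commute)
    qed
  qed
  show ?thesis using negligible_add[OF diff loc] by (simp add: \<phi>_def)
qed

text \<open>Points of moderate norm are handled by selection, larger ones by the decay of the transform of a
test net: there one additional power of \<open>|\<xi>|\<close> outweighs the order of growth.\<close>

lemma localized_transform_uniform:
  fixes w :: "'n::finite fnet"
  assumes K: "compact K" and w: "w \<in> test_nets K" and b: "b > 0"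
    and van: "\<And>\<xi>. \<forall>\<^sub>0\<epsilon>. \<epsilon> powr (- b) \<le> norm (\<xi> \<epsilon>) \<Longrightarrow> moderate \<xi> \<Longrightarrow> negligible_net (\<lambda>\<epsilon>. fourier (w \<epsilon>) (\<xi> \<epsilon>))"
  shows "\<forall>\<^sub>0\<epsilon>. \<forall>\<xi>. \<epsilon> powr (- b) \<le> norm \<xi> \<longrightarrow> weight \<xi> * (norm \<xi> ^ k * norm (fourier (w \<epsilon>) \<xi>)) \<le> 1"
proof -
  obtain N where N: "\<forall>\<^sub>0\<epsilon>. \<forall>\<xi>\<in>UNIV. weight \<xi> * (norm \<xi> ^ Suc k * norm (fourier (w \<epsilon>) \<xi>)) \<le> \<epsilon> powr N"
    using test_nets_fourier_weighted[OF K w, of "Suc k"] unfolding moderate_on_def by blast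
  \<comment> \<open>Beyond \<open>\<epsilon>\<^sup>-\<^sup>M\<close> the additional power of \<open>|\<xi>|\<close> suffices, so that the selected points are moderate.\<close>
  define M where "M = max b (- N)"
  define A where "A \<epsilon> = {\<xi>::real^'n. \<epsilon> powr (- b) \<le> norm \<xi> \<and> norm \<xi> \<le> \<epsilon> powr (- M)}" for \<epsilon>
  have "\<forall>\<^sub>0\<epsilon>. \<forall>\<xi>\<in>A \<epsilon>. weight \<xi> * (norm \<xi> ^ k * norm (fourier (w \<epsilon>) \<xi>)) \<le> 1"
  proof (rule eventually_Ball_if_selections)
    show "\<forall>\<^sub>0\<epsilon>. \<epsilon> powr (- b) *\<^sub>R axis undefined 1 \<in> A \<epsilon>"
      using small_unit
    proof eventually_elim
      case (elim \<epsilon>)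
      have "\<epsilon> powr (- b) \<le> \<epsilon> powr (- M)" using elim by (intro powr_mono') (auto simp: M_def)
      then show ?case by (simp add: A_def norm_axis_1)
    qed
    fix s assume s: "\<forall>\<^sub>0\<epsilon>. s \<epsilon> \<in> A \<epsilon>"
    have up: "\<forall>\<^sub>0\<epsilon>. norm (s \<epsilon>) \<le> \<epsilon> powr (- M)" using s by eventually_elim (simp add: A_def)
    then have mod: "moderate s" unfolding moderate_iff by blast
    have "\<forall>\<^sub>0\<epsilon>. \<epsilon> powr (- b) \<le> norm (s \<epsilon>)" using s by eventually_elim (simp add: A_def)
    then have n: "negligible_on (\<lambda>\<epsilon>. {s \<epsilon>}) (\<lambda>\<epsilon> \<xi>. norm (fourier (w \<epsilon>) \<xi>))"
      unfolding negligible_iff_negligible_on[of "\<lambda>\<epsilon>. fourier (w \<epsilon>)" s, symmetric] by (rule van[OF _ mod])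
    have m: "moderate_on (\<lambda>\<epsilon>. {s \<epsilon>}) (\<lambda>_ \<xi>. norm \<xi>)" using mod by (simp add: moderate_iff_moderate_on)
    have mpow: "moderate_on (\<lambda>\<epsilon>. {s \<epsilon>}) (\<lambda>_ \<xi>. norm \<xi> ^ l)" for l
      by (induction l) (auto intro!: moderate_on_mult m moderate_on_const[of _ 1, simplified] always_eventually)
    have "moderate_on (\<lambda>\<epsilon>. {s \<epsilon>}) (\<lambda>_ \<xi>. (2 ^ CARD('n) * (1 + norm \<xi> ^ (2 * CARD('n)))) * norm \<xi> ^ k)"
      by (intro moderate_on_mult moderate_on_add moderate_on_const mpow) (auto intro!: always_eventually)
    then have "moderate_on (\<lambda>\<epsilon>. {s \<epsilon>}) (\<lambda>_ \<xi>. weight \<xi> * norm \<xi> ^ k)"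
      by (rule moderate_on_mono) (auto intro!: always_eventually mult_right_mono weight_le)
    from negligible_on_mult[OF n this] have "negligible_on (\<lambda>\<epsilon>. {s \<epsilon>}) (\<lambda>\<epsilon> \<xi>. norm (fourier (w \<epsilon>) \<xi>) * (weight \<xi> * norm \<xi> ^ k))"
      by (simp add: less_imp_le[OF weight_pos])
    then have "\<forall>\<^sub>0\<epsilon>. \<forall>\<xi>\<in>{s \<epsilon>}. norm (fourier (w \<epsilon>) \<xi>) * (weight \<xi> * norm \<xi> ^ k) \<le> \<epsilon> powr 0"
      unfolding negligible_on_def by (rule spec)
    then have "\<forall>\<^sub>0\<epsilon>. norm (fourier (w \<epsilon>) (s \<epsilon>)) * (weight (s \<epsilon>) * norm (s \<epsilon>) ^ k) \<le> \<epsilon> powr 0" by simp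
    with small_pos show "\<forall>\<^sub>0\<epsilon>. weight (s \<epsilon>) * (norm (s \<epsilon>) ^ k * norm (fourier (w \<epsilon>) (s \<epsilon>))) \<le> 1"
      by eventually_elim (simp add: mult_ac)
  qed
  then show ?thesis
    using N small_unit
  proof eventually_elim
    case (elim \<epsilon>)
    have e: "0 < \<epsilon>" "\<epsilon> \<le> 1" using elim by auto
    show ?case
    proof (intro allI impI)
      fix \<xi> :: "real^'n" assume \<xi>: "\<epsilon> powr (- b) \<le> norm \<xi>"
      define q where "q = weight \<xi> * (norm \<xi> ^ k * norm (fourier (w \<epsilon>) \<xi>))"
      have q0: "0 \<le> q" using weight_pos[of \<xi>] by (simp add: q_def)
      show "weight \<xi> * (norm \<xi> ^ k * norm (fourier (w \<epsilon>) \<xi>)) \<le> 1"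
      proof (cases "norm \<xi> \<le> \<epsilon> powr (- M)")
        case True then show ?thesis using elim(1) \<xi> by (simp add: A_def)
      next
        case False
        have "\<epsilon> powr (- M) * q \<le> norm \<xi> * q" using False q0 by (intro mult_right_mono) auto
        also have "\<dots> = weight \<xi> * (norm \<xi> ^ Suc k * norm (fourier (w \<epsilon>) \<xi>))" by (simp add: q_def mult_ac)
        also have "\<dots> \<le> \<epsilon> powr N" using elim(2) by blast
        finally have "\<epsilon> powr M * (\<epsilon> powr (- M) * q) \<le> \<epsilon> powr M * \<epsilon> powr N" by (rule mult_left_mono) simp
        moreover have "\<epsilon> powr M * (\<epsilon> powr (- M) * q) = q" using e by (simp add: powr_minus)
        ultimately have "q \<le> \<epsilon> powr (M + N)" by (simp only: powr_add)
        also have "\<dots> \<le> \<epsilon> powr 0" using e by (intro powr_mono') (auto simp: M_def)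
        finally show ?thesis using e by (simp add: q_def)
      qed
    qed
  qed
qed

text \<open>Fourier inversion: the low frequencies \<open>|\<xi>| \<le> \<epsilon>\<^sup>-\<^sup>b\<close> contribute at most the order of the function
  itself plus \<open>b\<close> times the number of derivatives and twice the dimension, so a small \<open>b\<close> costs one power of
  \<open>\<epsilon>\<close> only; the high frequencies contribute a bounded amount.\<close>

lemma derivative_bound_by_inversion:
  fixes f :: "real^'n \<Rightarrow> complex"
  assumes K: "compact K" and f: "test_function K f" and e: "0 < \<epsilon>" "\<epsilon> \<le> 1" and b: "b > 0"
    and b': "b * (real (length is) + 2 * real CARD('n)) \<le> 1"
    and N: "N \<le> 0" "\<And>x. norm (f x) \<le> \<epsilon> powr N"
    and high: "\<And>\<xi>. \<epsilon> powr (- b) \<le> norm \<xi> \<Longrightarrow> weight \<xi> * (norm \<xi> ^ length is * norm (fourier f \<xi>)) \<le> 1"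
  shows "norm (pd is f x) \<le> fourier_const TYPE('n) * (2 ^ CARD('n) * measure lborel K + 1)
    * (\<integral>x. inverse (weight x) \<partial>(lborel :: (real^'n) measure)) * \<epsilon> powr (N - 1)"
proof -
  define k where "k = length is"
  define C where "C = (2 ^ CARD('n) * measure lborel K + 1) * \<epsilon> powr (N - 1)"
  have cl: "closed K" by (rule compact_imp_closed[OF K])
  have tf: "test_function K (pd is f)" by (rule test_function_pd[OF cl f])
  have nf: "norm (fourier (pd is f) \<xi>) \<le> norm \<xi> ^ k * norm (fourier f \<xi>)" for \<xi>
  proof -
    have "(\<Prod>j\<leftarrow>is. \<bar>\<xi> $ j\<bar>) \<le> norm \<xi> ^ length is"
      by (induction "is") (auto intro!: mult_mono component_le_norm_cart prod_list_nonneg)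
    then show ?thesis unfolding norm_fourier_pd[OF K f] k_def by (intro mult_right_mono) auto
  qed
  have bound: "weight \<xi> * norm (fourier (pd is f) \<xi>) \<le> C" for \<xi>
  proof (cases "\<epsilon> powr (- b) \<le> norm \<xi>")
    case True
    have "weight \<xi> * norm (fourier (pd is f) \<xi>) \<le> weight \<xi> * (norm \<xi> ^ k * norm (fourier f \<xi>))"
      using weight_pos[of \<xi>] by (intro mult_left_mono nf) auto
    also have "\<dots> \<le> 1" using high[OF True] by (simp add: k_def)
    also have "1 = \<epsilon> powr 0" using e by simp
    also have "\<epsilon> powr 0 \<le> \<epsilon> powr (N - 1)" using e N by (intro powr_mono') auto
    also have "\<epsilon> powr (N - 1) \<le> C" unfolding C_def by (simp add: distrib_right)
    finally show ?thesis .
  next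
    case False
    define t where "t = \<epsilon> powr (- b)"
    have t: "1 \<le> t" unfolding t_def using powr_mono'[of "- b" 0 \<epsilon>] e b by simp
    have \<xi>t: "norm \<xi> \<le> t" using False by (simp add: t_def)
    have "1 + norm \<xi> ^ 2 \<le> 2 * t ^ 2"
      using power_mono[OF \<xi>t, of 2] one_le_power[OF t, of 2] by simp
    then have "weight \<xi> \<le> (2 * t ^ 2) ^ CARD('n)" unfolding weight_def by (intro power_mono) auto
    then have W: "weight \<xi> \<le> 2 ^ CARD('n) * t ^ (2 * CARD('n))" by (simp add: power_mult_distrib power_mult)
    have Ff: "norm (fourier f \<xi>) \<le> \<epsilon> powr N * measure lborel K"
      using f by (intro norm_fourier_le[OF K N(2)]) (auto simp: test_function_def)
    have "weight \<xi> * norm (fourier (pd is f) \<xi>) \<le> weight \<xi> * (norm \<xi> ^ k * norm (fourier f \<xi>))"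
      using weight_pos[of \<xi>] by (intro mult_left_mono nf) auto
    also have "\<dots> \<le> (2 ^ CARD('n) * t ^ (2 * CARD('n))) * (t ^ k * (\<epsilon> powr N * measure lborel K))"
      using W Ff \<xi>t t weight_pos[of \<xi>] by (intro mult_mono power_mono) auto
    also have "\<dots> = 2 ^ CARD('n) * measure lborel K * (t ^ (k + 2 * CARD('n)) * \<epsilon> powr N)"
      by (simp add: power_add mult_ac)
    also have "t ^ (k + 2 * CARD('n)) = \<epsilon> powr (- (b * (real k + 2 * real CARD('n))))"
      unfolding t_def using e by (simp add: powr_powr flip: powr_realpow)
    also have "\<dots> \<le> \<epsilon> powr (-1)" using e b' by (intro powr_mono') (auto simp: k_def)
    also have "\<epsilon> powr (-1) * \<epsilon> powr N = \<epsilon> powr (N - 1)" using powr_add[of \<epsilon> "-1" N] by simp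
    also have "2 ^ CARD('n) * measure lborel K * \<epsilon> powr (N - 1) \<le> C" by (simp add: C_def distrib_right)
    finally show ?thesis by (simp add: mult_left_mono mult_right_mono)
  qed
  have meas: "(\<lambda>\<xi>. fourier (pd is f) \<xi> * exp (\<i> * of_real (x \<bullet> \<xi>))) \<in> borel_measurable borel"
    by (intro borel_measurable_continuous_onI continuous_on_mult continuous_intros
        smooth_on_continuous_on[OF smooth_on_fourier[OF K test_function_supp_in[OF tf]]])
  have "norm (pd is f x) = fourier_const TYPE('n) * norm (\<integral>\<xi>. fourier (pd is f) \<xi> * exp (\<i> * of_real (x \<bullet> \<xi>)) \<partial>lborel)"
    by (subst fourier_inversion[OF K tf]) (simp add: norm_mult fourier_const_nonneg)
  also have "\<dots> \<le> fourier_const TYPE('n) * (C * (\<integral>x. inverse (weight x) \<partial>(lborel :: (real^'n) measure)))"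
    by (intro mult_left_mono integrable_if_weighted_bound(2)[OF meas])
      (use bound in \<open>auto simp: norm_mult norm_exp_eq_Re fourier_const_def\<close>)
  finally show ?thesis by (simp add: C_def mult_ac)
qed

text \<open>The order depends neither on the number of derivatives nor on \<open>b\<close>; only the admissible scales \<open>b\<close>
depend on the number of derivatives.\<close>

lemma microlocally_regular_growth:
  fixes \<Omega> :: "(real^'n) set"
  assumes "open \<Omega>" "u \<in> G \<Omega>" "u' \<in> u"
    and ml: "\<And>\<xi>0. \<xi>0 \<in> gsphere \<Longrightarrow> microlocally_regular \<Omega> u x0 \<xi>0"
    and x0: "represents x0' x0" "\<delta> > 0" "compact K" "K \<subseteq> \<Omega>" "\<And>\<epsilon> y. norm (y - x0' \<epsilon>) \<le> \<delta> \<Longrightarrow> y \<in> K"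
  shows "\<exists>N. \<forall>is b. 0 < b \<longrightarrow> b * (real (length is) + 2 * real CARD('n)) \<le> 1 \<longrightarrow>
    (\<forall>\<^sub>0\<epsilon>. \<forall>x\<in>cball (x0' \<epsilon>) (\<epsilon> powr b). norm (pd is (u' \<epsilon>) x) \<le> \<epsilon> powr N)"
proof -
  have u': "u' \<in> EM \<Omega>" by (rule G_EM[OF assms(1-3)])
  obtain N' where N': "\<forall>\<^sub>0\<epsilon>. \<forall>x\<in>K. norm (pd [] (u' \<epsilon>) x) \<le> \<epsilon> powr N'"
    using EM_moderate_on[OF u' assms(1) x0(3,4), of "[]"] unfolding moderate_on_def by blast
  define N where "N = min N' 0"
  have N: "N \<le> 0" "N \<le> N'" by (auto simp: N_def)
  define C where "C = fourier_const TYPE('n) * (2 ^ CARD('n) * measure lborel K + 1)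
    * (\<integral>x. inverse (weight x) \<partial>(lborel :: (real^'n) measure))"
  have "\<forall>\<^sub>0\<epsilon>. \<forall>x\<in>cball (x0' \<epsilon>) (\<epsilon> powr b). norm (pd is (u' \<epsilon>) x) \<le> \<epsilon> powr (N - 2)"
    if b: "0 < b" "b * (real (length is) + 2 * real CARD('n)) \<le> 1" for "is" b
  proof -
    define a where "a = b / 2"
    have a: "a > 0" using b by (simp add: a_def)
    have ab: "- 2 * a = - b" "2 * a = b" by (auto simp: a_def)
    define w where "w \<epsilon> x = scale_cutoff x0' \<delta> a \<epsilon> x * u' \<epsilon> x" for \<epsilon> x
    have w: "w \<in> test_nets K"
      unfolding w_def[abs_def] by (rule scale_cutoff_test_nets(1)[OF assms(1) u' a x0(2-4)]) (rule x0(5))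
    have van: "negligible_net (\<lambda>\<epsilon>. fourier (w \<epsilon>) (\<xi> \<epsilon>))"
      if "\<forall>\<^sub>0\<epsilon>. \<epsilon> powr (- b) \<le> norm (\<xi> \<epsilon>)" "moderate \<xi>" for \<xi>
      unfolding w_def[abs_def]
      by (rule localized_transform_negligible[OF assms(1-3) ml x0(1-4) _ a]) (use that ab x0(5) in auto)
    have high: "\<forall>\<^sub>0\<epsilon>. \<forall>\<xi>. \<epsilon> powr (- b) \<le> norm \<xi> \<longrightarrow> weight \<xi> * (norm \<xi> ^ length is * norm (fourier (w \<epsilon>) \<xi>)) \<le> 1"
      by (rule localized_transform_uniform[OF x0(3) w b(1) van])
    have "\<forall>\<^sub>0\<epsilon>. C * \<epsilon> powr (N - 1) \<le> \<epsilon> powr (N - 2)" by (rule small_const_mult) simp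
    then show ?thesis
      using high N' scale_cutoff_radius(2)[OF x0(2) a, where 'n='n] small_unit
    proof eventually_elim
      case (elim \<epsilon>)
      have e: "0 < \<epsilon>" "\<epsilon> \<le> 1" using elim(5) by auto
      have wN: "norm (w \<epsilon> x) \<le> \<epsilon> powr N" for x
      proof (cases "x \<in> K")
        case True
        have "norm (w \<epsilon> x) \<le> 1 * \<epsilon> powr N'"
          unfolding w_def norm_mult scale_cutoff_def using elim(3) True norm_bump_le by (intro mult_mono) auto
        also have "\<dots> \<le> \<epsilon> powr N" using e N by (simp add: powr_mono')
        finally show ?thesis .
      next
        case False
        then have "w \<epsilon> x = 0" using w elim(5) by (auto simp: test_nets_def)
        then show ?thesis by simp
      qed
      define q where "q = min \<delta> (\<epsilon> powr a) / (2 * real CARD('n))"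
      have q: "0 < q" unfolding q_def by (rule scale_cutoff_radius(1)[OF x0(2) a e(1)])
      have qd: "q \<le> \<delta>"
      proof -
        have "1 \<le> 2 * real CARD('n)" using zero_less_card_finite[where 'a='n] by linarith
        then have "min \<delta> (\<epsilon> powr a) / (2 * real CARD('n)) \<le> min \<delta> (\<epsilon> powr a) / 1"
          using x0(2) by (intro divide_left_mono) auto
        then show ?thesis by (simp add: q_def)
      qed
      show ?case
      proof
        fix x assume x: "x \<in> cball (x0' \<epsilon>) (\<epsilon> powr b)"
        then have xq: "x \<in> ball (x0' \<epsilon>) q" using elim(4) by (simp add: ab q_def)
        have eq: "w \<epsilon> y = u' \<epsilon> y" if "y \<in> ball (x0' \<epsilon>) q" for y
        proof -
          have "bump (x0' \<epsilon>) q y = 1" using that by (intro bump_eq_1[OF q]) (simp add: dist_norm norm_minus_commute)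
          then show ?thesis by (simp add: w_def scale_cutoff_def q_def)
        qed
        have "pd is (u' \<epsilon>) x = pd is (w \<epsilon>) x"
          by (rule pd_cong[OF open_ball eq[symmetric] xq])
        also have "norm \<dots> \<le> C * \<epsilon> powr (N - 1)"
          unfolding C_def
          by (rule derivative_bound_by_inversion[OF x0(3) test_nets_function[OF w elim(5)] e b N(1) wN])
            (use elim(2) in blast)
        also have "\<dots> \<le> \<epsilon> powr (N - 2)" by (rule elim)
        finally show "norm (pd is (u' \<epsilon>) x) \<le> \<epsilon> powr (N - 2)" .
      qed
    qed
  qed
  then show ?thesis by blast
qed

text \<open>A diagonal choice of exponents tending to zero turns the balls of radius \<open>\<epsilon>\<^sup>b\<close>, whose admissible
  exponents depend on the number of derivatives, into one slow scale ball.\<close>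

lemma microlocally_regular_imp_regular:
  fixes \<Omega> :: "(real^'n) set"
  assumes "open \<Omega>" "x0 \<in> compact_points \<Omega>" "u \<in> G \<Omega>"
    and ml: "\<And>\<xi>0. \<xi>0 \<in> gsphere \<Longrightarrow> microlocally_regular \<Omega> u x0 \<xi>0"
  shows "\<exists>V. slow_scale_nbhd \<Omega> x0 V \<and> Ginf_on \<Omega> u V"
proof -
  obtain x0' K \<delta> where x0': "represents x0' x0" "\<delta> > 0" "compact K" "K \<subseteq> \<Omega>"
    "\<And>\<epsilon> y. norm (y - x0' \<epsilon>) \<le> \<delta> \<Longrightarrow> y \<in> K"
    using compact_points_rep[OF assms(1,2)] by metis
  obtain u' where u': "u' \<in> EM \<Omega>" "u' \<in> u" using G_ex_rep[OF assms(1,3)] by blast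
  have "\<exists>N. \<forall>is b. 0 < b \<longrightarrow> b * (real (length is) + 2 * real CARD('n)) \<le> 1 \<longrightarrow>
    (\<forall>\<^sub>0\<epsilon>. \<forall>x\<in>cball (x0' \<epsilon>) (\<epsilon> powr b). norm (pd is (u' \<epsilon>) x) \<le> \<epsilon> powr N)"
    by (rule microlocally_regular_growth[OF assms(1,3) u'(2) ml x0'(1-4)]) (auto intro: x0'(5))
  then obtain N where N: "\<And>is b. 0 < b \<Longrightarrow> b * (real (length is) + 2 * real CARD('n)) \<le> 1 \<Longrightarrow>
    \<forall>\<^sub>0\<epsilon>. \<forall>x\<in>cball (x0' \<epsilon>) (\<epsilon> powr b). norm (pd is (u' \<epsilon>) x) \<le> \<epsilon> powr N"
    by blast
  \<comment> \<open>Exponents that are admissible for all lists of at most \<open>k\<close> derivations.\<close>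
  define b where "b k = 1 / (real k + 1 + 2 * real CARD('n))" for k :: nat
  have b0: "b k > 0" for k unfolding b_def by (auto intro!: divide_pos_pos add_nonneg_pos add_pos_nonneg)
  have b1: "b k * (real l + 2 * real CARD('n)) \<le> 1" if "l \<le> k" for k l
    using that by (simp add: b_def divide_le_eq_1)
  define P where "P k \<epsilon> \<longleftrightarrow> \<epsilon> powr b k < min \<delta> (1 / (real k + 1)) \<and>
    (\<forall>is\<in>{is::'n list. length is \<le> k}. \<forall>x\<in>cball (x0' \<epsilon>) (\<epsilon> powr b k). norm (pd is (u' \<epsilon>) x) \<le> \<epsilon> powr N)" for k \<epsilon>
  have "\<forall>\<^sub>0\<epsilon>. P k \<epsilon>" for k
    unfolding P_def
  proof (intro eventually_conj eventually_ball_finite ballI)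
    show "\<forall>\<^sub>0\<epsilon>. \<epsilon> powr b k < min \<delta> (1 / (real k + 1))"
      using x0'(2) by (intro small_powr_le b0) auto
    show "finite {is::'n list. length is \<le> k}"
      using finite_lists_length_le[OF finite[of "UNIV :: 'n set"], of k] by simp
    fix "is" :: "'n list" assume "is \<in> {is. length is \<le> k}"
    then show "\<forall>\<^sub>0\<epsilon>. \<forall>x\<in>cball (x0' \<epsilon>) (\<epsilon> powr b k). norm (pd is (u' \<epsilon>) x) \<le> \<epsilon> powr N"
      by (intro N b0 b1) simp
  qed
  then obtain \<kappa> where \<kappa>: "\<forall>\<^sub>0\<epsilon>. P (\<kappa> \<epsilon>) \<epsilon>" "\<And>k. \<forall>\<^sub>0\<epsilon>. k \<le> \<kappa> \<epsilon>"
    using diagonal_index[of P] by blast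
  define R where "R \<epsilon> = \<epsilon> powr b (\<kappa> \<epsilon>)" for \<epsilon>
  have R_low: "\<forall>\<^sub>0\<epsilon>. \<epsilon> powr a \<le> R \<epsilon>" if a: "a > 0" for a
  proof -
    obtain k :: nat where k: "1 / a \<le> real k" using real_arch_simple by blast
    show ?thesis
      using \<kappa>(2)[of k] small_unit
    proof eventually_elim
      case (elim \<epsilon>)
      have "1 / a \<le> real (\<kappa> \<epsilon>) + 1 + 2 * real CARD('n)" using k elim(1) by linarith
      then have "b (\<kappa> \<epsilon>) \<le> a" using a unfolding b_def by (simp add: field_simps add_nonneg_pos)
      then show ?case unfolding R_def using elim(2) by (intro powr_mono') auto
    qed
  qed
  have R_up: "\<forall>\<^sub>0\<epsilon>. R \<epsilon> \<le> a" if a: "a > 0" for a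
  proof -
    obtain k :: nat where k: "1 / a \<le> real k" using real_arch_simple by blast
    show ?thesis
      using \<kappa>(1) \<kappa>(2)[of k]
    proof eventually_elim
      case (elim \<epsilon>)
      have "1 / a \<le> real (\<kappa> \<epsilon>) + 1" using k elim(2) by linarith
      then have "1 / (real (\<kappa> \<epsilon>) + 1) \<le> a" using a by (simp add: field_simps)
      then show ?case using elim(1) unfolding P_def R_def by linarith
    qed
  qed
  \<comment> \<open>Half of the radius, because a point of the closed ball of radius \<open>r\<close> satisfies the inequality
    only up to a negligible error.\<close>
  define r' where "r' \<epsilon> = R \<epsilon> / 2" for \<epsilon>
  have r'0: "0 \<le> r' \<epsilon>" for \<epsilon> by (simp add: r'_def R_def)
  have r'_low: "\<forall>\<^sub>0\<epsilon>. \<epsilon> powr a \<le> r' \<epsilon>" if a: "a > 0" for a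
  proof -
    have "\<forall>\<^sub>0\<epsilon>. 2 * \<epsilon> powr a \<le> \<epsilon> powr (a/2)" using a by (intro small_const_mult) simp
    with R_low[OF half_gt_zero[OF a]] show ?thesis by eventually_elim (simp add: r'_def)
  qed
  have r'_up: "\<forall>\<^sub>0\<epsilon>. r' \<epsilon> \<le> a" if a: "a > 0" for a
    using R_up[OF a]
  proof eventually_elim
    case (elim \<epsilon>)
    have "0 \<le> R \<epsilon>" by (simp add: R_def)
    with elim show ?case by (simp add: r'_def)
  qed
  have "\<forall>\<^sub>0\<epsilon>. norm (r' \<epsilon>) \<le> \<epsilon> powr 0"
    using r'_up[OF zero_less_one] small_pos by eventually_elim (use r'0 in auto)
  then have mod: "moderate r'" unfolding moderate_iff by blast
  define r where "r = abs_colombeau r'"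
  have rr: "represents r' r" unfolding r_def by (rule represents_abs[OF mod])
  have rpos: "r \<in> gpositive"
    unfolding gpositive_def
  proof (intro CollectI conjI)
    show "0 \<le> r" by (rule le_colombeauI[OF represents_0 rr]) (simp add: r'0)
    show "ginvertible r" by (rule ginvertibleI[OF rr r'_low[OF zero_less_one]])
  qed
  have rslow: "approx_slow_0 r"
    unfolding approx_slow_0_def
  proof (intro allI impI conjI)
    fix a :: real assume a: "a > 0"
    show "rho_powr a \<le> gnorm r"
      by (rule le_colombeauI[OF represents_rho_powr represents_gnorm[OF rr]]) (use r'_low[OF a] r'0 in simp)
    show "gnorm r \<le> gconst a"
      by (rule le_colombeauI[OF represents_gnorm[OF rr] represents_gconst]) (use r'_up[OF a] r'0 in simp)
  qed
  define V where "V = {x. gnorm (x - x0) \<le> r}"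
  have near: "\<exists>x'. represents x' x \<and> (\<forall>\<^sub>0\<epsilon>. norm (x' \<epsilon> - x0' \<epsilon>) \<le> R \<epsilon>) \<and> (\<forall>\<^sub>0\<epsilon>. x' \<epsilon> \<in> K)" if "x \<in> V" for x
  proof -
    obtain x' where x': "represents x' x" using represents_ex by blast
    have "gnorm (x - x0) \<le> r" using that by (simp add: V_def)
    then have "\<forall>\<^sub>0\<epsilon>. norm (x' \<epsilon> - x0' \<epsilon>) \<le> r' \<epsilon> + \<epsilon> powr 1"
      by (simp only: le_colombeau_iff[OF represents_gnorm[OF represents_diff[OF x' x0'(1)]] rr])
    with r'_low[OF zero_less_one] have n: "\<forall>\<^sub>0\<epsilon>. norm (x' \<epsilon> - x0' \<epsilon>) \<le> R \<epsilon>"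
      by eventually_elim (simp add: r'_def)
    moreover have "\<forall>\<^sub>0\<epsilon>. x' \<epsilon> \<in> K"
      using n R_up[OF x0'(2)] by eventually_elim (meson x0'(5) order_trans)
    ultimately show ?thesis using x' by blast
  qed
  have "V \<subseteq> compact_points \<Omega>" using near x0'(3,4) unfolding compact_points_def by blast
  then have "slow_scale_nbhd \<Omega> x0 V"
    unfolding slow_scale_nbhd_def using rpos rslow by (auto simp: V_def)
  moreover have "Ginf_at \<Omega> u x" if xV: "x \<in> V" for x
  proof -
    obtain x' where x': "represents x' x" "\<forall>\<^sub>0\<epsilon>. norm (x' \<epsilon> - x0' \<epsilon>) \<le> R \<epsilon>" "\<forall>\<^sub>0\<epsilon>. x' \<epsilon> \<in> K"
      using near[OF xV] by blast
    obtain M :: nat where M: "- N \<le> real M" using real_arch_simple by blast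
    have "gnorm (Gpoint \<Omega> (Gderiv \<Omega> \<alpha> u) x) \<le> rho_powr (- real M)" for \<alpha>
    proof (rule le_colombeauI[OF represents_gnorm[OF Gpoint_Gderiv[OF assms(1,3) u'(2) x'(1) x0'(3,4) x'(3)]] represents_rho_powr])
      show "\<forall>\<^sub>0\<epsilon>. norm (pd (mlist \<alpha>) (u' \<epsilon>) (x' \<epsilon>)) \<le> \<epsilon> powr (- real M)"
        using \<kappa>(1) \<kappa>(2)[of "length (mlist \<alpha>)"] x'(2) small_unit
      proof eventually_elim
        case (elim \<epsilon>)
        have "x' \<epsilon> \<in> cball (x0' \<epsilon>) (\<epsilon> powr b (\<kappa> \<epsilon>))"
          using elim(3) by (simp add: R_def dist_norm norm_minus_commute)
        with elim(1,2) have "norm (pd (mlist \<alpha>) (u' \<epsilon>) (x' \<epsilon>)) \<le> \<epsilon> powr N" unfolding P_def by blast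
        also have "\<dots> \<le> \<epsilon> powr (- real M)" using elim(4) M by (intro powr_mono') auto
        finally show ?case .
      qed
    qed
    then show ?thesis unfolding Ginf_at_def by blast
  qed
  ultimately show ?thesis by (auto simp: Ginf_on_def)
qed

theorem theorem4p5:
  fixes \<Omega> :: "(real^'n) set"
    and x0 :: "(real^'n) colombeau"
    and u :: "(real \<Rightarrow> real^'n \<Rightarrow> complex) set"
  assumes "open \<Omega>"
    and "x0 \<in> compact_points \<Omega>"
    and "u \<in> G \<Omega>"
  shows "(\<forall>\<xi>0\<in>gsphere. microlocally_regular \<Omega> u x0 \<xi>0) \<longleftrightarrow>
         (\<exists>V. slow_scale_nbhd \<Omega> x0 V \<and> Ginf_on \<Omega> u V)"
  using microlocally_regular_imp_regular[OF assms] regular_imp_microlocally_regular[OF assms] by blast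

end
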